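(* Assume Assumptions 1 and 2 (as below) and fix $c>0$. There exist $\kappa_{\min},\beta_{\min}>0$ such that for all $\kappa\ge\kappa_{\min}$, $\beta\ge\beta_{\min}$ (including $\beta=\infty$) with $\|\Upsilon\|_\kappa\le1$ the following hold. For every finite $\Lambda\subset\mathbb{Z}^d$ there are real functions $\Psi_{\Lambda,A}:\Omega_A\to\mathbb{R}$, $A\subset\Lambda$, with $\mu^{\beta,X}_\Lambda(x_\Lambda)=\tilde Z_\Lambda^{-1}\exp(\sum_{A\subset\Lambda}\Psi_{\Lambda,A}(x_A))$; the limits $\Psi_A(x_A)=\lim_{\Lambda\nearrow\mathbb{Z}^d}\Psi_{\Lambda,A}(x_A)$ exist (and this limit may be interchanged with $\beta\to\infty$); the thermodynamic limit $\mu$ of $\mu_\Lambda^{\beta,X}$ is unique and satisfies $\mu(x_\Lambda\mid x_{\Lambda^c})\propto\exp(\sum_{A\cap\Lambda\ne\emptyset}\Psi_A(x_A))$; and $\Psi$ decays exponentially: $\sum_{A\ni0}e^{c|A|}\max_{x_A}|\Psi_A(x_A)|<\infty$ and $\sum_{A\ni0}e^{c\,\mathrm{diam}(A)}\max_{x_A}|\Psi_A(x_A)|<\infty$.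
   Context: Setting as in the low-temperature theorem: quantum spin system on $\mathbb{Z}^d$, $\mathcal{H}=\mathbb{C}^m$, interaction $\Phi=\Phi_0+\Upsilon$ (translation invariant, vanishing on non-connected sets), $\|\Upsilon\|_\kappa=\sum_{A\ni0}e^{\kappa|A|}\|\Upsilon(A)\|$; $\mu^{\beta,X}_\Lambda(x_\Lambda)=\omega^\beta_\Lambda(Q_\Lambda(x_\Lambda))$ with $\omega^\beta_\Lambda$ the finite-volume Gibbs state of $H^\Phi_\Lambda$ (for $\beta=\infty$ its ground state), $Q_\Lambda(x_\Lambda)=\prod_{i\in\Lambda}Q_i(x_i)$ where $X=\sum_x xQ(x)$, $\Omega_A=\mathrm{sp}(X)^A$. Assumption 1: $\Phi_0$ has finite range and there is a one-dimensional orthogonal projection $\mathcal{P}$ on $\mathcal{H}$ such that, with $\mathcal{P}_\Lambda(S)=(\bigotimes_{i\in S}\mathcal{P}_i^\perp)\otimes(\bigotimes_{i\in\Lambda\setminus S}\mathcal{P}_i)$, $H^{\Phi_0}_\Lambda$ commutes with every $\mathcal{P}_\Lambda(S)$, $H^{\Phi_0}_\Lambda\mathcal{P}_\Lambda(\emptyset)=0$, and $H^{\Phi_0}_\Lambda\mathcal{P}_\Lambda(S)\ge g|S|\mathcal{P}_\Lambda(S)$ for a $\Lambda$-uniform $g>0$. Assumption 2: $\mathrm{Tr}(Q(x)\mathcal{P})>0$ for all $x\in\mathrm{sp}(X)$. *)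

theory Defs
  imports "HOL-Analysis.Analysis" "HOL-Probability.Probability"
begin

section \<open>Lattice geometry of Z^d\<close>

type_synonym 'd site = "int ^ 'd"

definition dist1 :: "'d::finite site \<Rightarrow> 'd site \<Rightarrow> int" where
  "dist1 x y = (\<Sum>k\<in>UNIV. \<bar>x $ k - y $ k\<bar>)"

definition lat_diam :: "'d::finite site set \<Rightarrow> int" where
  "lat_diam A = (if A = {} then 0 else Max {dist1 x y | x y. x \<in> A \<and> y \<in> A})"

text \<open>Connected = finite, nonempty, connected in the nearest-neighbour graph.\<close>
definition lat_connected :: "'d::finite site set \<Rightarrow> bool" where
  "lat_connected A \<longleftrightarrow> finite A \<and> A \<noteq> {} \<and>
     (\<forall>x\<in>A. \<forall>y\<in>A. (x, y) \<in> {(u, v). u \<in> A \<and> v \<in> A \<and> dist1 u v = 1}\<^sup>*)"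

section \<open>Finite-volume Hilbert spaces: basis configurations and operators as matrices\<close>

text \<open>Basis of (C^m)^{\<otimes>A}: configurations A \<rightarrow> {0..<m}. An operator on it is a matrix
  indexed by such configurations.\<close>
definition confs :: "nat \<Rightarrow> 'a set \<Rightarrow> ('a \<Rightarrow> nat) set" where
  "confs m A = PiE A (\<lambda>_. {..<m})"

type_synonym 'a op = "('a \<Rightarrow> nat) \<Rightarrow> ('a \<Rightarrow> nat) \<Rightarrow> complex"
type_synonym smat = "nat \<Rightarrow> nat \<Rightarrow> complex"  \<comment> \<open>single-site m\<times>m matrices\<close>

definition op_zero_on :: "('a \<Rightarrow> nat) set \<Rightarrow> 'a op \<Rightarrow> bool" where
  "op_zero_on D M \<longleftrightarrow> (\<forall>\<sigma>\<in>D. \<forall>\<tau>\<in>D. M \<sigma> \<tau> = 0)"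

definition op_eq_on :: "('a \<Rightarrow> nat) set \<Rightarrow> 'a op \<Rightarrow> 'a op \<Rightarrow> bool" where
  "op_eq_on D M N \<longleftrightarrow> (\<forall>\<sigma>\<in>D. \<forall>\<tau>\<in>D. M \<sigma> \<tau> = N \<sigma> \<tau>)"

definition op_id :: "'a op" where
  "op_id \<sigma> \<tau> = (if \<sigma> = \<tau> then 1 else 0)"

definition op_mult :: "('a \<Rightarrow> nat) set \<Rightarrow> 'a op \<Rightarrow> 'a op \<Rightarrow> 'a op" where
  "op_mult D M N \<sigma> \<tau> = (\<Sum>\<rho>\<in>D. M \<sigma> \<rho> * N \<rho> \<tau>)"

fun op_pow :: "('a \<Rightarrow> nat) set \<Rightarrow> 'a op \<Rightarrow> nat \<Rightarrow> 'a op" where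
  "op_pow D M 0 = op_id"
| "op_pow D M (Suc n) = op_mult D M (op_pow D M n)"

definition op_trace :: "('a \<Rightarrow> nat) set \<Rightarrow> 'a op \<Rightarrow> complex" where
  "op_trace D M = (\<Sum>\<sigma>\<in>D. M \<sigma> \<sigma>)"

definition op_hermitian :: "('a \<Rightarrow> nat) set \<Rightarrow> 'a op \<Rightarrow> bool" where
  "op_hermitian D M \<longleftrightarrow> (\<forall>\<sigma>\<in>D. \<forall>\<tau>\<in>D. M \<tau> \<sigma> = cnj (M \<sigma> \<tau>))"

definition op_apply :: "('a \<Rightarrow> nat) set \<Rightarrow> 'a op \<Rightarrow> (('a \<Rightarrow> nat) \<Rightarrow> complex) \<Rightarrow> ('a \<Rightarrow> nat) \<Rightarrow> complex" where
  "op_apply D M v \<sigma> = (\<Sum>\<tau>\<in>D. M \<sigma> \<tau> * v \<tau>)"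

definition vec_norm :: "('a \<Rightarrow> nat) set \<Rightarrow> (('a \<Rightarrow> nat) \<Rightarrow> complex) \<Rightarrow> real" where
  "vec_norm D v = sqrt (\<Sum>\<sigma>\<in>D. (cmod (v \<sigma>))\<^sup>2)"

text \<open>Operator norm on the finite-dimensional Hilbert space spanned by D.\<close>
definition op_norm :: "('a \<Rightarrow> nat) set \<Rightarrow> 'a op \<Rightarrow> real" where
  "op_norm D M = Sup {vec_norm D (op_apply D M v) | v. vec_norm D v \<le> 1}"

text \<open>Positive semidefinite: <v, M v> is real and nonnegative for all v.\<close>
definition op_psd :: "('a \<Rightarrow> nat) set \<Rightarrow> 'a op \<Rightarrow> bool" where
  "op_psd D M \<longleftrightarrow> (\<forall>v. (\<Sum>\<sigma>\<in>D. cnj (v \<sigma>) * op_apply D M v \<sigma>) \<in> \<real> \<and>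
                         Re (\<Sum>\<sigma>\<in>D. cnj (v \<sigma>) * op_apply D M v \<sigma>) \<ge> 0)"

text \<open>Matrix exponential exp(t M) via its power series.\<close>
definition op_exp :: "('a \<Rightarrow> nat) set \<Rightarrow> real \<Rightarrow> 'a op \<Rightarrow> 'a op" where
  "op_exp D t M \<sigma> \<tau> = (\<Sum>n. complex_of_real (t ^ n / fact n) * op_pow D M n \<sigma> \<tau>)"

text \<open>M \<otimes> Id_{\<Lambda>\<setminus>A}, for M an operator on the sites A \<subseteq> \<Lambda>.\<close>
definition op_embed :: "'a set \<Rightarrow> 'a set \<Rightarrow> 'a op \<Rightarrow> 'a op" where
  "op_embed \<Lambda> A M \<sigma> \<tau> =
     (if restrict \<sigma> (\<Lambda> - A) = restrict \<tau> (\<Lambda> - A) then M (restrict \<sigma> A) (restrict \<tau> A) else 0)"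

text \<open>Tensor product \<Otimes>_{i\<in>\<Lambda>} M_i of single-site matrices.\<close>
definition op_tensor :: "'a set \<Rightarrow> ('a \<Rightarrow> smat) \<Rightarrow> 'a op" where
  "op_tensor \<Lambda> M \<sigma> \<tau> = (\<Prod>i\<in>\<Lambda>. M i (\<sigma> i) (\<tau> i))"

section \<open>Single-site matrices\<close>

definition smat_mult :: "nat \<Rightarrow> smat \<Rightarrow> smat \<Rightarrow> smat" where
  "smat_mult m A B i j = (\<Sum>k<m. A i k * B k j)"

definition smat_id :: smat where
  "smat_id i j = (if i = j then 1 else 0)"

definition smat_trace :: "nat \<Rightarrow> smat \<Rightarrow> complex" where
  "smat_trace m A = (\<Sum>i<m. A i i)"

definition smat_eq :: "nat \<Rightarrow> smat \<Rightarrow> smat \<Rightarrow> bool" where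
  "smat_eq m A B \<longleftrightarrow> (\<forall>i<m. \<forall>j<m. A i j = B i j)"

definition smat_hermitian :: "nat \<Rightarrow> smat \<Rightarrow> bool" where
  "smat_hermitian m A \<longleftrightarrow> (\<forall>i<m. \<forall>j<m. A j i = cnj (A i j))"

definition orth_proj :: "nat \<Rightarrow> smat \<Rightarrow> bool" where
  "orth_proj m P \<longleftrightarrow> smat_hermitian m P \<and> smat_eq m (smat_mult m P P) P"

text \<open>One-dimensional orthogonal projection: orthogonal projection of trace (= rank) 1.\<close>
definition rank_one_proj :: "nat \<Rightarrow> smat \<Rightarrow> bool" where
  "rank_one_proj m P \<longleftrightarrow> orth_proj m P \<and> smat_trace m P = 1"

text \<open>Spectral decomposition X = \<Sum>_{x\<in>sp X} x Q(x) of a Hermitian observable X on C^m: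
  Sp is the (finite, nonempty) spectrum, Q x the (nonzero, mutually orthogonal)
  spectral projections, which resolve the identity.\<close>
definition spectral_decomp :: "nat \<Rightarrow> real set \<Rightarrow> (real \<Rightarrow> smat) \<Rightarrow> bool" where
  "spectral_decomp m Sp Q \<longleftrightarrow> finite Sp \<and> Sp \<noteq> {} \<and>
     (\<forall>x\<in>Sp. orth_proj m (Q x) \<and> (\<exists>i<m. \<exists>j<m. Q x i j \<noteq> 0)) \<and>
     (\<forall>x\<in>Sp. \<forall>y\<in>Sp. x \<noteq> y \<longrightarrow> smat_eq m (smat_mult m (Q x) (Q y)) (\<lambda>_ _. 0)) \<and>
     smat_eq m (\<lambda>i j. \<Sum>x\<in>Sp. Q x i j) smat_id"

section \<open>Interactions and Hamiltonians\<close>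

type_synonym 'd interaction = "'d site set \<Rightarrow> 'd site op"

definition shift_set :: "'d::finite site \<Rightarrow> 'd site set \<Rightarrow> 'd site set" where
  "shift_set a A = (\<lambda>i. i + a) ` A"

text \<open>A translation-invariant interaction (Hermitian terms) vanishing on non-connected sets.\<close>
definition is_interaction :: "nat \<Rightarrow> ('d::finite) interaction \<Rightarrow> bool" where
  "is_interaction m \<Phi> \<longleftrightarrow>
     (\<forall>A. op_hermitian (confs m A) (\<Phi> A)) \<and>
     (\<forall>A. \<not> lat_connected A \<longrightarrow> op_zero_on (confs m A) (\<Phi> A)) \<and>
     (\<forall>A a. \<forall>\<sigma>\<in>confs m (shift_set a A). \<forall>\<tau>\<in>confs m (shift_set a A).
        \<Phi> (shift_set a A) \<sigma> \<tau> = \<Phi> A (restrict (\<lambda>i. \<sigma> (i + a)) A) (restrict (\<lambda>i. \<tau> (i + a)) A))"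

definition finite_range :: "nat \<Rightarrow> ('d::finite) interaction \<Rightarrow> bool" where
  "finite_range m \<Phi> \<longleftrightarrow> (\<exists>R. \<forall>A. lat_diam A > R \<longrightarrow> op_zero_on (confs m A) (\<Phi> A))"

text \<open>||\<Upsilon>||_\<kappa> \<le> b, with the sum over finite A \<ni> 0 required to converge.\<close>
definition kappa_norm_le :: "nat \<Rightarrow> real \<Rightarrow> ('d::finite) interaction \<Rightarrow> real \<Rightarrow> bool" where
  "kappa_norm_le m \<kappa> \<Upsilon> b \<longleftrightarrow>
     (let f = (\<lambda>A. exp (\<kappa> * real (card A)) * op_norm (confs m A) (\<Upsilon> A));
          I = {A. finite A \<and> (0::'d site) \<in> A}
      in f summable_on I \<and> infsum f I \<le> b)"

definition hamiltonian :: "nat \<Rightarrow> ('d::finite) interaction \<Rightarrow> 'd site set \<Rightarrow> 'd site op" where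
  "hamiltonian m \<Phi> \<Lambda> \<sigma> \<tau> = (\<Sum>A\<in>Pow \<Lambda>. op_embed \<Lambda> A (\<Phi> A) \<sigma> \<tau>)"

definition int_add :: "('d::finite) interaction \<Rightarrow> 'd interaction \<Rightarrow> 'd interaction" where
  "int_add \<Phi> \<Psi> A \<sigma> \<tau> = \<Phi> A \<sigma> \<tau> + \<Psi> A \<sigma> \<tau>"

section \<open>Gibbs states\<close>

text \<open>Finite-volume Gibbs state Tr(e^{-\<beta>H} O)/Tr(e^{-\<beta>H}).\<close>
definition gibbs_fin :: "('a \<Rightarrow> nat) set \<Rightarrow> 'a op \<Rightarrow> real \<Rightarrow> 'a op \<Rightarrow> complex" where
  "gibbs_fin D H \<beta> Ob =
     op_trace D (op_mult D (op_exp D (-\<beta>) H) Ob) / op_trace D (op_exp D (-\<beta>) H)"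

text \<open>For \<beta> = \<infinity> the ground state, taken as the zero-temperature limit of the Gibbs states
  (the normalized trace on the ground space).\<close>
definition gibbs :: "('a \<Rightarrow> nat) set \<Rightarrow> 'a op \<Rightarrow> ereal \<Rightarrow> 'a op \<Rightarrow> complex" where
  "gibbs D H \<beta> Ob =
     (if \<beta> = \<infinity> then Lim at_top (\<lambda>b. gibbs_fin D H b Ob) else gibbs_fin D H (real_of_ereal \<beta>) Ob)"

text \<open>\<mu>^{\<beta>,X}_\<Lambda>(x_\<Lambda>) = \<omega>^\<beta>_\<Lambda>(Q_\<Lambda>(x_\<Lambda>)).\<close>
definition meas_dist :: "nat \<Rightarrow> ('d::finite) interaction \<Rightarrow> (real \<Rightarrow> smat) \<Rightarrow> ereal
                          \<Rightarrow> 'd site set \<Rightarrow> ('d site \<Rightarrow> real) \<Rightarrow> complex" where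
  "meas_dist m \<Phi> Q \<beta> \<Lambda> x =
     gibbs (confs m \<Lambda>) (hamiltonian m \<Phi> \<Lambda>) \<beta> (op_tensor \<Lambda> (\<lambda>i. Q (x i)))"

text \<open>Marginal of \<mu>_\<Lambda> on B \<subseteq> \<Lambda>.\<close>
definition meas_marginal :: "nat \<Rightarrow> ('d::finite) interaction \<Rightarrow> real set \<Rightarrow> (real \<Rightarrow> smat) \<Rightarrow> ereal
                          \<Rightarrow> 'd site set \<Rightarrow> 'd site set \<Rightarrow> ('d site \<Rightarrow> real) \<Rightarrow> complex" where
  "meas_marginal m \<Phi> Sp Q \<beta> \<Lambda> B xB =
     (\<Sum>y\<in>{y \<in> PiE \<Lambda> (\<lambda>_. Sp). restrict y B = xB}. meas_dist m \<Phi> Q \<beta> \<Lambda> y)"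

section \<open>Classical configuration space and DLR condition\<close>

definition config_space :: "real set \<Rightarrow> ('d::finite site \<Rightarrow> real) measure" where
  "config_space Sp = PiM UNIV (\<lambda>_. count_space Sp)"

text \<open>Specification kernel \<gamma>_\<Lambda>(x_\<Lambda> | \<omega>) \<propto> exp(\<Sum>_{A \<inter> \<Lambda> \<noteq> \<emptyset>} \<Psi>_A(x_A)).\<close>
definition local_energy :: "('d::finite site set \<Rightarrow> ('d site \<Rightarrow> real) \<Rightarrow> real) \<Rightarrow> 'd site set
                              \<Rightarrow> ('d site \<Rightarrow> real) \<Rightarrow> real" where
  "local_energy \<Psi> \<Lambda> z = infsum (\<lambda>A. \<Psi> A (restrict z A)) {A. finite A \<and> A \<inter> \<Lambda> \<noteq> {}}"

definition glue :: "'a set \<Rightarrow> ('a \<Rightarrow> 'b) \<Rightarrow> ('a \<Rightarrow> 'b) \<Rightarrow> 'a \<Rightarrow> 'b" where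
  "glue \<Lambda> x \<omega> i = (if i \<in> \<Lambda> then x i else \<omega> i)"

definition spec_kernel :: "real set \<Rightarrow> ('d::finite site set \<Rightarrow> ('d site \<Rightarrow> real) \<Rightarrow> real) \<Rightarrow> 'd site set
                             \<Rightarrow> ('d site \<Rightarrow> real) \<Rightarrow> ('d site \<Rightarrow> real) \<Rightarrow> real" where
  "spec_kernel Sp \<Psi> \<Lambda> x \<omega> =
     exp (local_energy \<Psi> \<Lambda> (glue \<Lambda> x \<omega>)) /
     (\<Sum>y\<in>PiE \<Lambda> (\<lambda>_. Sp). exp (local_energy \<Psi> \<Lambda> (glue \<Lambda> y \<omega>)))"

text \<open>DLR: \<mu>(x_\<Lambda> | x_{\<Lambda>^c}) = \<gamma>_\<Lambda>(x_\<Lambda> | \<cdot>) \<mu>-a.s., i.e. for every event E measurable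
  w.r.t. the spins outside \<Lambda>: \<mu>({\<omega>_\<Lambda> = x_\<Lambda>} \<inter> E) = \<integral>_E \<gamma>_\<Lambda>(x_\<Lambda>|\<omega>) d\<mu>.\<close>
definition DLR :: "real set \<Rightarrow> ('d::finite site set \<Rightarrow> ('d site \<Rightarrow> real) \<Rightarrow> real)
                     \<Rightarrow> ('d site \<Rightarrow> real) measure \<Rightarrow> bool" where
  "DLR Sp \<Psi> \<mu> \<longleftrightarrow>
     (\<forall>\<Lambda>. finite \<Lambda> \<longrightarrow> (\<forall>x\<in>PiE \<Lambda> (\<lambda>_. Sp).
        \<forall>F\<in>sets (PiM (- \<Lambda>) (\<lambda>_. count_space Sp)).
          (let E = {\<omega> \<in> space \<mu>. restrict \<omega> (- \<Lambda>) \<in> F} in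
           measure \<mu> ({\<omega> \<in> space \<mu>. restrict \<omega> \<Lambda> = x} \<inter> E) =
           (\<integral>\<omega>\<in>E. spec_kernel Sp \<Psi> \<Lambda> x \<omega> \<partial>\<mu>))))"

definition max_abs :: "real set \<Rightarrow> ('d::finite site set \<Rightarrow> ('d site \<Rightarrow> real) \<Rightarrow> real) \<Rightarrow> 'd site set \<Rightarrow> real" where
  "max_abs Sp \<Psi> A = Max ((\<lambda>x. \<bar>\<Psi> A x\<bar>) ` PiE A (\<lambda>_. Sp))"

end

theory Submission
  imports Defs
begin

text \<open>The potential is the Moebius transform of \<open>B \<mapsto> ln \<mu>\<^sub>B(x\<^sub>B)\<close>, the logarithms of the finite-volume
  measures with free boundary conditions. Thus it does not depend on \<open>\<Lambda>\<close>, the normalization is 1, and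
  everything reduces to its decay, uniformly in \<open>\<beta>\<close>.

  For a product observable \<open>O\<close>, cut \<open>exp (- \<beta> H)\<close> into slabs of bounded length \<open>t\<close>. In a basis starting with
  the vacuum, a slab is the vacuum projection up to terms that are small by the gap (\<open>exp (- g t)\<close> for each
  excited site) or by the perturbation (\<open>exp (t - \<kappa>)\<close> for each site it touches), so \<open>Tr (exp (- \<beta> H) O)\<close>
  is the partition function of a gas of connected space-time polymers. The weights are
  treated as functions of the volume \<open>V\<close> in the norm \<open>\<Sum>U. exp (a |U|) |mob f U|\<close>, which is submultiplicative.
  A Kotecky-Preiss argument in this normed algebra bounds \<open>ln (Tr (exp (- \<beta> H) O) / Tr (exp (- \<beta> H)))\<close>,
  and boundedness in this norm is exactly exponential decay of the Moebius transform.

  The bounds survive the limit \<open>\<beta> \<rightarrow> \<infinity>\<close>. The marginal of \<open>\<mu>\<^sub>\<Lambda>\<close> on \<open>B\<close> is the expectation of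
  a product observable that is the identity off \<open>B\<close>, whose Moebius transform vanishes on sets disjoint from \<open>B\<close>;
  hence marginals converge. Kolmogorov's extension theorem yields the limit measure, and the DLR equations pass
  to the limit from finite volumes.\<close>

section \<open>Moebius transforms of set functions\<close>

text \<open>The two small factors of a slab pull in opposite directions:
  \<open>exp (- g * t)\<close> asks for long slabs, \<open>exp (t - \<kappa>)\<close> for short
  ones. So \<open>t\<close> is kept between \<open>\<beta>0\<close> and \<open>2 * \<beta>0\<close>,
  with \<open>\<beta>0\<close> fixed by the gap and \<kappa> chosen afterwards; every larger inverse
  temperature is an integer multiple of such a \<open>t\<close>. Uniformity in \<beta> has one
  source: the weights with and without observable agree on all sets that avoid the two slabs at the
  seam. The logarithm of the quotient therefore costs a constant for each site of the seam, at most
  \<open>4 * card A\<close> in the norm, whatever the number of slabs. This linear growth is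
  harmless, because the coefficient on \<open>A\<close> carries the factor
  \<open>exp (a * card A)\<close> with \<open>a\<close> as large as desired. Each factor of
  \<open>O\<close> is divided by its vacuum expectation, so that empty space weighs 1. Here the
  positivity of \<open>Tr (Q x P)\<close> enters. The logarithms of these expectations add up over
  sites, so they contribute to the potential on one-point sets only.\<close>

definition mob :: "('i set \<Rightarrow> 'b::comm_ring_1) \<Rightarrow> 'i set \<Rightarrow> 'b" where
  "mob f U = (\<Sum>T\<in>Pow U. (-1) ^ card (U - T) * f T)"

lemma alternating_sum_Pow:
  assumes "finite U"
  shows "(\<Sum>T\<in>Pow U. (-1::'b::comm_ring_1) ^ card (U - T)) = (if U = {} then 1 else 0)"
  using assms
proof (induction U rule: finite_induct)
  case empty
  thus ?case by simp
next
  case (insert x F)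
  have inj: "inj_on (insert x) (Pow F)" using insert(2) by (auto simp: inj_on_def)
  have "(\<Sum>T\<in>Pow (insert x F). (-1::'b) ^ card (insert x F - T)) =
     (\<Sum>T\<in>Pow F. (-1) ^ card (insert x F - T)) + (\<Sum>T\<in>insert x ` Pow F. (-1) ^ card (insert x F - T))"
    unfolding Pow_insert by (rule sum.union_disjoint) (use insert in auto)
  also have "(\<Sum>T\<in>insert x ` Pow F. (-1::'b) ^ card (insert x F - T)) = (\<Sum>T\<in>Pow F. (-1) ^ card (F - T))"
    unfolding sum.reindex[OF inj] using insert(2) by (intro sum.cong) (auto intro!: arg_cong[where f="\<lambda>n. (-1)^n"] arg_cong[where f=card])
  also have "(\<Sum>T\<in>Pow F. (-1::'b) ^ card (insert x F - T)) = (\<Sum>T\<in>Pow F. - ((-1) ^ card (F - T)))"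
  proof (intro sum.cong refl)
    fix T assume "T \<in> Pow F"
    hence "insert x F - T = insert x (F - T)" using insert(2) by auto
    moreover have "x \<notin> F - T" "finite (F - T)" using insert by auto
    ultimately show "(-1::'b) ^ card (insert x F - T) = - ((-1) ^ card (F - T))" by simp
  qed
  finally show ?case by (simp add: sum_negf)
qed

lemma sum_nested_Pow:
  fixes c :: "'i set \<Rightarrow> 'i set \<Rightarrow> 'b::comm_monoid_add"
  assumes "finite U"
  shows "(\<Sum>T\<in>Pow U. \<Sum>S\<in>Pow T. c T S) = (\<Sum>S\<in>Pow U. \<Sum>T\<in>{T\<in>Pow U. S \<subseteq> T}. c T S)"
proof -
  have "(\<Sum>T\<in>Pow U. \<Sum>S\<in>Pow T. c T S) = (\<Sum>T\<in>Pow U. \<Sum>S\<in>{S\<in>Pow U. S \<subseteq> T}. c T S)"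
    by (intro sum.cong) auto
  also have "\<dots> = (\<Sum>S\<in>Pow U. \<Sum>T\<in>{T\<in>Pow U. S \<subseteq> T}. c T S)"
    by (rule sum.swap_restrict) (use assms in auto)
  finally show ?thesis .
qed

lemma alternating_sum_between:
  assumes "finite U" "S \<subseteq> U"
  shows "(\<Sum>T\<in>{T\<in>Pow U. S \<subseteq> T}. (-1::'b::comm_ring_1) ^ card (U - T)) = (if S = U then 1 else 0)"
proof -
  have "(\<Sum>T\<in>{T\<in>Pow U. S \<subseteq> T}. (-1::'b) ^ card (U - T)) = (\<Sum>T\<in>Pow (U - S). (-1) ^ card ((U - S) - T))"
    by (rule sum.reindex_bij_witness[of _ "\<lambda>T. T \<union> S" "\<lambda>T. T - S"])
       (use assms in \<open>auto intro!: arg_cong[where f="\<lambda>n. (-1)^n"] arg_cong[where f=card]\<close>)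
  also have "\<dots> = (if U - S = {} then 1 else 0)"
    by (rule alternating_sum_Pow) (use assms in auto)
  finally show ?thesis using assms by (auto split: if_splits)
qed

text \<open>Moebius inversion in the form in which it is applied: any decomposition of
  \<open>f\<close> over subsets is the transform. To compute a transform it is enough to exhibit
  such a decomposition below \<open>U\<close>.\<close>

lemma mob_unique:
  fixes f :: "'i set \<Rightarrow> 'b::comm_ring_1"
  assumes "finite U" "\<And>T. T \<subseteq> U \<Longrightarrow> f T = (\<Sum>S\<in>Pow T. h S)"
  shows "mob f U = h U"
proof -
  have "mob f U = (\<Sum>T\<in>Pow U. \<Sum>S\<in>Pow T. (-1) ^ card (U - T) * h S)"
    unfolding mob_def by (intro sum.cong refl) (simp add: assms(2) sum_distrib_left)
  also have "\<dots> = (\<Sum>S\<in>Pow U. \<Sum>T\<in>{T\<in>Pow U. S \<subseteq> T}. (-1) ^ card (U - T) * h S)"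
    by (rule sum_nested_Pow[OF assms(1)])
  also have "\<dots> = (\<Sum>S\<in>Pow U. (if S = U then 1 else 0) * h S)"
    unfolding sum_distrib_right[symmetric]
    by (intro sum.cong refl) (subst alternating_sum_between, use assms(1) in auto)
  also have "\<dots> = h U" using assms(1) by (simp add: sum.delta' if_distrib[of "\<lambda>x. x * _"] cong: if_cong)
  finally show ?thesis .
qed

lemma alternating_sum_below:
  assumes "finite U" "S \<subseteq> U"
  shows "(\<Sum>T\<in>{T\<in>Pow U. S \<subseteq> T}. (-1::'b::comm_ring_1) ^ card (T - S)) = (if S = U then 1 else 0)"
proof -
  have "(\<Sum>T\<in>{T\<in>Pow U. S \<subseteq> T}. (-1::'b) ^ card (T - S)) = (\<Sum>T\<in>Pow (U - S). (-1) ^ card ((U - S) - T))"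
    by (rule sum.reindex_bij_witness[of _ "\<lambda>T. U - T" "\<lambda>T. U - T"])
       (use assms in \<open>auto intro!: arg_cong[where f="\<lambda>n. (-1)^n"] arg_cong[where f=card]\<close>)
  also have "\<dots> = (if U - S = {} then 1 else 0)"
    by (rule alternating_sum_Pow) (use assms in auto)
  finally show ?thesis using assms by (auto split: if_splits)
qed

lemma sum_mob:
  fixes f :: "'i set \<Rightarrow> 'b::comm_ring_1"
  assumes "finite U"
  shows "(\<Sum>T\<in>Pow U. mob f T) = f U"
proof -
  have "(\<Sum>T\<in>Pow U. mob f T) = (\<Sum>S\<in>Pow U. \<Sum>T\<in>{T\<in>Pow U. S \<subseteq> T}. (-1) ^ card (T - S) * f S)"
    unfolding mob_def by (rule sum_nested_Pow[OF assms])
  also have "\<dots> = (\<Sum>S\<in>Pow U. (if S = U then 1 else 0) * f S)"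
    unfolding sum_distrib_right[symmetric]
    by (intro sum.cong refl) (subst alternating_sum_below, use assms in auto)
  also have "\<dots> = f U" using assms by (simp add: sum.delta' if_distrib[of "\<lambda>x. x * _"] cong: if_cong)
  finally show ?thesis .
qed

lemma mob_cong: "(\<And>T. T \<subseteq> U \<Longrightarrow> f T = g T) \<Longrightarrow> mob f U = mob g U"
  unfolding mob_def by (intro sum.cong) auto

lemma mob_add: "mob (\<lambda>V. f V + g V) U = mob f U + mob g U"
  by (simp add: mob_def sum.distrib distrib_left)

lemma mob_sum: "mob (\<lambda>V. \<Sum>i\<in>I. f i V) U = (\<Sum>i\<in>I. mob (f i) U)"
  unfolding mob_def by (simp add: sum_distrib_left) (rule sum.swap)

lemma mob_cmult: "mob (\<lambda>V. c * f V) U = c * mob f U"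
  by (simp add: mob_def sum_distrib_left mult_ac)

lemma mob_uminus: "mob (\<lambda>V. - f V) U = - mob f U"
  by (simp add: mob_def sum_negf)

lemma mob_const: "finite U \<Longrightarrow> mob (\<lambda>_. c) U = (if U = {} then c else 0)"
  by (simp add: mob_def alternating_sum_Pow flip: sum_distrib_right)

lemma sum_union_pairs:
  fixes c :: "'i set \<Rightarrow> 'i set \<Rightarrow> 'b::comm_monoid_add"
  assumes "finite U"
  shows "(\<Sum>W\<in>Pow U. \<Sum>p\<in>{p\<in>Pow W \<times> Pow W. fst p \<union> snd p = W}. c (fst p) (snd p)) = (\<Sum>S\<in>Pow U. \<Sum>T\<in>Pow U. c S T)"
proof -
  have "(\<Sum>W\<in>Pow U. \<Sum>p\<in>{p\<in>Pow W \<times> Pow W. fst p \<union> snd p = W}. c (fst p) (snd p)) =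
     (\<Sum>W\<in>Pow U. \<Sum>p\<in>{p\<in>Pow U \<times> Pow U. fst p \<union> snd p = W}. c (fst p) (snd p))"
    by (intro sum.cong) auto
  also have "\<dots> = (\<Sum>p\<in>Pow U \<times> Pow U. c (fst p) (snd p))"
    by (rule sum.group) (use assms in auto)
  also have "\<dots> = (\<Sum>S\<in>Pow U. \<Sum>T\<in>Pow U. c S T)"
    by (simp add: sum.cartesian_product case_prod_beta)
  finally show ?thesis .
qed

text \<open>The Moebius transform turns products into union convolutions; this makes the weighted
  l1-norm below submultiplicative.\<close>

lemma mob_mult:
  fixes f :: "'i set \<Rightarrow> 'b::comm_ring_1"
  assumes "finite U"
  shows "mob (\<lambda>V. f V * g V) U = (\<Sum>p\<in>{p\<in>Pow U \<times> Pow U. fst p \<union> snd p = U}. mob f (fst p) * mob g (snd p))"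
proof (rule mob_unique[OF assms])
  fix T assume "T \<subseteq> U"
  hence fT: "finite T" using assms finite_subset by blast
  have "f T * g T = (\<Sum>S\<in>Pow T. mob f S) * (\<Sum>S\<in>Pow T. mob g S)" by (simp add: sum_mob fT)
  also have "\<dots> = (\<Sum>S\<in>Pow T. \<Sum>S'\<in>Pow T. mob f S * mob g S')" by (simp add: sum_product)
  finally show "f T * g T = (\<Sum>W\<in>Pow T. \<Sum>p\<in>{p\<in>Pow W \<times> Pow W. fst p \<union> snd p = W}. mob f (fst p) * mob g (snd p))"
    by (simp only: sum_union_pairs[OF fT, where c="\<lambda>S T. mob f S * mob g T"])
qed

lemma norm_mob_le:
  fixes f :: "'i set \<Rightarrow> 'b::{comm_ring_1,real_normed_div_algebra}"
  assumes "finite U" "\<And>V. V \<subseteq> U \<Longrightarrow> norm (f V) \<le> B"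
  shows "norm (mob f U) \<le> 2 ^ card U * B"
proof -
  have "norm (mob f U) \<le> (\<Sum>T\<in>Pow U. norm ((-1) ^ card (U - T) * f T))"
    unfolding mob_def by (rule norm_sum)
  also have "\<dots> \<le> (\<Sum>T\<in>Pow U. B)"
    by (intro sum_mono) (auto simp: norm_mult norm_power assms(2))
  finally show ?thesis using assms(1) by (simp add: card_Pow)
qed

text \<open>The terms of \<open>T\<close> and \<open>insert i T\<close> cancel. This confines the
  transform to the sites that \<open>f\<close> sees, and it annihilates a sum of two functions each
  of which misses some site of \<open>U\<close>.\<close>

lemma mob_eq_0_if_insensitive:
  fixes f :: "'i set \<Rightarrow> 'b::comm_ring_1"
  assumes "finite U" "i \<in> U" "\<And>V. V \<subseteq> U \<Longrightarrow> f (insert i V) = f (V - {i})"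
  shows "mob f U = 0"
proof -
  define F where "F = U - {i}"
  have U: "U = insert i F" "i \<notin> F" "finite F" using assms(1,2) by (auto simp: F_def)
  have inj: "inj_on (insert i) (Pow F)" using U by (auto simp: inj_on_def)
  have "mob f U = (\<Sum>T\<in>Pow F. (-1) ^ card (insert i F - T) * f T) + (\<Sum>T\<in>insert i ` Pow F. (-1) ^ card (insert i F - T) * f T)"
    unfolding mob_def U(1) Pow_insert by (rule sum.union_disjoint) (use U in auto)
  also have "(\<Sum>T\<in>insert i ` Pow F. (-1) ^ card (insert i F - T) * f T) = (\<Sum>T\<in>Pow F. (-1) ^ card (F - T) * f (insert i T))"
    unfolding sum.reindex[OF inj] using U(2)
    by (intro sum.cong) (auto intro!: arg_cong2[where f="(*)"] arg_cong[where f="\<lambda>n. (-1)^n"] arg_cong[where f=card])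
  also have "(\<Sum>T\<in>Pow F. (-1) ^ card (insert i F - T) * f T) = (\<Sum>T\<in>Pow F. - ((-1) ^ card (F - T) * f (insert i T)))"
  proof (intro sum.cong refl)
    fix T assume T: "T \<in> Pow F"
    hence "insert i F - T = insert i (F - T)" using U by auto
    moreover have "i \<notin> F - T" "finite (F - T)" using U by auto
    moreover have "f (insert i T) = f T"
    proof -
      have "T \<subseteq> U" "T - {i} = T" using T U by auto
      thus ?thesis using assms(3)[of T] by simp
    qed
    ultimately show "(-1) ^ card (insert i F - T) * f T = - ((-1) ^ card (F - T) * f (insert i T))" by simp
  qed
  finally show ?thesis by (simp add: sum_negf)
qed

section \<open>The weighted l1-norm of Moebius coefficients and its functional calculus\<close>

definition nb :: "'i set \<Rightarrow> real \<Rightarrow> ('i set \<Rightarrow> complex) \<Rightarrow> real" where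
  "nb A a f = (\<Sum>U\<in>Pow A. exp (a * real (card U)) * norm (mob f U))"

lemma nb_nonneg: "0 \<le> nb A a f"
  unfolding nb_def by (intro sum_nonneg) auto

lemma nb_cong: "(\<And>V. V \<subseteq> A \<Longrightarrow> f V = g V) \<Longrightarrow> nb A a f = nb A a g"
  unfolding nb_def by (intro sum.cong refl arg_cong2[where f="(*)"] arg_cong[where f=norm] mob_cong) auto

lemma nb_add: "nb A a (\<lambda>V. f V + g V) \<le> nb A a f + nb A a g"
  unfolding nb_def sum.distrib[symmetric]
  by (intro sum_mono) (auto simp: mob_add distrib_left[symmetric] norm_triangle_ineq)

lemma nb_uminus: "nb A a (\<lambda>V. - f V) = nb A a f"
  unfolding nb_def by (simp add: mob_uminus)

lemma nb_diff: "nb A a (\<lambda>V. f V - g V) \<le> nb A a f + nb A a g"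
  using nb_add[of A a f "\<lambda>V. - g V"] by (simp add: nb_uminus)

lemma nb_cmult: "nb A a (\<lambda>V. c * f V) = norm c * nb A a f"
  unfolding nb_def by (simp add: mob_cmult norm_mult sum_distrib_left mult_ac)

lemma nb_const: "finite A \<Longrightarrow> nb A a (\<lambda>V. c) = norm c"
proof -
  assume A: "finite A"
  have "nb A a (\<lambda>V. c) = (\<Sum>U\<in>Pow A. if U = {} then norm c else 0)"
    unfolding nb_def
  proof (intro sum.cong refl)
    fix U assume "U \<in> Pow A"
    hence "finite U" using A finite_subset by blast
    thus "exp (a * real (card U)) * norm (mob (\<lambda>V. c) U) = (if U = {} then norm c else 0)"
      by (simp add: mob_const)
  qed
  also have "\<dots> = norm c" using A by (subst sum.delta) auto
  finally show ?thesis .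
qed

lemma nb_sum: "nb A a (\<lambda>V. \<Sum>i\<in>I. f i V) \<le> (\<Sum>i\<in>I. nb A a (f i))"
proof -
  have "nb A a (\<lambda>V. \<Sum>i\<in>I. f i V) \<le> (\<Sum>U\<in>Pow A. \<Sum>i\<in>I. exp (a * real (card U)) * norm (mob (f i) U))"
    unfolding nb_def by (intro sum_mono) (auto simp: mob_sum sum_distrib_left[symmetric] norm_sum)
  thus ?thesis unfolding nb_def by (subst (asm) sum.swap)
qed

text \<open>A value is the sum of the coefficients below it. So smallness in the norm is smallness
  at every volume, which gives convergence of scalar series and absence of zeros.\<close>

lemma norm_le_nb:
  assumes "finite A" "a \<ge> 0" "V \<subseteq> A"
  shows "norm (f V) \<le> nb A a f"
proof -
  have "finite V" using assms finite_subset by blast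
  hence "norm (f V) = norm (\<Sum>U\<in>Pow V. mob f U)" by (simp add: sum_mob)
  also have "\<dots> \<le> (\<Sum>U\<in>Pow V. norm (mob f U))" by (rule norm_sum)
  also have "\<dots> \<le> (\<Sum>U\<in>Pow A. norm (mob f U))"
    by (rule sum_mono2) (use assms in auto)
  also have "\<dots> \<le> nb A a f" unfolding nb_def
    by (intro sum_mono) (use assms in \<open>simp add: mult_le_cancel_right1\<close>)
  finally show ?thesis .
qed

text \<open>A product has union convolution as its transform, and
  \<open>card (S \<union> T) \<le> card S + card T\<close> with \<open>a \<ge> 0\<close> makes the
  exponential weight of a union at most the product of the weights.\<close>

lemma nb_mult:
  assumes "finite A" "a \<ge> 0"
  shows "nb A a (\<lambda>V. f V * g V) \<le> nb A a f * nb A a g"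
proof -
  have "nb A a (\<lambda>V. f V * g V) \<le> (\<Sum>U\<in>Pow A. \<Sum>p\<in>{p\<in>Pow U \<times> Pow U. fst p \<union> snd p = U}.
      (exp (a * real (card (fst p))) * norm (mob f (fst p))) * (exp (a * real (card (snd p))) * norm (mob g (snd p))))"
    unfolding nb_def
  proof (intro sum_mono)
    fix U assume "U \<in> Pow A"
    hence fU: "finite U" using assms finite_subset by blast
    let ?P = "{p\<in>Pow U \<times> Pow U. fst p \<union> snd p = U}"
    have "exp (a * real (card U)) * norm (mob (\<lambda>V. f V * g V) U) \<le>
       exp (a * real (card U)) * (\<Sum>p\<in>?P. norm (mob f (fst p)) * norm (mob g (snd p)))"
      unfolding mob_mult[OF fU] norm_mult[symmetric] by (intro mult_left_mono norm_sum) auto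
    also have "\<dots> \<le> (\<Sum>p\<in>?P. (exp (a * real (card (fst p))) * norm (mob f (fst p))) * (exp (a * real (card (snd p))) * norm (mob g (snd p))))"
      unfolding sum_distrib_left
    proof (rule sum_mono)
      fix p assume p: "p \<in> ?P"
      have "card U \<le> card (fst p) + card (snd p)" using p card_Un_le[of "fst p" "snd p"] by auto
      hence "real (card U) \<le> real (card (fst p)) + real (card (snd p))" by linarith
      hence "a * real (card U) \<le> a * (real (card (fst p)) + real (card (snd p)))"
        using assms by (intro mult_left_mono) auto
      hence "exp (a * real (card U)) \<le> exp (a * real (card (fst p))) * exp (a * real (card (snd p)))"
        by (simp add: exp_add[symmetric] distrib_left)
      hence "exp (a * real (card U)) * (norm (mob f (fst p)) * norm (mob g (snd p))) \<le>
         (exp (a * real (card (fst p))) * exp (a * real (card (snd p)))) * (norm (mob f (fst p)) * norm (mob g (snd p)))"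
        by (rule mult_right_mono) auto
      thus "exp (a * real (card U)) * (norm (mob f (fst p)) * norm (mob g (snd p))) \<le>
        (exp (a * real (card (fst p))) * norm (mob f (fst p))) * (exp (a * real (card (snd p))) * norm (mob g (snd p)))"
        by (simp add: mult_ac)
    qed
    finally show "exp (a * real (card U)) * norm (mob (\<lambda>V. f V * g V) U) \<le>
       (\<Sum>p\<in>?P. (exp (a * real (card (fst p))) * norm (mob f (fst p))) * (exp (a * real (card (snd p))) * norm (mob g (snd p))))" .
  qed
  also have "\<dots> = nb A a f * nb A a g"
    unfolding nb_def sum_union_pairs[OF assms(1), where c="\<lambda>S T. (exp (a * real (card S)) * norm (mob f S)) * (exp (a * real (card T)) * norm (mob g T))"]
    by (simp add: sum_product)
  finally show ?thesis .
qed

lemma nb_prod: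
  assumes "finite A" "a \<ge> 0" "finite I"
  shows "nb A a (\<lambda>V. \<Prod>i\<in>I. f i V) \<le> (\<Prod>i\<in>I. nb A a (f i))"
  using assms(3)
proof (induction I rule: finite_induct)
  case empty
  thus ?case by (simp add: nb_const assms)
next
  case (insert x F)
  have "nb A a (\<lambda>V. \<Prod>i\<in>insert x F. f i V) = nb A a (\<lambda>V. f x V * (\<Prod>i\<in>F. f i V))"
    using insert by simp
  also have "\<dots> \<le> nb A a (f x) * nb A a (\<lambda>V. \<Prod>i\<in>F. f i V)" by (rule nb_mult[OF assms(1,2)])
  also have "\<dots> \<le> nb A a (f x) * (\<Prod>i\<in>F. nb A a (f i))" by (intro mult_left_mono insert nb_nonneg)
  finally show ?case using insert by simp
qed

lemma nb_power:
  assumes "finite A" "a \<ge> 0"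
  shows "nb A a (\<lambda>V. f V ^ k) \<le> nb A a f ^ k"
  using nb_prod[OF assms, of "{..<k}" "\<lambda>_. f"] by simp

text \<open>The norm is a finite sum of moduli of linear combinations of finitely many values, so
  pointwise convergence is enough. This takes the place of completeness of the algebra.\<close>

lemma nb_tendsto:
  assumes "finite A" "\<And>V. V \<subseteq> A \<Longrightarrow> (\<lambda>k. f k V) \<longlonglongrightarrow> g V"
  shows "(\<lambda>k. nb A a (f k)) \<longlonglongrightarrow> nb A a g"
  unfolding nb_def mob_def
  by (intro tendsto_intros assms(2)) auto

text \<open>Functional calculus: partial sums are bounded by submultiplicativity and the bound
  passes to the limit. It is applied to the geometric series and to the logarithm.\<close>

lemma nb_power_series:
  fixes c :: "nat \<Rightarrow> complex"
  assumes A: "finite A" "a \<ge> 0" and r: "nb A a r \<le> \<delta>"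
    and c: "\<And>k. norm (c k) \<le> 1" and \<delta>: "\<delta> < 1"
    and sums: "\<And>V. V \<subseteq> A \<Longrightarrow> (\<lambda>k. c k * r V ^ k) sums g V"
  shows "nb A a g \<le> norm (c 0) + \<delta> / (1 - \<delta>)"
proof (rule LIMSEQ_le_const2[where X="\<lambda>n. nb A a (\<lambda>V. \<Sum>k<n. c k * r V ^ k)"])
  show "(\<lambda>n. nb A a (\<lambda>V. \<Sum>k<n. c k * r V ^ k)) \<longlonglongrightarrow> nb A a g"
    by (rule nb_tendsto[OF A(1)]) (use sums in \<open>auto simp: sums_def\<close>)
  have \<delta>0: "0 \<le> \<delta>" using nb_nonneg r order_trans by blast
  have "nb A a (\<lambda>V. \<Sum>k<Suc n. c k * r V ^ k) \<le> norm (c 0) + \<delta> / (1 - \<delta>)" for n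
  proof -
    have "nb A a (\<lambda>V. \<Sum>k<Suc n. c k * r V ^ k) \<le> (\<Sum>k<Suc n. nb A a (\<lambda>V. c k * r V ^ k))" by (rule nb_sum)
    also have "\<dots> = nb A a (\<lambda>V. c 0) + (\<Sum>k<n. nb A a (\<lambda>V. c (Suc k) * r V ^ Suc k))"
      by (subst sum.lessThan_Suc_shift) simp
    also have "\<dots> \<le> norm (c 0) + (\<Sum>k<n. \<delta> ^ Suc k)"
    proof (intro add_mono sum_mono)
      fix k
      have "nb A a (\<lambda>V. c (Suc k) * r V ^ Suc k) = norm (c (Suc k)) * nb A a (\<lambda>V. r V ^ Suc k)" by (rule nb_cmult)
      also have "\<dots> \<le> 1 * nb A a r ^ Suc k" by (intro mult_mono nb_power A c) (auto simp: nb_nonneg)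
      also have "\<dots> \<le> \<delta> ^ Suc k" using r by (simp only: mult_1) (intro power_mono nb_nonneg)
      finally show "nb A a (\<lambda>V. c (Suc k) * r V ^ Suc k) \<le> \<delta> ^ Suc k" .
    qed (simp add: nb_const A)
    also have "(\<Sum>k<n. \<delta> ^ Suc k) = \<delta> * (\<Sum>k<n. \<delta> ^ k)" by (simp add: sum_distrib_left)
    also have "(\<Sum>k<n. \<delta> ^ k) \<le> 1 / (1 - \<delta>)"
      using \<delta> \<delta>0 by (subst sum_gp_strict) (auto simp: divide_simps)
    finally show ?thesis using \<delta>0 by (simp add: mult_left_mono)
  qed
  thus "\<exists>N. \<forall>n\<ge>N. nb A a (\<lambda>V. \<Sum>k<n. c k * r V ^ k) \<le> norm (c 0) + \<delta> / (1 - \<delta>)"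
    by (metis Suc_le_D)
qed

lemma nb_inverse_one_plus:
  assumes A: "finite A" "a \<ge> 0" and r: "nb A a r \<le> 1/2"
  shows "nb A a (\<lambda>V. inverse (1 + r V)) \<le> 2"
proof -
  have "nb A a (\<lambda>V. inverse (1 + r V)) \<le> norm ((-1::complex)^0) + (1/2) / (1 - 1/2)"
  proof (rule nb_power_series[OF A r])
    fix V assume "V \<subseteq> A"
    hence "norm (r V) \<le> 1/2" using norm_le_nb[OF A] r order_trans by blast
    hence "(\<lambda>k. (- r V) ^ k) sums (1 / (1 - (- r V)))" by (intro geometric_sums) auto
    thus "(\<lambda>k. (-1) ^ k * r V ^ k) sums inverse (1 + r V)"
      by (simp add: power_minus[of "r V"] divide_inverse)
  qed (auto simp: norm_power)
  thus ?thesis by simp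
qed

lemma nb_ln_one_plus:
  assumes A: "finite A" "a \<ge> 0" and r: "nb A a r \<le> 1/2"
  shows "nb A a (\<lambda>V. ln (1 + r V)) \<le> 1"
proof -
  \<comment> \<open>The coefficient at \<open>k = 0\<close> is a division by 0 and hence 0, as it
    should be: the logarithmic series has no constant term.\<close>
  have "nb A a (\<lambda>V. ln (1 + r V)) \<le> norm ((\<lambda>k. - ((-1) ^ k) / of_nat k :: complex) 0) + (1/2) / (1 - 1/2)"
  proof (rule nb_power_series[OF A r])
    fix V assume "V \<subseteq> A"
    hence "norm (r V) \<le> 1/2" using norm_le_nb[OF A] r order_trans by blast
    hence "(\<lambda>k. - ((- r V) ^ k) / of_nat k) sums ln (1 + r V)" by (intro Ln_series') auto
    thus "(\<lambda>k. - ((-1) ^ k) / of_nat k * r V ^ k) sums ln (1 + r V)"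
      by (simp add: power_minus[of "r V"])
  next
    fix k show "norm (- ((-1) ^ k) / of_nat k :: complex) \<le> 1"
      by (cases k) (auto simp: norm_power norm_divide norm_mult simp del: of_nat_Suc)
  qed auto
  thus ?thesis by simp
qed

lemma sum_power_card_Pow:
  fixes x :: "'b::comm_ring_1"
  assumes "finite N"
  shows "(\<Sum>U\<in>Pow N. x ^ card U) = (x + 1) ^ card N"
  using prod_add[OF assms, of "\<lambda>_. x" "\<lambda>_. 1"] by simp

text \<open>Coefficients vanish unless \<open>U \<subseteq> N\<close>, and then they are at most
  \<open>2 ^ card U * B\<close>; the binomial theorem adds up \<open>(2 * exp a) ^ card U\<close>. A
  local quantity thus pays for its neighbourhood \<open>N\<close> and not for the size of
  \<open>A\<close>.\<close>

lemma nb_local: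
  assumes A: "finite A" "a \<ge> 0" and N: "N \<subseteq> A"
    and loc: "\<And>V. V \<subseteq> A \<Longrightarrow> f V = f (V \<inter> N)"
    and B: "\<And>V. V \<subseteq> A \<Longrightarrow> norm (f V) \<le> B"
  shows "nb A a f \<le> (1 + 2 * exp a) ^ card N * B"
proof -
  have fN: "finite N" using A N finite_subset by blast
  have z: "mob f U = 0" if "U \<in> Pow A - Pow N" for U
  proof -
    from that obtain i where i: "i \<in> U" "i \<notin> N" by blast
    show ?thesis
    proof (rule mob_eq_0_if_insensitive[of U i])
      fix V assume V: "V \<subseteq> U"
      have "f (insert i V) = f (insert i V \<inter> N)" by (rule loc) (use that V i in auto)
      also have "insert i V \<inter> N = (V - {i}) \<inter> N" using i by auto
      also have "f \<dots> = f (V - {i})" by (rule loc[symmetric]) (use that V in auto)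
      finally show "f (insert i V) = f (V - {i})" .
    qed (use i that A finite_subset in auto)
  qed
  have "nb A a f = (\<Sum>U\<in>Pow N. exp (a * real (card U)) * norm (mob f U))"
    unfolding nb_def by (rule sum.mono_neutral_right) (use A N z in auto)
  also have "\<dots> \<le> (\<Sum>U\<in>Pow N. (2 * exp a) ^ card U * B)"
  proof (rule sum_mono)
    fix U assume U: "U \<in> Pow N"
    have "norm (mob f U) \<le> 2 ^ card U * B" by (rule norm_mob_le) (use U N A fN finite_subset B in auto)
    hence "exp (a * real (card U)) * norm (mob f U) \<le> exp (a * real (card U)) * (2 ^ card U * B)"
      by (rule mult_left_mono) auto
    thus "exp (a * real (card U)) * norm (mob f U) \<le> (2 * exp a) ^ card U * B"
      unfolding exp_of_nat2_mult power_mult_distrib by (simp only: mult_ac)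
  qed
  also have "\<dots> = (1 + 2 * exp a) ^ card N * B"
    unfolding sum_distrib_right[symmetric]
    by (simp only: sum_power_card_Pow[OF fN] add.commute)
  finally show ?thesis .
qed

section \<open>Connected sets in graphs of bounded degree\<close>

text \<open>The start point belongs to its component even when it lies outside \<open>C\<close>,
  hence the assumption \<open>x \<in> C\<close> where containment matters.\<close>

definition comp_of :: "'v rel \<Rightarrow> 'v set \<Rightarrow> 'v \<Rightarrow> 'v set" where
  "comp_of E C x = {y. (x, y) \<in> (E \<inter> C \<times> C)\<^sup>*}"

definition conn :: "'v rel \<Rightarrow> 'v set \<Rightarrow> bool" where
  "conn E C \<longleftrightarrow> (\<forall>x\<in>C. \<forall>y\<in>C. (x, y) \<in> (E \<inter> C \<times> C)\<^sup>*)"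

lemma sym_Int_Times: "sym E \<Longrightarrow> sym (E \<inter> C \<times> C)"
  by (auto simp: sym_def)

lemma comp_of_self: "x \<in> comp_of E C x"
  by (simp add: comp_of_def)

lemma comp_of_subset: "x \<in> C \<Longrightarrow> comp_of E C x \<subseteq> C"
  unfolding comp_of_def by (auto elim: rtranclE)

lemma comp_of_closed: "y \<in> comp_of E C x \<Longrightarrow> (y, u) \<in> E \<Longrightarrow> y \<in> C \<Longrightarrow> u \<in> C \<Longrightarrow> u \<in> comp_of E C x"
  unfolding comp_of_def by (auto intro: rtrancl_into_rtrancl)

lemma comp_of_path:
  assumes "y \<in> comp_of E C x" "x \<in> C"
  shows "(x, y) \<in> (E \<inter> comp_of E C x \<times> comp_of E C x)\<^sup>*"
proof -
  have "(x, y) \<in> (E \<inter> C \<times> C)\<^sup>*" using assms by (simp add: comp_of_def)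
  thus ?thesis
  proof (induction rule: rtrancl_induct)
    case base
    thus ?case by simp
  next
    case (step y u)
    have "y \<in> comp_of E C x" using step(1) by (simp add: comp_of_def)
    moreover have "u \<in> comp_of E C x" using step(1,2) by (auto simp: comp_of_def intro: rtrancl_into_rtrancl)
    ultimately show ?case using step(2,3) by (auto intro: rtrancl_into_rtrancl)
  qed
qed

lemma conn_if_rooted:
  assumes "sym E" "\<And>y. y \<in> C \<Longrightarrow> (x, y) \<in> (E \<inter> C \<times> C)\<^sup>*"
  shows "conn E C"
  unfolding conn_def
proof (intro ballI)
  fix u v assume "u \<in> C" "v \<in> C"
  hence "(x, u) \<in> (E \<inter> C \<times> C)\<^sup>*" "(x, v) \<in> (E \<inter> C \<times> C)\<^sup>*" using assms(2) by auto
  thus "(u, v) \<in> (E \<inter> C \<times> C)\<^sup>*"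
    using symD[OF sym_rtrancl[OF sym_Int_Times[OF assms(1)]], of x u C] by (auto intro: rtrancl_trans)
qed

lemma conn_comp_of: "sym E \<Longrightarrow> x \<in> C \<Longrightarrow> conn E (comp_of E C x)"
  by (rule conn_if_rooted[of E _ x]) (auto intro: comp_of_path)

lemma comp_of_eq:
  assumes "sym E" "y \<in> comp_of E C x"
  shows "comp_of E C y = comp_of E C x"
proof -
  have "(x, y) \<in> (E \<inter> C \<times> C)\<^sup>*" using assms(2) by (simp add: comp_of_def)
  moreover have "(y, x) \<in> (E \<inter> C \<times> C)\<^sup>*"
    using symD[OF sym_rtrancl[OF sym_Int_Times[OF assms(1)]], of x y C] calculation by simp
  ultimately show ?thesis unfolding comp_of_def by (blast intro: rtrancl_trans)
qed

text \<open>A path from \<open>x\<close> cannot leave \<open>G\<close>, because a step out of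
  \<open>G\<close> ends in its neighbourhood. In \<open>Zf_split\<close> this shows that attaching a
  separated remainder to an animal does not change the component of the root.\<close>

lemma comp_of_Un:
  assumes "conn E G" "x \<in> G" "E `` G \<inter> C' = {}"
  shows "comp_of E (G \<union> C') x = G"
proof
  show "G \<subseteq> comp_of E (G \<union> C') x"
  proof
    fix y assume "y \<in> G"
    hence "(x, y) \<in> (E \<inter> G \<times> G)\<^sup>*" using assms by (auto simp: conn_def)
    moreover have "(E \<inter> G \<times> G)\<^sup>* \<subseteq> (E \<inter> (G \<union> C') \<times> (G \<union> C'))\<^sup>*" by (rule rtrancl_mono) auto
    ultimately show "y \<in> comp_of E (G \<union> C') x" by (auto simp: comp_of_def)
  qed
  show "comp_of E (G \<union> C') x \<subseteq> G"
  proof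
    fix y assume "y \<in> comp_of E (G \<union> C') x"
    hence "(x, y) \<in> (E \<inter> (G \<union> C') \<times> (G \<union> C'))\<^sup>*" by (simp add: comp_of_def)
    thus "y \<in> G"
      by (induction rule: rtrancl_induct) (use assms in auto)
  qed
qed

text \<open>Follow a path from \<open>u\<close> until it first arrives at \<open>x\<close>: the site
  before is a neighbour of \<open>x\<close> and still in the component of \<open>u\<close>. So the
  number of components left after deleting the root is at most the degree of the root.\<close>

lemma conn_remove_root:
  assumes "conn E G" "x \<in> G" "u \<in> G - {x}" "sym E"
  obtains y where "(x, y) \<in> E" "y \<in> comp_of E (G - {x}) u"
proof -
  have "(u, x) \<in> (E \<inter> G \<times> G)\<^sup>*" using assms by (auto simp: conn_def)
  hence "u \<noteq> x \<longrightarrow> (\<exists>y. (x, y) \<in> E \<and> y \<in> comp_of E (G - {x}) u)"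
  proof (induction rule: converse_rtrancl_induct)
    case base
    thus ?case by simp
  next
    case (step u u')
    show ?case
    proof
      assume ux: "u \<noteq> x"
      show "\<exists>y. (x, y) \<in> E \<and> y \<in> comp_of E (G - {x}) u"
      proof (cases "u' = x")
        case True
        thus ?thesis using step(1) assms(4) by (intro exI[of _ u]) (auto simp: comp_of_self dest: symD)
      next
        case False
        then obtain y where y: "(x, y) \<in> E" "y \<in> comp_of E (G - {x}) u'" using step(3) by auto
        have "(u, u') \<in> E \<inter> (G - {x}) \<times> (G - {x})" using step(1) ux False by auto
        thus ?thesis using y unfolding comp_of_def by (auto intro: converse_rtrancl_into_rtrancl)
      qed
    qed
  qed
  thus ?thesis using assms(3) that by auto
qed

text \<open>The relation is reflexive, so that a neighbourhood contains the set itself; separation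
  then excludes overlap as well as contact.\<close>

locale bounded_degree =
  fixes E :: "'v rel" and \<Delta> :: nat
  assumes symE: "sym E" and reflE: "\<And>x. (x, x) \<in> E"
    and finE: "\<And>x. finite (E `` {x})" and degE: "\<And>x. card (E `` {x}) \<le> \<Delta>"
begin

definition animals :: "'v set \<Rightarrow> 'v \<Rightarrow> 'v set set" where
  "animals W x = {G. G \<subseteq> W \<and> x \<in> G \<and> conn E G}"

lemma finite_animals: "finite W \<Longrightarrow> finite (animals W x)"
  by (rule finite_subset[of _ "Pow W"]) (auto simp: animals_def)

lemma card_nbhd_le: "finite G \<Longrightarrow> finite (E `` G) \<and> card (E `` G) \<le> \<Delta> * card G"
proof -
  assume G: "finite G"
  have "E `` G = (\<Union>x\<in>G. E `` {x})" by auto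
  moreover have "card (\<Union>x\<in>G. E `` {x}) \<le> (\<Sum>x\<in>G. card (E `` {x}))" by (rule card_UN_le[OF G])
  moreover have "\<dots> \<le> (\<Sum>x\<in>G. \<Delta>)" by (intro sum_mono degE)
  ultimately show ?thesis using G finE by (auto simp: mult.commute)
qed

text \<open>Removing the root x splits an animal into components, each of which is charged to one of
  the neighbours of x; hence the generating function F satisfies F <= z (1 + F)^\<Delta>.\<close>

lemma sum_animals_le:
  fixes z :: real
  assumes "finite W" "z \<ge> 0" "z * 2 ^ \<Delta> \<le> 1"
  shows "(\<Sum>G\<in>animals W x. z ^ card G) \<le> z * 2 ^ \<Delta>"
  using assms(1)
proof (induction "card W" arbitrary: W x rule: less_induct)
  case less
  show ?case
  proof (cases "x \<in> W")
    case False
    hence "animals W x = {}" by (auto simp: animals_def)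
    thus ?thesis using assms by simp
  next
    case True
    define W' where "W' = W - {x}"
    have W': "finite W'" "card W' < card W" unfolding W'_def using less(2) True by (auto intro: card_Diff1_less simp only: finite_Diff)
    define Y where "Y = E `` {x}"
    have Y: "finite Y" "card Y \<le> \<Delta>" using finE degE by (auto simp: Y_def)
    \<comment> \<open>A component may contain several neighbours of \<open>x\<close>; choosing one
      of them avoids listing the component twice.\<close>
    define rep where "rep K = (SOME y. y \<in> Y \<and> y \<in> K)" for K
    \<comment> \<open>The animal is encoded as a family indexed by the neighbours of the root, with
      \<open>{}\<close> at the neighbours that represent no component. Injectivity of this code
      bounds the sum over animals by a product over \<open>Y\<close> of sums for the smaller set
      \<open>W'\<close>.\<close>
    define c where "c G = (\<lambda>y\<in>Y. if y \<in> G - {x} \<and> rep (comp_of E (G - {x}) y) = y then comp_of E (G - {x}) y else {})" for G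
    have rep: "rep (comp_of E (G - {x}) u) \<in> Y" "rep (comp_of E (G - {x}) u) \<in> comp_of E (G - {x}) u"
      if "G \<in> animals W x" "u \<in> G - {x}" for G u
    proof -
      have "\<exists>y. y \<in> Y \<and> y \<in> comp_of E (G - {x}) u"
        using conn_remove_root[of E G x u] that symE by (auto simp: animals_def Y_def)
      hence "rep (comp_of E (G - {x}) u) \<in> Y \<and> rep (comp_of E (G - {x}) u) \<in> comp_of E (G - {x}) u"
        unfolding rep_def by (rule someI_ex)
      thus "rep (comp_of E (G - {x}) u) \<in> Y" "rep (comp_of E (G - {x}) u) \<in> comp_of E (G - {x}) u" by auto
    qed
    have un: "(\<Union>y\<in>Y. c G y) = G - {x}" if G: "G \<in> animals W x" for G
    proof (intro equalityI subsetI)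
      fix u assume "u \<in> (\<Union>y\<in>Y. c G y)"
      thus "u \<in> G - {x}" using comp_of_subset[of _ "G - {x}" E] by (auto simp: c_def split: if_splits)
    next
      fix u assume u: "u \<in> G - {x}"
      define y where "y = rep (comp_of E (G - {x}) u)"
      have y: "y \<in> Y" "y \<in> comp_of E (G - {x}) u" using rep[OF G u] by (auto simp: y_def)
      have eq: "comp_of E (G - {x}) y = comp_of E (G - {x}) u" by (rule comp_of_eq[OF symE y(2)])
      have "y \<in> G - {x}" using y comp_of_subset[OF u, of E] by auto
      moreover have "rep (comp_of E (G - {x}) y) = y" unfolding eq using y_def by simp
      ultimately have "c G y = comp_of E (G - {x}) u" using y(1) eq by (auto simp: c_def)
      thus "u \<in> (\<Union>y\<in>Y. c G y)" using y(1) comp_of_self by fastforce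
    qed
    have disj: "c G y \<inter> c G y' = {}" if "y \<in> Y" "y' \<in> Y" "y \<noteq> y'" for G y y'
    proof (rule ccontr)
      assume "c G y \<inter> c G y' \<noteq> {}"
      then obtain u where u: "u \<in> c G y" "u \<in> c G y'" by auto
      have 1: "u \<in> comp_of E (G - {x}) y" "rep (comp_of E (G - {x}) y) = y" using u that by (auto simp: c_def split: if_splits)
      have 2: "u \<in> comp_of E (G - {x}) y'" "rep (comp_of E (G - {x}) y') = y'" using u that by (auto simp: c_def split: if_splits)
      show False using comp_of_eq[OF symE 1(1)] comp_of_eq[OF symE 2(1)] 1(2) 2(2) that by metis
    qed
    have cardG: "z ^ card G = z * (\<Prod>y\<in>Y. z ^ card (c G y))" if G: "G \<in> animals W x" for G
    proof -
      have fG: "finite G" "x \<in> G" using G less(2) finite_subset by (auto simp: animals_def)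
      have "card (\<Union>y\<in>Y. c G y) = (\<Sum>y\<in>Y. card (c G y))"
      proof (rule card_UN_disjoint[OF Y(1)])
        show "\<forall>i\<in>Y. finite (c G i)"
        proof
          fix i assume "i \<in> Y"
          hence "c G i \<subseteq> G - {x}" using un[OF G] by auto
          thus "finite (c G i)" using fG finite_subset by blast
        qed
      qed (use disj in auto)
      hence "card G = Suc (\<Sum>y\<in>Y. card (c G y))" using fG un[OF G] by (metis card_Suc_Diff1)
      thus ?thesis by (simp add: power_sum)
    qed
    define S where "S y = insert {} (animals W' y)" for y
    have S: "finite (S y)" for y unfolding S_def using finite_animals[OF W'(1)] by auto
    have cS: "c G \<in> PiE Y S" if G: "G \<in> animals W x" for G
    proof (rule PiE_I)
      fix y assume y: "y \<in> Y"
      show "c G y \<in> S y"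
      proof (cases "y \<in> G - {x} \<and> rep (comp_of E (G - {x}) y) = y")
        case True
        have "comp_of E (G - {x}) y \<in> animals W' y"
          using True comp_of_subset[of y "G - {x}" E] conn_comp_of[OF symE, of y "G - {x}"] G
          by (auto simp: animals_def W'_def comp_of_self)
        thus ?thesis using True y by (auto simp: c_def S_def)
      qed (use y in \<open>auto simp: c_def S_def\<close>)
    qed (auto simp: c_def)
    have inj: "inj_on c (animals W x)"
    proof (rule inj_onI)
      fix G G' assume G: "G \<in> animals W x" "G' \<in> animals W x" "c G = c G'"
      have "G - {x} = G' - {x}" using un[OF G(1)] un[OF G(2)] G(3) by simp
      thus "G = G'" using G by (auto simp: animals_def)
    qed
    have "(\<Sum>G\<in>animals W x. z ^ card G) = z * (\<Sum>G\<in>animals W x. \<Prod>y\<in>Y. z ^ card (c G y))"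
      by (simp add: sum_distrib_left cardG)
    also have "(\<Sum>G\<in>animals W x. \<Prod>y\<in>Y. z ^ card (c G y)) = (\<Sum>f\<in>c ` animals W x. \<Prod>y\<in>Y. z ^ card (f y))"
      by (simp add: sum.reindex[OF inj])
    also have "\<dots> \<le> (\<Sum>f\<in>PiE Y S. \<Prod>y\<in>Y. z ^ card (f y))"
      by (rule sum_mono2) (use cS S Y assms in \<open>auto intro!: finite_PiE prod_nonneg\<close>)
    also have "\<dots> = (\<Prod>y\<in>Y. \<Sum>K\<in>S y. z ^ card K)"
      by (rule prod_sum_PiE[symmetric]) (use Y S in auto)
    also have "\<dots> \<le> (\<Prod>y\<in>Y. 2)"
    proof (rule prod_mono, intro conjI)
      fix y assume "y \<in> Y"
      show "0 \<le> (\<Sum>K\<in>S y. z ^ card K)" using assms by (intro sum_nonneg) auto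
      have "{} \<notin> animals W' y" by (auto simp: animals_def)
      hence "(\<Sum>K\<in>S y. z ^ card K) = 1 + (\<Sum>K\<in>animals W' y. z ^ card K)"
        unfolding S_def using finite_animals[OF W'(1)] by (subst sum.insert) auto
      also have "\<dots> \<le> 1 + z * 2 ^ \<Delta>" using less(1)[OF W'(2,1)] by simp
      finally show "(\<Sum>K\<in>S y. z ^ card K) \<le> 2" using assms by simp
    qed
    also have "\<dots> \<le> 2 ^ \<Delta>" using Y by (simp add: power_increasing)
    finally show ?thesis using assms(2) by (simp add: mult_left_mono)
  qed
qed

section \<open>A cluster expansion with values in the Moebius algebra\<close>

text \<open>The sum runs over occupied sets and not over families of compatible polymers. For
  weights that are multiplicative over separated sets this is the same, each set being the family of
  its components.\<close>

definition Zf :: "('v set \<Rightarrow> 'i set \<Rightarrow> complex) \<Rightarrow> 'v set \<Rightarrow> 'i set \<Rightarrow> complex" where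
  "Zf w W V = (\<Sum>C\<in>Pow W. w C V)"

text \<open>Sort the sets that contain \<open>x\<close> by the component \<open>G\<close> of
  \<open>x\<close>: the remainder avoids the neighbourhood of \<open>G\<close>, so the weight
  factorizes and the remainder is summed freely.\<close>

lemma Zf_split:
  assumes W: "finite W" "x \<in> W"
    and mult: "\<And>C1 C2. C1 \<subseteq> W \<Longrightarrow> C2 \<subseteq> W \<Longrightarrow> E `` C1 \<inter> C2 = {} \<Longrightarrow> w (C1 \<union> C2) V = w C1 V * w C2 V"
  shows "Zf w W V = Zf w (W - {x}) V + (\<Sum>G\<in>animals W x. w G V * Zf w (W - E `` G) V)"
proof -
  have "Zf w W V = (\<Sum>C\<in>Pow (W - {x}) \<union> {C\<in>Pow W. x \<in> C}. w C V)"
    unfolding Zf_def by (rule sum.cong) auto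
  also have "\<dots> = Zf w (W - {x}) V + (\<Sum>C\<in>{C\<in>Pow W. x \<in> C}. w C V)"
    unfolding Zf_def by (rule sum.union_disjoint) (use W in auto)
  also have "(\<Sum>C\<in>{C\<in>Pow W. x \<in> C}. w C V) = (\<Sum>(G, C)\<in>Sigma (animals W x) (\<lambda>G. Pow (W - E `` G)). w (G \<union> C) V)"
  proof (rule sum.reindex_bij_witness[of _ "\<lambda>(G, C). G \<union> C" "\<lambda>C. (comp_of E C x, C - comp_of E C x)"])
    fix C assume "C \<in> {C\<in>Pow W. x \<in> C}"
    hence C: "C \<subseteq> W" "x \<in> C" by auto
    have sub: "comp_of E C x \<subseteq> C" by (rule comp_of_subset[OF C(2)])
    show "(case (comp_of E C x, C - comp_of E C x) of (G, C) \<Rightarrow> G \<union> C) = C" using sub by auto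
    show "(comp_of E C x, C - comp_of E C x) \<in> Sigma (animals W x) (\<lambda>G. Pow (W - E `` G))"
      using sub C conn_comp_of[OF symE C(2)] comp_of_closed[of _ E C x] by (auto simp: animals_def comp_of_self)
    show "(case (comp_of E C x, C - comp_of E C x) of (G, C) \<Rightarrow> w (G \<union> C) V) = w C V" using sub by (simp add: Un_absorb1)
  next
    fix p assume "p \<in> Sigma (animals W x) (\<lambda>G. Pow (W - E `` G))"
    then obtain G C where p: "p = (G, C)" "G \<in> animals W x" "C \<subseteq> W - E `` G" by auto
    have G: "x \<in> G" "G \<subseteq> W" "conn E G" using p by (auto simp: animals_def)
    have eq: "comp_of E (G \<union> C) x = G" by (rule comp_of_Un) (use G p in auto)
    have "G \<inter> C = {}" using p reflE by auto
    thus "(comp_of E (case p of (G, C) \<Rightarrow> G \<union> C) x, (case p of (G, C) \<Rightarrow> G \<union> C) - comp_of E (case p of (G, C) \<Rightarrow> G \<union> C) x) = p"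
      using eq p by auto
    show "(case p of (G, C) \<Rightarrow> G \<union> C) \<in> {C \<in> Pow W. x \<in> C}" using p G by auto
  qed
  also have "\<dots> = (\<Sum>G\<in>animals W x. \<Sum>C\<in>Pow (W - E `` G). w (G \<union> C) V)"
    by (rule sum.Sigma[symmetric]) (use W finite_animals in auto)
  also have "\<dots> = (\<Sum>G\<in>animals W x. w G V * Zf w (W - E `` G) V)"
    unfolding Zf_def sum_distrib_left
    by (intro sum.cong refl mult) (auto simp: animals_def)
  finally show ?thesis .
qed

text \<open>The bound is in the norm of the Moebius algebra, so it controls the dependence of a
  weight on the volume together with its size.\<close>

definition kp_weight :: "'i set \<Rightarrow> real \<Rightarrow> 'v set \<Rightarrow> real \<Rightarrow> ('v set \<Rightarrow> 'i set \<Rightarrow> complex) \<Rightarrow> bool" where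
  "kp_weight A a W z w \<longleftrightarrow>
     (\<forall>V\<subseteq>A. w {} V = 1) \<and>
     (\<forall>V\<subseteq>A. \<forall>C1\<subseteq>W. \<forall>C2\<subseteq>W. E `` C1 \<inter> C2 = {} \<longrightarrow> w (C1 \<union> C2) V = w C1 V * w C2 V) \<and>
     (\<forall>C\<subseteq>W. nb A a (w C) \<le> z ^ card C)"

lemma kp_weight_subset: "kp_weight A a W z w \<Longrightarrow> W' \<subseteq> W \<Longrightarrow> kp_weight A a W' z w"
  unfolding kp_weight_def by (meson order_trans)

text \<open>Remove the sites of \<open>Y\<close> one at a time. Each removal multiplies by the
  inverse of \<open>1 + r\<close> with \<open>r\<close> of norm at most 1/2, which has norm at most
  2.\<close>

lemma Zf_quotient_bound:
  assumes A: "finite A" "a \<ge> 0" and Y: "finite Y"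
    and nz: "\<And>W' V. W' \<subseteq> W \<Longrightarrow> V \<subseteq> A \<Longrightarrow> Zf w W' V \<noteq> 0"
    and r: "\<And>W' x. W' \<subseteq> W \<Longrightarrow> x \<in> W' \<Longrightarrow> nb A a (\<lambda>V. Zf w W' V / Zf w (W' - {x}) V - 1) \<le> 1/2"
  shows "nb A a (\<lambda>V. Zf w (W - Y) V / Zf w W V) \<le> 2 ^ card Y"
  using Y
proof (induction Y rule: finite_induct)
  case empty
  have "nb A a (\<lambda>V. Zf w (W - {}) V / Zf w W V) = nb A a (\<lambda>V. 1)"
    by (rule nb_cong) (simp add: nz)
  thus ?case by (simp add: nb_const A)
next
  case (insert y Y)
  have le: "nb A a (\<lambda>V. Zf w (W - insert y Y) V / Zf w (W - Y) V) \<le> 2"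
  proof (cases "y \<in> W - Y")
    case True
    let ?r = "\<lambda>V. Zf w (W - Y) V / Zf w (W - Y - {y}) V - 1"
    have eq: "W - insert y Y = W - Y - {y}" by auto
    have "nb A a (\<lambda>V. Zf w (W - insert y Y) V / Zf w (W - Y) V) = nb A a (\<lambda>V. inverse (1 + ?r V))"
      by (rule nb_cong) (simp add: eq)
    also have "\<dots> \<le> 2" by (rule nb_inverse_one_plus[OF A]) (rule r, use True in auto)
    finally show ?thesis .
  next
    case False
    hence "W - insert y Y = W - Y" by auto
    hence "nb A a (\<lambda>V. Zf w (W - insert y Y) V / Zf w (W - Y) V) = nb A a (\<lambda>V. 1)"
      by (intro nb_cong) (simp add: nz)
    thus ?thesis by (simp add: nb_const A)
  qed
  have "nb A a (\<lambda>V. Zf w (W - insert y Y) V / Zf w W V) =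
     nb A a (\<lambda>V. (Zf w (W - insert y Y) V / Zf w (W - Y) V) * (Zf w (W - Y) V / Zf w W V))"
    by (rule nb_cong) (simp add: nz)
  also have "\<dots> \<le> nb A a (\<lambda>V. Zf w (W - insert y Y) V / Zf w (W - Y) V) * nb A a (\<lambda>V. Zf w (W - Y) V / Zf w W V)"
    by (rule nb_mult[OF A])
  also have "\<dots> \<le> 2 * 2 ^ card Y" by (intro mult_mono le insert) (auto simp: nb_nonneg)
  finally show ?case using insert by simp
qed

text \<open>Induction on \<open>W\<close>, with the ratios \<open>Zf W / Zf (W - {x}) - 1\<close> expanded over the animals that contain \<open>x\<close>;
  this avoids Ursell functions.\<close>

theorem kp_convergence:
  assumes A: "finite A" "a \<ge> 0" and W: "finite W" and z: "z \<ge> 0" "z * 2 ^ \<Delta> * 2 ^ \<Delta> \<le> 1/2"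
    and w: "kp_weight A a W z w"
  shows "(\<forall>V\<subseteq>A. Zf w W V \<noteq> 0) \<and> (\<forall>x\<in>W. nb A a (\<lambda>V. Zf w W V / Zf w (W - {x}) V - 1) \<le> 1/2)"
  using W w
proof (induction "card W" arbitrary: W rule: less_induct)
  case less
  have IH: "(\<forall>V\<subseteq>A. Zf w W' V \<noteq> 0) \<and> (\<forall>x\<in>W'. nb A a (\<lambda>V. Zf w W' V / Zf w (W' - {x}) V - 1) \<le> 1/2)"
    if "W' \<subset> W" for W'
  proof (rule less(1))
    show "card W' < card W" using that less(2) by (rule psubset_card_mono[rotated])
    show "finite W'" using that less(2) finite_subset by blast
    show "kp_weight A a W' z w" using that less(3) kp_weight_subset by blast
  qed
  have main: "nb A a (\<lambda>V. Zf w W V / Zf w (W - {x}) V - 1) \<le> 1/2" if x: "x \<in> W" for x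
  proof -
    define W' where "W' = W - {x}"
    have sub: "W'' \<subset> W" if "W'' \<subseteq> W'" for W'' using that x by (auto simp: W'_def)
    have nz: "Zf w W'' V \<noteq> 0" if "W'' \<subseteq> W'" "V \<subseteq> A" for W'' V using IH[OF sub[OF that(1)]] that by auto
    let ?r = "\<lambda>V. \<Sum>G\<in>animals W x. w G V * (Zf w (W' - E `` G) V / Zf w W' V)"
    have "nb A a (\<lambda>V. Zf w W V / Zf w W' V - 1) = nb A a ?r"
    proof (rule nb_cong)
      fix V assume V: "V \<subseteq> A"
      have "Zf w W V = Zf w W' V + (\<Sum>G\<in>animals W x. w G V * Zf w (W - E `` G) V)"
        unfolding W'_def by (rule Zf_split[OF less(2) x]) (use less(3) V in \<open>auto simp: kp_weight_def\<close>)
      also have "(\<Sum>G\<in>animals W x. w G V * Zf w (W - E `` G) V) = (\<Sum>G\<in>animals W x. w G V * Zf w (W' - E `` G) V)"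
      proof (intro sum.cong refl)
        fix G assume "G \<in> animals W x"
        hence "x \<in> E `` G" using reflE by (auto simp: animals_def)
        hence "W - E `` G = W' - E `` G" by (auto simp: W'_def)
        thus "w G V * Zf w (W - E `` G) V = w G V * Zf w (W' - E `` G) V" by simp
      qed
      finally show "Zf w W V / Zf w W' V - 1 = ?r V"
        using nz[of W' V] V by (simp add: add_divide_distrib sum_divide_distrib)
    qed
    also have "\<dots> \<le> (\<Sum>G\<in>animals W x. nb A a (\<lambda>V. w G V * (Zf w (W' - E `` G) V / Zf w W' V)))" by (rule nb_sum)
    \<comment> \<open>Deleting the neighbourhood of \<open>G\<close> costs 2 for each of its at most
      \<open>\<Delta> * card G\<close> sites. The other factor \<open>2 ^ \<Delta>\<close> in the
      condition on \<open>z\<close> is spent on the sum over animals.\<close>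
    also have "\<dots> \<le> (\<Sum>G\<in>animals W x. (z * 2 ^ \<Delta>) ^ card G)"
    proof (rule sum_mono)
      fix G assume G: "G \<in> animals W x"
      hence fG: "finite G" "G \<subseteq> W" using less(2) finite_subset by (auto simp: animals_def)
      have c: "finite (E `` G)" "card (E `` G) \<le> \<Delta> * card G" using card_nbhd_le[OF fG(1)] by auto
      have q: "nb A a (\<lambda>V. Zf w (W' - E `` G) V / Zf w W' V) \<le> 2 ^ card (E `` G)"
        by (rule Zf_quotient_bound[OF A c(1)]) (use nz IH sub in auto)
      have "nb A a (\<lambda>V. w G V * (Zf w (W' - E `` G) V / Zf w W' V)) \<le> nb A a (w G) * nb A a (\<lambda>V. Zf w (W' - E `` G) V / Zf w W' V)"
        by (rule nb_mult[OF A])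
      also have "\<dots> \<le> z ^ card G * 2 ^ (\<Delta> * card G)"
      proof (rule mult_mono)
        show "nb A a (w G) \<le> z ^ card G" using less(3) fG by (auto simp: kp_weight_def)
        show "nb A a (\<lambda>V. Zf w (W' - E `` G) V / Zf w W' V) \<le> 2 ^ (\<Delta> * card G)"
          using q c(2) power_increasing[OF c(2), of "2::real"] by linarith
      qed (use z nb_nonneg in auto)
      finally show "nb A a (\<lambda>V. w G V * (Zf w (W' - E `` G) V / Zf w W' V)) \<le> (z * 2 ^ \<Delta>) ^ card G"
        by (simp add: power_mult_distrib power_mult)
    qed
    also have "\<dots> \<le> z * 2 ^ \<Delta> * 2 ^ \<Delta>"
      by (rule sum_animals_le[OF less(2)]) (use z in \<open>auto simp: mult_ac\<close>)
    finally show ?thesis using z unfolding W'_def by linarith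
  qed
  show ?case
  proof (intro conjI ballI allI impI main)
    fix V assume V: "V \<subseteq> A"
    show "Zf w W V \<noteq> 0"
    proof (cases "W = {}")
      case True
      thus ?thesis using less(3) V by (simp add: Zf_def kp_weight_def)
    next
      case False
      then obtain x where x: "x \<in> W" by auto
      have "norm (Zf w W V / Zf w (W - {x}) V - 1) \<le> 1/2"
        using norm_le_nb[OF A V, of "\<lambda>V. Zf w W V / Zf w (W - {x}) V - 1"] main[OF x] by linarith
      thus ?thesis by auto
    qed
  qed
qed

text \<open>Each removed site contributes a factor \<open>1 + r\<close> whose logarithm has norm at
  most 1. Adding these logarithms, rather than taking the logarithm of the whole quotient, avoids a
  choice of branch.\<close>

corollary kp_log_ratio:
  assumes A: "finite A" "a \<ge> 0" and W: "finite W" and z: "z \<ge> 0" "z * 2 ^ \<Delta> * 2 ^ \<Delta> \<le> 1/2"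
    and w: "kp_weight A a W z w" and L: "L \<subseteq> W"
  shows "\<exists>l. nb A a l \<le> card L \<and> (\<forall>V\<subseteq>A. Zf w W V = Zf w (W - L) V * exp (l V))"
proof -
  have "finite L" using L W finite_subset by blast
  thus ?thesis using L
  proof (induction L rule: finite_induct)
    case empty
    thus ?case by (intro exI[of _ "\<lambda>_. 0"]) (simp add: nb_const A)
  next
    case (insert x L)
    then obtain l where l: "nb A a l \<le> card L" "\<forall>V\<subseteq>A. Zf w W V = Zf w (W - L) V * exp (l V)" by auto
    let ?r = "\<lambda>V. Zf w (W - L) V / Zf w (W - L - {x}) V - 1"
    have KP: "(\<forall>V\<subseteq>A. Zf w W' V \<noteq> 0) \<and> (\<forall>x\<in>W'. nb A a (\<lambda>V. Zf w W' V / Zf w (W' - {x}) V - 1) \<le> 1/2)" if "W' \<subseteq> W" for W'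
      using kp_convergence[OF A _ z kp_weight_subset[OF w that]] W that finite_subset by blast
    have eq: "W - insert x L = W - L - {x}" by auto
    have "nb A a ?r \<le> 1/2" using KP[of "W - L"] insert by auto
    hence "nb A a (\<lambda>V. ln (1 + ?r V)) \<le> 1" by (rule nb_ln_one_plus[OF A])
    hence "nb A a (\<lambda>V. l V + ln (1 + ?r V)) \<le> card L + 1" using nb_add[of A a l "\<lambda>V. ln (1 + ?r V)"] l(1) by linarith
    moreover have "Zf w W V = Zf w (W - insert x L) V * exp (l V + ln (1 + ?r V))" if V: "V \<subseteq> A" for V
    proof -
      have "Zf w (W - L) V \<noteq> 0" "Zf w (W - L - {x}) V \<noteq> 0" using KP[of "W - L"] KP[of "W - L - {x}"] V by auto
      thus ?thesis using l(2) V unfolding eq by (simp add: exp_add)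
    qed
    ultimately show ?case using insert by (intro exI[of _ "\<lambda>V. l V + ln (1 + ?r V)"]) auto
  qed
qed

text \<open>Both partition functions are compared with their common value on \<open>W - L\<close>,
  so the cost is counted by \<open>L\<close> alone and not by \<open>W\<close>.\<close>

corollary kp_log_ratio2:
  assumes A: "finite A" "a \<ge> 0" and W: "finite W" and z: "z \<ge> 0" "z * 2 ^ \<Delta> * 2 ^ \<Delta> \<le> 1/2"
    and w: "kp_weight A a W z w" and w': "kp_weight A a W z w'" and L: "L \<subseteq> W"
    and eq: "\<And>C V. C \<subseteq> W - L \<Longrightarrow> V \<subseteq> A \<Longrightarrow> w C V = w' C V"
  shows "\<exists>l. nb A a l \<le> 2 * card L \<and> (\<forall>V\<subseteq>A. Zf w' W V \<noteq> 0 \<and> Zf w W V = Zf w' W V * exp (l V))"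
proof -
  obtain l where l: "nb A a l \<le> card L" "\<forall>V\<subseteq>A. Zf w W V = Zf w (W - L) V * exp (l V)"
    using kp_log_ratio[OF A W z w L] by auto
  obtain l' where l': "nb A a l' \<le> card L" "\<forall>V\<subseteq>A. Zf w' W V = Zf w' (W - L) V * exp (l' V)"
    using kp_log_ratio[OF A W z w' L] by auto
  have nz: "\<forall>V\<subseteq>A. Zf w' W V \<noteq> 0" using kp_convergence[OF A W z w'] by auto
  have "Zf w (W - L) V = Zf w' (W - L) V" if "V \<subseteq> A" for V
    unfolding Zf_def by (intro sum.cong refl eq) (use that in auto)
  hence "\<forall>V\<subseteq>A. Zf w W V = Zf w' W V * exp (l V - l' V)" using l l' by (simp add: exp_diff)
  moreover have "nb A a (\<lambda>V. l V - l' V) \<le> 2 * card L" using nb_diff[of A a l l'] l l' by linarith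
  ultimately show ?thesis using nz by blast
qed

end

section \<open>Operators on finite index sets\<close>

definition ip :: "('a \<Rightarrow> nat) set \<Rightarrow> (('a \<Rightarrow> nat) \<Rightarrow> complex) \<Rightarrow> (('a \<Rightarrow> nat) \<Rightarrow> complex) \<Rightarrow> complex" where
  "ip D u v = (\<Sum>s\<in>D. cnj (u s) * v s)"

lemma vec_norm_L2: "vec_norm D v = L2_set (\<lambda>s. cmod (v s)) D"
  by (simp add: vec_norm_def L2_set_def)

lemma vec_norm_nonneg [simp]: "0 \<le> vec_norm D v"
  by (simp add: vec_norm_L2)

lemma vec_norm_add: "vec_norm D (\<lambda>s. u s + v s) \<le> vec_norm D u + vec_norm D v"
  unfolding vec_norm_L2
  by (rule order_trans[OF L2_set_mono L2_set_triangle_ineq]) (auto simp: norm_triangle_ineq)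

lemma vec_norm_cmult: "vec_norm D (\<lambda>s. c * v s) = cmod c * vec_norm D v"
  by (simp add: vec_norm_L2 norm_mult L2_set_right_distrib)

lemma vec_norm_cong: "(\<And>s. s \<in> D \<Longrightarrow> u s = v s) \<Longrightarrow> vec_norm D u = vec_norm D v"
  by (simp add: vec_norm_def)

lemma vec_norm_entry: "finite D \<Longrightarrow> s \<in> D \<Longrightarrow> cmod (v s) \<le> vec_norm D v"
  unfolding vec_norm_L2 by (rule member_le_L2_set) auto

lemma vec_norm_eq_0_iff: "finite D \<Longrightarrow> vec_norm D v = 0 \<longleftrightarrow> (\<forall>s\<in>D. v s = 0)"
  by (auto simp: vec_norm_L2 L2_set_eq_0_iff)

lemma vec_norm_mono_set: "finite D \<Longrightarrow> D' \<subseteq> D \<Longrightarrow> vec_norm D' v \<le> vec_norm D v"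
  unfolding vec_norm_def by (intro real_sqrt_le_mono sum_mono2) auto

lemma vec_norm_sq: "(vec_norm D v)\<^sup>2 = (\<Sum>s\<in>D. (cmod (v s))\<^sup>2)"
  by (simp add: vec_norm_def sum_nonneg)

lemma ip_self: "ip D v v = complex_of_real ((vec_norm D v)\<^sup>2)"
  unfolding vec_norm_sq ip_def of_real_sum
  by (intro sum.cong refl) (simp add: complex_norm_square mult.commute del: of_real_power)

lemma ip_add_left: "ip D (\<lambda>s. u s + v s) w = ip D u w + ip D v w"
  and ip_add_right: "ip D w (\<lambda>s. u s + v s) = ip D w u + ip D w v"
  by (simp_all add: ip_def algebra_simps sum.distrib)

lemma ip_diff_left: "ip D (\<lambda>s. u s - v s) w = ip D u w - ip D v w"
  and ip_diff_right: "ip D w (\<lambda>s. u s - v s) = ip D w u - ip D w v"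
  by (simp_all add: ip_def algebra_simps sum_subtractf)

lemma ip_cmult_left: "ip D (\<lambda>s. c * u s) w = cnj c * ip D u w"
  and ip_cmult_right: "ip D w (\<lambda>s. c * u s) = c * ip D w u"
  by (simp_all add: ip_def sum_distrib_left mult_ac)

lemma cnj_ip: "cnj (ip D u v) = ip D v u"
  by (simp add: ip_def mult.commute)

lemma op_apply_add: "op_apply D M (\<lambda>s. u s + v s) s = op_apply D M u s + op_apply D M v s"
  and op_apply_diff: "op_apply D M (\<lambda>s. u s - v s) s = op_apply D M u s - op_apply D M v s"
  and op_apply_cmult: "op_apply D M (\<lambda>s. c * u s) s = c * op_apply D M u s"
  by (simp_all add: op_apply_def algebra_simps sum.distrib sum_subtractf sum_distrib_left)

lemma op_hermitianD: "op_hermitian D M \<Longrightarrow> s \<in> D \<Longrightarrow> t \<in> D \<Longrightarrow> cnj (M s t) = M t s"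
  unfolding op_hermitian_def by metis

lemma op_hermitianI: "(\<And>s t. s \<in> D \<Longrightarrow> t \<in> D \<Longrightarrow> M t s = cnj (M s t)) \<Longrightarrow> op_hermitian D M"
  unfolding op_hermitian_def by blast

lemma hermitian_ip:
  assumes "op_hermitian D B"
  shows "ip D u (op_apply D B v) = ip D (op_apply D B u) v"
proof -
  have "ip D u (op_apply D B v) = (\<Sum>s\<in>D. \<Sum>t\<in>D. cnj (u s) * B s t * v t)"
    by (simp add: ip_def op_apply_def sum_distrib_left mult_ac)
  also have "\<dots> = (\<Sum>t\<in>D. \<Sum>s\<in>D. cnj (u s) * B s t * v t)" by (rule sum.swap)
  also have "\<dots> = (\<Sum>t\<in>D. \<Sum>s\<in>D. cnj (u s) * cnj (B t s) * v t)"
    by (intro sum.cong refl) (simp add: op_hermitianD[OF assms])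
  also have "\<dots> = ip D (op_apply D B u) v"
    by (simp add: ip_def op_apply_def sum_distrib_left sum_distrib_right mult_ac)
  finally show ?thesis .
qed

text \<open>Operator bounds as a relation: admissible constants add and multiply without any
  evaluation of the supremum in \<open>op_norm\<close>. For empty \<open>D\<close> the inequality
  alone would admit negative \<open>c\<close>, hence the first conjunct.\<close>

definition ob :: "('a \<Rightarrow> nat) set \<Rightarrow> real \<Rightarrow> 'a op \<Rightarrow> bool" where
  "ob D c M \<longleftrightarrow> 0 \<le> c \<and> (\<forall>v. vec_norm D (op_apply D M v) \<le> c * vec_norm D v)"

lemma obD: "ob D c M \<Longrightarrow> vec_norm D (op_apply D M v) \<le> c * vec_norm D v"
  by (simp add: ob_def)

lemma ob_cong: "(\<And>s t. s \<in> D \<Longrightarrow> t \<in> D \<Longrightarrow> M s t = N s t) \<Longrightarrow> ob D c M \<longleftrightarrow> ob D c N"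
proof -
  assume *: "\<And>s t. s \<in> D \<Longrightarrow> t \<in> D \<Longrightarrow> M s t = N s t"
  have "vec_norm D (op_apply D M v) = vec_norm D (op_apply D N v)" for v
    by (rule vec_norm_cong) (simp add: op_apply_def *)
  thus ?thesis by (simp add: ob_def)
qed

lemma ob_mono: "ob D c M \<Longrightarrow> c \<le> c' \<Longrightarrow> ob D c' M"
  unfolding ob_def by (auto intro: order_trans[OF _ mult_right_mono])

lemma ob_id: "finite D \<Longrightarrow> ob D 1 op_id"
proof -
  assume D: "finite D"
  have "vec_norm D (op_apply D op_id v) = vec_norm D v" for v
    by (rule vec_norm_cong) (simp add: op_apply_def op_id_def D if_distrib[of "\<lambda>x. x * _"] sum.delta cong: if_cong)
  thus ?thesis by (simp add: ob_def)
qed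

lemma ob_zero: "ob D 0 (\<lambda>_ _. 0)"
  by (simp add: ob_def op_apply_def vec_norm_def)

lemma ob_cmult: "ob D c M \<Longrightarrow> ob D (cmod k * c) (\<lambda>s t. k * M s t)"
proof -
  assume *: "ob D c M"
  have "op_apply D (\<lambda>s t. k * M s t) v = (\<lambda>s. k * op_apply D M v s)" for v
    by (rule ext) (simp add: op_apply_def sum_distrib_left mult_ac)
  thus ?thesis using * by (auto simp: ob_def vec_norm_cmult mult.assoc intro: mult_left_mono)
qed

lemma ob_add: "ob D c M \<Longrightarrow> ob D d N \<Longrightarrow> ob D (c + d) (\<lambda>s t. M s t + N s t)"
proof -
  assume *: "ob D c M" "ob D d N"
  have eq: "op_apply D (\<lambda>s t. M s t + N s t) v = (\<lambda>s. op_apply D M v s + op_apply D N v s)" for v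
    by (rule ext) (simp add: op_apply_def sum.distrib algebra_simps)
  have "vec_norm D (op_apply D (\<lambda>s t. M s t + N s t) v) \<le> (c + d) * vec_norm D v" for v
    using vec_norm_add[of D "op_apply D M v" "op_apply D N v"] obD[OF *(1), of v] obD[OF *(2), of v]
    by (simp add: eq algebra_simps)
  thus ?thesis using * by (simp add: ob_def)
qed

lemma ob_uminus: "ob D c M \<Longrightarrow> ob D c (\<lambda>s t. - M s t)"
  using ob_cmult[of D c M "-1"] by simp

lemma ob_sum: "finite I \<Longrightarrow> (\<And>i. i \<in> I \<Longrightarrow> ob D (c i) (M i)) \<Longrightarrow> ob D (\<Sum>i\<in>I. c i) (\<lambda>s t. \<Sum>i\<in>I. M i s t)"
  by (induction I rule: finite_induct) (auto intro: ob_add ob_zero)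

lemma op_apply_mult:
  "finite D \<Longrightarrow> op_apply D (op_mult D M N) v s = op_apply D M (op_apply D N v) s"
  unfolding op_apply_def op_mult_def
  by (simp add: sum_distrib_left sum_distrib_right mult_ac) (rule sum.swap)

lemma ob_mult:
  assumes "finite D" "ob D c M" "ob D d N"
  shows "ob D (c * d) (op_mult D M N)"
  unfolding ob_def
proof (intro conjI allI)
  fix v
  have "vec_norm D (op_apply D (op_mult D M N) v) = vec_norm D (op_apply D M (op_apply D N v))"
    by (rule vec_norm_cong) (simp add: op_apply_mult assms(1))
  also have "\<dots> \<le> c * vec_norm D (op_apply D N v)" by (rule obD[OF assms(2)])
  also have "\<dots> \<le> c * (d * vec_norm D v)" using assms by (intro mult_left_mono obD) (auto simp: ob_def)
  finally show "vec_norm D (op_apply D (op_mult D M N) v) \<le> c * d * vec_norm D v" by (simp add: mult.assoc)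
qed (use assms in \<open>auto simp: ob_def\<close>)

lemma ob_pow: "finite D \<Longrightarrow> ob D c M \<Longrightarrow> ob D (c ^ n) (op_pow D M n)"
  by (induction n) (auto intro: ob_mult ob_id)

lemma op_apply_delta: "finite D \<Longrightarrow> t \<in> D \<Longrightarrow> op_apply D M (\<lambda>r. if r = t then 1 else 0) s = M s t"
  by (simp add: op_apply_def if_distrib[of "\<lambda>x. _ * x"] sum.delta' cong: if_cong)

lemma vec_norm_delta: "finite D \<Longrightarrow> t \<in> D \<Longrightarrow> vec_norm D (\<lambda>r. if r = t then 1 else 0) = 1"
  by (simp add: vec_norm_def if_distrib[of cmod] if_distrib[of "\<lambda>x. x\<^sup>2"] sum.delta' cong: if_cong)

lemma ob_entry:
  assumes "finite D" "ob D c M" "s \<in> D" "t \<in> D"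
  shows "cmod (M s t) \<le> c"
proof -
  let ?e = "\<lambda>r. if r = t then 1 else 0 :: complex"
  have "cmod (M s t) = cmod (op_apply D M ?e s)" using assms by (simp add: op_apply_delta)
  also have "\<dots> \<le> vec_norm D (op_apply D M ?e)" by (rule vec_norm_entry) (use assms in auto)
  also have "\<dots> \<le> c * vec_norm D ?e" by (rule obD[OF assms(2)])
  finally show ?thesis using assms by (simp add: vec_norm_delta)
qed

lemma ob_exists:
  assumes "finite D"
  shows "\<exists>c. ob D c M"
proof -
  define c where "c = (\<Sum>s\<in>D. \<Sum>t\<in>D. cmod (M s t))"
  have c: "0 \<le> c" by (auto simp: c_def intro!: sum_nonneg)
  have "vec_norm D (op_apply D M v) \<le> c * vec_norm D v" for v
  proof -
    have "vec_norm D (op_apply D M v) \<le> (\<Sum>s\<in>D. \<bar>cmod (op_apply D M v s)\<bar>)"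
      unfolding vec_norm_L2 by (rule L2_set_le_sum_abs)
    also have "\<dots> \<le> (\<Sum>s\<in>D. \<Sum>t\<in>D. cmod (M s t) * vec_norm D v)"
    proof (intro sum_mono)
      fix s assume "s \<in> D"
      have "\<bar>cmod (op_apply D M v s)\<bar> \<le> (\<Sum>t\<in>D. cmod (M s t * v t))"
        unfolding op_apply_def abs_norm_cancel by (rule norm_sum)
      also have "\<dots> \<le> (\<Sum>t\<in>D. cmod (M s t) * vec_norm D v)"
        unfolding norm_mult by (intro sum_mono mult_left_mono vec_norm_entry assms) auto
      finally show "\<bar>cmod (op_apply D M v s)\<bar> \<le> (\<Sum>t\<in>D. cmod (M s t) * vec_norm D v)" .
    qed
    finally show ?thesis by (simp add: c_def sum_distrib_right)
  qed
  thus ?thesis using c by (auto simp: ob_def)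
qed

text \<open>By \<open>ob_exists\<close> the set in the definition of \<open>op_norm\<close> is
  bounded above, so its supremum is a genuine upper bound on the unit ball; scaling extends it to
  all vectors.\<close>

lemma ob_op_norm:
  assumes "finite D"
  shows "ob D (op_norm D M) M"
proof -
  obtain c where c: "ob D c M" using ob_exists[OF assms] by blast
  let ?S = "{vec_norm D (op_apply D M v) | v. vec_norm D v \<le> 1}"
  have bdd: "bdd_above ?S"
  proof (rule bdd_aboveI[of _ c])
    fix x assume "x \<in> ?S"
    then obtain v where v: "x = vec_norm D (op_apply D M v)" "vec_norm D v \<le> 1" by auto
    have "c * vec_norm D v \<le> c" using v c by (simp add: ob_def mult_left_le)
    thus "x \<le> c" using obD[OF c, of v] v by simp
  qed
  have up: "vec_norm D (op_apply D M v) \<le> op_norm D M" if "vec_norm D v \<le> 1" for v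
    unfolding op_norm_def by (rule cSup_upper[OF _ bdd]) (use that in auto)
  have "vec_norm D (\<lambda>_. 0) = 0" by (simp add: vec_norm_def)
  hence nn: "0 \<le> op_norm D M" using up[of "\<lambda>_. 0"] vec_norm_nonneg[of D "op_apply D M (\<lambda>_. 0)"] by linarith
  have "vec_norm D (op_apply D M v) \<le> op_norm D M * vec_norm D v" for v
  proof (cases "vec_norm D v = 0")
    case True
    thus ?thesis using obD[OF c, of v] by simp
  next
    case False
    hence pos: "vec_norm D v > 0" using vec_norm_nonneg[of D v] by linarith
    define k where "k = complex_of_real (1 / vec_norm D v)"
    have k: "cmod k = 1 / vec_norm D v" using pos by (simp add: k_def norm_divide)
    have "vec_norm D (\<lambda>s. k * v s) = 1" unfolding vec_norm_cmult k using pos by simp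
    hence "vec_norm D (op_apply D M (\<lambda>s. k * v s)) \<le> op_norm D M" using up by simp
    moreover have "vec_norm D (op_apply D M (\<lambda>s. k * v s)) = 1 / vec_norm D v * vec_norm D (op_apply D M v)"
      unfolding k[symmetric] vec_norm_cmult[symmetric] by (rule vec_norm_cong) (rule op_apply_cmult)
    ultimately show ?thesis using pos by (simp add: field_simps)
  qed
  thus ?thesis using nn by (simp add: ob_def)
qed

lemma op_norm_le:
  assumes "ob D c M"
  shows "op_norm D M \<le> c"
  unfolding op_norm_def
proof (rule cSup_least)
  have "vec_norm D (\<lambda>_. 0) \<le> 1" by (simp add: vec_norm_def)
  thus "{vec_norm D (op_apply D M v) |v. vec_norm D v \<le> 1} \<noteq> {}" by blast
  fix x assume "x \<in> {vec_norm D (op_apply D M v) |v. vec_norm D v \<le> 1}"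
  then obtain v where v: "x = vec_norm D (op_apply D M v)" "vec_norm D v \<le> 1" by auto
  have "c * vec_norm D v \<le> c" using v assms by (simp add: ob_def mult_left_le)
  thus "x \<le> c" using obD[OF assms, of v] v by simp
qed

text \<open>Polarization: let \<open>u\<close> be the multiple of \<open>B v\<close> that has the
  norm of \<open>v\<close>. Then \<open>4 * Re (ip D u (op_apply D B v))\<close> is the difference
  of the forms at \<open>u + v\<close> and \<open>u - v\<close>, and the parallelogram law bounds it
  by four times \<open>c\<close> times the squared norm of \<open>v\<close>.\<close>

lemma hermitian_form_bound:
  assumes D: "finite D" and h: "op_hermitian D B" and c: "0 \<le> c"
    and q: "\<And>v. \<bar>Re (ip D v (op_apply D B v))\<bar> \<le> c * (vec_norm D v)\<^sup>2"
  shows "ob D c B"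
proof -
  have "vec_norm D (op_apply D B v) \<le> c * vec_norm D v" for v
  proof -
    define w where "w = op_apply D B v"
    define N where "N = vec_norm D v"
    define M where "M = vec_norm D w"
    show ?thesis
    proof (cases "N = 0 \<or> M = 0")
      case True
      have "M = 0" if "N = 0"
      proof -
        obtain k where k: "ob D k B" using ob_exists[OF D] by blast
        have "M \<le> 0" using obD[OF k, of v] that by (simp add: M_def w_def N_def)
        thus ?thesis using vec_norm_nonneg[of D w] by (simp add: M_def)
      qed
      thus ?thesis using True c by (auto simp: M_def w_def N_def)
    next
      case False
      hence pos: "N > 0" "M > 0" using vec_norm_nonneg[of D v] vec_norm_nonneg[of D w] by (auto simp: M_def N_def less_le)
      define u where "u = (\<lambda>s. complex_of_real (N / M) * w s)"
      have nu: "vec_norm D u = N" using pos unfolding u_def by (subst vec_norm_cmult) (simp add: norm_divide M_def)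
      have Bp: "op_apply D B (\<lambda>s. u s + v s) = (\<lambda>s. op_apply D B u s + op_apply D B v s)"
        and Bm: "op_apply D B (\<lambda>s. u s - v s) = (\<lambda>s. op_apply D B u s - op_apply D B v s)"
        by (auto simp: op_apply_add op_apply_diff)
      have sym: "Re (ip D v (op_apply D B u)) = Re (ip D u (op_apply D B v))"
        unfolding hermitian_ip[OF h, of v u] cnj_ip[of D u "op_apply D B v", symmetric] by simp
      have "4 * Re (ip D u (op_apply D B v)) =
        Re (ip D (\<lambda>s. u s + v s) (op_apply D B (\<lambda>s. u s + v s))) - Re (ip D (\<lambda>s. u s - v s) (op_apply D B (\<lambda>s. u s - v s)))"
        unfolding Bp Bm ip_add_left ip_add_right ip_diff_left ip_diff_right using sym by simp
      also have "\<dots> \<le> c * (vec_norm D (\<lambda>s. u s + v s))\<^sup>2 + c * (vec_norm D (\<lambda>s. u s - v s))\<^sup>2"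
        using q[of "\<lambda>s. u s + v s"] q[of "\<lambda>s. u s - v s"] by linarith
      also have "\<dots> = c * Re (ip D (\<lambda>s. u s + v s) (\<lambda>s. u s + v s) + ip D (\<lambda>s. u s - v s) (\<lambda>s. u s - v s))"
        unfolding ip_self by (simp add: distrib_left)
      also have "\<dots> = c * Re (2 * ip D u u + 2 * ip D v v)"
        unfolding ip_add_left ip_add_right ip_diff_left ip_diff_right by simp
      also have "\<dots> = 4 * c * N\<^sup>2" unfolding ip_self nu N_def[symmetric] by simp
      finally have 1: "Re (ip D u (op_apply D B v)) \<le> c * N\<^sup>2" by simp
      have "ip D u (op_apply D B v) = complex_of_real (N / M) * ip D w w"
        unfolding u_def ip_cmult_left w_def[symmetric] by simp
      also have "\<dots> = complex_of_real (N * M)" using pos unfolding ip_self M_def[symmetric] by (simp add: power2_eq_square)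
      finally have "N * M \<le> c * N * N" using 1 by (simp add: power2_eq_square mult.assoc)
      thus ?thesis using pos by (simp add: M_def[symmetric] N_def[symmetric] w_def[symmetric] mult.commute)
    qed
  qed
  thus ?thesis using c by (simp add: ob_def)
qed

subsection \<open>Products, powers and the exponential series\<close>

lemma op_mult_assoc:
  "finite D \<Longrightarrow> op_mult D (op_mult D L M) N s t = op_mult D L (op_mult D M N) s t"
  unfolding op_mult_def
  by (simp add: sum_distrib_left sum_distrib_right mult_ac) (rule sum.swap)

lemma op_mult_id_left: "finite D \<Longrightarrow> s \<in> D \<Longrightarrow> op_mult D op_id M s t = M s t"
  by (simp add: op_mult_def op_id_def if_distrib[of "\<lambda>x. x * _"] sum.delta cong: if_cong)

lemma op_mult_id_right: "finite D \<Longrightarrow> t \<in> D \<Longrightarrow> op_mult D M op_id s t = M s t"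
  by (simp add: op_mult_def op_id_def if_distrib[of "\<lambda>x. _ * x"] sum.delta' cong: if_cong)

lemma op_mult_cong:
  "(\<And>r. r \<in> D \<Longrightarrow> M s r = M' s r) \<Longrightarrow> (\<And>r. r \<in> D \<Longrightarrow> N r t = N' r t) \<Longrightarrow> op_mult D M N s t = op_mult D M' N' s t"
  by (simp add: op_mult_def)

lemma op_pow_cong:
  assumes "\<And>s t. s \<in> D \<Longrightarrow> t \<in> D \<Longrightarrow> M s t = N s t" "s \<in> D" "t \<in> D"
  shows "op_pow D M n s t = op_pow D N n s t"
  using assms(2,3) by (induction n arbitrary: s) (auto simp: op_mult_def assms(1))

lemma op_pow_add:
  assumes "finite D" "s \<in> D"
  shows "op_pow D M (j + k) s t = op_mult D (op_pow D M j) (op_pow D M k) s t"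
  using assms(2)
proof (induction j arbitrary: s)
  case 0
  thus ?case by (simp add: op_mult_id_left assms)
next
  case (Suc j)
  have "op_pow D M (Suc j + k) s t = op_mult D M (op_mult D (op_pow D M j) (op_pow D M k)) s t"
    by (simp, rule op_mult_cong) (auto simp: Suc.IH)
  thus ?case by (simp add: op_mult_assoc assms)
qed

lemma op_pow_Suc_right:
  assumes "finite D" "s \<in> D" "t \<in> D"
  shows "op_pow D M (Suc n) s t = op_mult D (op_pow D M n) M s t"
proof -
  have "op_pow D M (Suc n) s t = op_mult D (op_pow D M n) (op_pow D M (Suc 0)) s t"
    using op_pow_add[OF assms(1,2), of M n 1 t] by simp
  also have "\<dots> = op_mult D (op_pow D M n) M s t"
    by (rule op_mult_cong) (auto simp: op_mult_id_right assms)
  finally show ?thesis .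
qed

lemma op_pow_hermitian:
  assumes "finite D" "op_hermitian D M"
  shows "op_hermitian D (op_pow D M n)"
proof (induction n)
  case 0
  thus ?case by (auto simp: op_id_def intro: op_hermitianI)
next
  case (Suc n)
  show ?case
  proof (rule op_hermitianI)
    fix s t assume st: "s \<in> D" "t \<in> D"
    have "op_pow D M (Suc n) t s = op_mult D (op_pow D M n) M t s" by (rule op_pow_Suc_right) (use assms st in auto)
    also have "\<dots> = cnj (op_mult D M (op_pow D M n) s t)"
      using st by (simp add: op_mult_def op_hermitianD[OF assms(2)] op_hermitianD[OF Suc.IH] mult.commute)
    finally show "op_pow D M (Suc n) t s = cnj (op_pow D M (Suc n) s t)" by simp
  qed
qed

text \<open>The exponential generating function of a scalar sequence. Entries of
  \<open>op_exp\<close> are of this kind, so identities for matrix exponentials become identities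
  for the sequences of entries of powers, and a geometric bound settles all convergence
  questions.\<close>

definition egf :: "real \<Rightarrow> (nat \<Rightarrow> complex) \<Rightarrow> complex" where
  "egf t a = (\<Sum>n. complex_of_real (t ^ n / fact n) * a n)"

definition geom_bounded :: "(nat \<Rightarrow> complex) \<Rightarrow> bool" where
  "geom_bounded a \<longleftrightarrow> (\<exists>K r. \<forall>n. cmod (a n) \<le> K * r ^ n)"

lemma op_exp_egf: "op_exp D t M s z = egf t (\<lambda>n. op_pow D M n s z)"
  by (simp add: op_exp_def egf_def)

lemma egf_summable_norm:
  assumes "geom_bounded a"
  shows "summable (\<lambda>n. norm (complex_of_real (t ^ n / fact n) * a n))"
proof -
  obtain K r where b: "\<forall>n. cmod (a n) \<le> K * r ^ n" using assms by (auto simp: geom_bounded_def)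
  show ?thesis
  proof (rule summable_comparison_test'[where N=0])
    show "summable (\<lambda>n. K * ((\<bar>t\<bar> * \<bar>r\<bar>) ^ n /\<^sub>R fact n))"
      by (intro summable_mult summable_exp_generic)
    fix n
    have "K \<ge> 0" using order_trans[OF norm_ge_zero b[rule_format, of 0]] by simp
    hence "K * r ^ n \<le> K * \<bar>r\<bar> ^ n" using abs_ge_self[of "r ^ n"] by (intro mult_left_mono) (auto simp: power_abs)
    hence "cmod (a n) \<le> K * \<bar>r\<bar> ^ n" using b[rule_format, of n] by linarith
    hence "\<bar>t\<bar> ^ n / fact n * cmod (a n) \<le> \<bar>t\<bar> ^ n / fact n * (K * \<bar>r\<bar> ^ n)" by (intro mult_left_mono) auto
    moreover have "norm (norm (complex_of_real (t ^ n / fact n) * a n)) = \<bar>t\<bar> ^ n / fact n * cmod (a n)"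
      by (simp add: norm_mult norm_divide norm_power)
    moreover have "K * ((\<bar>t\<bar> * \<bar>r\<bar>) ^ n /\<^sub>R fact n) = \<bar>t\<bar> ^ n / fact n * (K * \<bar>r\<bar> ^ n)"
      by (simp add: power_mult_distrib divide_inverse mult_ac)
    ultimately show "norm (norm (complex_of_real (t ^ n / fact n) * a n)) \<le> K * ((\<bar>t\<bar> * \<bar>r\<bar>) ^ n /\<^sub>R fact n)" by simp
  qed
qed

lemma egf_summable: "geom_bounded a \<Longrightarrow> summable (\<lambda>n. complex_of_real (t ^ n / fact n) * a n)"
  by (rule summable_norm_cancel[OF egf_summable_norm])

lemma egf_sums: "geom_bounded a \<Longrightarrow> (\<lambda>n. complex_of_real (t ^ n / fact n) * a n) sums egf t a"
  unfolding egf_def by (rule summable_sums[OF egf_summable])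

lemma geom_bounded_pow:
  assumes "finite D" "s \<in> D" "t \<in> D"
  shows "geom_bounded (\<lambda>n. op_pow D M n s t)"
proof -
  obtain c where "ob D c M" using ob_exists[OF assms(1)] by blast
  hence "cmod (op_pow D M n s t) \<le> 1 * c ^ n" for n
    using ob_entry[OF assms(1) ob_pow assms(2,3)] assms(1) by simp
  thus ?thesis unfolding geom_bounded_def by blast
qed

lemma geom_bounded_cmult:
  assumes "geom_bounded a"
  shows "geom_bounded (\<lambda>n. c * a n)"
proof -
  obtain K r where "\<forall>n. cmod (a n) \<le> K * r ^ n" using assms by (auto simp: geom_bounded_def)
  hence "cmod (c * a n) \<le> (cmod c * K) * r ^ n" for n by (simp add: norm_mult mult.assoc mult_left_mono)
  thus ?thesis unfolding geom_bounded_def by blast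
qed

lemma egf_cmult: "geom_bounded a \<Longrightarrow> egf t (\<lambda>n. c * a n) = c * egf t a"
  using sums_mult[OF egf_sums, of a c t] by (simp add: egf_def sums_iff mult_ac)

lemma egf_sum: "(\<And>i. i \<in> I \<Longrightarrow> geom_bounded (a i)) \<Longrightarrow> egf t (\<lambda>n. \<Sum>i\<in>I. a i n) = (\<Sum>i\<in>I. egf t (a i))"
  unfolding egf_def sum_distrib_left by (rule suminf_sum) (rule egf_summable)

lemma egf_uminus: "egf (-t) a = egf t (\<lambda>n. (-1) ^ n * a n)"
  unfolding egf_def by (intro arg_cong[where f=suminf] ext) (simp add: power_minus[of t])

lemma egf_binomial:
  assumes "geom_bounded a" "geom_bounded b" "\<And>k. c k = (\<Sum>j\<le>k. of_nat (k choose j) * a j * b (k - j))"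
  shows "egf t c = egf t a * egf t b"
proof -
  have "egf t a * egf t b = (\<Sum>k. \<Sum>i\<le>k. (complex_of_real (t ^ i / fact i) * a i) * (complex_of_real (t ^ (k - i) / fact (k - i)) * b (k - i)))"
    unfolding egf_def by (rule Cauchy_product[OF egf_summable_norm[OF assms(1)] egf_summable_norm[OF assms(2)]])
  also have "\<dots> = egf t c"
    unfolding egf_def
  proof (intro arg_cong[where f=suminf] ext)
    fix k
    show "(\<Sum>i\<le>k. (complex_of_real (t ^ i / fact i) * a i) * (complex_of_real (t ^ (k - i) / fact (k - i)) * b (k - i))) = complex_of_real (t ^ k / fact k) * c k"
      unfolding assms(3) sum_distrib_left
    proof (intro sum.cong refl)
      fix i assume "i \<in> {..k}"
      hence i: "i \<le> k" by simp
      have "t ^ i * t ^ (k - i) = t ^ k" using i by (simp add: power_add[symmetric])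
      hence "complex_of_real (t ^ i) * complex_of_real (t ^ (k - i)) = complex_of_real (t ^ k)" by (metis of_real_mult)
      moreover have "of_nat (k choose i) = (fact k / (fact i * fact (k - i)) :: complex)" by (rule binomial_fact[OF i])
      ultimately show "(complex_of_real (t ^ i / fact i) * a i) * (complex_of_real (t ^ (k - i) / fact (k - i)) * b (k - i)) = complex_of_real (t ^ k / fact k) * (of_nat (k choose i) * a i * b (k - i))"
        by (simp add: field_simps)
    qed
  qed
  finally show ?thesis by simp
qed

lemma egf_power_seq: "egf t (\<lambda>n. complex_of_real s ^ n) = exp (complex_of_real (t * s))"
proof -
  have "exp (complex_of_real (t * s)) = (\<Sum>n. (complex_of_real (t * s)) ^ n /\<^sub>R fact n)" by (simp add: exp_def)
  also have "\<dots> = egf t (\<lambda>n. complex_of_real s ^ n)" unfolding egf_def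
    by (intro arg_cong[where f=suminf] ext) (simp add: power_mult_distrib scaleR_conv_of_real field_simps)
  finally show ?thesis by simp
qed

lemma egf_norm_le:
  assumes "\<And>n. cmod (a n) \<le> K * r ^ n" "t \<ge> 0" "r \<ge> 0"
  shows "cmod (egf t a) \<le> K * exp (t * r)"
proof -
  have gb: "geom_bounded a" using assms by (auto simp: geom_bounded_def)
  have s: "(\<lambda>n. K * ((t * r) ^ n /\<^sub>R fact n)) sums (K * exp (t * r))"
    by (intro sums_mult exp_converges)
  have "cmod (egf t a) \<le> (\<Sum>n. norm (complex_of_real (t ^ n / fact n) * a n))"
    unfolding egf_def by (rule summable_norm[OF egf_summable_norm[OF gb]])
  also have "\<dots> \<le> (\<Sum>n. K * ((t * r) ^ n /\<^sub>R fact n))"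
  proof (rule suminf_le[OF _ egf_summable_norm[OF gb] sums_summable[OF s]])
    fix n
    have "t ^ n / fact n * cmod (a n) \<le> t ^ n / fact n * (K * r ^ n)" using assms by (intro mult_left_mono) auto
    moreover have "norm (complex_of_real (t ^ n / fact n) * a n) = t ^ n / fact n * cmod (a n)"
      using assms(2) by (simp add: norm_mult norm_divide norm_power)
    moreover have "K * ((t * r) ^ n /\<^sub>R fact n) = t ^ n / fact n * (K * r ^ n)"
      by (simp add: power_mult_distrib divide_inverse mult_ac)
    ultimately show "norm (complex_of_real (t ^ n / fact n) * a n) \<le> K * ((t * r) ^ n /\<^sub>R fact n)" by simp
  qed
  also have "\<dots> = K * exp (t * r)" using s by (simp add: sums_iff)
  finally show ?thesis .
qed

text \<open>The combinatorics of (X \<otimes> 1 + 1 \<otimes> Y)^k, with an arbitrary pairing of the index sets.\<close>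

lemma op_pow_tensor_sum:
  assumes fin: "finite D1" "finite D2" and bij: "bij_betw (\<lambda>(x, y). J x y) (D1 \<times> D2) D"
    and H: "\<And>x y x' y'. x \<in> D1 \<Longrightarrow> x' \<in> D1 \<Longrightarrow> y \<in> D2 \<Longrightarrow> y' \<in> D2 \<Longrightarrow>
        H (J x y) (J x' y') = (if y = y' then H1 x x' else 0) + (if x = x' then H2 y y' else 0)"
    and xy: "x \<in> D1" "y \<in> D2" "x' \<in> D1" "y' \<in> D2"
  shows "op_pow D H k (J x y) (J x' y') = (\<Sum>j\<le>k. of_nat (k choose j) * op_pow D1 H1 j x x' * op_pow D2 H2 (k - j) y y')"
  using xy(1,2)
proof (induction k arbitrary: x y)
  case 0
  have "J x y = J x' y' \<longleftrightarrow> x = x' \<and> y = y'"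
    using bij 0 xy unfolding bij_betw_def inj_on_def by fastforce
  thus ?case by (simp add: op_id_def)
next
  case (Suc k)
  let ?P = "\<lambda>k x y. \<Sum>j\<le>k. of_nat (k choose j) * op_pow D1 H1 j x x' * op_pow D2 H2 (k - j) y y'"
  have "op_pow D H (Suc k) (J x y) (J x' y') = (\<Sum>(u, v)\<in>D1 \<times> D2. H (J x y) (J u v) * op_pow D H k (J u v) (J x' y'))"
    unfolding op_pow.simps op_mult_def by (subst sum.reindex_bij_betw[OF bij, symmetric]) (simp add: case_prod_beta)
  also have "\<dots> = (\<Sum>u\<in>D1. \<Sum>v\<in>D2. H (J x y) (J u v) * op_pow D H k (J u v) (J x' y'))"
    by (simp add: sum.cartesian_product)
  also have "\<dots> = (\<Sum>u\<in>D1. \<Sum>v\<in>D2. ((if y = v then H1 x u else 0) + (if x = u then H2 y v else 0)) * ?P k u v)"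
    by (intro sum.cong refl) (simp add: H Suc)
  also have "\<dots> = (\<Sum>u\<in>D1. \<Sum>v\<in>D2. if y = v then H1 x u * ?P k u v else 0) + (\<Sum>u\<in>D1. \<Sum>v\<in>D2. if x = u then H2 y v * ?P k u v else 0)"
    unfolding sum.distrib[symmetric] by (intro sum.cong refl) (auto simp: distrib_right)
  also have "(\<Sum>u\<in>D1. \<Sum>v\<in>D2. if y = v then H1 x u * ?P k u v else 0) = (\<Sum>u\<in>D1. H1 x u * ?P k u y)"
    using fin Suc by (simp add: sum.delta)
  also have "(\<Sum>u\<in>D1. \<Sum>v\<in>D2. if x = u then H2 y v * ?P k u v else 0) = (\<Sum>v\<in>D2. H2 y v * ?P k x v)"
    using fin Suc by (subst sum.swap) (simp add: sum.delta)
  also have "(\<Sum>u\<in>D1. H1 x u * ?P k u y) = (\<Sum>j\<le>k. of_nat (k choose j) * op_pow D1 H1 (Suc j) x x' * op_pow D2 H2 (k - j) y y')"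
    by (simp add: sum_distrib_left sum_distrib_right op_mult_def mult_ac) (rule sum.swap)
  also have "(\<Sum>v\<in>D2. H2 y v * ?P k x v) = (\<Sum>j\<le>k. of_nat (k choose j) * op_pow D1 H1 j x x' * op_pow D2 H2 (Suc (k - j)) y y')"
    by (simp add: sum_distrib_left sum_distrib_right op_mult_def mult_ac) (rule sum.swap)
  also have "(\<Sum>j\<le>k. of_nat (k choose j) * op_pow D1 H1 j x x' * op_pow D2 H2 (Suc (k - j)) y y') =
     (\<Sum>j\<le>k. of_nat (k choose j) * op_pow D1 H1 j x x' * op_pow D2 H2 (Suc k - j) y y')"
    by (intro sum.cong refl) (simp add: Suc_diff_le)
  also have "(\<Sum>j\<le>k. of_nat (k choose j) * op_pow D1 H1 (Suc j) x x' * op_pow D2 H2 (k - j) y y') +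
     (\<Sum>j\<le>k. of_nat (k choose j) * op_pow D1 H1 j x x' * op_pow D2 H2 (Suc k - j) y y') = ?P (Suc k) x y"
  proof -
    let ?t = "\<lambda>c j. of_nat c * op_pow D1 H1 j x x' * op_pow D2 H2 (Suc k - j) y y'"
    have "?P (Suc k) x y = ?t (Suc k choose 0) 0 + (\<Sum>j\<le>k. ?t (Suc k choose Suc j) (Suc j))"
      by (rule sum.atMost_Suc_shift)
    also have "(\<Sum>j\<le>k. ?t (Suc k choose Suc j) (Suc j)) = (\<Sum>j\<le>k. ?t (k choose j) (Suc j)) + (\<Sum>j\<le>k. ?t (k choose Suc j) (Suc j))"
      unfolding sum.distrib[symmetric] by (intro sum.cong refl) (simp only: binomial_Suc_Suc of_nat_add distrib_right)
    also have "?t (Suc k choose 0) 0 + (\<dots>) = (\<Sum>j\<le>k. ?t (k choose j) (Suc j)) + (?t (k choose 0) 0 + (\<Sum>j\<le>k. ?t (k choose Suc j) (Suc j)))"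
      by (simp only: binomial_n_0 add_ac)
    also have "?t (k choose 0) 0 + (\<Sum>j\<le>k. ?t (k choose Suc j) (Suc j)) = (\<Sum>j\<le>Suc k. ?t (k choose j) j)"
      by (rule sum.atMost_Suc_shift[symmetric])
    also have "\<dots> = (\<Sum>j\<le>k. ?t (k choose j) j)" by simp
    finally show ?thesis by simp
  qed
  finally show ?case .
qed

text \<open>The binomial formula for powers becomes a product of generating functions. There are two
  uses: evolutions factorize over separated regions, which are joined by \<open>add0\<close>, and a
  scalar can be split off an exponential.\<close>

corollary op_exp_tensor_sum:
  assumes fin: "finite D1" "finite D2" and bij: "bij_betw (\<lambda>(x, y). J x y) (D1 \<times> D2) D"
    and H: "\<And>x y x' y'. x \<in> D1 \<Longrightarrow> x' \<in> D1 \<Longrightarrow> y \<in> D2 \<Longrightarrow> y' \<in> D2 \<Longrightarrow>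
        H (J x y) (J x' y') = (if y = y' then H1 x x' else 0) + (if x = x' then H2 y y' else 0)"
    and xy: "x \<in> D1" "y \<in> D2" "x' \<in> D1" "y' \<in> D2"
  shows "op_exp D t H (J x y) (J x' y') = op_exp D1 t H1 x x' * op_exp D2 t H2 y y'"
  unfolding op_exp_egf
proof (rule egf_binomial)
  show "geom_bounded (\<lambda>n. op_pow D1 H1 n x x')" by (rule geom_bounded_pow) fact+
  show "geom_bounded (\<lambda>n. op_pow D2 H2 n y y')" by (rule geom_bounded_pow) fact+
  fix k
  show "op_pow D H k (J x y) (J x' y') = (\<Sum>j\<le>k. of_nat (k choose j) * op_pow D1 H1 j x x' * op_pow D2 H2 (k - j) y y')"
    by (rule op_pow_tensor_sum[where J=J and H=H and ?H1.0=H1 and ?H2.0=H2]) fact+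
qed

lemma op_pow_scalar: "op_pow {x} (\<lambda>_ _. c) n x x = c ^ n"
  by (induction n) (auto simp: op_id_def op_mult_def)

lemma op_pow_uminus: "op_pow D (\<lambda>s t. - M s t) n s t = (-1) ^ n * op_pow D M n s t"
  by (induction n arbitrary: s) (auto simp: op_mult_def sum_distrib_left sum_negf mult_ac)

lemma op_exp_shift:
  assumes D: "finite D" and st: "r \<in> D" "z \<in> D"
  shows "op_exp D (-t) H r z = exp (complex_of_real (- t * s)) * op_exp D t (\<lambda>r z. complex_of_real s * op_id r z - H r z) r z"
proof -
  let ?B = "\<lambda>r z. complex_of_real s * op_id r z - H r z"
  \<comment> \<open>With a one-point space as first tensor factor, adding the scalar
    \<open>s\<close> is an instance of the tensor sum.\<close>
  let ?x = "undefined :: 'a \<Rightarrow> nat"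
  have "bij_betw (\<lambda>(x, y). y) ({?x} \<times> D) D" by (auto simp: bij_betw_def inj_on_def)
  hence "op_exp D t ?B r z = op_exp {?x} t (\<lambda>_ _. complex_of_real s) ?x ?x * op_exp D t (\<lambda>r z. - H r z) r z"
    by (rule op_exp_tensor_sum[where J="\<lambda>_ y. y", rotated 2]) (simp_all add: D st op_id_def)
  also have "op_exp {?x} t (\<lambda>_ _. complex_of_real s) ?x ?x = exp (complex_of_real (t * s))"
    unfolding op_exp_egf op_pow_scalar by (rule egf_power_seq)
  also have "op_exp D t (\<lambda>r z. - H r z) r z = op_exp D (-t) H r z"
    unfolding op_exp_egf egf_uminus op_pow_uminus ..
  finally show ?thesis by (simp add: exp_minus field_simps)
qed

lemma op_exp_add:
  assumes D: "finite D" and st: "x \<in> D" "z \<in> D"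
  shows "op_exp D (s + t) M x z = op_mult D (op_exp D s M) (op_exp D t M) x z"
proof -
  let ?a = "\<lambda>t n x z. complex_of_real (t ^ n / fact n) * op_pow D M n x z"
  have "(\<lambda>k. \<Sum>r\<in>D. \<Sum>i\<le>k. ?a s i x r * ?a t (k - i) r z) sums (\<Sum>r\<in>D. (\<Sum>n. ?a s n x r) * (\<Sum>n. ?a t n r z))"
    by (intro sums_sum Cauchy_product_sums egf_summable_norm geom_bounded_pow D st)
  hence "(\<lambda>k. \<Sum>r\<in>D. \<Sum>i\<le>k. ?a s i x r * ?a t (k - i) r z) sums op_mult D (op_exp D s M) (op_exp D t M) x z"
    by (simp add: op_mult_def op_exp_def)
  moreover have "(\<Sum>r\<in>D. \<Sum>i\<le>k. ?a s i x r * ?a t (k - i) r z) = ?a (s + t) k x z" for k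
  proof -
    have "(\<Sum>r\<in>D. \<Sum>i\<le>k. ?a s i x r * ?a t (k - i) r z) =
      (\<Sum>i\<le>k. complex_of_real (s ^ i / fact i) * complex_of_real (t ^ (k - i) / fact (k - i)) * op_mult D (op_pow D M i) (op_pow D M (k - i)) x z)"
      by (subst sum.swap) (simp add: op_mult_def sum_distrib_left sum_divide_distrib mult_ac)
    also have "\<dots> = (\<Sum>i\<le>k. complex_of_real (s ^ i / fact i) * complex_of_real (t ^ (k - i) / fact (k - i)) * op_pow D M k x z)"
      by (intro sum.cong refl) (simp add: op_pow_add[OF D st(1), symmetric])
    also have "\<dots> = complex_of_real (\<Sum>i\<le>k. s ^ i / fact i * (t ^ (k - i) / fact (k - i))) * op_pow D M k x z"
      unfolding of_real_sum of_real_mult sum_distrib_right ..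
    also have "(\<Sum>i\<le>k. s ^ i / fact i * (t ^ (k - i) / fact (k - i))) = (s + t) ^ k / fact k"
      unfolding binomial_ring sum_divide_distrib
      by (intro sum.cong refl) (simp add: binomial_fact field_simps)
    finally show ?thesis .
  qed
  ultimately show ?thesis unfolding op_exp_def by (simp add: sums_iff)
qed

lemma op_exp_pow:
  assumes D: "finite D" and st: "s \<in> D" "z \<in> D"
  shows "op_exp D (real n * t) M s z = op_pow D (op_exp D t M) n s z"
  using st(1)
proof (induction n arbitrary: s)
  case 0
  have "op_exp D 0 M s z = (\<Sum>n. (if n = 0 then op_pow D M n s z else 0))"
    unfolding op_exp_def by (intro arg_cong[where f=suminf] ext) (simp add: power_0_left)
  also have "\<dots> = op_pow D M 0 s z" by (subst suminf_finite[of "{0}"]) auto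
  finally show ?case by simp
next
  case (Suc n)
  have "op_exp D (real (Suc n) * t) M s z = op_exp D (t + real n * t) M s z" by (simp add: algebra_simps)
  also have "\<dots> = op_mult D (op_exp D t M) (op_exp D (real n * t) M) s z" by (rule op_exp_add) (use D Suc st in auto)
  also have "\<dots> = op_mult D (op_exp D t M) (op_pow D (op_exp D t M) n) s z"
    by (rule op_mult_cong) (auto simp: Suc.IH)
  finally show ?case by simp
qed

lemma op_exp_hermitian:
  assumes "finite D" "op_hermitian D M"
  shows "op_hermitian D (op_exp D t M)"
proof (rule op_hermitianI)
  fix s z assume st: "s \<in> D" "z \<in> D"
  have "(\<lambda>n. cnj (complex_of_real (t ^ n / fact n) * op_pow D M n s z)) sums cnj (op_exp D t M s z)"
    unfolding op_exp_egf by (subst sums_cnj) (rule egf_sums[OF geom_bounded_pow[OF assms(1) st]])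
  moreover have "cnj (op_pow D M n s z) = op_pow D M n z s" for n
    using op_hermitianD[OF op_pow_hermitian[OF assms]] st by blast
  ultimately show "op_exp D t M z s = cnj (op_exp D t M s z)"
    unfolding op_exp_def by (simp add: sums_iff)
qed

lemma op_exp_cong:
  assumes "\<And>s z. s \<in> D \<Longrightarrow> z \<in> D \<Longrightarrow> M s z = N s z" "s \<in> D" "z \<in> D"
  shows "op_exp D t M s z = op_exp D t N s z"
  unfolding op_exp_def using op_pow_cong[OF assms] by simp

text \<open>Rows in \<open>D1\<close> do not reach columns outside, so the matrix is block
  triangular and powers can be computed inside the block. The block will be a sector of conserved
  excitations or the configurations of a smaller region.\<close>

lemma op_pow_invariant:
  assumes fin: "finite D" and sub: "D1 \<subseteq> D" and inv: "\<And>s t. s \<in> D1 \<Longrightarrow> t \<in> D - D1 \<Longrightarrow> M s t = 0"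
    and "s \<in> D1"
  shows "op_pow D M n s t = op_pow D1 M n s t"
  using assms(4)
proof (induction n arbitrary: s)
  case (Suc n)
  have "op_pow D M (Suc n) s t = (\<Sum>r\<in>D1. M s r * op_pow D M n r t)"
    unfolding op_pow.simps op_mult_def by (rule sum.mono_neutral_right) (use fin sub inv Suc in auto)
  thus ?case by (simp add: op_mult_def Suc.IH)
qed simp

lemma op_exp_invariant:
  assumes "finite D" "D1 \<subseteq> D" "\<And>s z. s \<in> D1 \<Longrightarrow> z \<in> D - D1 \<Longrightarrow> M s z = 0" "s \<in> D1"
  shows "op_exp D t M s z = op_exp D1 t M s z"
  unfolding op_exp_def using op_pow_invariant[OF assms] by simp

lemma op_pow_invariant_zero:
  assumes fin: "finite D" and sub: "D1 \<subseteq> D" and inv: "\<And>s t. s \<in> D1 \<Longrightarrow> t \<in> D - D1 \<Longrightarrow> M s t = 0"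
    and "s \<in> D1" "t \<in> D - D1"
  shows "op_pow D M n s t = 0"
  using assms(4)
proof (induction n arbitrary: s)
  case (Suc n)
  have "op_pow D M (Suc n) s t = (\<Sum>r\<in>D1. M s r * op_pow D M n r t)"
    unfolding op_pow.simps op_mult_def by (rule sum.mono_neutral_right) (use fin sub inv Suc in auto)
  thus ?case by (simp add: Suc.IH)
qed (use assms(5) in \<open>auto simp: op_id_def\<close>)

lemma op_exp_invariant_zero:
  assumes "finite D" "D1 \<subseteq> D" "\<And>s z. s \<in> D1 \<Longrightarrow> z \<in> D - D1 \<Longrightarrow> M s z = 0" "s \<in> D1" "z \<in> D - D1"
  shows "op_exp D t M s z = 0"
  unfolding op_exp_def using op_pow_invariant_zero[OF assms] by simp

section \<open>Perturbed gapped Hamiltonians in the vacuum basis\<close>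

text \<open>Configurations are extended by the vacuum value 0 outside the volume, so that those of all
  volumes live in one type and an operator on A acts on every volume containing A.\<close>

definition conf0 :: "nat \<Rightarrow> 'a set \<Rightarrow> ('a \<Rightarrow> nat) set" where
  "conf0 m V = {s. (\<forall>i. i \<notin> V \<longrightarrow> s i = 0) \<and> (\<forall>i\<in>V. s i < m)}"

definition supp0 :: "('a \<Rightarrow> nat) \<Rightarrow> 'a set" where
  "supp0 s = {i. s i \<noteq> 0}"

definition restr0 :: "('a \<Rightarrow> nat) \<Rightarrow> 'a set \<Rightarrow> 'a \<Rightarrow> nat" where
  "restr0 s A i = (if i \<in> A then s i else 0)"

definition ext0 :: "'a set \<Rightarrow> 'a op \<Rightarrow> 'a op" where
  "ext0 A M s t = (if \<forall>i. i \<notin> A \<longrightarrow> s i = t i then M (restr0 s A) (restr0 t A) else 0)"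

text \<open>Juxtaposition: for configurations of disjoint sets the pointwise sum copies at each site
  the one that may be nonzero there.\<close>

definition add0 :: "('a \<Rightarrow> nat) \<Rightarrow> ('a \<Rightarrow> nat) \<Rightarrow> 'a \<Rightarrow> nat" where
  "add0 s t i = s i + t i"

lemma finite_conf0: "finite V \<Longrightarrow> finite (conf0 m V)"
proof -
  assume V: "finite V"
  have "conf0 m V \<subseteq> (\<lambda>f i. if i \<in> V then f i else 0) ` PiE V (\<lambda>_. {..<m})"
  proof
    fix x assume s: "x \<in> conf0 m V"
    have "x = (\<lambda>i. if i \<in> V then restrict x V i else 0)" using s by (auto simp: conf0_def)
    moreover have "restrict x V \<in> PiE V (\<lambda>_. {..<m})" using s by (auto simp: conf0_def)
    ultimately show "x \<in> (\<lambda>f i. if i \<in> V then f i else 0) ` PiE V (\<lambda>_. {..<m})" by blast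
  qed
  thus ?thesis by (rule finite_subset) (intro finite_imageI finite_PiE V finite_lessThan)
qed

lemma restr0_conf0: "s \<in> conf0 m V \<Longrightarrow> 0 < m \<Longrightarrow> restr0 s A \<in> conf0 m A"
  by (auto simp: conf0_def restr0_def)

lemma restr0_id: "s \<in> conf0 m A \<Longrightarrow> restr0 s A = s"
  by (auto simp: conf0_def restr0_def fun_eq_iff)

lemma conf0_mono: "A \<subseteq> V \<Longrightarrow> 0 < m \<Longrightarrow> conf0 m A \<subseteq> conf0 m V"
  unfolding conf0_def by auto

lemma supp0_subset: "s \<in> conf0 m V \<Longrightarrow> supp0 s \<subseteq> V"
  by (auto simp: conf0_def supp0_def)

lemma conf0_supp0: "s \<in> conf0 m V \<Longrightarrow> supp0 s \<subseteq> C \<Longrightarrow> C \<subseteq> V \<Longrightarrow> s \<in> conf0 m C"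
  by (auto simp: conf0_def supp0_def)

lemma bij_add0:
  assumes "C1 \<inter> C2 = {}"
  shows "bij_betw (\<lambda>(x, y). add0 x y) (conf0 m C1 \<times> conf0 m C2) (conf0 m (C1 \<union> C2))"
proof (rule bij_betw_byWitness[where f'="\<lambda>s. (restr0 s C1, restr0 s C2)"])
  show "\<forall>a\<in>conf0 m C1 \<times> conf0 m C2. (restr0 (case a of (x, y) \<Rightarrow> add0 x y) C1, restr0 (case a of (x, y) \<Rightarrow> add0 x y) C2) = a"
    using assms by (auto simp: conf0_def restr0_def add0_def fun_eq_iff)
  show "\<forall>a'\<in>conf0 m (C1 \<union> C2). (case (restr0 a' C1, restr0 a' C2) of (x, y) \<Rightarrow> add0 x y) = a'"
    using assms by (auto simp: conf0_def restr0_def add0_def fun_eq_iff)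
  show "(\<lambda>(x, y). add0 x y) ` (conf0 m C1 \<times> conf0 m C2) \<subseteq> conf0 m (C1 \<union> C2)"
    using assms by (auto simp: conf0_def add0_def)
  show "(\<lambda>s. (restr0 s C1, restr0 s C2)) ` conf0 m (C1 \<union> C2) \<subseteq> conf0 m C1 \<times> conf0 m C2"
    by (auto simp: conf0_def restr0_def)
qed

lemma ob_subset:
  assumes "finite D" "D1 \<subseteq> D" "ob D c M"
  shows "ob D1 c M"
  unfolding ob_def
proof (intro conjI allI)
  fix v :: "('a \<Rightarrow> nat) \<Rightarrow> complex"
  let ?v = "\<lambda>s. if s \<in> D1 then v s else 0"
  have "op_apply D1 M v s = op_apply D M ?v s" for s
    unfolding op_apply_def by (rule sum.mono_neutral_cong_left) (use assms in auto)
  hence "vec_norm D1 (op_apply D1 M v) = vec_norm D1 (op_apply D M ?v)" by (intro vec_norm_cong) auto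
  also have "\<dots> \<le> vec_norm D (op_apply D M ?v)" by (rule vec_norm_mono_set) (use assms in auto)
  also have "\<dots> \<le> c * vec_norm D ?v" by (rule obD[OF assms(3)])
  also have "vec_norm D ?v = vec_norm D1 v"
    unfolding vec_norm_def by (intro arg_cong[where f=sqrt] sum.mono_neutral_cong_right) (use assms in auto)
  finally show "vec_norm D1 (op_apply D1 M v) \<le> c * vec_norm D1 v" .
qed (use assms in \<open>auto simp: ob_def\<close>)

text \<open>For a fixed configuration \<open>d\<close> off \<open>A\<close> the operator acts on the
  slice as \<open>M\<close>, and squared norms add over the slices.\<close>

lemma ob_ext0:
  assumes V: "finite V" "A \<subseteq> V" and ob: "ob (conf0 m A) c M"
  shows "ob (conf0 m V) c (ext0 A M)"
  unfolding ob_def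
proof (intro conjI allI)
  show c: "0 \<le> c" using ob by (simp add: ob_def)
  fix v :: "('a \<Rightarrow> nat) \<Rightarrow> complex"
  have fA: "finite A" using V finite_subset by blast
  have U: "A \<union> (V - A) = V" using V by auto
  have bij: "bij_betw (\<lambda>(x, y). add0 x y) (conf0 m A \<times> conf0 m (V - A)) (conf0 m V)"
    using bij_add0[of A "V - A" m] unfolding U by simp
  have split: "(\<Sum>s\<in>conf0 m V. f s) = (\<Sum>d\<in>conf0 m (V - A). \<Sum>s\<in>conf0 m A. f (add0 s d))" for f :: "('a \<Rightarrow> nat) \<Rightarrow> 'c::comm_monoid_add"
    unfolding sum.reindex_bij_betw[OF bij, symmetric] by (subst sum.swap) (simp add: sum.cartesian_product case_prod_beta)
  have app: "op_apply (conf0 m V) (ext0 A M) v (add0 s d) = op_apply (conf0 m A) M (\<lambda>t. v (add0 t d)) s"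
    if "s \<in> conf0 m A" "d \<in> conf0 m (V - A)" for s d
  proof -
    have "op_apply (conf0 m V) (ext0 A M) v (add0 s d) =
      (\<Sum>d'\<in>conf0 m (V - A). \<Sum>t\<in>conf0 m A. ext0 A M (add0 s d) (add0 t d') * v (add0 t d'))"
      unfolding op_apply_def by (rule split)
    also have "\<dots> = (\<Sum>d'\<in>conf0 m (V - A). if d' = d then (\<Sum>t\<in>conf0 m A. M s t * v (add0 t d)) else 0)"
    proof (intro sum.cong refl)
      fix d' assume r: "d' \<in> conf0 m (V - A)"
      have "ext0 A M (add0 s d) (add0 t d') = (if d' = d then M s t else 0)" if "t \<in> conf0 m A" for t
      proof -
        have 1: "restr0 (add0 s d) A = s" "restr0 (add0 t d') A = t"
          using that r \<open>s \<in> conf0 m A\<close> \<open>d \<in> conf0 m (V - A)\<close> by (auto simp: conf0_def restr0_def add0_def fun_eq_iff)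
        have 2: "(\<forall>i. i \<notin> A \<longrightarrow> add0 s d i = add0 t d' i) \<longleftrightarrow> d' = d"
        proof
          assume *: "\<forall>i. i \<notin> A \<longrightarrow> add0 s d i = add0 t d' i"
          show "d' = d"
          proof
            fix i show "d' i = d i"
              using * that r \<open>s \<in> conf0 m A\<close> \<open>d \<in> conf0 m (V - A)\<close>
              by (cases "i \<in> A") (auto simp: conf0_def add0_def)
          qed
        next
          assume "d' = d"
          thus "\<forall>i. i \<notin> A \<longrightarrow> add0 s d i = add0 t d' i"
            using that \<open>s \<in> conf0 m A\<close> by (auto simp: conf0_def add0_def)
        qed
        show ?thesis unfolding ext0_def 1 2 by simp
      qed
      thus "(\<Sum>t\<in>conf0 m A. ext0 A M (add0 s d) (add0 t d') * v (add0 t d')) =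
         (if d' = d then (\<Sum>t\<in>conf0 m A. M s t * v (add0 t d)) else 0)" by auto
    qed
    also have "\<dots> = op_apply (conf0 m A) M (\<lambda>t. v (add0 t d)) s"
      using that V finite_conf0[of "V - A" m] by (simp add: op_apply_def)
    finally show ?thesis .
  qed
  have "(vec_norm (conf0 m V) (op_apply (conf0 m V) (ext0 A M) v))\<^sup>2 =
     (\<Sum>d\<in>conf0 m (V - A). (vec_norm (conf0 m A) (op_apply (conf0 m A) M (\<lambda>t. v (add0 t d))))\<^sup>2)"
    unfolding vec_norm_sq split by (intro sum.cong refl) (simp add: app)
  also have "\<dots> \<le> (\<Sum>d\<in>conf0 m (V - A). c\<^sup>2 * (vec_norm (conf0 m A) (\<lambda>t. v (add0 t d)))\<^sup>2)"
    unfolding power_mult_distrib[symmetric] by (intro sum_mono power_mono obD[OF ob]) auto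
  also have "\<dots> = (c * vec_norm (conf0 m V) v)\<^sup>2"
    unfolding power_mult_distrib vec_norm_sq split sum_distrib_left ..
  finally show "vec_norm (conf0 m V) (op_apply (conf0 m V) (ext0 A M) v) \<le> c * vec_norm (conf0 m V) v"
    using c by (auto intro: power2_le_imp_le)
qed

lemma ip_le: "cmod (ip D u v) \<le> vec_norm D u * vec_norm D v"
proof -
  have "cmod (ip D u v) \<le> (\<Sum>s\<in>D. \<bar>cmod (u s)\<bar> * \<bar>cmod (v s)\<bar>)"
    unfolding ip_def by (rule order_trans[OF norm_sum]) (simp add: norm_mult)
  also have "\<dots> \<le> vec_norm D u * vec_norm D v" unfolding vec_norm_L2 by (rule L2_set_mult_ineq)
  finally show ?thesis .
qed

lemma ext0_supp_preserving:
  assumes "\<And>s t. s \<in> conf0 m A \<Longrightarrow> t \<in> conf0 m A \<Longrightarrow> supp0 s \<noteq> supp0 t \<Longrightarrow> M s t = 0"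
    and "s \<in> conf0 m V" "t \<in> conf0 m V'" "0 < m" "supp0 s \<noteq> supp0 t"
  shows "ext0 A M s t = 0"
proof (cases "\<forall>i. i \<notin> A \<longrightarrow> s i = t i")
  case True
  have "supp0 (restr0 s A) \<noteq> supp0 (restr0 t A)"
  proof
    assume "supp0 (restr0 s A) = supp0 (restr0 t A)"
    hence "i \<in> supp0 s \<longleftrightarrow> i \<in> supp0 t" for i
      using True by (cases "i \<in> A") (auto simp: supp0_def restr0_def set_eq_iff split: if_splits)
    thus False using assms by auto
  qed
  hence "M (restr0 s A) (restr0 t A) = 0"
    by (intro assms(1) restr0_conf0[OF assms(2,4)] restr0_conf0[OF assms(3,4)])
  thus ?thesis by (simp add: ext0_def)
qed (auto simp: ext0_def)

text \<open>What the expansion uses of the model, in a basis where the vacuum is the zero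
  configuration. \<open>h\<close> is the unperturbed interaction, with its range encoded in
  \<open>nbr\<close>, and \<open>y\<close> is the perturbation. Conservation of the excited set and
  vanishing on the vacuum are demanded of each term, since locality arguments treat terms
  separately; the gap concerns the total Hamiltonian of a volume.\<close>

locale gapped_system =
  fixes m :: nat and nbr :: "'a rel" and \<Delta> :: nat and h y :: "'a set \<Rightarrow> 'a op" and g \<kappa> :: real
    and ynorm :: "'a set \<Rightarrow> real"
  assumes m: "0 < m"
    and bd: "bounded_degree nbr \<Delta>"
    and h_local: "\<And>A. finite A \<Longrightarrow> \<not> A \<times> A \<subseteq> nbr \<Longrightarrow> op_zero_on (conf0 m A) (h A)"
    and h_supp: "\<And>A s t. finite A \<Longrightarrow> s \<in> conf0 m A \<Longrightarrow> t \<in> conf0 m A \<Longrightarrow> supp0 s \<noteq> supp0 t \<Longrightarrow> h A s t = 0"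
    and h_vac: "\<And>A. finite A \<Longrightarrow> h A (\<lambda>_. 0) (\<lambda>_. 0) = 0"
    and H0_herm: "\<And>V. finite V \<Longrightarrow> op_hermitian (conf0 m V) (\<lambda>s t. \<Sum>A\<in>Pow V. ext0 A (h A) s t)"
    and gap: "\<And>V S v. finite V \<Longrightarrow> S \<subseteq> V \<Longrightarrow> (\<And>s. s \<in> conf0 m V \<Longrightarrow> supp0 s \<noteq> S \<Longrightarrow> v s = 0) \<Longrightarrow>
        g * real (card S) * (vec_norm (conf0 m V) v)\<^sup>2 \<le>
          Re (ip (conf0 m V) v (op_apply (conf0 m V) (\<lambda>s t. \<Sum>A\<in>Pow V. ext0 A (h A) s t) v))"
    and y_local: "\<And>X C1 C2. finite X \<Longrightarrow> X \<subseteq> C1 \<union> C2 \<Longrightarrow> X \<inter> C1 \<noteq> {} \<Longrightarrow> X \<inter> C2 \<noteq> {} \<Longrightarrow> nbr `` C1 \<inter> C2 = {}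
        \<Longrightarrow> op_zero_on (conf0 m X) (y X)"
    and y_empty: "op_zero_on (conf0 m {}) (y {})"
    and y_ob: "\<And>X. finite X \<Longrightarrow> ob (conf0 m X) (ynorm X) (y X)"
    and y_norm: "\<And>U. finite U \<Longrightarrow> (\<Sum>X\<in>Pow U. exp (\<kappa> * real (card X)) * ynorm X) \<le> real (card U)"
    and \<kappa>: "0 \<le> \<kappa>" and g: "0 \<le> g"
begin

definition H0 :: "'a set \<Rightarrow> 'a op" where
  "H0 V s t = (\<Sum>A\<in>Pow V. ext0 A (h A) s t)"

text \<open>\<open>V\<close> is the volume of the unperturbed part, and \<open>U\<close> is the
  region in which the perturbation is switched on. Keeping them apart permits a Moebius transform in
  \<open>U\<close> at fixed \<open>V\<close>.\<close>

definition Ham :: "'a set \<Rightarrow> 'a set \<Rightarrow> 'a op" where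
  "Ham V U s t = H0 V s t + (\<Sum>X\<in>Pow U. ext0 X (y X) s t)"

lemma zero_conf0 [simp]: "(\<lambda>_. 0) \<in> conf0 m A"
  using m by (auto simp: conf0_def)

lemma h_ext_supp:
  assumes "finite A" "s \<in> conf0 m V" "t \<in> conf0 m V'" "supp0 s \<noteq> supp0 t"
  shows "ext0 A (h A) s t = 0"
  by (rule ext0_supp_preserving[OF h_supp]) (use assms m in auto)

lemma H0_supp:
  assumes "finite V" "s \<in> conf0 m V1" "t \<in> conf0 m V2" "supp0 s \<noteq> supp0 t"
  shows "H0 V s t = 0"
  unfolding H0_def
proof (rule sum.neutral, rule ballI)
  fix A assume "A \<in> Pow V"
  hence "finite A" using assms(1) finite_subset by blast
  thus "ext0 A (h A) s t = 0" by (rule h_ext_supp) fact+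
qed

lemma y_ext_supp:
  assumes "supp0 s - X \<noteq> supp0 t - X"
  shows "ext0 X M s t = 0"
  using assms by (auto simp: ext0_def supp0_def)

text \<open>Excitations off \<open>U\<close> are conserved: the unperturbed part conserves all
  excitations, and the perturbation acts inside \<open>U\<close>.\<close>

lemma Ham_supp:
  assumes "finite V" "s \<in> conf0 m V1" "t \<in> conf0 m V2" "supp0 s - U \<noteq> supp0 t - U"
  shows "Ham V U s t = 0"
proof -
  have "H0 V s t = 0" using H0_supp[OF assms(1-3)] assms(4) by auto
  moreover have "ext0 X (y X) s t = 0" if "X \<in> Pow U" for X
    by (rule y_ext_supp) (use that assms(4) in auto)
  ultimately show ?thesis by (simp add: Ham_def)
qed

subsection \<open>Decay of the Moebius coefficients of one time slab\<close>

text \<open>The form is block diagonal in the set of excited sites. The gap inequality is applied to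
  the component \<open>w S\<close> of \<open>v\<close> in each block, and the squared norms of the
  components add up.\<close>

lemma H0_form_ge:
  assumes V: "finite V" and D0: "\<And>x. x \<in> conf0 m V \<Longrightarrow> v x \<noteq> 0 \<Longrightarrow> d \<le> card (supp0 x)"
  shows "g * real d * (vec_norm (conf0 m V) v)\<^sup>2 \<le> Re (ip (conf0 m V) v (op_apply (conf0 m V) (H0 V) v))"
proof -
  let ?D = "conf0 m V"
  define w where "w S x = (if supp0 x = S then v x else 0)" for S x
  have fD: "finite ?D" by (rule finite_conf0[OF V])
  have pick: "(\<Sum>S\<in>Pow V. if supp0 x = S then c S else 0) = c (supp0 x)" if "x \<in> ?D" for x and c :: "_ \<Rightarrow> 'b::comm_monoid_add"
    using V supp0_subset[OF that] by (subst sum.delta') auto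
  have "ip ?D v (op_apply ?D (H0 V) v) = (\<Sum>x\<in>?D. \<Sum>t\<in>?D. \<Sum>S\<in>Pow V. cnj (w S x) * H0 V x t * w S t)"
    unfolding ip_def op_apply_def sum_distrib_left
  proof (intro sum.cong refl)
    fix x t assume st: "x \<in> ?D" "t \<in> ?D"
    have "(\<Sum>S\<in>Pow V. cnj (w S x) * H0 V x t * w S t) =
       (\<Sum>S\<in>Pow V. if supp0 x = S then cnj (v x) * H0 V x t * w S t else 0)"
      by (intro sum.cong refl) (simp add: w_def)
    also have "\<dots> = cnj (v x) * H0 V x t * w (supp0 x) t" by (rule pick[OF st(1)])
    also have "\<dots> = cnj (v x) * (H0 V x t * v t)"
      using H0_supp[OF V st] by (auto simp: w_def)
    finally show "cnj (v x) * (H0 V x t * v t) = (\<Sum>S\<in>Pow V. cnj (w S x) * H0 V x t * w S t)" by simp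
  qed
  also have "\<dots> = (\<Sum>x\<in>?D. \<Sum>S\<in>Pow V. \<Sum>t\<in>?D. cnj (w S x) * H0 V x t * w S t)"
    by (rule sum.cong[OF refl]) (rule sum.swap)
  also have "\<dots> = (\<Sum>S\<in>Pow V. ip ?D (w S) (op_apply ?D (H0 V) (w S)))"
    unfolding ip_def op_apply_def sum_distrib_left by (subst sum.swap) (simp add: mult.assoc)
  finally have ip: "ip ?D v (op_apply ?D (H0 V) v) = (\<Sum>S\<in>Pow V. ip ?D (w S) (op_apply ?D (H0 V) (w S)))" .
  have "(vec_norm ?D v)\<^sup>2 = (\<Sum>x\<in>?D. \<Sum>S\<in>Pow V. (cmod (w S x))\<^sup>2)"
    unfolding vec_norm_sq
  proof (intro sum.cong refl)
    fix x assume s: "x \<in> ?D"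
    have "(\<Sum>S\<in>Pow V. (cmod (w S x))\<^sup>2) = (\<Sum>S\<in>Pow V. if supp0 x = S then (cmod (v x))\<^sup>2 else 0)"
      by (intro sum.cong refl) (simp add: w_def)
    also have "\<dots> = (cmod (v x))\<^sup>2" by (rule pick[OF s])
    finally show "(cmod (v x))\<^sup>2 = (\<Sum>S\<in>Pow V. (cmod (w S x))\<^sup>2)" by simp
  qed
  also have "\<dots> = (\<Sum>S\<in>Pow V. (vec_norm ?D (w S))\<^sup>2)" unfolding vec_norm_sq by (rule sum.swap)
  finally have nrm: "(vec_norm ?D v)\<^sup>2 = (\<Sum>S\<in>Pow V. (vec_norm ?D (w S))\<^sup>2)" .
  have "g * real d * (vec_norm ?D (w S))\<^sup>2 \<le> Re (ip ?D (w S) (op_apply ?D (H0 V) (w S)))" if "S \<in> Pow V" for S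
  proof -
    have "g * real (card S) * (vec_norm ?D (w S))\<^sup>2 \<le> Re (ip ?D (w S) (op_apply ?D (H0 V) (w S)))"
      unfolding H0_def[abs_def] by (rule gap[OF V]) (use that in \<open>auto simp: w_def\<close>)
    moreover have "g * real d * (vec_norm ?D (w S))\<^sup>2 \<le> g * real (card S) * (vec_norm ?D (w S))\<^sup>2"
    proof (cases "\<exists>x\<in>?D. w S x \<noteq> 0")
      case True
      then obtain x where "x \<in> ?D" "w S x \<noteq> 0" by auto
      hence "d \<le> card S" using D0[of x] by (auto simp: w_def split: if_splits)
      thus ?thesis using g by (intro mult_right_mono mult_left_mono) auto
    next
      case False
      hence "vec_norm ?D (w S) = 0" by (auto simp: vec_norm_eq_0_iff[OF fD])
      thus ?thesis by simp
    qed
    ultimately show ?thesis by linarith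
  qed
  thus ?thesis unfolding ip nrm Re_sum sum_distrib_left by (intro sum_mono) auto
qed

text \<open>The sector with conserved excitations \<open>S\<close>; what happens on \<open>U\<close>
  is left free.\<close>

definition Dset :: "'a set \<Rightarrow> 'a set \<Rightarrow> 'a set \<Rightarrow> ('a \<Rightarrow> nat) set" where
  "Dset V U S = {s\<in>conf0 m V. supp0 s - U = S}"

lemma finite_Dset: "finite V \<Longrightarrow> finite (Dset V U S)"
  using finite_conf0[of V m] by (simp add: Dset_def)

text \<open>The lower bound on \<open>H0\<close> given by the gap turns into an upper bound on the
  norm of \<open>s - H0\<close>, provided that \<open>s\<close> is large enough to keep this
  operator positive. Its powers are then controlled, and a Taylor series can play the part of a
  time-ordered expansion.\<close>

lemma H0_contraction:
  assumes V: "finite V"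
  shows "\<exists>s\<ge>g * real (card S). ob (Dset V U S) (s - g * real (card S)) (\<lambda>r t. complex_of_real s * op_id r t - H0 V r t)"
proof -
  let ?D = "conf0 m V" and ?d = "g * real (card S)" and ?D1 = "Dset V U S"
  have fD: "finite ?D" by (rule finite_conf0[OF V])
  have fD1: "finite ?D1" by (rule finite_Dset[OF V])
  obtain c where c: "ob ?D c (H0 V)" using ob_exists[OF fD] by blast
  have c0: "0 \<le> c" using c by (simp add: ob_def)
  have d0: "0 \<le> ?d" using g by simp
  \<comment> \<open>With this choice the form of \<open>s - H0\<close> lies between
    \<open>?d\<close>, which is nonnegative, and \<open>c\<close>, in units of the squared
    norm.\<close>
  define s where "s = c + ?d"
  let ?B = "\<lambda>r t. complex_of_real s * op_id r t - H0 V r t"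
  have "ob ?D1 c ?B"
  proof (rule hermitian_form_bound[OF fD1 _ c0])
    have h: "op_hermitian ?D (H0 V)" using H0_herm[OF V] by (simp add: H0_def[abs_def])
    show "op_hermitian ?D1 ?B"
    proof (rule op_hermitianI)
      fix r t assume "r \<in> ?D1" "t \<in> ?D1"
      hence "r \<in> ?D" "t \<in> ?D" by (auto simp: Dset_def)
      thus "?B t r = cnj (?B r t)" using op_hermitianD[OF h] by (auto simp: op_id_def)
    qed
    fix v :: "('a \<Rightarrow> nat) \<Rightarrow> complex"
    define v' where "v' r = (if r \<in> ?D1 then v r else 0)" for r
    have sub: "?D1 \<subseteq> ?D" by (auto simp: Dset_def)
    have nv: "vec_norm ?D v' = vec_norm ?D1 v"
      unfolding vec_norm_def by (intro arg_cong[where f=sqrt] sum.mono_neutral_cong_right) (use fD sub in \<open>auto simp: v'_def\<close>)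
    have a1: "op_apply ?D1 M v r = op_apply ?D M v' r" for M r
      unfolding op_apply_def by (rule sum.mono_neutral_cong_left) (use fD sub in \<open>auto simp: v'_def\<close>)
    have ipv: "ip ?D1 v u = ip ?D v' u" for u
      unfolding ip_def by (rule sum.mono_neutral_cong_left) (use fD sub in \<open>auto simp: v'_def\<close>)
    have "op_apply ?D1 ?B v r = complex_of_real s * v r - op_apply ?D1 (H0 V) v r" if "r \<in> ?D1" for r
      using that fD1 by (simp add: op_apply_def left_diff_distrib sum_subtractf op_id_def
          if_distrib[of "\<lambda>x. x * _"] if_distrib[of "\<lambda>x. _ * x"] sum.delta cong: if_cong)
    hence "ip ?D1 v (op_apply ?D1 ?B v) = ip ?D1 v (\<lambda>r. complex_of_real s * v r - op_apply ?D1 (H0 V) v r)"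
      by (simp add: ip_def)
    also have "\<dots> = complex_of_real (s * (vec_norm ?D1 v)\<^sup>2) - ip ?D v' (op_apply ?D (H0 V) v')"
      unfolding ip_diff_right ip_cmult_right ip_self by (simp add: ipv[symmetric] a1)
    finally have eq: "Re (ip ?D1 v (op_apply ?D1 ?B v)) = s * (vec_norm ?D1 v)\<^sup>2 - Re (ip ?D v' (op_apply ?D (H0 V) v'))" by simp
    have "?d * (vec_norm ?D v')\<^sup>2 \<le> Re (ip ?D v' (op_apply ?D (H0 V) v'))"
    proof (rule H0_form_ge[OF V])
      fix r assume s: "r \<in> ?D" "v' r \<noteq> 0"
      have "finite (supp0 r)" using s(1) supp0_subset V finite_subset by metis
      moreover have "S \<subseteq> supp0 r" using s by (auto simp: v'_def Dset_def split: if_splits)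
      ultimately show "card S \<le> card (supp0 r)" by (rule card_mono)
    qed
    moreover have "Re (ip ?D v' (op_apply ?D (H0 V) v')) \<le> c * (vec_norm ?D v')\<^sup>2"
    proof -
      have "Re (ip ?D v' (op_apply ?D (H0 V) v')) \<le> cmod (ip ?D v' (op_apply ?D (H0 V) v'))" by (rule complex_Re_le_cmod)
      also have "\<dots> \<le> vec_norm ?D v' * vec_norm ?D (op_apply ?D (H0 V) v')" by (rule ip_le)
      also have "\<dots> \<le> vec_norm ?D v' * (c * vec_norm ?D v')" by (intro mult_left_mono obD[OF c]) auto
      finally show ?thesis by (simp add: power2_eq_square mult_ac)
    qed
    moreover have "0 \<le> ?d * (vec_norm ?D1 v)\<^sup>2" "0 \<le> c * (vec_norm ?D1 v)\<^sup>2" using d0 c0 by auto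
    moreover have "s * (vec_norm ?D1 v)\<^sup>2 = c * (vec_norm ?D1 v)\<^sup>2 + ?d * (vec_norm ?D1 v)\<^sup>2"
      by (simp add: s_def distrib_right)
    ultimately show "\<bar>Re (ip ?D1 v (op_apply ?D1 ?B v))\<bar> \<le> c * (vec_norm ?D1 v)\<^sup>2"
      unfolding eq nv by linarith
  qed
  thus ?thesis using c0 by (intro exI[of _ s]) (auto simp: s_def)
qed

text \<open>Expand the \<open>k\<close>-th power of \<open>B\<close> minus the perturbation into
  words. \<open>Ecoef\<close> collects the words whose perturbation factors have union exactly
  \<open>W\<close>, and \<open>Ebd\<close> bounds their norm by the same recursion.\<close>

fun Ecoef :: "('a \<Rightarrow> nat) set \<Rightarrow> 'a op \<Rightarrow> nat \<Rightarrow> 'a set \<Rightarrow> 'a op" where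
  "Ecoef D B 0 W = (if W = {} then op_id else (\<lambda>_ _. 0))"
| "Ecoef D B (Suc k) W = (\<lambda>r t. op_mult D B (Ecoef D B k W) r t +
     (\<Sum>p\<in>{p\<in>Pow W \<times> Pow W. fst p \<union> snd p = W}. - op_mult D (ext0 (fst p) (y (fst p))) (Ecoef D B k (snd p)) r t))"

fun Ebd :: "real \<Rightarrow> nat \<Rightarrow> 'a set \<Rightarrow> real" where
  "Ebd b 0 W = (if W = {} then 1 else 0)"
| "Ebd b (Suc k) W = b * Ebd b k W + (\<Sum>p\<in>{p\<in>Pow W \<times> Pow W. fst p \<union> snd p = W}. ynorm (fst p) * Ebd b k (snd p))"

lemma Ecoef_sum:
  assumes D: "finite D" and U: "finite U'" and st: "s \<in> D" "t \<in> D"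
  shows "op_pow D (\<lambda>s t. B s t - (\<Sum>X\<in>Pow U'. ext0 X (y X) s t)) k s t = (\<Sum>W\<in>Pow U'. Ecoef D B k W s t)"
  using st(1)
proof (induction k arbitrary: s)
  case 0
  have "(\<Sum>W\<in>Pow U'. Ecoef D B 0 W s t) = (\<Sum>W\<in>Pow U'. if W = {} then op_id s t else 0)"
    by (intro sum.cong) auto
  thus ?case using U by (simp add: sum.delta)
next
  case (Suc k)
  let ?E = "Ecoef D B k" and ?Y = "\<lambda>X. ext0 X (y X)"
  have "(\<Sum>W\<in>Pow U'. Ecoef D B (Suc k) W s t) = (\<Sum>W\<in>Pow U'. op_mult D B (?E W) s t)
     + (\<Sum>W\<in>Pow U'. \<Sum>p\<in>{p\<in>Pow W \<times> Pow W. fst p \<union> snd p = W}. - op_mult D (?Y (fst p)) (?E (snd p)) s t)"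
    by (simp add: sum.distrib)
  also have "\<dots> = (\<Sum>W\<in>Pow U'. op_mult D B (?E W) s t) + (\<Sum>X\<in>Pow U'. \<Sum>W\<in>Pow U'. - op_mult D (?Y X) (?E W) s t)"
    by (simp only: sum_union_pairs[OF U, where c="\<lambda>X W. - op_mult D (?Y X) (?E W) s t"])
  also have "\<dots> = (\<Sum>r\<in>D. (B s r - (\<Sum>X\<in>Pow U'. ?Y X s r)) * (\<Sum>W\<in>Pow U'. ?E W r t))"
  proof -
    have 1: "(\<Sum>W\<in>Pow U'. op_mult D B (?E W) s t) = (\<Sum>r\<in>D. B s r * (\<Sum>W\<in>Pow U'. ?E W r t))"
      unfolding op_mult_def sum_distrib_left by (rule sum.swap)
    have "(\<Sum>X\<in>Pow U'. \<Sum>W\<in>Pow U'. op_mult D (?Y X) (?E W) s t) = (\<Sum>X\<in>Pow U'. \<Sum>r\<in>D. ?Y X s r * (\<Sum>W\<in>Pow U'. ?E W r t))"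
      unfolding op_mult_def sum_distrib_left by (intro sum.cong refl) (rule sum.swap)
    also have "\<dots> = (\<Sum>r\<in>D. (\<Sum>X\<in>Pow U'. ?Y X s r) * (\<Sum>W\<in>Pow U'. ?E W r t))"
      unfolding sum_distrib_right by (rule sum.swap)
    finally show ?thesis unfolding sum_negf 1 by (simp add: left_diff_distrib sum_subtractf)
  qed
  also have "\<dots> = op_pow D (\<lambda>s t. B s t - (\<Sum>X\<in>Pow U'. ?Y X s t)) (Suc k) s t"
    unfolding op_pow.simps op_mult_def by (intro sum.cong refl) (simp add: Suc.IH)
  finally show ?case by simp
qed

lemma Ebd_nonneg:
  assumes "0 \<le> b"
  shows "finite W \<Longrightarrow> 0 \<le> Ebd b k W"
proof (induction k arbitrary: W)
  case (Suc k)
  have "0 \<le> ynorm X" if "finite X" for X using y_ob[OF that] by (simp add: ob_def)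
  moreover have "finite X" if "X \<in> Pow W" for X using that Suc(2) by (auto intro: finite_subset)
  ultimately have "0 \<le> ynorm (fst p) * Ebd b k (snd p)" if "p \<in> Pow W \<times> Pow W" for p
    using that Suc.IH by (intro mult_nonneg_nonneg) (auto simp: mem_Times_iff)
  hence "0 \<le> (\<Sum>p\<in>{p\<in>Pow W \<times> Pow W. fst p \<union> snd p = W}. ynorm (fst p) * Ebd b k (snd p))"
    by (intro sum_nonneg) blast
  moreover have "0 \<le> b * Ebd b k W" using Suc.IH[OF Suc(2)] assms by simp
  ultimately show ?case by simp
qed auto

lemma Ecoef_ob:
  assumes V: "finite V" and D: "D \<subseteq> conf0 m V" and B: "ob D b B"
  shows "W \<subseteq> V \<Longrightarrow> ob D (Ebd b k W) (Ecoef D B k W)"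
proof (induction k arbitrary: W)
  case 0
  have "finite D" using D finite_conf0[OF V] finite_subset by blast
  thus ?case by (simp add: ob_id ob_zero)
next
  case (Suc k)
  have fD: "finite D" using D finite_conf0[OF V] finite_subset by blast
  have fW: "finite W" using Suc V finite_subset by blast
  have Y: "ob D (ynorm X) (ext0 X (y X))" if "X \<subseteq> V" for X
  proof -
    have "finite X" using that V finite_subset by blast
    thus ?thesis using ob_subset[OF finite_conf0[OF V] D ob_ext0[OF V that y_ob]] by blast
  qed
  show ?case unfolding Ecoef.simps Ebd.simps
    by (intro ob_add ob_sum ob_uminus ob_mult fD B Suc Y) (use fW Suc in auto)
qed

text \<open>The weight \<open>exp (\<kappa> * card W)\<close> is submultiplicative under unions, so
  the weighted sum obeys a scalar recursion: a further factor of the word contributes at most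
  \<open>b\<close> if it is \<open>B\<close>, and at most \<open>card U\<close>, by
  \<open>y_norm\<close>, if it is a perturbation term.\<close>

lemma Ebd_sum_le:
  assumes b: "0 \<le> b" and U: "finite U"
  shows "(\<Sum>W\<in>Pow U. exp (\<kappa> * real (card W)) * Ebd b k W) \<le> (b + real (card U)) ^ k"
proof (induction k)
  case 0
  have "(\<Sum>W\<in>Pow U. exp (\<kappa> * real (card W)) * Ebd b 0 W) = (\<Sum>W\<in>Pow U. if W = {} then 1 else 0)"
    by (intro sum.cong) auto
  thus ?case using U by (simp add: sum.delta)
next
  case (Suc k)
  let ?e = "\<lambda>W. exp (\<kappa> * real (card W))"
  have yn: "0 \<le> ynorm X" if "finite X" for X using y_ob[OF that] by (simp add: ob_def)
  have "(\<Sum>W\<in>Pow U. ?e W * Ebd b (Suc k) W) = b * (\<Sum>W\<in>Pow U. ?e W * Ebd b k W) +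
     (\<Sum>W\<in>Pow U. \<Sum>p\<in>{p\<in>Pow W \<times> Pow W. fst p \<union> snd p = W}. ?e W * (ynorm (fst p) * Ebd b k (snd p)))"
    by (simp add: distrib_left sum.distrib sum_distrib_left mult_ac)
  also have "(\<Sum>W\<in>Pow U. \<Sum>p\<in>{p\<in>Pow W \<times> Pow W. fst p \<union> snd p = W}. ?e W * (ynorm (fst p) * Ebd b k (snd p))) \<le>
     (\<Sum>W\<in>Pow U. \<Sum>p\<in>{p\<in>Pow W \<times> Pow W. fst p \<union> snd p = W}. (?e (fst p) * ynorm (fst p)) * (?e (snd p) * Ebd b k (snd p)))"
  proof (intro sum_mono)
    fix W p assume W: "W \<in> Pow U" and p: "p \<in> {p\<in>Pow W \<times> Pow W. fst p \<union> snd p = W}"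
    have fW: "finite W" using W U finite_subset by blast
    have f: "finite (fst p)" "finite (snd p)" using p fW finite_subset by auto
    have "real (card W) \<le> real (card (fst p)) + real (card (snd p))" using p card_Un_le[of "fst p" "snd p"] by auto
    hence "?e W \<le> ?e (fst p) * ?e (snd p)" unfolding exp_add[symmetric] distrib_left[symmetric]
      using \<kappa> by (simp add: mult_left_mono)
    hence "?e W * (ynorm (fst p) * Ebd b k (snd p)) \<le> (?e (fst p) * ?e (snd p)) * (ynorm (fst p) * Ebd b k (snd p))"
      by (intro mult_right_mono mult_nonneg_nonneg yn Ebd_nonneg b f)
    thus "?e W * (ynorm (fst p) * Ebd b k (snd p)) \<le> (?e (fst p) * ynorm (fst p)) * (?e (snd p) * Ebd b k (snd p))"
      by (simp add: mult_ac)
  qed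
  also have "\<dots> = (\<Sum>X\<in>Pow U. ?e X * ynorm X) * (\<Sum>W\<in>Pow U. ?e W * Ebd b k W)"
    unfolding sum_union_pairs[OF U, where c="\<lambda>X W. (?e X * ynorm X) * (?e W * Ebd b k W)"] sum_product ..
  also have "b * (\<Sum>W\<in>Pow U. ?e W * Ebd b k W) + (\<Sum>X\<in>Pow U. ?e X * ynorm X) * (\<Sum>W\<in>Pow U. ?e W * Ebd b k W) \<le>
     (b + real (card U)) * (b + real (card U)) ^ k"
    unfolding distrib_right[symmetric]
  proof (rule mult_mono)
    show "b + (\<Sum>X\<in>Pow U. ?e X * ynorm X) \<le> b + real (card U)" using y_norm[OF U] by simp
    show "(\<Sum>W\<in>Pow U. ?e W * Ebd b k W) \<le> (b + real (card U)) ^ k" by (rule Suc)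
    show "0 \<le> (\<Sum>W\<in>Pow U. ?e W * Ebd b k W)"
      using U b by (intro sum_nonneg mult_nonneg_nonneg Ebd_nonneg) (auto intro: finite_subset)
  qed (use b in auto)
  finally show ?case by simp
qed

lemma Ebd_le:
  assumes b: "0 \<le> b" and U: "finite U"
  shows "exp (\<kappa> * real (card U)) * Ebd b k U \<le> (b + real (card U)) ^ k"
proof -
  have "exp (\<kappa> * real (card U)) * Ebd b k U \<le> (\<Sum>W\<in>Pow U. exp (\<kappa> * real (card W)) * Ebd b k W)"
  proof (rule member_le_sum[where f="\<lambda>W. exp (\<kappa> * real (card W)) * Ebd b k W"])
    fix W assume "W \<in> Pow U - {U}"
    hence "finite W" using U by (auto intro: finite_subset)
    thus "0 \<le> exp (\<kappa> * real (card W)) * Ebd b k W" using Ebd_nonneg[OF b] by simp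
  qed (use U in auto)
  thus ?thesis using Ebd_sum_le[OF b U, of k] by linarith
qed

text \<open>The part of a slab in which the perturbation acts on exactly the sites of \<open>U\<close>.\<close>

definition Mhat :: "real \<Rightarrow> 'a set \<Rightarrow> 'a set \<Rightarrow> 'a op" where
  "Mhat t V U s z = mob (\<lambda>U'. op_exp (conf0 m V) (-t) (Ham V U') s z) U"

lemma Mhat_zero:
  assumes V: "finite V" and st: "s \<in> conf0 m V" "z \<in> conf0 m V" and ne: "supp0 s - U \<noteq> supp0 z - U"
  shows "Mhat t V U s z = 0"
proof -
  have "op_exp (conf0 m V) (-t) (Ham V U') s z = 0" if "U' \<subseteq> U" for U'
  proof (rule op_exp_invariant_zero[of _ "Dset V U (supp0 s - U)"])
    fix r r' assume "r \<in> Dset V U (supp0 s - U)" "r' \<in> conf0 m V - Dset V U (supp0 s - U)"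
    thus "Ham V U' r r' = 0" using that by (intro Ham_supp[OF V, of _ V _ V]) (auto simp: Dset_def)
  qed (use st ne finite_conf0[OF V] in \<open>auto simp: Dset_def\<close>)
  hence "Mhat t V U s z = mob (\<lambda>U'. 0) U" unfolding Mhat_def by (intro mob_cong) auto
  thus ?thesis by (simp add: mob_def)
qed

text \<open>Words with union \<open>U\<close> sum to at most
  \<open>exp (- \<kappa> * card U) * exp (t * (b + card U))\<close> with
  \<open>b = s - g * card S\<close>. The prefactor \<open>exp (- t * s)\<close> of the shift removes
  the arbitrary \<open>s\<close> and leaves the two small factors.\<close>

lemma Mhat_bound:
  assumes V: "finite V" and U: "U \<subseteq> V" and st: "x \<in> conf0 m V" "z \<in> conf0 m V" and t: "0 \<le> t"
  shows "cmod (Mhat t V U x z) \<le> exp ((t - \<kappa>) * real (card U)) * exp (- g * t * real (card (supp0 x - U)))"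
proof (cases "supp0 x - U = supp0 z - U")
  case False
  thus ?thesis using Mhat_zero[OF V st] by simp
next
  case True
  define S where "S = supp0 x - U"
  let ?D = "conf0 m V" and ?D1 = "Dset V U S"
  have fD: "finite ?D" by (rule finite_conf0[OF V])
  have fD1: "finite ?D1" by (rule finite_Dset[OF V])
  have sub: "?D1 \<subseteq> ?D" by (auto simp: Dset_def)
  have st1: "x \<in> ?D1" "z \<in> ?D1" using st True by (auto simp: Dset_def S_def)
  have fU: "finite U" using U V finite_subset by blast
  obtain s where s: "g * real (card S) \<le> s" "ob ?D1 (s - g * real (card S)) (\<lambda>x z. complex_of_real s * op_id x z - H0 V x z)"
    using H0_contraction[OF V] by blast
  define B where "B = (\<lambda>x z. complex_of_real s * op_id x z - H0 V x z)"
  define b where "b = s - g * real (card S)"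
  have b: "0 \<le> b" "ob ?D1 b B" using s by (auto simp: b_def B_def)
  have gb: "geom_bounded (\<lambda>k. Ecoef ?D1 B k W x z)" if "W \<subseteq> U" for W
  proof -
    have fW: "finite W" using that fU finite_subset by blast
    have "cmod (Ecoef ?D1 B k W x z) \<le> 1 * (b + real (card W)) ^ k" for k
    proof -
      have "cmod (Ecoef ?D1 B k W x z) \<le> Ebd b k W"
        by (rule ob_entry[OF fD1 Ecoef_ob[OF V sub b(2)]]) (use that U st1 in auto)
      also have "\<dots> \<le> exp (\<kappa> * real (card W)) * Ebd b k W"
        using Ebd_nonneg[OF b(1) fW, of k] \<kappa> by (simp add: mult_le_cancel_right1)
      also have "\<dots> \<le> (b + real (card W)) ^ k" by (rule Ebd_le[OF b(1) fW])
      finally show ?thesis by simp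
    qed
    thus ?thesis unfolding geom_bounded_def by blast
  qed
  have ex: "op_exp ?D (-t) (Ham V U') x z = (\<Sum>W\<in>Pow U'. exp (complex_of_real (- t * s)) * egf t (\<lambda>k. Ecoef ?D1 B k W x z))"
    if U': "U' \<subseteq> U" for U'
  proof -
    have fU': "finite U'" using U' fU finite_subset by blast
    have "op_exp ?D (-t) (Ham V U') x z = op_exp ?D1 (-t) (Ham V U') x z"
    proof (rule op_exp_invariant[OF fD sub _ st1(1)])
      fix r r' assume "r \<in> ?D1" "r' \<in> ?D - ?D1"
      thus "Ham V U' r r' = 0" using U' by (intro Ham_supp[OF V, of _ V _ V]) (auto simp: Dset_def)
    qed
    also have "\<dots> = exp (complex_of_real (- t * s)) * op_exp ?D1 t (\<lambda>x z. complex_of_real s * op_id x z - Ham V U' x z) x z"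
      by (rule op_exp_shift[OF fD1 st1])
    also have "op_exp ?D1 t (\<lambda>x z. complex_of_real s * op_id x z - Ham V U' x z) x z = egf t (\<lambda>k. \<Sum>W\<in>Pow U'. Ecoef ?D1 B k W x z)"
    proof -
      have "op_pow ?D1 (\<lambda>x z. complex_of_real s * op_id x z - Ham V U' x z) k x z = (\<Sum>W\<in>Pow U'. Ecoef ?D1 B k W x z)" for k
        unfolding Ecoef_sum[OF fD1 fU' st1, symmetric] B_def Ham_def by (simp add: diff_diff_eq)
      thus ?thesis unfolding op_exp_egf by simp
    qed
    also have "\<dots> = (\<Sum>W\<in>Pow U'. egf t (\<lambda>k. Ecoef ?D1 B k W x z))" by (rule egf_sum) (use gb U' in auto)
    finally show ?thesis by (simp add: sum_distrib_left)
  qed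
  \<comment> \<open>For every \<open>U' \<subseteq> U\<close> the exponential is the sum over
    \<open>W \<subseteq> U'\<close> of the words with union \<open>W\<close>, and these do not
    depend on \<open>U'\<close>. Uniqueness of the transform picks out the words with union
    \<open>U\<close>.\<close>
  have "Mhat t V U x z = exp (complex_of_real (- t * s)) * egf t (\<lambda>k. Ecoef ?D1 B k U x z)"
    unfolding Mhat_def by (rule mob_unique[OF fU]) (rule ex)
  hence "cmod (Mhat t V U x z) = exp (- t * s) * cmod (egf t (\<lambda>k. Ecoef ?D1 B k U x z))"
    by (simp add: norm_mult)
  also have "\<dots> \<le> exp (- t * s) * (exp (- \<kappa> * real (card U)) * exp (t * (b + real (card U))))"
  proof (intro mult_left_mono egf_norm_le)
    fix k
    have "cmod (Ecoef ?D1 B k U x z) \<le> Ebd b k U"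
      by (rule ob_entry[OF fD1 Ecoef_ob[OF V sub b(2) U] st1])
    moreover have "exp (\<kappa> * real (card U)) * Ebd b k U \<le> (b + real (card U)) ^ k" by (rule Ebd_le[OF b(1) fU])
    hence "Ebd b k U \<le> exp (- \<kappa> * real (card U)) * (b + real (card U)) ^ k"
      by (simp add: exp_minus field_simps)
    ultimately show "cmod (Ecoef ?D1 B k U x z) \<le> exp (- \<kappa> * real (card U)) * (b + real (card U)) ^ k" by linarith
  qed (use t b in auto)
  also have "\<dots> = exp ((t - \<kappa>) * real (card U)) * exp (- g * t * real (card S))"
    unfolding exp_add[symmetric] b_def by (simp add: algebra_simps)
  finally show ?thesis unfolding S_def .
qed

end

context gapped_system
begin

subsection \<open>Factorization and locality\<close>

text \<open>No excitation is created off \<open>U\<close>, so configurations that are vacuum off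
  \<open>C\<close> span an invariant subspace and the evolution can be computed in
  \<open>C\<close>.\<close>

lemma Ham_conf0:
  assumes V: "finite V" and U: "U \<subseteq> C" and s: "x \<in> conf0 m C" "C \<subseteq> V" and t: "z \<in> conf0 m V - conf0 m C"
  shows "Ham V U x z = 0"
proof (rule Ham_supp[OF V s(1)])
  show "z \<in> conf0 m V" using t by simp
  have "\<not> supp0 z \<subseteq> C" using t conf0_supp0[of z m V C] s by auto
  thus "supp0 x - U \<noteq> supp0 z - U" using supp0_subset[OF s(1)] U by auto
qed

lemma exp_Ham_conf0:
  assumes V: "finite V" and U: "U \<subseteq> C" and s: "x \<in> conf0 m C" "C \<subseteq> V"
  shows "op_exp (conf0 m V) t (Ham V U) x z = op_exp (conf0 m C) t (Ham V U) x z"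
  by (rule op_exp_invariant[OF finite_conf0[OF V] conf0_mono[OF s(2) m] _ s(1)]) (rule Ham_conf0[OF V U _ s(2)])

lemma restr0_add0:
  "A \<inter> C2 = {} \<Longrightarrow> s2 \<in> conf0 m C2 \<Longrightarrow> restr0 (add0 s1 s2) A = restr0 s1 A"
  by (auto simp: restr0_def add0_def conf0_def fun_eq_iff)

lemma agree_off_add0:
  assumes "A \<inter> C2 = {}" "C1 \<inter> C2 = {}" "s1 \<in> conf0 m C1" "t1 \<in> conf0 m C1" "s2 \<in> conf0 m C2" "t2 \<in> conf0 m C2"
  shows "(\<forall>i. i \<notin> A \<longrightarrow> add0 s1 s2 i = add0 t1 t2 i) \<longleftrightarrow> (\<forall>i. i \<notin> A \<longrightarrow> s1 i = t1 i) \<and> s2 = t2"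
proof
  assume *: "\<forall>i. i \<notin> A \<longrightarrow> add0 s1 s2 i = add0 t1 t2 i"
  have "s1 i = t1 i" if "i \<notin> A" for i
    using *[rule_format, OF that] assms by (cases "i \<in> C1"; cases "i \<in> C2") (auto simp: conf0_def add0_def)
  moreover have "s2 i = t2 i" for i
  proof (cases "i \<in> C2")
    case True
    hence "i \<notin> A" "i \<notin> C1" using assms by auto
    thus ?thesis using *[rule_format, of i] assms by (auto simp: conf0_def add0_def)
  qed (use assms in \<open>auto simp: conf0_def\<close>)
  ultimately show "(\<forall>i. i \<notin> A \<longrightarrow> s1 i = t1 i) \<and> s2 = t2" by auto
qed (auto simp: add0_def)

lemma ext0_add0_left:
  assumes "A \<inter> C2 = {}" "C1 \<inter> C2 = {}" "s1 \<in> conf0 m C1" "t1 \<in> conf0 m C1" "s2 \<in> conf0 m C2" "t2 \<in> conf0 m C2"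
  shows "ext0 A M (add0 s1 s2) (add0 t1 t2) = (if s2 = t2 then ext0 A M s1 t1 else 0)"
  unfolding ext0_def agree_off_add0[OF assms] restr0_add0[OF assms(1,5)] restr0_add0[OF assms(1,6)] by auto

lemma add0_commute: "add0 s t = add0 t s"
  by (auto simp: add0_def)

text \<open>Both configurations are vacuum on \<open>A\<close>, where the diagonal entry of
  \<open>h A\<close> is 0. So the surroundings of a region contribute nothing, and separating
  regions creates no boundary energy.\<close>

lemma ext0_vac:
  assumes "finite A" "A \<inter> C = {}" "s \<in> conf0 m C" "t \<in> conf0 m C"
  shows "ext0 A (h A) s t = 0"
proof -
  have "restr0 s A = (\<lambda>_. 0)" "restr0 t A = (\<lambda>_. 0)"
    using assms by (auto simp: restr0_def conf0_def fun_eq_iff)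
  thus ?thesis using h_vac[OF assms(1)] by (simp add: ext0_def)
qed

lemma ext0_zero_on:
  assumes "op_zero_on (conf0 m A) M" "s \<in> conf0 m V" "t \<in> conf0 m V'"
  shows "ext0 A M s t = 0"
  using assms(1) restr0_conf0[OF assms(2) m, of A] restr0_conf0[OF assms(3) m, of A] by (simp add: ext0_def op_zero_on_def)

text \<open>Each term meets at most one of the two regions or vanishes. A set \<open>A\<close> that
  sticks out of \<open>C1 \<union> C2\<close> finds the vacuum there, so it acts on the region that
  it meets as if this region were alone.\<close>

lemma Ham_add0:
  assumes V: "finite V" "C1 \<subseteq> V" "C2 \<subseteq> V" and disj: "C1 \<inter> C2 = {}" and U: "U1 \<subseteq> C1" "U2 \<subseteq> C2"
    and hz: "\<And>A. A \<subseteq> V \<Longrightarrow> A \<inter> C1 \<noteq> {} \<Longrightarrow> A \<inter> C2 \<noteq> {} \<Longrightarrow> op_zero_on (conf0 m A) (h A)"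
    and yz: "\<And>X. X \<subseteq> U1 \<union> U2 \<Longrightarrow> X \<inter> C1 \<noteq> {} \<Longrightarrow> X \<inter> C2 \<noteq> {} \<Longrightarrow> op_zero_on (conf0 m X) (y X)"
    and s: "x1 \<in> conf0 m C1" "t1 \<in> conf0 m C1" "x2 \<in> conf0 m C2" "t2 \<in> conf0 m C2"
  shows "Ham V (U1 \<union> U2) (add0 x1 x2) (add0 t1 t2) =
    (if x2 = t2 then Ham V U1 x1 t1 else 0) + (if x1 = t1 then Ham V U2 x2 t2 else 0)"
proof -
  have disj': "C2 \<inter> C1 = {}" using disj by auto
  have add: "add0 x1 x2 \<in> conf0 m (C1 \<union> C2)" "add0 t1 t2 \<in> conf0 m (C1 \<union> C2)"
    using bij_add0[OF disj, of m] s by (auto simp: bij_betw_def)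
  have h: "ext0 A (h A) (add0 x1 x2) (add0 t1 t2) =
    (if x2 = t2 then ext0 A (h A) x1 t1 else 0) + (if x1 = t1 then ext0 A (h A) x2 t2 else 0)" if A: "A \<in> Pow V" for A
  proof -
    have fA: "finite A" using A V by (auto intro: finite_subset)
    consider "A \<inter> C2 = {}" | "A \<inter> C1 = {}" | "op_zero_on (conf0 m A) (h A)" using hz[of A] A by auto
    thus ?thesis
    proof cases
      case 1
      thus ?thesis using ext0_add0_left[OF 1 disj s(1,2,3,4)] ext0_vac[OF fA 1 s(3,4)] by simp
    next
      case 2
      thus ?thesis using ext0_add0_left[OF 2 disj' s(3,4,1,2)] ext0_vac[OF fA 2 s(1,2)]
        by (simp add: add0_commute[of x1] add0_commute[of t1])
    next
      case 3
      thus ?thesis using ext0_zero_on[OF 3] add s by simp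
    qed
  qed
  have fU: "finite U1" "finite U2" using U V(2,3) by (auto intro!: finite_subset[OF _ V(1)])
  have y: "(\<Sum>X\<in>Pow (U1 \<union> U2). ext0 X (y X) (add0 x1 x2) (add0 t1 t2)) =
     (if x2 = t2 then \<Sum>X\<in>Pow U1. ext0 X (y X) x1 t1 else 0) + (if x1 = t1 then \<Sum>X\<in>Pow U2. ext0 X (y X) x2 t2 else 0)"
  proof -
    let ?Y = "\<lambda>X. ext0 X (y X) (add0 x1 x2) (add0 t1 t2)"
    have "(\<Sum>X\<in>Pow (U1 \<union> U2). ?Y X) = (\<Sum>X\<in>Pow U1 \<union> Pow U2. ?Y X)"
    proof (rule sum.mono_neutral_right)
      show "\<forall>X\<in>Pow (U1 \<union> U2) - (Pow U1 \<union> Pow U2). ?Y X = 0"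
      proof
        fix X assume X: "X \<in> Pow (U1 \<union> U2) - (Pow U1 \<union> Pow U2)"
        hence "op_zero_on (conf0 m X) (y X)" using U by (intro yz) auto
        thus "?Y X = 0" by (rule ext0_zero_on) (rule add)+
      qed
    qed (use fU in auto)
    also have "\<dots> = (\<Sum>X\<in>Pow U1. ?Y X) + (\<Sum>X\<in>Pow U2. ?Y X) - (\<Sum>X\<in>Pow U1 \<inter> Pow U2. ?Y X)"
      by (rule sum_Un) (use fU in auto)
    also have "(\<Sum>X\<in>Pow U1 \<inter> Pow U2. ?Y X) = 0"
    proof (rule sum.neutral, rule ballI)
      fix X assume "X \<in> Pow U1 \<inter> Pow U2"
      hence "X = {}" using U disj by blast
      thus "?Y X = 0" using ext0_zero_on[OF y_empty add] by simp
    qed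
    also have "(\<Sum>X\<in>Pow U1. ?Y X) = (if x2 = t2 then \<Sum>X\<in>Pow U1. ext0 X (y X) x1 t1 else 0)"
    proof -
      have "?Y X = (if x2 = t2 then ext0 X (y X) x1 t1 else 0)" if "X \<in> Pow U1" for X
        by (rule ext0_add0_left[OF _ disj s(1,2,3,4)]) (use that U disj in auto)
      thus ?thesis by simp
    qed
    also have "(\<Sum>X\<in>Pow U2. ?Y X) = (if x1 = t1 then \<Sum>X\<in>Pow U2. ext0 X (y X) x2 t2 else 0)"
    proof -
      have "?Y X = (if x1 = t1 then ext0 X (y X) x2 t2 else 0)" if "X \<in> Pow U2" for X
        unfolding add0_commute[of x1] add0_commute[of t1]
        by (rule ext0_add0_left[OF _ disj' s(3,4,1,2)]) (use that U disj in auto)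
      thus ?thesis by simp
    qed
    finally show ?thesis by simp
  qed
  have "H0 V (add0 x1 x2) (add0 t1 t2) = (if x2 = t2 then H0 V x1 t1 else 0) + (if x1 = t1 then H0 V x2 t2 else 0)"
  proof -
    have "H0 V (add0 x1 x2) (add0 t1 t2) = (\<Sum>A\<in>Pow V. (if x2 = t2 then ext0 A (h A) x1 t1 else 0) + (if x1 = t1 then ext0 A (h A) x2 t2 else 0))"
      unfolding H0_def by (intro sum.cong refl h)
    thus ?thesis by (simp add: sum.distrib H0_def)
  qed
  thus ?thesis unfolding Ham_def y by auto
qed

lemma exp_Ham_add0:
  assumes V: "finite V" "C1 \<subseteq> V" "C2 \<subseteq> V" and disj: "C1 \<inter> C2 = {}" and U: "U1 \<subseteq> C1" "U2 \<subseteq> C2"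
    and hz: "\<And>A. A \<subseteq> V \<Longrightarrow> A \<inter> C1 \<noteq> {} \<Longrightarrow> A \<inter> C2 \<noteq> {} \<Longrightarrow> op_zero_on (conf0 m A) (h A)"
    and yz: "\<And>X. X \<subseteq> U1 \<union> U2 \<Longrightarrow> X \<inter> C1 \<noteq> {} \<Longrightarrow> X \<inter> C2 \<noteq> {} \<Longrightarrow> op_zero_on (conf0 m X) (y X)"
    and s: "r1 \<in> conf0 m C1" "r2 \<in> conf0 m C2" "z1 \<in> conf0 m C1" "z2 \<in> conf0 m C2"
  shows "op_exp (conf0 m V) t (Ham V (U1 \<union> U2)) (add0 r1 r2) (add0 z1 z2) =
    op_exp (conf0 m V) t (Ham V U1) r1 z1 * op_exp (conf0 m V) t (Ham V U2) r2 z2"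
proof -
  have add: "add0 r1 r2 \<in> conf0 m (C1 \<union> C2)" using bij_add0[OF disj, of m] s by (auto simp: bij_betw_def)
  have "op_exp (conf0 m V) t (Ham V (U1 \<union> U2)) (add0 r1 r2) (add0 z1 z2) =
     op_exp (conf0 m (C1 \<union> C2)) t (Ham V (U1 \<union> U2)) (add0 r1 r2) (add0 z1 z2)"
    by (rule exp_Ham_conf0[OF V(1) _ add]) (use U V in auto)
  also have "\<dots> = op_exp (conf0 m C1) t (Ham V U1) r1 z1 * op_exp (conf0 m C2) t (Ham V U2) r2 z2"
  proof (rule op_exp_tensor_sum[where J=add0, OF _ _ bij_add0[OF disj]])
    fix x y x' y' assume "x \<in> conf0 m C1" "x' \<in> conf0 m C1" "y \<in> conf0 m C2" "y' \<in> conf0 m C2"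
    thus "Ham V (U1 \<union> U2) (add0 x y) (add0 x' y') = (if y = y' then Ham V U1 x x' else 0) + (if x = x' then Ham V U2 y y' else 0)"
      by (intro Ham_add0[OF V disj U hz yz])
  qed (use s V in \<open>auto intro!: finite_conf0 intro: finite_subset\<close>)
  also have "op_exp (conf0 m C1) t (Ham V U1) r1 z1 = op_exp (conf0 m V) t (Ham V U1) r1 z1"
    by (rule exp_Ham_conf0[OF V(1) U(1) s(1) V(2), symmetric])
  also have "op_exp (conf0 m C2) t (Ham V U2) r2 z2 = op_exp (conf0 m V) t (Ham V U2) r2 z2"
    by (rule exp_Ham_conf0[OF V(1) U(2) s(2) V(3), symmetric])
  finally show ?thesis .
qed

lemma sum_Pow_Un:
  fixes f :: "'a set \<Rightarrow> 'a set \<Rightarrow> 'c::comm_monoid_add"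
  assumes "U1 \<inter> U2 = {}"
  shows "(\<Sum>U\<in>Pow (U1 \<union> U2). f (U \<inter> U1) (U \<inter> U2)) = (\<Sum>T1\<in>Pow U1. \<Sum>T2\<in>Pow U2. f T1 T2)"
proof -
  have "(\<Sum>T1\<in>Pow U1. \<Sum>T2\<in>Pow U2. f T1 T2) = (\<Sum>p\<in>Pow U1 \<times> Pow U2. f (fst p) (snd p))"
    by (simp add: sum.cartesian_product case_prod_beta)
  also have "\<dots> = (\<Sum>U\<in>Pow (U1 \<union> U2). f (U \<inter> U1) (U \<inter> U2))"
    by (rule sum.reindex_bij_witness[of _ "\<lambda>U. (U \<inter> U1, U \<inter> U2)" "\<lambda>p. fst p \<union> snd p"])
       (use assms in \<open>auto intro!: arg_cong2[where f=f]\<close>)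
  finally show ?thesis by simp
qed

text \<open>Signs and exponentials factorize over \<open>T \<inter> U1\<close> and
  \<open>T \<inter> U2\<close>, so the alternating sum over subsets of \<open>U1 \<union> U2\<close>
  is a product. Separation in \<open>nbr\<close> rules out interaction terms that meet both
  parts.\<close>

lemma Mhat_add0:
  assumes V: "finite V" "C1 \<subseteq> V" "C2 \<subseteq> V" and disj: "C1 \<inter> C2 = {}" and U: "U1 \<subseteq> C1" "U2 \<subseteq> C2"
    and sep: "nbr `` C1 \<inter> C2 = {}"
    and s: "x1 \<in> conf0 m C1" "x2 \<in> conf0 m C2" "z1 \<in> conf0 m C1" "z2 \<in> conf0 m C2"
  shows "Mhat t V (U1 \<union> U2) (add0 x1 x2) (add0 z1 z2) = Mhat t V U1 x1 z1 * Mhat t V U2 x2 z2"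
proof -
  let ?e = "\<lambda>U x z. op_exp (conf0 m V) (-t) (Ham V U) x z"
  have fU: "finite U1" "finite U2" using U V(2,3) by (auto intro!: finite_subset[OF _ V(1)])
  have dU: "U1 \<inter> U2 = {}" using U disj by auto
  have "Mhat t V (U1 \<union> U2) (add0 x1 x2) (add0 z1 z2) = (\<Sum>T\<in>Pow (U1 \<union> U2).
     ((-1) ^ card (U1 - T \<inter> U1) * ?e (T \<inter> U1) x1 z1) * ((-1) ^ card (U2 - T \<inter> U2) * ?e (T \<inter> U2) x2 z2))"
    unfolding Mhat_def mob_def
  proof (rule sum.cong[OF refl])
    fix T assume T: "T \<in> Pow (U1 \<union> U2)"
    hence TT: "(T \<inter> U1) \<union> (T \<inter> U2) = T" by auto
    have "U1 \<union> U2 - T = (U1 - T \<inter> U1) \<union> (U2 - T \<inter> U2)" using dU by auto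
    moreover have "card ((U1 - T \<inter> U1) \<union> (U2 - T \<inter> U2)) = card (U1 - T \<inter> U1) + card (U2 - T \<inter> U2)"
      by (rule card_Un_disjoint) (use fU dU in auto)
    ultimately have c: "(-1::complex) ^ card (U1 \<union> U2 - T) = (-1) ^ card (U1 - T \<inter> U1) * (-1) ^ card (U2 - T \<inter> U2)"
      by (simp add: power_add)
    have "?e ((T \<inter> U1) \<union> (T \<inter> U2)) (add0 x1 x2) (add0 z1 z2) = ?e (T \<inter> U1) x1 z1 * ?e (T \<inter> U2) x2 z2"
    proof (rule exp_Ham_add0[OF V disj _ _ _ _ s])
      fix A assume A: "A \<subseteq> V" "A \<inter> C1 \<noteq> {}" "A \<inter> C2 \<noteq> {}"
      hence "\<not> A \<times> A \<subseteq> nbr" using sep by blast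
      thus "op_zero_on (conf0 m A) (h A)" using A V by (intro h_local) (auto intro: finite_subset)
    next
      fix X assume X: "X \<subseteq> (T \<inter> U1) \<union> (T \<inter> U2)" "X \<inter> C1 \<noteq> {}" "X \<inter> C2 \<noteq> {}"
      have "finite X" "X \<subseteq> C1 \<union> C2" using X fU U by (auto intro: finite_subset)
      thus "op_zero_on (conf0 m X) (y X)" by (rule y_local) (use X sep in auto)
    qed (use U in auto)
    thus "(-1) ^ card (U1 \<union> U2 - T) * ?e T (add0 x1 x2) (add0 z1 z2) =
      ((-1) ^ card (U1 - T \<inter> U1) * ?e (T \<inter> U1) x1 z1) * ((-1) ^ card (U2 - T \<inter> U2) * ?e (T \<inter> U2) x2 z2)"
      unfolding c TT by (simp add: mult_ac)
  qed
  also have "\<dots> = (\<Sum>T1\<in>Pow U1. \<Sum>T2\<in>Pow U2. ((-1) ^ card (U1 - T1) * ?e T1 x1 z1) * ((-1) ^ card (U2 - T2) * ?e T2 x2 z2))"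
    by (rule sum_Pow_Un[OF dU])
  also have "\<dots> = Mhat t V U1 x1 z1 * Mhat t V U2 x2 z2"
    unfolding Mhat_def mob_def sum_product ..
  finally show ?thesis .
qed

text \<open>A site belongs to \<open>C\<close> if it is excited or touched by the perturbation.\<close>

definition Wt :: "real \<Rightarrow> 'a set \<Rightarrow> 'a set \<Rightarrow> 'a op" where
  "Wt t V C s z = (if s \<in> conf0 m C \<and> z \<in> conf0 m C then
     \<Sum>U\<in>{U\<in>Pow C. U \<union> supp0 s = C}. Mhat t V U s z else 0)"

lemma Wt_alt:
  assumes "finite C" "s \<in> conf0 m C" "z \<in> conf0 m C"
  shows "Wt t V C s z = (\<Sum>U\<in>Pow C. if U \<union> supp0 s = C then Mhat t V U s z else 0)"
proof -
  have "finite (Pow C)" using assms by simp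
  from sum.inter_filter[OF this, of "\<lambda>U. Mhat t V U s z" "\<lambda>U. U \<union> supp0 s = C"]
  show ?thesis using assms by (simp only: Wt_def simp_thms if_True)
qed

text \<open>Group the Moebius terms by \<open>C = U \<union> supp0 s\<close>. The condition on
  \<open>z\<close> in \<open>Wt\<close> discards nothing, since \<open>Mhat\<close> vanishes when
  \<open>z\<close> has an excitation outside \<open>C\<close>.\<close>

lemma Wt_sum:
  assumes V: "finite V" and st: "s \<in> conf0 m V" "z \<in> conf0 m V"
  shows "op_exp (conf0 m V) (-t) (Ham V V) s z = (\<Sum>C\<in>Pow V. Wt t V C s z)"
proof -
  have "op_exp (conf0 m V) (-t) (Ham V V) s z = (\<Sum>U\<in>Pow V. Mhat t V U s z)"
    unfolding Mhat_def by (rule sum_mob[OF V, symmetric])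
  also have "\<dots> = (\<Sum>C\<in>Pow V. \<Sum>U\<in>{U\<in>Pow V. U \<union> supp0 s = C}. Mhat t V U s z)"
    by (rule sum.group[symmetric]) (use V supp0_subset[OF st(1)] in auto)
  also have "\<dots> = (\<Sum>C\<in>Pow V. Wt t V C s z)"
  proof (rule sum.cong[OF refl])
    fix C assume C: "C \<in> Pow V"
    have eq: "{U\<in>Pow V. U \<union> supp0 s = C} = {U\<in>Pow C. U \<union> supp0 s = C}" using C by auto
    show "(\<Sum>U\<in>{U\<in>Pow V. U \<union> supp0 s = C}. Mhat t V U s z) = Wt t V C s z"
    proof (cases "s \<in> conf0 m C \<and> z \<in> conf0 m C")
      case True
      thus ?thesis unfolding Wt_def eq by simp
    next
      case False
      have "Mhat t V U s z = 0" if U: "U \<union> supp0 s = C" for U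
      proof (rule Mhat_zero[OF V st])
        have "s \<in> conf0 m C" using conf0_supp0[OF st(1), of C] U C by auto
        hence "\<not> supp0 z \<subseteq> C" using conf0_supp0[OF st(2), of C] C False by auto
        thus "supp0 s - U \<noteq> supp0 z - U" using U by auto
      qed
      thus ?thesis using False by (auto simp: Wt_def intro!: sum.neutral)
    qed
  qed
  finally show ?thesis .
qed

lemma Wt_add0:
  assumes V: "finite V" "C1 \<subseteq> V" "C2 \<subseteq> V" and disj: "C1 \<inter> C2 = {}" and sep: "nbr `` C1 \<inter> C2 = {}"
    and s: "x1 \<in> conf0 m C1" "x2 \<in> conf0 m C2" "z1 \<in> conf0 m C1" "z2 \<in> conf0 m C2"
  shows "Wt t V (C1 \<union> C2) (add0 x1 x2) (add0 z1 z2) = Wt t V C1 x1 z1 * Wt t V C2 x2 z2"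
proof -
  have add: "add0 x1 x2 \<in> conf0 m (C1 \<union> C2)" "add0 z1 z2 \<in> conf0 m (C1 \<union> C2)"
    using bij_add0[OF disj, of m] s by (auto simp: bij_betw_def)
  have supp: "supp0 (add0 x1 x2) = supp0 x1 \<union> supp0 x2" by (auto simp: supp0_def add0_def)
  have ss: "supp0 x1 \<subseteq> C1" "supp0 x2 \<subseteq> C2" using supp0_subset s by auto
  have fC: "finite C1" "finite C2" using V by (auto intro: finite_subset)
  have "Wt t V (C1 \<union> C2) (add0 x1 x2) (add0 z1 z2) =
     (\<Sum>U\<in>Pow (C1 \<union> C2). if U \<union> (supp0 x1 \<union> supp0 x2) = C1 \<union> C2 then Mhat t V U (add0 x1 x2) (add0 z1 z2) else 0)"
    unfolding supp[symmetric] by (rule Wt_alt[OF _ add]) (use fC in auto)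
  also have "\<dots> = (\<Sum>U\<in>Pow (C1 \<union> C2). (if U \<inter> C1 \<union> supp0 x1 = C1 then Mhat t V (U \<inter> C1) x1 z1 else 0) *
      (if U \<inter> C2 \<union> supp0 x2 = C2 then Mhat t V (U \<inter> C2) x2 z2 else 0))"
  proof (rule sum.cong[OF refl])
    fix U assume U: "U \<in> Pow (C1 \<union> C2)"
    have iff: "U \<union> (supp0 x1 \<union> supp0 x2) = C1 \<union> C2 \<longleftrightarrow> U \<inter> C1 \<union> supp0 x1 = C1 \<and> U \<inter> C2 \<union> supp0 x2 = C2"
      using U ss disj by blast
    have UU: "(U \<inter> C1) \<union> (U \<inter> C2) = U" using U by auto
    have "Mhat t V ((U \<inter> C1) \<union> (U \<inter> C2)) (add0 x1 x2) (add0 z1 z2) = Mhat t V (U \<inter> C1) x1 z1 * Mhat t V (U \<inter> C2) x2 z2"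
      by (rule Mhat_add0[OF V disj _ _ sep s]) auto
    thus "(if U \<union> (supp0 x1 \<union> supp0 x2) = C1 \<union> C2 then Mhat t V U (add0 x1 x2) (add0 z1 z2) else 0) =
      (if U \<inter> C1 \<union> supp0 x1 = C1 then Mhat t V (U \<inter> C1) x1 z1 else 0) *
      (if U \<inter> C2 \<union> supp0 x2 = C2 then Mhat t V (U \<inter> C2) x2 z2 else 0)"
      unfolding iff UU by auto
  qed
  also have "\<dots> = (\<Sum>T1\<in>Pow C1. \<Sum>T2\<in>Pow C2. (if T1 \<union> supp0 x1 = C1 then Mhat t V T1 x1 z1 else 0) *
      (if T2 \<union> supp0 x2 = C2 then Mhat t V T2 x2 z2 else 0))"
    by (rule sum_Pow_Un[OF disj])
  also have "\<dots> = Wt t V C1 x1 z1 * Wt t V C2 x2 z2"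
    unfolding sum_product[symmetric] Wt_alt[OF fC(1) s(1,3)] Wt_alt[OF fC(2) s(2,4)] ..
  finally show ?thesis .
qed

text \<open>The vacuum has energy 0, so a slab without excitation or perturbation weighs 1. This
  normalizes the polymer gas.\<close>

lemma Wt_empty:
  assumes "finite V"
  shows "Wt t V {} (\<lambda>_. 0) (\<lambda>_. 0) = 1"
proof -
  have z: "supp0 (\<lambda>_. 0) = ({}::'a set)" by (simp add: supp0_def)
  have c: "conf0 m ({}::'a set) = {\<lambda>_. 0}" by (auto simp: conf0_def)
  have "{U. U = {} \<and> U \<union> ({}::'a set) = {}} = {{}}" by auto
  hence "Wt t V {} (\<lambda>_. 0) (\<lambda>_. 0) = Mhat t V {} (\<lambda>_. 0) (\<lambda>_. 0)" by (simp add: Wt_def z)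
  also have "\<dots> = op_exp (conf0 m V) (-t) (Ham V {}) (\<lambda>_. 0) (\<lambda>_. 0)" by (simp add: Mhat_def mob_def)
  also have "\<dots> = op_exp (conf0 m {}) (-t) (Ham V {}) (\<lambda>_. 0) (\<lambda>_. 0)" by (rule exp_Ham_conf0) (use assms in auto)
  also have "\<dots> = egf (-t) (\<lambda>n. complex_of_real 0 ^ n)"
  proof -
    have "Ham V {} (\<lambda>_. 0) (\<lambda>_. 0) = 0"
    proof -
      have "ext0 A (h A) (\<lambda>_. 0) (\<lambda>_. 0) = 0" if "A \<in> Pow V" for A
        by (rule ext0_vac[where C="{}"]) (use that assms in \<open>auto intro: finite_subset\<close>)
      moreover have "ext0 {} (y {}) (\<lambda>_. 0) (\<lambda>_. 0) = 0" by (rule ext0_zero_on[OF y_empty zero_conf0 zero_conf0])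
      ultimately show ?thesis by (simp add: Ham_def H0_def)
    qed
    hence "op_pow (conf0 m {}) (Ham V {}) n (\<lambda>_. 0) (\<lambda>_. 0) = 0 ^ n" for n
      unfolding c by (cases n) (auto simp: op_id_def op_mult_def)
    thus ?thesis unfolding op_exp_egf by simp
  qed
  also have "\<dots> = 1" unfolding egf_power_seq by simp
  finally show ?thesis .
qed

text \<open>A nonzero term \<open>h A\<close> that meets \<open>C\<close> lies in the neighbourhood
  of \<open>C\<close>, and the terms that miss \<open>C\<close> see the vacuum. The volume therefore
  enters through its part near \<open>C\<close> only, as \<open>nb_local\<close> requires.\<close>

lemma Wt_local:
  assumes V: "finite V" "finite V'" and C: "C \<subseteq> V" "C \<subseteq> V'" and eq: "V \<inter> nbr `` C = V' \<inter> nbr `` C"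
  shows "Wt t V C s z = Wt t V' C s z"
proof -
  have H0: "H0 V s z = H0 (V \<inter> nbr `` C) s z" if V: "finite V" and st: "s \<in> conf0 m C" "z \<in> conf0 m C" for V s z
    unfolding H0_def
  proof (rule sum.mono_neutral_right)
    show "\<forall>A\<in>Pow V - Pow (V \<inter> nbr `` C). ext0 A (h A) s z = 0"
    proof
      fix A assume A: "A \<in> Pow V - Pow (V \<inter> nbr `` C)"
      have fA: "finite A" using A V by (auto intro: finite_subset)
      show "ext0 A (h A) s z = 0"
      proof (cases "A \<inter> C = {}")
        case True
        thus ?thesis using ext0_vac[OF fA True st] by simp
      next
        case False
        hence "\<not> A \<times> A \<subseteq> nbr" using A by auto
        from ext0_zero_on[OF h_local[OF fA this] st] show ?thesis .
      qed
    qed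
  qed (use V in auto)
  have "Mhat t V U s z = Mhat t V' U s z" if U: "U \<subseteq> C" and st: "s \<in> conf0 m C" "z \<in> conf0 m C" for U
    unfolding Mhat_def
  proof (rule mob_cong)
    fix T assume T: "T \<subseteq> U"
    have "op_exp (conf0 m V) (-t) (Ham V T) s z = op_exp (conf0 m C) (-t) (Ham V T) s z"
      by (rule exp_Ham_conf0[OF V(1) _ st(1) C(1)]) (use T U in auto)
    also have "\<dots> = op_exp (conf0 m C) (-t) (Ham V' T) s z"
      by (rule op_exp_cong[OF _ st]) (simp add: Ham_def H0[OF V(1)] H0[OF V(2)] eq)
    also have "\<dots> = op_exp (conf0 m V') (-t) (Ham V' T) s z"
      by (rule exp_Ham_conf0[OF V(2) _ st(1) C(2), symmetric]) (use T U in auto)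
    finally show "op_exp (conf0 m V) (-t) (Ham V T) s z = op_exp (conf0 m V') (-t) (Ham V' T) s z" .
  qed
  thus ?thesis unfolding Wt_def by (auto intro!: sum.cong)
qed

text \<open>A site of \<open>C\<close> is touched by the perturbation, at the price
  \<open>exp (t - \<kappa>)\<close>, or it is untouched and excited, at the price
  \<open>exp (- g * t)\<close>. Summing over the touched set \<open>U\<close> is a binomial
  expansion.\<close>

lemma Wt_bound:
  assumes V: "finite V" and C: "C \<subseteq> V" and t: "0 \<le> t"
  shows "cmod (Wt t V C s z) \<le> (exp (t - \<kappa>) + exp (- g * t)) ^ card C"
proof (cases "s \<in> conf0 m C \<and> z \<in> conf0 m C")
  case False
  thus ?thesis by (auto simp: Wt_def)
next
  case True
  have fC: "finite C" using C V by (auto intro: finite_subset)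
  have st: "s \<in> conf0 m V" "z \<in> conf0 m V" using True conf0_mono[OF C m] by auto
  have ss: "supp0 s \<subseteq> C" using True supp0_subset by blast
  have "cmod (Wt t V C s z) \<le> (\<Sum>U\<in>{U\<in>Pow C. U \<union> supp0 s = C}. cmod (Mhat t V U s z))"
    unfolding Wt_def using True by (simp add: norm_sum)
  also have "\<dots> \<le> (\<Sum>U\<in>{U\<in>Pow C. U \<union> supp0 s = C}. (\<Prod>i\<in>U. exp (t - \<kappa>)) * (\<Prod>i\<in>C - U. exp (- g * t)))"
  proof (rule sum_mono)
    fix U assume U: "U \<in> {U\<in>Pow C. U \<union> supp0 s = C}"
    hence eq: "supp0 s - U = C - U" using ss by auto
    have "cmod (Mhat t V U s z) \<le> exp ((t - \<kappa>) * real (card U)) * exp (- g * t * real (card (supp0 s - U)))"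
      by (rule Mhat_bound[OF V _ st t]) (use U C in auto)
    also have "\<dots> = (\<Prod>i\<in>U. exp (t - \<kappa>)) * (\<Prod>i\<in>C - U. exp (- g * t))"
      unfolding eq by (simp only: prod_constant exp_of_nat2_mult)
    finally show "cmod (Mhat t V U s z) \<le> (\<Prod>i\<in>U. exp (t - \<kappa>)) * (\<Prod>i\<in>C - U. exp (- g * t))" .
  qed
  also have "\<dots> \<le> (\<Sum>U\<in>Pow C. (\<Prod>i\<in>U. exp (t - \<kappa>)) * (\<Prod>i\<in>C - U. exp (- g * t)))"
    by (rule sum_mono2) (use fC in \<open>auto intro!: mult_nonneg_nonneg prod_nonneg\<close>)
  also have "\<dots> = (\<Prod>i\<in>C. exp (t - \<kappa>) + exp (- g * t))" by (rule prod_add[OF fC, symmetric])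
  finally show ?thesis by simp
qed

end

section \<open>Space-time expansion of traces\<close>

text \<open>A power of \<open>T\<close> is a sum over paths with \<open>n\<close> steps. The two end
  points are kept apart because \<open>F\<close> couples them; later \<open>F\<close> is the
  observable.\<close>

lemma sum_paths:
  assumes D: "finite D"
  shows "(\<Sum>s\<in>D. \<Sum>t\<in>D. op_pow D T n s t * F s t) =
    (\<Sum>p\<in>PiE {..n} (\<lambda>_. D). (\<Prod>j<n. T (p j) (p (Suc j))) * F (p 0) (p n))"
proof (induction n arbitrary: F)
  case 0
  have 1: "(\<Sum>p\<in>PiE {..0::nat} (\<lambda>_. D). F (p 0) (p 0)) = (\<Sum>s\<in>D. F s s)"
  proof (rule sum.reindex_bij_witness[of _ "\<lambda>s. \<lambda>j\<in>{..0}. s" "\<lambda>p. p 0"])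
    fix p assume p: "p \<in> PiE {..0::nat} (\<lambda>_. D)"
    show "(\<lambda>j\<in>{..0}. p 0) = p"
    proof
      fix j show "(\<lambda>j\<in>{..0}. p 0) j = p j" using PiE_arb[OF p, of j] by (cases "j = 0") auto
    qed
  qed auto
  have "(\<Sum>s\<in>D. \<Sum>t\<in>D. op_pow D T 0 s t * F s t) = (\<Sum>s\<in>D. F s s)"
    using D by (intro sum.cong refl) (simp add: op_id_def if_distrib[of "\<lambda>x. x * _"] sum.delta cong: if_cong)
  thus ?case using 1 by simp
next
  case (Suc n)
  have "(\<Sum>s\<in>D. \<Sum>t\<in>D. op_pow D T (Suc n) s t * F s t) =
    (\<Sum>s\<in>D. \<Sum>t\<in>D. \<Sum>r\<in>D. op_pow D T n s r * T r t * F s t)"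
    by (intro sum.cong refl) (simp only: op_pow_Suc_right[OF D] op_mult_def sum_distrib_right)
  also have "\<dots> = (\<Sum>s\<in>D. \<Sum>r\<in>D. op_pow D T n s r * (\<Sum>t\<in>D. T r t * F s t))"
    unfolding sum_distrib_left mult.assoc by (rule sum.cong[OF refl]) (rule sum.swap)
  also have "\<dots> = (\<Sum>p\<in>PiE {..n} (\<lambda>_. D). (\<Prod>j<n. T (p j) (p (Suc j))) * (\<Sum>t\<in>D. T (p n) t * F (p 0) t))"
    by (rule Suc.IH)
  also have "\<dots> = (\<Sum>p\<in>PiE {..n} (\<lambda>_. D). \<Sum>t\<in>D. (\<Prod>j<n. T (p j) (p (Suc j))) * (T (p n) t * F (p 0) t))"
    by (simp add: sum_distrib_left)
  also have "\<dots> = (\<Sum>(t, p)\<in>D \<times> PiE {..n} (\<lambda>_. D). (\<Prod>j<n. T (p j) (p (Suc j))) * (T (p n) t * F (p 0) t))"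
    by (subst sum.swap) (simp add: sum.cartesian_product)
  also have "\<dots> = (\<Sum>p\<in>PiE {..Suc n} (\<lambda>_. D). (\<Prod>j<Suc n. T (p j) (p (Suc j))) * F (p 0) (p (Suc n)))"
  proof (rule sum.reindex_bij_witness[of _ "\<lambda>p. (p (Suc n), restrict p {..n})" "\<lambda>(t, p). p(Suc n := t)"])
    fix x assume x: "x \<in> D \<times> PiE {..n} (\<lambda>_. D)"
    obtain t p where xp: "x = (t, p)" "t \<in> D" "p \<in> PiE {..n} (\<lambda>_. D)" using x by auto
    show "((case x of (t, p) \<Rightarrow> p(Suc n := t)) (Suc n), restrict (case x of (t, p) \<Rightarrow> p(Suc n := t)) {..n}) = x"
      using xp PiE_arb[OF xp(3)] by (auto simp: fun_eq_iff restrict_def)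
    show "(case x of (t, p) \<Rightarrow> p(Suc n := t)) \<in> PiE {..Suc n} (\<lambda>_. D)"
      using xp by (auto simp: PiE_iff extensional_def le_Suc_eq)
    have "(\<Prod>j<n. T ((p(Suc n := t)) j) ((p(Suc n := t)) (Suc j))) = (\<Prod>j<n. T (p j) (p (Suc j)))"
      by (intro prod.cong) auto
    thus "(\<Prod>j<Suc n. T ((case x of (t, p) \<Rightarrow> p(Suc n := t)) j) ((case x of (t, p) \<Rightarrow> p(Suc n := t)) (Suc j))) *
         F ((case x of (t, p) \<Rightarrow> p(Suc n := t)) 0) ((case x of (t, p) \<Rightarrow> p(Suc n := t)) (Suc n)) =
         (case x of (t, p) \<Rightarrow> (\<Prod>j<n. T (p j) (p (Suc j))) * (T (p n) t * F (p 0) t))"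
      using xp by (simp add: mult_ac)
  next
    fix p assume p: "p \<in> PiE {..Suc n} (\<lambda>_. D)"
    have "(restrict p {..n})(Suc n := p (Suc n)) = p"
    proof
      fix j show "((restrict p {..n})(Suc n := p (Suc n))) j = p j"
        using PiE_arb[OF p, of j] by (cases "j \<le> n"; cases "j = Suc n") auto
    qed
    thus "(case (p (Suc n), restrict p {..n}) of (t, p) \<Rightarrow> p(Suc n := t)) = p" by simp
    show "(p (Suc n), restrict p {..n}) \<in> D \<times> PiE {..n} (\<lambda>_. D)" using p by auto
  qed
  finally show ?case .
qed

definition sl :: "('a \<times> nat) set \<Rightarrow> nat \<Rightarrow> 'a set" where
  "sl C j = {i. (i, j) \<in> C}"

lemma sl_Un: "sl (C1 \<union> C2) j = sl C1 j \<union> sl C2 j"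
  by (auto simp: sl_def)

lemma sl_subset: "sl C j \<subseteq> fst ` C"
  by (force simp: sl_def)

lemma finite_sl: "finite C \<Longrightarrow> finite (sl C j)"
  by (rule finite_subset[OF sl_subset finite_imageI])

lemma sum_card_sl:
  assumes "finite C" "C \<subseteq> UNIV \<times> {..<n}"
  shows "(\<Sum>j<n. card (sl C j)) = card C"
proof -
  have "bij_betw prod.swap (SIGMA j:{..<n}. sl C j) C"
    by (rule bij_betw_byWitness[where f'=prod.swap]) (use assms(2) in \<open>auto simp: sl_def\<close>)
  hence "card C = card (SIGMA j:{..<n}. sl C j)" by (simp add: bij_betw_same_card)
  also have "\<dots> = (\<Sum>j<n. card (sl C j))" by (rule card_SigmaI) (use assms finite_sl in auto)
  finally show ?thesis by simp
qed

lemma bij_slices: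
  "bij_betw (\<lambda>C. \<lambda>j\<in>{..<n}. sl C j) (Pow (V \<times> {..<n})) (PiE {..<n} (\<lambda>_. Pow V))"
proof (rule bij_betw_byWitness[where f'="\<lambda>c. {(i, j). j < n \<and> i \<in> c j}"])
  show "\<forall>a\<in>Pow (V \<times> {..<n}). {(i, j). j < n \<and> i \<in> (\<lambda>j\<in>{..<n}. sl a j) j} = a" by (auto simp: sl_def)
  show "\<forall>a'\<in>PiE {..<n} (\<lambda>_. Pow V). (\<lambda>j\<in>{..<n}. sl {(i, j). j < n \<and> i \<in> a' j} j) = a'"
    by (auto simp: sl_def fun_eq_iff restrict_def PiE_iff extensional_def)
  show "(\<lambda>C. \<lambda>j\<in>{..<n}. sl C j) ` Pow (V \<times> {..<n}) \<subseteq> PiE {..<n} (\<lambda>_. Pow V)" by (auto simp: sl_def)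
  show "(\<lambda>c. {(i, j). j < n \<and> i \<in> c j}) ` PiE {..<n} (\<lambda>_. Pow V) \<subseteq> Pow (V \<times> {..<n})" by (auto simp: PiE_iff)
qed

text \<open>Adjacency on the cycle of \<open>n\<close> slabs. The wrap-around accounts for the
  observable, which couples the last slab to the first.\<close>

definition time_nbr :: "nat \<Rightarrow> nat \<Rightarrow> nat \<Rightarrow> bool" where
  "time_nbr n j k \<longleftrightarrow> j = k \<or> k = Suc j \<or> j = Suc k \<or> (j = 0 \<and> k = n - 1) \<or> (j = n - 1 \<and> k = 0)"

definition st_rel :: "nat \<Rightarrow> 'a rel \<Rightarrow> ('a \<times> nat) rel" where
  "st_rel n r = {((i, j), (i', j')). (i, i') \<in> r \<and> time_nbr n j j'}"

text \<open>The times adjacent to \<open>j\<close> are among \<open>j\<close>, \<open>Suc j\<close>,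
  \<open>j - 1\<close>, \<open>n - 1\<close> and \<open>0\<close>, hence the factor 5. It does not
  grow with the number of slabs.\<close>

lemma bounded_degree_st:
  assumes "bounded_degree r \<Delta>"
  shows "bounded_degree (st_rel n r) (5 * \<Delta>)"
proof -
  interpret r: bounded_degree r \<Delta> by (rule assms)
  show ?thesis
  proof
    show "sym (st_rel n r)" using r.symE by (auto simp: st_rel_def sym_def time_nbr_def)
    show "(x, x) \<in> st_rel n r" for x using r.reflE by (auto simp: st_rel_def time_nbr_def)
    fix x :: "'a \<times> nat"
    obtain i j where x: "x = (i, j)" by (cases x)
    have sub: "st_rel n r `` {x} \<subseteq> (r `` {i}) \<times> {j, Suc j, j - 1, n - 1, 0}"
      by (auto simp: st_rel_def time_nbr_def x)
    have fin: "finite ((r `` {i}) \<times> {j, Suc j, j - 1, n - 1, 0})" using r.finE by auto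
    show "finite (st_rel n r `` {x})" by (rule finite_subset[OF sub fin])
    have "card {j, Suc j, j - 1, n - 1, 0} \<le> 5"
      using card_length[of "[j, Suc j, j - 1, n - 1, 0]"] by simp
    hence "card ((r `` {i}) \<times> {j, Suc j, j - 1, n - 1, 0}) \<le> \<Delta> * 5"
      unfolding card_cartesian_product using r.degE by (intro mult_le_mono) auto
    thus "card (st_rel n r `` {x}) \<le> 5 * \<Delta>" using card_mono[OF fin sub] by simp
  qed
qed

lemma card_conf0:
  assumes "finite V"
  shows "card (conf0 m V) = m ^ card V"
proof -
  have "bij_betw (\<lambda>s. restrict s V) (conf0 m V) (PiE V (\<lambda>_. {..<m}))"
    by (rule bij_betw_byWitness[where f'="\<lambda>f i. if i \<in> V then f i else 0"])
       (auto simp: conf0_def fun_eq_iff PiE_iff extensional_def)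
  thus ?thesis using assms by (simp add: bij_betw_same_card card_PiE)
qed

section \<open>Space-time polymers: their weights, factorization and bounds\<close>

context gapped_system
begin

text \<open>There are \<open>n\<close> slabs but \<open>n + 1\<close> configurations: the one at
  time \<open>j\<close> begins slab \<open>j\<close>, and the one at time \<open>n\<close> ends slab
  \<open>n - 1\<close>, hence the \<open>min\<close>. Confining configurations to their slabs
  discards only vanishing terms, because \<open>Wt\<close> is 0 otherwise.\<close>

definition st_conf :: "nat \<Rightarrow> ('a \<times> nat) set \<Rightarrow> (nat \<Rightarrow> 'a \<Rightarrow> nat) set" where
  "st_conf n C = PiE {..n} (\<lambda>j. conf0 m (sl C (min j (n - 1))))"

definition st_base :: "nat \<Rightarrow> ('a \<times> nat) set \<Rightarrow> 'a set" where
  "st_base n C = sl C 0 \<union> sl C (n - 1)"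

text \<open>Space-time is periodic in time; the observable sits at the seam between the slabs \<open>n - 1\<close> and \<open>0\<close>,
  where the two configurations \<open>p n\<close> and \<open>p 0\<close> differ.\<close>

definition st_weight :: "real \<Rightarrow> nat \<Rightarrow> ('a \<Rightarrow> smat) \<Rightarrow> ('a \<times> nat) set \<Rightarrow> 'a set \<Rightarrow> complex" where
  "st_weight t n Ob C V = (if fst ` C \<subseteq> V then
     (\<Sum>p\<in>st_conf n C. (\<Prod>j<n. Wt t V (sl C j) (p j) (p (Suc j))) * (\<Prod>i\<in>st_base n C. Ob i (p n i) (p 0 i))) else 0)"

definition Tr_obs :: "real \<Rightarrow> ('a \<Rightarrow> smat) \<Rightarrow> 'a set \<Rightarrow> complex" where
  "Tr_obs b Ob V = op_trace (conf0 m V) (op_mult (conf0 m V) (op_exp (conf0 m V) (-b) (Ham V V)) (\<lambda>s t. \<Prod>i\<in>V. Ob i (s i) (t i)))"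

lemma Tr_obs_paths:
  assumes V: "finite V"
  shows "Tr_obs (real n * t) Ob V =
    (\<Sum>p\<in>PiE {..n} (\<lambda>_. conf0 m V). (\<Prod>j<n. op_exp (conf0 m V) (-t) (Ham V V) (p j) (p (Suc j))) * (\<Prod>i\<in>V. Ob i (p n i) (p 0 i)))"
proof -
  let ?D = "conf0 m V"
  have D: "finite ?D" by (rule finite_conf0[OF V])
  have "Tr_obs (real n * t) Ob V = (\<Sum>s\<in>?D. \<Sum>z\<in>?D. op_exp ?D (- (real n * t)) (Ham V V) s z * (\<Prod>i\<in>V. Ob i (z i) (s i)))"
    by (simp add: Tr_obs_def op_trace_def op_mult_def)
  also have "\<dots> = (\<Sum>s\<in>?D. \<Sum>z\<in>?D. op_pow ?D (op_exp ?D (-t) (Ham V V)) n s z * (\<Prod>i\<in>V. Ob i (z i) (s i)))"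
    using op_exp_pow[OF D, of _ _ n "-t" "Ham V V"] by (intro sum.cong refl) simp
  also have "\<dots> = (\<Sum>p\<in>PiE {..n} (\<lambda>_. ?D). (\<Prod>j<n. op_exp ?D (-t) (Ham V V) (p j) (p (Suc j))) * (\<Prod>i\<in>V. Ob i (p n i) (p 0 i)))"
    by (rule sum_paths[OF D])
  finally show ?thesis .
qed

lemma st_conf_sub:
  assumes n: "0 < n" and C: "C \<subseteq> V \<times> {..<n}"
  shows "st_conf n C \<subseteq> PiE {..n} (\<lambda>_. conf0 m V)"
proof -
  have "sl C j \<subseteq> V" for j using C by (auto simp: sl_def)
  thus ?thesis unfolding st_conf_def by (intro PiE_mono conf0_mono[OF _ m])
qed

lemma st_confD:
  assumes n: "0 < n" and p: "p \<in> st_conf n C"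
  shows "j < n \<Longrightarrow> p j \<in> conf0 m (sl C j)" "p n \<in> conf0 m (sl C (n - 1))"
proof -
  have a: "p j \<in> conf0 m (sl C (min j (n - 1)))" if "j \<le> n" for j using p that by (auto simp: st_conf_def)
  have "min n (n - 1) = n - 1" by simp
  thus "p n \<in> conf0 m (sl C (n - 1))" using a[of n] by simp
  assume "j < n"
  hence "min j (n - 1) = j" "j \<le> n" by auto
  thus "p j \<in> conf0 m (sl C j)" using a[of j] by simp
qed

lemma st_conf_iff:
  assumes n: "0 < n" and p: "p \<in> PiE {..n} (\<lambda>_. conf0 m V)"
  shows "p \<in> st_conf n C \<longleftrightarrow> (\<forall>j<n. p j \<in> conf0 m (sl C j)) \<and> p n \<in> conf0 m (sl C (n - 1))"
proof
  assume a: "p \<in> st_conf n C"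
  thus "(\<forall>j<n. p j \<in> conf0 m (sl C j)) \<and> p n \<in> conf0 m (sl C (n - 1))" using st_confD[OF n a] by blast
next
  assume a: "(\<forall>j<n. p j \<in> conf0 m (sl C j)) \<and> p n \<in> conf0 m (sl C (n - 1))"
  have "p j \<in> conf0 m (sl C (min j (n - 1)))" if "j \<le> n" for j
  proof (cases "j = n")
    case False
    hence "j < n" "min j (n - 1) = j" using that by auto
    thus ?thesis using a by simp
  qed (use a in simp)
  thus "p \<in> st_conf n C" using p by (auto simp: st_conf_def PiE_iff)
qed

text \<open>Each slab is decomposed by \<open>Wt_sum\<close>; a choice of one set for each slab is a
  subset of space-time. Sites outside the base are vacuum on both sides of the seam and give the
  factor \<open>Ob i 0 0 = 1\<close>. Sets that leave \<open>V\<close> have weight 0, so that one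
  index set serves all \<open>V \<subseteq> A\<close>.\<close>

lemma Tr_obs_expansion:
  assumes A: "finite A" and V: "V \<subseteq> A" and n: "0 < n" and Ob: "\<And>i. Ob i 0 0 = 1"
  shows "Tr_obs (real n * t) Ob V = bounded_degree.Zf (st_weight t n Ob) (A \<times> {..<n}) V"
proof -
  interpret st: bounded_degree "st_rel n nbr" "5 * \<Delta>" by (rule bounded_degree_st[OF bd])
  let ?D = "conf0 m V" and ?P = "PiE {..n} (\<lambda>_. conf0 m V)"
  have fV: "finite V" using A V finite_subset by blast
  have D: "finite ?D" by (rule finite_conf0[OF fV])
  have fP: "finite ?P" by (rule finite_PiE) (use D in auto)
  let ?F = "\<lambda>p. \<Prod>i\<in>V. Ob i (p n i) (p 0 i)"
  have "Tr_obs (real n * t) Ob V = (\<Sum>p\<in>?P. (\<Prod>j<n. \<Sum>C\<in>Pow V. Wt t V C (p j) (p (Suc j))) * ?F p)"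
    unfolding Tr_obs_paths[OF fV]
    by (intro sum.cong refl arg_cong2[where f="(*)"] prod.cong Wt_sum[OF fV]) (auto simp: PiE_iff)
  also have "\<dots> = (\<Sum>p\<in>?P. (\<Sum>c\<in>PiE {..<n} (\<lambda>_. Pow V). \<Prod>j<n. Wt t V (c j) (p j) (p (Suc j))) * ?F p)"
    using fV by (intro sum.cong refl arg_cong2[where f="(*)"] prod_sum_PiE) auto
  also have "\<dots> = (\<Sum>c\<in>PiE {..<n} (\<lambda>_. Pow V). \<Sum>p\<in>?P. (\<Prod>j<n. Wt t V (c j) (p j) (p (Suc j))) * ?F p)"
    unfolding sum_distrib_right by (rule sum.swap)
  also have "\<dots> = (\<Sum>C\<in>Pow (V \<times> {..<n}). \<Sum>p\<in>?P. (\<Prod>j<n. Wt t V ((\<lambda>j\<in>{..<n}. sl C j) j) (p j) (p (Suc j))) * ?F p)"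
    by (rule sum.reindex_bij_betw[OF bij_slices, symmetric])
  also have "\<dots> = (\<Sum>C\<in>Pow (V \<times> {..<n}). st_weight t n Ob C V)"
  proof (rule sum.cong[OF refl])
    fix C assume C: "C \<in> Pow (V \<times> {..<n})"
    have slV: "sl C j \<subseteq> V" for j using C by (auto simp: sl_def)
    have "(\<Sum>p\<in>?P. (\<Prod>j<n. Wt t V ((\<lambda>j\<in>{..<n}. sl C j) j) (p j) (p (Suc j))) * ?F p) =
       (\<Sum>p\<in>?P. (\<Prod>j<n. Wt t V (sl C j) (p j) (p (Suc j))) * ?F p)"
      by (intro sum.cong refl arg_cong2[where f="(*)"] prod.cong) auto
    also have "\<dots> = (\<Sum>p\<in>st_conf n C. (\<Prod>j<n. Wt t V (sl C j) (p j) (p (Suc j))) * (\<Prod>i\<in>st_base n C. Ob i (p n i) (p 0 i)))"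
    proof (rule sum.mono_neutral_cong_right[OF fP])
      show "st_conf n C \<subseteq> ?P" by (rule st_conf_sub[OF n]) (use C in auto)
      show "\<forall>p\<in>?P - st_conf n C. (\<Prod>j<n. Wt t V (sl C j) (p j) (p (Suc j))) * ?F p = 0"
      proof
        fix p assume p: "p \<in> ?P - st_conf n C"
        have "\<exists>j<n. Wt t V (sl C j) (p j) (p (Suc j)) = 0"
        proof (cases "\<forall>j<n. p j \<in> conf0 m (sl C j)")
          case True
          hence "p n \<notin> conf0 m (sl C (n - 1))" using p st_conf_iff[OF n, of p V C] by auto
          thus ?thesis using n by (intro exI[of _ "n - 1"]) (auto simp: Wt_def)
        qed (auto simp: Wt_def)
        thus "(\<Prod>j<n. Wt t V (sl C j) (p j) (p (Suc j))) * ?F p = 0" by auto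
      qed
      fix p assume p: "p \<in> st_conf n C"
      have "?F p = (\<Prod>i\<in>st_base n C. Ob i (p n i) (p 0 i))"
      proof (rule prod.mono_neutral_right[OF fV])
        show "st_base n C \<subseteq> V" using slV by (auto simp: st_base_def)
        have "p n \<in> conf0 m (sl C (n - 1))" "p 0 \<in> conf0 m (sl C 0)"
          using st_confD[OF n p] n by auto
        thus "\<forall>i\<in>V - st_base n C. Ob i (p n i) (p 0 i) = 1"
          using Ob by (auto simp: conf0_def st_base_def)
      qed
      thus "(\<Prod>j<n. Wt t V (sl C j) (p j) (p (Suc j))) * ?F p =
         (\<Prod>j<n. Wt t V (sl C j) (p j) (p (Suc j))) * (\<Prod>i\<in>st_base n C. Ob i (p n i) (p 0 i))" by simp
    qed
    also have "\<dots> = st_weight t n Ob C V" using C by (auto simp: st_weight_def)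
    finally show "(\<Sum>p\<in>?P. (\<Prod>j<n. Wt t V ((\<lambda>j\<in>{..<n}. sl C j) j) (p j) (p (Suc j))) * ?F p) = st_weight t n Ob C V" .
  qed
  also have "\<dots> = (\<Sum>C\<in>Pow (A \<times> {..<n}). st_weight t n Ob C V)"
  proof (rule sum.mono_neutral_left)
    show "\<forall>C\<in>Pow (A \<times> {..<n}) - Pow (V \<times> {..<n}). st_weight t n Ob C V = 0"
    proof
      fix C assume "C \<in> Pow (A \<times> {..<n}) - Pow (V \<times> {..<n})"
      hence "\<not> fst ` C \<subseteq> V" by force
      thus "st_weight t n Ob C V = 0" by (simp add: st_weight_def)
    qed
  qed (use A V in auto)
  finally show ?thesis by (simp add: st.Zf_def)
qed

lemma st_weight_empty:
  assumes V: "finite V" and n: "0 < n"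
  shows "st_weight t n Ob {} V = 1"
proof -
  have sl: "sl {} j = ({}::'a set)" for j by (simp add: sl_def)
  have c: "conf0 m ({}::'a set) = {\<lambda>_. 0}" by (auto simp: conf0_def)
  have "st_conf n {} = {\<lambda>j\<in>{..n}. (\<lambda>_. 0)}" unfolding st_conf_def sl c by (auto simp: PiE_iff extensional_def fun_eq_iff)
  thus ?thesis using Wt_empty[OF V] n by (simp add: st_weight_def sl st_base_def)
qed

text \<open>Paths for \<open>C1 \<union> C2\<close> are pairs of paths joined by
  \<open>add0\<close>. The parts must be separated in time as well as in space: consecutive slabs
  share a configuration, and the observable links the last slab with the first.\<close>

lemma st_weight_mult:
  assumes V: "finite V" and n: "0 < n" and C: "C1 \<subseteq> A \<times> {..<n}" "C2 \<subseteq> A \<times> {..<n}" "finite A" and sep: "st_rel n nbr `` C1 \<inter> C2 = {}"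
  shows "st_weight t n Ob (C1 \<union> C2) V = st_weight t n Ob C1 V * st_weight t n Ob C2 V"
proof (cases "fst ` C1 \<subseteq> V \<and> fst ` C2 \<subseteq> V")
  case False
  thus ?thesis by (auto simp: st_weight_def image_Un)
next
  case True
  interpret r: bounded_degree nbr \<Delta> by (rule bd)
  have fC: "finite C1" "finite C2" using C finite_subset by blast+
  have slV: "sl C1 j \<subseteq> V" "sl C2 j \<subseteq> V" for j using True sl_subset[of C1 j] sl_subset[of C2 j] by auto
  have sepj: "False" if "(i, i') \<in> nbr" "i \<in> sl C1 j" "i' \<in> sl C2 k" "time_nbr n j k" for i i' j k
    using sep that by (auto simp: sl_def st_rel_def)
  have sepd: "sl C1 j \<inter> sl C2 k = {}" if "time_nbr n j k" for j k
    using sepj[OF r.reflE _ _ that] by auto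
  have refl_t: "time_nbr n j j" for j by (simp add: time_nbr_def)
  have dj: "sl C1 j \<inter> sl C2 j = {}" for j by (rule sepd[OF refl_t])
  have nj: "nbr `` sl C1 j \<inter> sl C2 j = {}" for j using sepj[OF _ _ _ refl_t] by auto
  have mt: "time_nbr n j (min (Suc j) (n - 1))" "time_nbr n (min (Suc j) (n - 1)) j" if "j < n" for j
    using that by (auto simp: time_nbr_def min_def)
  have bases: "st_base n C1 \<inter> st_base n C2 = {}"
    using sepd[of 0 0] sepd[of 0 "n - 1"] sepd[of "n - 1" 0] sepd[of "n - 1" "n - 1"]
    by (auto simp: st_base_def time_nbr_def)
  let ?J = "\<lambda>p q. \<lambda>j\<in>{..n}. add0 (p j) (q j)"
  let ?m = "\<lambda>j. min j (n - 1)"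
  have bij: "bij_betw (\<lambda>(p, q). ?J p q) (st_conf n C1 \<times> st_conf n C2) (st_conf n (C1 \<union> C2))"
  proof (rule bij_betw_byWitness[where f'="\<lambda>p. (\<lambda>j\<in>{..n}. restr0 (p j) (sl C1 (?m j)), \<lambda>j\<in>{..n}. restr0 (p j) (sl C2 (?m j)))"])
    have b: "bij_betw (\<lambda>(x, y). add0 x y) (conf0 m (sl C1 j) \<times> conf0 m (sl C2 j)) (conf0 m (sl C1 j \<union> sl C2 j))" for j
      by (rule bij_add0[OF dj])
    have r1: "restr0 (add0 x y) (sl C1 j) = x" "restr0 (add0 x y) (sl C2 j) = y" "add0 x y \<in> conf0 m (sl C1 j \<union> sl C2 j)"
      if "x \<in> conf0 m (sl C1 j)" "y \<in> conf0 m (sl C2 j)" for x y j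
      using that dj[of j] by (auto simp: conf0_def restr0_def add0_def fun_eq_iff)
    have r2: "add0 (restr0 x (sl C1 j)) (restr0 x (sl C2 j)) = x"
      if "x \<in> conf0 m (sl C1 j \<union> sl C2 j)" for x j
      using that dj[of j] by (auto simp: conf0_def restr0_def add0_def fun_eq_iff)
    have r3: "restr0 x (sl C1 j) \<in> conf0 m (sl C1 j)" "restr0 x (sl C2 j) \<in> conf0 m (sl C2 j)"
      if "x \<in> conf0 m (sl C1 j \<union> sl C2 j)" for x j
      using restr0_conf0[OF that m] by auto
    show "\<forall>a\<in>st_conf n C1 \<times> st_conf n C2. (\<lambda>j\<in>{..n}. restr0 ((case a of (p, q) \<Rightarrow> ?J p q) j) (sl C1 (?m j)), \<lambda>j\<in>{..n}. restr0 ((case a of (p, q) \<Rightarrow> ?J p q) j) (sl C2 (?m j))) = a"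
      using r1 by (auto simp: st_conf_def PiE_iff fun_eq_iff extensional_def restrict_def)
    show "\<forall>p\<in>st_conf n (C1 \<union> C2). (case (\<lambda>j\<in>{..n}. restr0 (p j) (sl C1 (?m j)), \<lambda>j\<in>{..n}. restr0 (p j) (sl C2 (?m j))) of (p, q) \<Rightarrow> ?J p q) = p"
      using r2 by (auto simp: st_conf_def PiE_iff fun_eq_iff extensional_def restrict_def sl_Un)
    show "(\<lambda>(p, q). ?J p q) ` (st_conf n C1 \<times> st_conf n C2) \<subseteq> st_conf n (C1 \<union> C2)"
      using r1 by (auto simp: st_conf_def PiE_iff sl_Un)
    show "(\<lambda>p. (\<lambda>j\<in>{..n}. restr0 (p j) (sl C1 (?m j)), \<lambda>j\<in>{..n}. restr0 (p j) (sl C2 (?m j)))) ` st_conf n (C1 \<union> C2) \<subseteq> st_conf n C1 \<times> st_conf n C2"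
      using r3 by (auto simp: st_conf_def PiE_iff sl_Un)
  qed
  have W: "Wt t V (sl (C1 \<union> C2) j) (?J p q j) (?J p q (Suc j)) = Wt t V (sl C1 j) (p j) (p (Suc j)) * Wt t V (sl C2 j) (q j) (q (Suc j))"
    if p: "p \<in> st_conf n C1" and q: "q \<in> st_conf n C2" and j: "j < n" for p q j
  proof -
    have pj: "p k \<in> conf0 m (sl C1 (?m k))" "q k \<in> conf0 m (sl C2 (?m k))" if "k \<le> n" for k
      using p q that by (auto simp: st_conf_def PiE_iff)
    have "?m j = j" using j by simp
    hence p0: "p j \<in> conf0 m (sl C1 j)" "q j \<in> conf0 m (sl C2 j)" using pj[of j] j by auto
    have p1: "p (Suc j) \<in> conf0 m (sl C1 (?m (Suc j)))" "q (Suc j) \<in> conf0 m (sl C2 (?m (Suc j)))" using pj[of "Suc j"] j by auto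
    have J: "?J p q j = add0 (p j) (q j)" "?J p q (Suc j) = add0 (p (Suc j)) (q (Suc j))" using j by auto
    show ?thesis
    proof (cases "p (Suc j) \<in> conf0 m (sl C1 j) \<and> q (Suc j) \<in> conf0 m (sl C2 j)")
      case True
      thus ?thesis unfolding J sl_Un by (intro Wt_add0[OF V slV dj nj p0]) auto
    next
      case False
      \<comment> \<open>An excitation of \<open>p (Suc j)\<close> outside the \<open>C1\<close>-part
        of slab \<open>j\<close> cannot lie in the \<open>C2\<close>-part, because adjacent slabs of
        \<open>C1\<close> and \<open>C2\<close> are disjoint; likewise with the roles exchanged. So
        the joint configuration leaves the slab too, and both sides are 0.\<close>
      have "add0 (p (Suc j)) (q (Suc j)) \<notin> conf0 m (sl C1 j \<union> sl C2 j)"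
      proof
        assume a: "add0 (p (Suc j)) (q (Suc j)) \<in> conf0 m (sl C1 j \<union> sl C2 j)"
        hence z: "p (Suc j) i = 0" "q (Suc j) i = 0" if "i \<notin> sl C1 j" "i \<notin> sl C2 j" for i
          using that by (auto simp: conf0_def add0_def)
        have "p (Suc j) i = 0" if "i \<notin> sl C1 j" for i
        proof (cases "i \<in> sl C2 j")
          case True
          hence "i \<notin> sl C1 (?m (Suc j))" using sepd[OF mt(2)[OF j]] by auto
          thus ?thesis using p1(1) by (auto simp: conf0_def)
        qed (use z that in auto)
        moreover have "q (Suc j) i = 0" if "i \<notin> sl C2 j" for i
        proof (cases "i \<in> sl C1 j")
          case True
          hence "i \<notin> sl C2 (?m (Suc j))" using sepd[OF mt(1)[OF j]] by auto
          thus ?thesis using p1(2) by (auto simp: conf0_def)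
        qed (use z that in auto)
        moreover have "p (Suc j) i < m" "q (Suc j) i < m" for i
          using p1 m by (auto simp: conf0_def)
        ultimately show False using False by (auto simp: conf0_def)
      qed
      hence "Wt t V (sl (C1 \<union> C2) j) (?J p q j) (?J p q (Suc j)) = 0" unfolding J sl_Un by (simp add: Wt_def)
      moreover have "Wt t V (sl C1 j) (p j) (p (Suc j)) * Wt t V (sl C2 j) (q j) (q (Suc j)) = 0"
        using False by (auto simp: Wt_def)
      ultimately show ?thesis by simp
    qed
  qed
  have O: "(\<Prod>i\<in>st_base n (C1 \<union> C2). Ob i (?J p q n i) (?J p q 0 i)) =
     (\<Prod>i\<in>st_base n C1. Ob i (p n i) (p 0 i)) * (\<Prod>i\<in>st_base n C2. Ob i (q n i) (q 0 i))"
    if p: "p \<in> st_conf n C1" and q: "q \<in> st_conf n C2" for p q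
  proof -
    have pc: "p n \<in> conf0 m (sl C1 (n - 1))" "q n \<in> conf0 m (sl C2 (n - 1))" "p 0 \<in> conf0 m (sl C1 0)" "q 0 \<in> conf0 m (sl C2 0)"
      using st_confD[OF n p] st_confD[OF n q] n by auto
    have un: "st_base n (C1 \<union> C2) = st_base n C1 \<union> st_base n C2" by (auto simp: st_base_def sl_Un)
    have "(\<Prod>i\<in>st_base n (C1 \<union> C2). Ob i (?J p q n i) (?J p q 0 i)) =
      (\<Prod>i\<in>st_base n C1. Ob i (?J p q n i) (?J p q 0 i)) * (\<Prod>i\<in>st_base n C2. Ob i (?J p q n i) (?J p q 0 i))"
      unfolding un by (rule prod.union_disjoint) (use fC bases in \<open>auto simp: st_base_def intro: finite_sl\<close>)
    moreover have "(\<Prod>i\<in>st_base n C1. Ob i (?J p q n i) (?J p q 0 i)) = (\<Prod>i\<in>st_base n C1. Ob i (p n i) (p 0 i))"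
    proof (rule prod.cong[OF refl])
      fix i assume "i \<in> st_base n C1"
      hence "i \<notin> st_base n C2" using bases by auto
      hence "q n i = 0" "q 0 i = 0" using pc by (auto simp: st_base_def conf0_def)
      thus "Ob i (?J p q n i) (?J p q 0 i) = Ob i (p n i) (p 0 i)" by (simp add: add0_def)
    qed
    moreover have "(\<Prod>i\<in>st_base n C2. Ob i (?J p q n i) (?J p q 0 i)) = (\<Prod>i\<in>st_base n C2. Ob i (q n i) (q 0 i))"
    proof (rule prod.cong[OF refl])
      fix i assume "i \<in> st_base n C2"
      hence "i \<notin> st_base n C1" using bases by auto
      hence "p n i = 0" "p 0 i = 0" using pc by (auto simp: st_base_def conf0_def)
      thus "Ob i (?J p q n i) (?J p q 0 i) = Ob i (q n i) (q 0 i)" by (simp add: add0_def)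
    qed
    ultimately show ?thesis by simp
  qed
  let ?t = "\<lambda>C p. (\<Prod>j<n. Wt t V (sl C j) (p j) (p (Suc j))) * (\<Prod>i\<in>st_base n C. Ob i (p n i) (p 0 i))"
  have "st_weight t n Ob (C1 \<union> C2) V = (\<Sum>p\<in>st_conf n (C1 \<union> C2). ?t (C1 \<union> C2) p)"
    using True by (auto simp: st_weight_def image_Un)
  also have "\<dots> = (\<Sum>(p, q)\<in>st_conf n C1 \<times> st_conf n C2. ?t (C1 \<union> C2) (?J p q))"
    by (subst sum.reindex_bij_betw[OF bij, symmetric]) (simp add: case_prod_beta)
  also have "\<dots> = (\<Sum>(p, q)\<in>st_conf n C1 \<times> st_conf n C2. ?t C1 p * ?t C2 q)"
  proof (rule sum.cong[OF refl])
    fix x assume "x \<in> st_conf n C1 \<times> st_conf n C2"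
    then obtain p q where x: "x = (p, q)" "p \<in> st_conf n C1" "q \<in> st_conf n C2" by auto
    have "(\<Prod>j<n. Wt t V (sl (C1 \<union> C2) j) (?J p q j) (?J p q (Suc j))) =
      (\<Prod>j<n. Wt t V (sl C1 j) (p j) (p (Suc j)) * Wt t V (sl C2 j) (q j) (q (Suc j)))"
      by (rule prod.cong[OF refl]) (rule W[OF x(2,3)], simp)
    thus "(case x of (p, q) \<Rightarrow> ?t (C1 \<union> C2) (?J p q)) = (case x of (p, q) \<Rightarrow> ?t C1 p * ?t C2 q)"
      unfolding x(1) prod.case O[OF x(2,3)] by (simp only: prod.distrib mult_ac)
  qed
  also have "\<dots> = (\<Sum>p\<in>st_conf n C1. ?t C1 p) * (\<Sum>q\<in>st_conf n C2. ?t C2 q)"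
    by (simp only: sum.cartesian_product[symmetric] sum_product)
  also have "\<dots> = st_weight t n Ob C1 V * st_weight t n Ob C2 V" using True by (simp add: st_weight_def)
  finally show ?thesis .
qed

text \<open>Only slab \<open>n - 1\<close> carries two configurations, those at times
  \<open>n - 1\<close> and \<open>n\<close>, so each site of \<open>C\<close> is counted at most
  twice.\<close>

lemma card_st_conf_le:
  assumes n: "0 < n" and C: "C \<subseteq> A \<times> {..<n}" "finite A"
  shows "card (st_conf n C) \<le> m ^ (2 * card C)"
proof -
  have fC: "finite C" using C finite_subset by blast
  have sum: "(\<Sum>j<n. card (sl C j)) = card C" by (rule sum_card_sl) (use C fC in auto)
  have "(\<Sum>j\<le>n. card (sl C (min j (n - 1)))) = (\<Sum>j<n. card (sl C (min j (n - 1)))) + card (sl C (min n (n - 1)))"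
    using lessThan_Suc_atMost[of n] sum.lessThan_Suc[of "\<lambda>j. card (sl C (min j (n - 1)))" n] by simp
  also have "(\<Sum>j<n. card (sl C (min j (n - 1)))) = (\<Sum>j<n. card (sl C j))" by (intro sum.cong) auto
  also have "card (sl C (min n (n - 1))) \<le> (\<Sum>j<n. card (sl C j))"
    using member_le_sum[of "n - 1" "{..<n}" "\<lambda>j. card (sl C j)"] n by simp
  finally have le: "(\<Sum>j\<le>n. card (sl C (min j (n - 1)))) \<le> 2 * card C" using sum by simp
  have "card (st_conf n C) = (\<Prod>j\<le>n. m ^ card (sl C (min j (n - 1))))"
    unfolding st_conf_def by (simp add: card_PiE card_conf0 finite_sl fC)
  also have "\<dots> = m ^ (\<Sum>j\<le>n. card (sl C (min j (n - 1))))" by (simp add: power_sum)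
  also have "\<dots> \<le> m ^ (2 * card C)" using m le by (intro power_increasing) auto
  finally show ?thesis .
qed

text \<open>The price of a site of \<open>C\<close> consists of \<open>m ^ 2\<close> for the number
  of paths, \<open>K ^ 2\<close> because the base has at most \<open>2 * card C\<close> sites, and
  the slab bound.\<close>

lemma st_weight_bound:
  assumes V: "finite V" and n: "0 < n" and C: "C \<subseteq> A \<times> {..<n}" "finite A" and t: "0 \<le> t"
    and K: "1 \<le> K" "\<And>i a b. a < m \<Longrightarrow> b < m \<Longrightarrow> cmod (Ob i a b) \<le> K"
  shows "cmod (st_weight t n Ob C V) \<le> (real m ^ 2 * K ^ 2 * (exp (t - \<kappa>) + exp (- g * t))) ^ card C"
proof (cases "fst ` C \<subseteq> V")
  case False
  thus ?thesis using K by (auto simp: st_weight_def intro!: add_nonneg_nonneg)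
next
  case True
  let ?e = "exp (t - \<kappa>) + exp (- g * t)"
  have e0: "0 \<le> ?e" by (simp add: add_nonneg_nonneg)
  have fC: "finite C" using C finite_subset by blast
  have slV: "sl C j \<subseteq> V" for j using True sl_subset[of C j] by auto
  have sum: "(\<Sum>j<n. card (sl C j)) = card C" by (rule sum_card_sl) (use C fC in auto)
  have "cmod (st_weight t n Ob C V) \<le> (\<Sum>p\<in>st_conf n C. ?e ^ card C * K ^ (2 * card C))"
    unfolding st_weight_def using True
  proof (simp only: if_True, intro order_trans[OF norm_sum] sum_mono)
    fix p assume p: "p \<in> st_conf n C"
    have 1: "cmod (\<Prod>j<n. Wt t V (sl C j) (p j) (p (Suc j))) \<le> ?e ^ card C"
    proof -
      have "cmod (\<Prod>j<n. Wt t V (sl C j) (p j) (p (Suc j))) \<le> (\<Prod>j<n. ?e ^ card (sl C j))"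
        unfolding prod_norm[symmetric] by (intro prod_mono conjI Wt_bound[OF V slV t]) auto
      thus ?thesis by (simp add: power_sum[symmetric] sum)
    qed
    have 2: "cmod (\<Prod>i\<in>st_base n C. Ob i (p n i) (p 0 i)) \<le> K ^ (2 * card C)"
    proof -
      have lt: "p n i < m" "p 0 i < m" for i
        using st_confD(2)[OF n p] st_confD(1)[OF n p n] m by (auto simp: conf0_def)
      have "cmod (\<Prod>i\<in>st_base n C. Ob i (p n i) (p 0 i)) \<le> (\<Prod>i\<in>st_base n C. K)"
        unfolding prod_norm[symmetric] by (intro prod_mono conjI K lt) auto
      also have "\<dots> = K ^ card (st_base n C)" by simp
      also have "\<dots> \<le> K ^ (2 * card C)"
      proof (rule power_increasing[OF _ K(1)])
        have "card (sl C j) \<le> card C" if "j < n" for j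
          using member_le_sum[of j "{..<n}" "\<lambda>j. card (sl C j)"] that sum by simp
        from this[of 0] this[of "n - 1"] show "card (st_base n C) \<le> 2 * card C"
          using card_Un_le[of "sl C 0" "sl C (n - 1)"] n by (simp add: st_base_def)
      qed
      finally show ?thesis .
    qed
    show "cmod ((\<Prod>j<n. Wt t V (sl C j) (p j) (p (Suc j))) * (\<Prod>i\<in>st_base n C. Ob i (p n i) (p 0 i))) \<le> ?e ^ card C * K ^ (2 * card C)"
      unfolding norm_mult by (rule mult_mono[OF 1 2]) (use e0 in auto)
  qed
  also have "\<dots> = real (card (st_conf n C)) * (?e ^ card C * K ^ (2 * card C))" by simp
  also have "\<dots> \<le> real (m ^ (2 * card C)) * (?e ^ card C * K ^ (2 * card C))"
    using card_st_conf_le[OF n C] K e0 by (intro mult_right_mono mult_nonneg_nonneg) (auto simp: of_nat_le_iff simp del: of_nat_power)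
  also have "\<dots> = (real m ^ 2 * K ^ 2 * ?e) ^ card C" unfolding of_nat_power power_mult power_mult_distrib by (simp only: mult_ac)
  finally show ?thesis .
qed

lemma st_weight_local:
  assumes V: "finite V"
  shows "st_weight t n Ob C V = st_weight t n Ob C (V \<inter> nbr `` (fst ` C))"
proof -
  interpret r: bounded_degree nbr \<Delta> by (rule bd)
  have sub: "fst ` C \<subseteq> nbr `` (fst ` C)" using r.reflE by auto
  show ?thesis
  proof (cases "fst ` C \<subseteq> V")
    case True
    have "Wt t V (sl C j) s z = Wt t (V \<inter> nbr `` (fst ` C)) (sl C j) s z" for j s z
      by (rule Wt_local) (use V True sub sl_subset[of C j] in \<open>auto simp: sl_def\<close>)
    thus ?thesis using True sub by (simp add: st_weight_def)
  qed (auto simp: st_weight_def)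
qed

text \<open>As a function of the volume the weight depends only on the neighbourhood of the spatial
  projection of \<open>C\<close>, which has at most \<open>\<Delta> * card C\<close> sites.
  \<open>nb_local\<close> charges \<open>1 + 2 * exp a\<close> for each of them.\<close>

lemma kp_st_weight:
  assumes A: "finite A" "0 \<le> a" and n: "0 < n" and t: "0 \<le> t"
    and K: "1 \<le> K" "\<And>i a b. a < m \<Longrightarrow> b < m \<Longrightarrow> cmod (Ob i a b) \<le> K"
    and z: "z = (1 + 2 * exp a) ^ \<Delta> * (real m ^ 2 * K ^ 2 * (exp (t - \<kappa>) + exp (- g * t)))"
  shows "bounded_degree.kp_weight (st_rel n nbr) A a (A \<times> {..<n}) z (st_weight t n Ob)"
proof -
  interpret r: bounded_degree nbr \<Delta> by (rule bd)
  interpret st: bounded_degree "st_rel n nbr" "5 * \<Delta>" by (rule bounded_degree_st[OF bd])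
  show ?thesis unfolding st.kp_weight_def
  proof (intro conjI allI impI)
    fix V assume V: "V \<subseteq> A"
    have fV: "finite V" using V A finite_subset by blast
    show "st_weight t n Ob {} V = 1" by (rule st_weight_empty[OF fV n])
    fix C1 C2 assume C: "C1 \<subseteq> A \<times> {..<n}" "C2 \<subseteq> A \<times> {..<n}" "st_rel n nbr `` C1 \<inter> C2 = {}"
    show "st_weight t n Ob (C1 \<union> C2) V = st_weight t n Ob C1 V * st_weight t n Ob C2 V"
      by (rule st_weight_mult[OF fV n C(1,2) A(1) C(3)])
  next
    fix C assume C: "C \<subseteq> A \<times> {..<n}"
    have fC: "finite C" using C A finite_subset by blast
    let ?N = "nbr `` (fst ` C)" and ?b = "real m ^ 2 * K ^ 2 * (exp (t - \<kappa>) + exp (- g * t))"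
    have b0: "0 \<le> ?b" by (intro mult_nonneg_nonneg add_nonneg_nonneg) auto
    have N: "finite ?N" "card ?N \<le> \<Delta> * card (fst ` C)" using r.card_nbhd_le[of "fst ` C"] fC by auto
    have "nb A a (st_weight t n Ob C) \<le> (1 + 2 * exp a) ^ card (A \<inter> ?N) * ?b ^ card C"
    proof (rule nb_local[OF A])
      fix V assume V: "V \<subseteq> A"
      have fV: "finite V" using V A finite_subset by blast
      have "V \<inter> (A \<inter> ?N) = V \<inter> ?N" using V by auto
      thus "st_weight t n Ob C V = st_weight t n Ob C (V \<inter> (A \<inter> ?N))" using st_weight_local[OF fV] by simp
      show "cmod (st_weight t n Ob C V) \<le> ?b ^ card C" by (rule st_weight_bound[OF fV n C A(1) t K])
    qed auto
    also have "\<dots> \<le> (1 + 2 * exp a) ^ (\<Delta> * card C) * ?b ^ card C"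
    proof (intro mult_right_mono power_increasing)
      have "card (A \<inter> ?N) \<le> card ?N" by (rule card_mono) (use N in auto)
      also have "\<dots> \<le> \<Delta> * card (fst ` C)" by (rule N)
      also have "\<dots> \<le> \<Delta> * card C" by (intro mult_le_mono2 card_image_le fC)
      finally show "card (A \<inter> ?N) \<le> \<Delta> * card C" .
    qed (use b0 in auto)
    also have "\<dots> = z ^ card C" unfolding z power_mult power_mult_distrib[symmetric] ..
    finally show "nb A a (st_weight t n Ob C) \<le> z ^ card C" .
  qed
qed

text \<open>The two slabs at the seam have at most \<open>2 * card A\<close> sites, and each of the
  two partition functions pays 1 for a site; hence the constant 4.\<close>

theorem log_ratio_expansion:
  assumes A: "finite A" "0 \<le> a" and n: "0 < n" and t: "0 \<le> t"
    and K: "1 \<le> K" "\<And>i a b. a < m \<Longrightarrow> b < m \<Longrightarrow> cmod (Ob i a b) \<le> K" and Ob: "\<And>i. Ob i 0 0 = 1"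
    and small: "(1 + 2 * exp a) ^ \<Delta> * (real m ^ 2 * K ^ 2 * (exp (t - \<kappa>) + exp (- g * t))) * 2 ^ (5 * \<Delta>) * 2 ^ (5 * \<Delta>) \<le> 1/2"
  shows "\<exists>l. nb A a l \<le> 4 * real (card A) \<and> (\<forall>V\<subseteq>A. Tr_obs (real n * t) (\<lambda>_. smat_id) V \<noteq> 0 \<and>
     Tr_obs (real n * t) Ob V = Tr_obs (real n * t) (\<lambda>_. smat_id) V * exp (l V))"
proof -
  interpret st: bounded_degree "st_rel n nbr" "5 * \<Delta>" by (rule bounded_degree_st[OF bd])
  let ?z = "(1 + 2 * exp a) ^ \<Delta> * (real m ^ 2 * K ^ 2 * (exp (t - \<kappa>) + exp (- g * t)))"
  let ?W = "A \<times> {..<n}" and ?L = "A \<times> {0, n - 1}" and ?w = "st_weight t n Ob" and ?w1 = "st_weight t n (\<lambda>_. smat_id)"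
  have K1: "cmod (smat_id a b) \<le> K" for a b using K by (auto simp: smat_id_def)
  have z0: "0 \<le> ?z" by (intro mult_nonneg_nonneg add_nonneg_nonneg) auto
  have w: "st.kp_weight A a ?W ?z ?w" by (rule kp_st_weight[OF A n t K refl])
  have w1: "st.kp_weight A a ?W ?z ?w1" by (rule kp_st_weight[OF A n t K(1) K1 refl])
  have eq: "?w C V = ?w1 C V" if "C \<subseteq> ?W - ?L" for C V
  proof -
    have "sl C 0 = {}" "sl C (n - 1) = {}" using that by (auto simp: sl_def)
    hence "st_base n C = {}" by (simp add: st_base_def)
    thus ?thesis by (simp add: st_weight_def)
  qed
  obtain l where l: "nb A a l \<le> 2 * card ?L" "\<forall>V\<subseteq>A. st.Zf ?w1 ?W V \<noteq> 0 \<and> st.Zf ?w ?W V = st.Zf ?w1 ?W V * exp (l V)"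
  proof -
    have "finite ?W" "?L \<subseteq> ?W" using A n by auto
    from st.kp_log_ratio2[OF A this(1) z0 small w w1 this(2) eq] show ?thesis using that by blast
  qed
  have "card {0, n - 1} \<le> 2" by (simp add: card_insert_if)
  hence "card ?L \<le> 2 * card A" by (simp add: card_cartesian_product)
  hence "nb A a l \<le> 4 * real (card A)" using l(1) by linarith
  moreover have "Tr_obs (real n * t) (\<lambda>_. smat_id) V \<noteq> 0 \<and> Tr_obs (real n * t) Ob V = Tr_obs (real n * t) (\<lambda>_. smat_id) V * exp (l V)"
    if V: "V \<subseteq> A" for V
    using l(2) V Tr_obs_expansion[OF A(1) V n, of Ob t] Tr_obs_expansion[OF A(1) V n, of "\<lambda>_. smat_id" t] Ob
    by (simp add: smat_id_def)
  ultimately show ?thesis by blast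
qed

text \<open>The hypothesis is that terms meeting both parts vanish, rather than separation in
  \<open>nbr\<close>. On the lattice, interactions vanish on sets that are not connected by nearest
  neighbours, so volumes decouple as soon as their distance exceeds 1, even when \<open>nbr\<close>
  reaches further.\<close>

lemma Tr_obs_Un:
  assumes V: "finite V1" "finite V2" and disj: "V1 \<inter> V2 = {}"
    and hz: "\<And>A. A \<subseteq> V1 \<union> V2 \<Longrightarrow> A \<inter> V1 \<noteq> {} \<Longrightarrow> A \<inter> V2 \<noteq> {} \<Longrightarrow> op_zero_on (conf0 m A) (h A)"
    and yz: "\<And>X. X \<subseteq> V1 \<union> V2 \<Longrightarrow> X \<inter> V1 \<noteq> {} \<Longrightarrow> X \<inter> V2 \<noteq> {} \<Longrightarrow> op_zero_on (conf0 m X) (y X)"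
  shows "Tr_obs d Ob (V1 \<union> V2) = Tr_obs d Ob V1 * Tr_obs d Ob V2"
proof -
  let ?V = "V1 \<union> V2"
  have bij: "bij_betw (\<lambda>(x, y). add0 x y) (conf0 m V1 \<times> conf0 m V2) (conf0 m ?V)" by (rule bij_add0[OF disj])
  have Hloc: "Ham ?V U r t = Ham U U r t" if U: "U = V1 \<and> U' = V2 \<or> U = V2 \<and> U' = V1" and st: "r \<in> conf0 m U" "t \<in> conf0 m U" for U U' r t
  proof -
    have UV: "U \<union> U' = ?V" "U \<inter> U' = {}" using U disj by auto
    have "H0 ?V r t = H0 U r t" unfolding H0_def
    proof (rule sum.mono_neutral_right)
      show "\<forall>A\<in>Pow ?V - Pow U. ext0 A (h A) r t = 0"
      proof
        fix A assume A: "A \<in> Pow ?V - Pow U"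
        have fA: "finite A" using A V by (auto intro: finite_subset)
        show "ext0 A (h A) r t = 0"
        proof (cases "A \<inter> U = {}")
          case True
          thus ?thesis using ext0_vac[OF fA True st] by simp
        next
          case False
          have "A \<inter> V1 \<noteq> {}" "A \<inter> V2 \<noteq> {}" using A False U UV by auto
          hence "op_zero_on (conf0 m A) (h A)" using A by (intro hz) auto
          from ext0_zero_on[OF this st] show ?thesis .
        qed
      qed
    qed (use V UV in auto)
    thus ?thesis by (simp add: Ham_def)
  qed
  have E: "op_exp (conf0 m ?V) (-d) (Ham ?V ?V) (add0 r1 r2) (add0 t1 t2) =
     op_exp (conf0 m V1) (-d) (Ham V1 V1) r1 t1 * op_exp (conf0 m V2) (-d) (Ham V2 V2) r2 t2"
    if s: "r1 \<in> conf0 m V1" "r2 \<in> conf0 m V2" "t1 \<in> conf0 m V1" "t2 \<in> conf0 m V2" for r1 r2 t1 t2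
  proof -
    have fV: "finite ?V" using V by simp
    have "op_exp (conf0 m ?V) (-d) (Ham ?V ?V) (add0 r1 r2) (add0 t1 t2) =
      op_exp (conf0 m ?V) (-d) (Ham ?V V1) r1 t1 * op_exp (conf0 m ?V) (-d) (Ham ?V V2) r2 t2"
      by (rule exp_Ham_add0[OF fV _ _ disj _ _ hz yz s]) auto
    also have "op_exp (conf0 m ?V) (-d) (Ham ?V V1) r1 t1 = op_exp (conf0 m V1) (-d) (Ham ?V V1) r1 t1"
      by (rule exp_Ham_conf0[OF fV _ s(1)]) auto
    also have "\<dots> = op_exp (conf0 m V1) (-d) (Ham V1 V1) r1 t1"
      by (rule op_exp_cong[OF Hloc s(1,3)]) auto
    also have "op_exp (conf0 m ?V) (-d) (Ham ?V V2) r2 t2 = op_exp (conf0 m V2) (-d) (Ham ?V V2) r2 t2"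
      by (rule exp_Ham_conf0[OF fV _ s(2)]) auto
    also have "\<dots> = op_exp (conf0 m V2) (-d) (Ham V2 V2) r2 t2"
      by (rule op_exp_cong[OF Hloc s(2,4)]) auto
    finally show ?thesis .
  qed
  have P: "(\<Prod>i\<in>?V. Ob i (add0 r1 r2 i) (add0 t1 t2 i)) = (\<Prod>i\<in>V1. Ob i (r1 i) (t1 i)) * (\<Prod>i\<in>V2. Ob i (r2 i) (t2 i))"
    if s: "r1 \<in> conf0 m V1" "r2 \<in> conf0 m V2" "t1 \<in> conf0 m V1" "t2 \<in> conf0 m V2" for r1 r2 t1 t2
  proof -
    have "(\<Prod>i\<in>?V. Ob i (add0 r1 r2 i) (add0 t1 t2 i)) =
      (\<Prod>i\<in>V1. Ob i (add0 r1 r2 i) (add0 t1 t2 i)) * (\<Prod>i\<in>V2. Ob i (add0 r1 r2 i) (add0 t1 t2 i))"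
      by (rule prod.union_disjoint) (use V disj in auto)
    also have "(\<Prod>i\<in>V1. Ob i (add0 r1 r2 i) (add0 t1 t2 i)) = (\<Prod>i\<in>V1. Ob i (r1 i) (t1 i))"
    proof (rule prod.cong[OF refl])
      fix i assume "i \<in> V1"
      hence "i \<notin> V2" using disj by auto
      hence "r2 i = 0" "t2 i = 0" using s by (auto simp: conf0_def)
      thus "Ob i (add0 r1 r2 i) (add0 t1 t2 i) = Ob i (r1 i) (t1 i)" by (simp add: add0_def)
    qed
    also have "(\<Prod>i\<in>V2. Ob i (add0 r1 r2 i) (add0 t1 t2 i)) = (\<Prod>i\<in>V2. Ob i (r2 i) (t2 i))"
    proof (rule prod.cong[OF refl])
      fix i assume "i \<in> V2"
      hence "i \<notin> V1" using disj by auto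
      hence "r1 i = 0" "t1 i = 0" using s by (auto simp: conf0_def)
      thus "Ob i (add0 r1 r2 i) (add0 t1 t2 i) = Ob i (r2 i) (t2 i)" by (simp add: add0_def)
    qed
    finally show ?thesis .
  qed
  have ss: "(\<Sum>r\<in>conf0 m ?V. f r) = (\<Sum>r1\<in>conf0 m V1. \<Sum>r2\<in>conf0 m V2. f (add0 r1 r2))" for f :: "_ \<Rightarrow> complex"
    by (subst sum.reindex_bij_betw[OF bij, symmetric]) (simp add: sum.cartesian_product case_prod_beta)
  let ?a = "\<lambda>r t. op_exp (conf0 m V1) (-d) (Ham V1 V1) r t * (\<Prod>i\<in>V1. Ob i (t i) (r i))"
  let ?b = "\<lambda>r t. op_exp (conf0 m V2) (-d) (Ham V2 V2) r t * (\<Prod>i\<in>V2. Ob i (t i) (r i))"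
  have "Tr_obs d Ob ?V = (\<Sum>r1\<in>conf0 m V1. \<Sum>r2\<in>conf0 m V2. \<Sum>t1\<in>conf0 m V1. \<Sum>t2\<in>conf0 m V2. ?a r1 t1 * ?b r2 t2)"
    unfolding Tr_obs_def op_trace_def op_mult_def ss
    by (intro sum.cong refl) (simp add: E P mult_ac)
  also have "\<dots> = (\<Sum>r1\<in>conf0 m V1. \<Sum>r2\<in>conf0 m V2. (\<Sum>t1\<in>conf0 m V1. ?a r1 t1) * (\<Sum>t2\<in>conf0 m V2. ?b r2 t2))"
    by (simp only: sum_product)
  also have "\<dots> = (\<Sum>r1\<in>conf0 m V1. \<Sum>t1\<in>conf0 m V1. ?a r1 t1) * (\<Sum>r2\<in>conf0 m V2. \<Sum>t2\<in>conf0 m V2. ?b r2 t2)"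
    by (simp only: sum_product)
  finally show ?thesis unfolding Tr_obs_def op_trace_def op_mult_def .
qed

end

section \<open>Unitary changes of basis\<close>

text \<open>The adjoint of \<open>U\<close>, times \<open>M\<close>, times \<open>U\<close>. Rows
  and columns of \<open>U\<close> are indexed by different sets: the given configurations are
  undefined outside the volume, the new ones are 0 there.\<close>

definition conjop :: "(('a \<Rightarrow> nat) \<Rightarrow> ('a \<Rightarrow> nat) \<Rightarrow> complex) \<Rightarrow> ('a \<Rightarrow> nat) set \<Rightarrow> 'a op \<Rightarrow> 'a op" where
  "conjop U D M s t = (\<Sum>r\<in>D. \<Sum>r'\<in>D. cnj (U r s) * M r r' * U r' t)"

lemma conjop_cong:
  "(\<And>r r'. r \<in> D \<Longrightarrow> r' \<in> D \<Longrightarrow> M r r' = N r r') \<Longrightarrow> conjop U D M s t = conjop U D N s t"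
  by (simp add: conjop_def)

lemma conjop_sum: "conjop U D (\<lambda>s t. \<Sum>i\<in>I. M i s t) s t = (\<Sum>i\<in>I. conjop U D (M i) s t)"
proof -
  have "conjop U D (\<lambda>s t. \<Sum>i\<in>I. M i s t) s t = (\<Sum>r\<in>D. \<Sum>i\<in>I. \<Sum>r'\<in>D. cnj (U r s) * M i r r' * U r' t)"
    unfolding conjop_def sum_distrib_left sum_distrib_right by (rule sum.cong[OF refl]) (rule sum.swap)
  thus ?thesis unfolding conjop_def by (subst (asm) sum.swap)
qed

lemma conjop_add: "conjop U D (\<lambda>s t. M s t + N s t) s t = conjop U D M s t + conjop U D N s t"
  by (simp add: conjop_def distrib_left distrib_right sum.distrib)

lemma conjop_diff: "conjop U D (\<lambda>s t. M s t - N s t) s t = conjop U D M s t - conjop U D N s t"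
  by (simp add: conjop_def left_diff_distrib right_diff_distrib sum_subtractf)

lemma conjop_cmult: "conjop U D (\<lambda>s t. c * M s t) s t = c * conjop U D M s t"
  by (simp add: conjop_def sum_distrib_left mult_ac)

lemma conjop_zero: "op_zero_on D M \<Longrightarrow> conjop U D M s t = 0"
  by (simp add: conjop_def op_zero_on_def)

lemma conjop_hermitian: "op_hermitian D M \<Longrightarrow> op_hermitian D' (conjop U D M)"
proof (rule op_hermitianI)
  fix s t assume h: "op_hermitian D M"
  have "cnj (conjop U D M s t) = (\<Sum>r\<in>D. \<Sum>r'\<in>D. cnj (U r' t) * M r' r * U r s)"
    unfolding conjop_def cnj_sum complex_cnj_mult complex_cnj_cnj
    by (intro sum.cong refl) (simp add: op_hermitianD[OF h] mult_ac)
  also have "\<dots> = conjop U D M t s" unfolding conjop_def by (rule sum.swap)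
  finally show "conjop U D M t s = cnj (conjop U D M s t)" by simp
qed

locale unitary_kernel =
  fixes U :: "('a \<Rightarrow> nat) \<Rightarrow> ('a \<Rightarrow> nat) \<Rightarrow> complex" and D D' :: "('a \<Rightarrow> nat) set"
  assumes fin: "finite D" "finite D'"
    and U1: "\<And>s t. s \<in> D' \<Longrightarrow> t \<in> D' \<Longrightarrow> (\<Sum>r\<in>D. cnj (U r s) * U r t) = (if s = t then 1 else 0)"
    and U2: "\<And>r r'. r \<in> D \<Longrightarrow> r' \<in> D \<Longrightarrow> (\<Sum>s\<in>D'. U r s * cnj (U r' s)) = (if r = r' then 1 else 0)"
begin

definition Uv :: "(('a \<Rightarrow> nat) \<Rightarrow> complex) \<Rightarrow> ('a \<Rightarrow> nat) \<Rightarrow> complex" where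
  "Uv v r = (\<Sum>s\<in>D'. U r s * v s)"

lemma ip_Uv_right: "ip D w (Uv v) = ip D' (\<lambda>s. \<Sum>r\<in>D. cnj (U r s) * w r) v"
proof -
  have "ip D w (Uv v) = (\<Sum>r\<in>D. \<Sum>s\<in>D'. cnj (w r) * (U r s * v s))" by (simp add: ip_def Uv_def sum_distrib_left)
  also have "\<dots> = (\<Sum>s\<in>D'. \<Sum>r\<in>D. cnj (w r) * (U r s * v s))" by (rule sum.swap)
  finally show ?thesis by (simp add: ip_def sum_distrib_left sum_distrib_right mult_ac)
qed

lemma Uadj_Uv: "x \<in> D' \<Longrightarrow> (\<Sum>r\<in>D. cnj (U r x) * Uv v r) = v x"
proof -
  assume s: "x \<in> D'"
  have "(\<Sum>r\<in>D. cnj (U r x) * Uv v r) = (\<Sum>r\<in>D. \<Sum>t\<in>D'. (cnj (U r x) * U r t) * v t)"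
    by (simp add: Uv_def sum_distrib_left mult_ac)
  also have "\<dots> = (\<Sum>t\<in>D'. (\<Sum>r\<in>D. cnj (U r x) * U r t) * v t)"
    unfolding sum_distrib_right by (rule sum.swap)
  also have "\<dots> = (\<Sum>t\<in>D'. if x = t then v t else 0)" using s by (intro sum.cong refl) (simp add: U1)
  also have "\<dots> = v x" using s fin by simp
  finally show ?thesis .
qed

lemma ip_Uv: "ip D (Uv v) (Uv w) = ip D' v w"
  unfolding ip_Uv_right by (simp add: ip_def Uadj_Uv)

lemma vec_norm_Uv: "vec_norm D (Uv v) = vec_norm D' v"
proof -
  have "complex_of_real ((vec_norm D (Uv v))\<^sup>2) = complex_of_real ((vec_norm D' v)\<^sup>2)"
    unfolding ip_self[symmetric] by (rule ip_Uv)
  hence "(vec_norm D (Uv v))\<^sup>2 = (vec_norm D' v)\<^sup>2" using of_real_eq_iff by blast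
  thus ?thesis by (simp add: power2_eq_iff_nonneg)
qed

lemma apply_conjop: "op_apply D' (conjop U D M) v s = (\<Sum>r\<in>D. cnj (U r s) * op_apply D M (Uv v) r)"
proof -
  have "op_apply D' (conjop U D M) v s = (\<Sum>t\<in>D'. \<Sum>r\<in>D. \<Sum>r'\<in>D. cnj (U r s) * M r r' * U r' t * v t)"
    by (simp add: op_apply_def conjop_def sum_distrib_right)
  also have "\<dots> = (\<Sum>r\<in>D. \<Sum>t\<in>D'. \<Sum>r'\<in>D. cnj (U r s) * M r r' * U r' t * v t)" by (rule sum.swap)
  also have "\<dots> = (\<Sum>r\<in>D. \<Sum>r'\<in>D. \<Sum>t\<in>D'. cnj (U r s) * M r r' * U r' t * v t)"
    by (rule sum.cong[OF refl]) (rule sum.swap)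
  also have "\<dots> = (\<Sum>r\<in>D. cnj (U r s) * op_apply D M (Uv v) r)"
    by (simp add: op_apply_def Uv_def sum_distrib_left mult_ac)
  finally show ?thesis .
qed

lemma form_conjop: "ip D' v (op_apply D' (conjop U D M) v) = ip D (Uv v) (op_apply D M (Uv v))"
proof -
  have "ip D' v (op_apply D' (conjop U D M) v) = cnj (ip D' (\<lambda>s. \<Sum>r\<in>D. cnj (U r s) * op_apply D M (Uv v) r) v)"
    by (simp add: cnj_ip) (simp add: ip_def apply_conjop)
  also have "\<dots> = cnj (ip D (op_apply D M (Uv v)) (Uv v))" by (simp add: ip_Uv_right)
  finally show ?thesis by (simp add: cnj_ip)
qed

text \<open>Duality: pair \<open>w\<close> with the image under \<open>U\<close> of its own adjoint
  image, and apply Cauchy-Schwarz.\<close>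

lemma vec_norm_Uadj_le: "vec_norm D' (\<lambda>s. \<Sum>r\<in>D. cnj (U r s) * w r) \<le> vec_norm D w"
proof -
  let ?a = "\<lambda>s. \<Sum>r\<in>D. cnj (U r s) * w r"
  have "ip D w (Uv ?a) = complex_of_real ((vec_norm D' ?a)\<^sup>2)" by (simp add: ip_Uv_right ip_self)
  hence "(vec_norm D' ?a)\<^sup>2 = cmod (ip D w (Uv ?a))" by (simp add: norm_power)
  also have "\<dots> \<le> vec_norm D w * vec_norm D (Uv ?a)" by (rule ip_le)
  also have "\<dots> = vec_norm D w * vec_norm D' ?a" by (simp add: vec_norm_Uv)
  finally have "vec_norm D' ?a * vec_norm D' ?a \<le> vec_norm D w * vec_norm D' ?a" by (simp add: power2_eq_square)
  thus ?thesis using vec_norm_nonneg[of D' ?a] vec_norm_nonneg[of D w]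
    by (cases "vec_norm D' ?a = 0") (auto simp: mult_le_cancel_right)
qed

lemma ob_conjop:
  assumes "ob D c M"
  shows "ob D' c (conjop U D M)"
  unfolding ob_def
proof (intro conjI allI)
  fix v
  have "vec_norm D' (op_apply D' (conjop U D M) v) = vec_norm D' (\<lambda>s. \<Sum>r\<in>D. cnj (U r s) * op_apply D M (Uv v) r)"
    by (rule vec_norm_cong) (rule apply_conjop)
  also have "\<dots> \<le> vec_norm D (op_apply D M (Uv v))" by (rule vec_norm_Uadj_le)
  also have "\<dots> \<le> c * vec_norm D (Uv v)" by (rule obD[OF assms])
  finally show "vec_norm D' (op_apply D' (conjop U D M) v) \<le> c * vec_norm D' v" by (simp add: vec_norm_Uv)
qed (use assms in \<open>simp add: ob_def\<close>)

lemma conjop_mult: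
  "conjop U D (op_mult D M N) s t = op_mult D' (conjop U D M) (conjop U D N) s t"
proof -
  let ?l = "\<lambda>v1. \<Sum>v\<in>D. cnj (U v s) * M v v1" and ?r = "\<lambda>v2. \<Sum>v'\<in>D. N v2 v' * U v' t"
  have L: "conjop U D M s \<upsilon> = (\<Sum>v1\<in>D. ?l v1 * U v1 \<upsilon>)" for \<upsilon>
    unfolding conjop_def sum_distrib_right by (rule sum.swap)
  have R: "conjop U D N \<upsilon> t = (\<Sum>v2\<in>D. cnj (U v2 \<upsilon>) * ?r v2)" for \<upsilon>
    unfolding conjop_def sum_distrib_left by (simp add: mult.assoc)
  have "op_mult D' (conjop U D M) (conjop U D N) s t = (\<Sum>\<upsilon>\<in>D'. \<Sum>v1\<in>D. \<Sum>v2\<in>D. (U v1 \<upsilon> * cnj (U v2 \<upsilon>)) * (?l v1 * ?r v2))"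
    unfolding op_mult_def L R
    by (rule sum.cong[OF refl], subst sum_product, intro sum.cong refl) (simp only: mult_ac)
  also have "\<dots> = (\<Sum>v1\<in>D. \<Sum>\<upsilon>\<in>D'. \<Sum>v2\<in>D. (U v1 \<upsilon> * cnj (U v2 \<upsilon>)) * (?l v1 * ?r v2))" by (rule sum.swap)
  also have "\<dots> = (\<Sum>v1\<in>D. \<Sum>v2\<in>D. (\<Sum>\<upsilon>\<in>D'. U v1 \<upsilon> * cnj (U v2 \<upsilon>)) * (?l v1 * ?r v2))"
    unfolding sum_distrib_right by (rule sum.cong[OF refl]) (rule sum.swap)
  also have "\<dots> = (\<Sum>v1\<in>D. \<Sum>v2\<in>D. if v1 = v2 then ?l v1 * ?r v2 else 0)"
    by (intro sum.cong refl) (simp add: U2)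
  also have "\<dots> = (\<Sum>v1\<in>D. ?l v1 * ?r v1)" using fin by (intro sum.cong refl) simp
  also have "\<dots> = (\<Sum>v1\<in>D. \<Sum>v\<in>D. \<Sum>v'\<in>D. cnj (U v s) * (M v v1 * N v1 v') * U v' t)"
    unfolding sum_product by (simp only: mult_ac)
  also have "\<dots> = (\<Sum>v\<in>D. \<Sum>v1\<in>D. \<Sum>v'\<in>D. cnj (U v s) * (M v v1 * N v1 v') * U v' t)" by (rule sum.swap)
  also have "\<dots> = (\<Sum>v\<in>D. \<Sum>v'\<in>D. \<Sum>v1\<in>D. cnj (U v s) * (M v v1 * N v1 v') * U v' t)"
    by (rule sum.cong[OF refl]) (rule sum.swap)
  also have "\<dots> = conjop U D (op_mult D M N) s t"
    by (simp add: conjop_def op_mult_def sum_distrib_left sum_distrib_right)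
  finally show ?thesis by simp
qed

lemma conjop_id: "s \<in> D' \<Longrightarrow> t \<in> D' \<Longrightarrow> conjop U D op_id s t = op_id s t"
proof -
  assume st: "s \<in> D'" "t \<in> D'"
  have "conjop U D op_id s t = (\<Sum>r\<in>D. \<Sum>r'\<in>D. if r = r' then cnj (U r s) * U r' t else 0)"
    unfolding conjop_def by (intro sum.cong refl) (simp add: op_id_def)
  also have "\<dots> = (\<Sum>r\<in>D. cnj (U r s) * U r t)" using fin by (intro sum.cong refl) simp
  finally show ?thesis using st by (simp add: U1 op_id_def)
qed

lemma conjop_pow: "s \<in> D' \<Longrightarrow> t \<in> D' \<Longrightarrow> conjop U D (op_pow D M n) s t = op_pow D' (conjop U D M) n s t"
proof (induction n arbitrary: s)
  case (Suc n)
  have "conjop U D (op_pow D M (Suc n)) s t = op_mult D' (conjop U D M) (conjop U D (op_pow D M n)) s t"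
    unfolding op_pow.simps by (rule conjop_mult)
  also have "\<dots> = op_mult D' (conjop U D M) (op_pow D' (conjop U D M) n) s t"
    by (rule op_mult_cong) (auto simp: Suc)
  finally show ?case by simp
qed (simp add: conjop_id)

lemma conjop_exp:
  assumes st: "x \<in> D'" "z \<in> D'"
  shows "conjop U D (op_exp D t M) x z = op_exp D' t (conjop U D M) x z"
proof -
  have gb: "geom_bounded (\<lambda>n. op_pow D M n r r')" if "r \<in> D" "r' \<in> D" for r r'
    by (rule geom_bounded_pow) (use that fin in auto)
  have s: "(\<lambda>n. \<Sum>r\<in>D. \<Sum>r'\<in>D. cnj (U r x) * (complex_of_real (t ^ n / fact n) * op_pow D M n r r') * U r' z) sums
     (\<Sum>r\<in>D. \<Sum>r'\<in>D. cnj (U r x) * egf t (\<lambda>n. op_pow D M n r r') * U r' z)"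
    by (intro sums_sum sums_mult sums_mult2 egf_sums gb)
  have "(\<Sum>r\<in>D. \<Sum>r'\<in>D. cnj (U r x) * (complex_of_real (t ^ n / fact n) * op_pow D M n r r') * U r' z) =
     complex_of_real (t ^ n / fact n) * op_pow D' (conjop U D M) n x z" for n
    unfolding conjop_pow[OF st, symmetric] conjop_cmult[symmetric] by (simp add: conjop_def)
  with s have "(\<lambda>n. complex_of_real (t ^ n / fact n) * op_pow D' (conjop U D M) n x z) sums conjop U D (op_exp D t M) x z"
    by (simp add: conjop_def op_exp_egf)
  thus ?thesis by (simp add: op_exp_def sums_iff)
qed

lemma trace_conjop: "op_trace D' (conjop U D M) = op_trace D M"
proof -
  have "op_trace D' (conjop U D M) = (\<Sum>s\<in>D'. \<Sum>r\<in>D. \<Sum>r'\<in>D. M r r' * (U r' s * cnj (U r s)))"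
    unfolding op_trace_def conjop_def by (simp only: mult_ac)
  also have "\<dots> = (\<Sum>r\<in>D. \<Sum>s\<in>D'. \<Sum>r'\<in>D. M r r' * (U r' s * cnj (U r s)))" by (rule sum.swap)
  also have "\<dots> = (\<Sum>r\<in>D. \<Sum>r'\<in>D. M r r' * (\<Sum>s\<in>D'. U r' s * cnj (U r s)))"
    unfolding sum_distrib_left by (rule sum.cong[OF refl]) (rule sum.swap)
  also have "\<dots> = (\<Sum>r\<in>D. \<Sum>r'\<in>D. if r' = r then M r r' else 0)"
    by (intro sum.cong refl) (simp add: U2)
  also have "\<dots> = op_trace D M" unfolding op_trace_def using fin by (intro sum.cong refl) simp
  finally show ?thesis .
qed

end

subsection \<open>Product bases\<close>

definition Uprod :: "smat \<Rightarrow> 'a set \<Rightarrow> ('a \<Rightarrow> nat) \<Rightarrow> ('a \<Rightarrow> nat) \<Rightarrow> complex" where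
  "Uprod u V r s = (\<Prod>i\<in>V. u (r i) (s i))"

definition smat_conj :: "smat \<Rightarrow> nat \<Rightarrow> smat \<Rightarrow> smat" where
  "smat_conj u m M a b = (\<Sum>k<m. \<Sum>l<m. cnj (u k a) * M k l * u l b)"

definition mg :: "'a set \<Rightarrow> ('a \<Rightarrow> nat) \<Rightarrow> ('a \<Rightarrow> nat) \<Rightarrow> 'a \<Rightarrow> nat" where
  "mg A \<alpha> r i = (if i \<in> A then \<alpha> i else r i)"

lemma bij_mg:
  assumes "A \<subseteq> V"
  shows "bij_betw (\<lambda>(\<alpha>, r). mg A \<alpha> r) (confs m A \<times> confs m (V - A)) (confs m V)"
proof (rule bij_betw_byWitness[where f'="\<lambda>s. (restrict s A, restrict s (V - A))"])
  show "\<forall>a\<in>confs m A \<times> confs m (V - A). (restrict (case a of (\<alpha>, r) \<Rightarrow> mg A \<alpha> r) A, restrict (case a of (\<alpha>, r) \<Rightarrow> mg A \<alpha> r) (V - A)) = a"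
    by (auto simp: confs_def mg_def fun_eq_iff restrict_def PiE_iff extensional_def)
  show "\<forall>a'\<in>confs m V. (case (restrict a' A, restrict a' (V - A)) of (\<alpha>, r) \<Rightarrow> mg A \<alpha> r) = a'"
    using assms by (auto simp: confs_def mg_def fun_eq_iff restrict_def PiE_iff extensional_def)
  show "(\<lambda>(\<alpha>, r). mg A \<alpha> r) ` (confs m A \<times> confs m (V - A)) \<subseteq> confs m V"
    using assms by (auto simp: confs_def mg_def PiE_iff extensional_def)
  show "(\<lambda>s. (restrict s A, restrict s (V - A))) ` confs m V \<subseteq> confs m A \<times> confs m (V - A)"
    using assms by (auto simp: confs_def PiE_iff)
qed

lemma finite_confs: "finite V \<Longrightarrow> finite (confs m V)"
  unfolding confs_def by (intro finite_PiE) auto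

lemma sum_prod_confs:
  fixes f :: "'a \<Rightarrow> nat \<Rightarrow> complex"
  assumes "finite V"
  shows "(\<Sum>r\<in>confs m V. \<Prod>i\<in>V. f i (r i)) = (\<Prod>i\<in>V. \<Sum>k<m. f i k)"
  unfolding confs_def by (rule prod_sum_PiE[symmetric]) (use assms in auto)

lemma sum_prod_conf0:
  fixes f :: "'a \<Rightarrow> nat \<Rightarrow> complex"
  assumes "finite V"
  shows "(\<Sum>s\<in>conf0 m V. \<Prod>i\<in>V. f i (s i)) = (\<Prod>i\<in>V. \<Sum>k<m. f i k)"
proof -
  have bij: "bij_betw (\<lambda>s. restrict s V) (conf0 m V) (confs m V)"
    by (rule bij_betw_byWitness[where f'="\<lambda>f i. if i \<in> V then f i else 0"])
       (auto simp: conf0_def confs_def fun_eq_iff PiE_iff extensional_def)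
  have "(\<Sum>s\<in>conf0 m V. \<Prod>i\<in>V. f i (s i)) = (\<Sum>s\<in>conf0 m V. \<Prod>i\<in>V. f i (restrict s V i))"
    by (intro sum.cong refl prod.cong) auto
  also have "\<dots> = (\<Sum>r\<in>confs m V. \<Prod>i\<in>V. f i (r i))" by (rule sum.reindex_bij_betw[OF bij])
  finally show ?thesis by (simp add: sum_prod_confs[OF assms])
qed

lemma prod_delta:
  assumes "finite V"
  shows "(\<Prod>i\<in>V. if f i = g i then 1 else 0 :: complex) = (if \<forall>i\<in>V. f i = g i then 1 else 0)"
  using assms by (induction V rule: finite_induct) auto

lemma unitary_Uprod:
  assumes V: "finite V"
    and u1: "\<And>a b. a < m \<Longrightarrow> b < m \<Longrightarrow> (\<Sum>k<m. cnj (u k a) * u k b) = (if a = b then 1 else 0)"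
    and u2: "\<And>a b. a < m \<Longrightarrow> b < m \<Longrightarrow> (\<Sum>k<m. u a k * cnj (u b k)) = (if a = b then 1 else 0)"
  shows "unitary_kernel (Uprod u V) (confs m V) (conf0 m V)"
proof
  show "finite (confs m V)" "finite (conf0 m V)" using V by (auto intro: finite_confs finite_conf0)
  fix s t assume st: "s \<in> conf0 m V" "t \<in> conf0 m V"
  have "(\<Sum>v\<in>confs m V. cnj (Uprod u V v s) * Uprod u V v t) = (\<Sum>v\<in>confs m V. \<Prod>i\<in>V. cnj (u (v i) (s i)) * u (v i) (t i))"
    by (simp add: Uprod_def prod.distrib)
  also have "\<dots> = (\<Prod>i\<in>V. \<Sum>k<m. cnj (u k (s i)) * u k (t i))" by (rule sum_prod_confs[OF V])
  also have "\<dots> = (\<Prod>i\<in>V. if s i = t i then 1 else 0)"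
    using st by (intro prod.cong refl u1) (auto simp: conf0_def)
  also have "\<dots> = (if \<forall>i\<in>V. s i = t i then 1 else 0)" by (rule prod_delta[OF V])
  also have "(\<forall>i\<in>V. s i = t i) \<longleftrightarrow> s = t" using st by (auto simp: conf0_def fun_eq_iff)
  finally show "(\<Sum>v\<in>confs m V. cnj (Uprod u V v s) * Uprod u V v t) = (if s = t then 1 else 0)" .
next
  fix v v' assume r: "v \<in> confs m V" "v' \<in> confs m V"
  have "(\<Sum>s\<in>conf0 m V. Uprod u V v s * cnj (Uprod u V v' s)) = (\<Sum>s\<in>conf0 m V. \<Prod>i\<in>V. u (v i) (s i) * cnj (u (v' i) (s i)))"
    by (simp add: Uprod_def prod.distrib)
  also have "\<dots> = (\<Prod>i\<in>V. \<Sum>k<m. u (v i) k * cnj (u (v' i) k))" by (rule sum_prod_conf0[OF V])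
  also have "\<dots> = (\<Prod>i\<in>V. if v i = v' i then 1 else 0)"
    using r by (intro prod.cong refl u2) (auto simp: confs_def)
  also have "\<dots> = (if \<forall>i\<in>V. v i = v' i then 1 else 0)" by (rule prod_delta[OF V])
  also have "(\<forall>i\<in>V. v i = v' i) \<longleftrightarrow> v = v'" using r by (auto simp: confs_def PiE_iff extensional_def fun_eq_iff)
  finally show "(\<Sum>s\<in>conf0 m V. Uprod u V v s * cnj (Uprod u V v' s)) = (if v = v' then 1 else 0)" .
qed

lemma conjop_tensor:
  assumes V: "finite V"
  shows "conjop (Uprod u V) (confs m V) (op_tensor V M) s t = (\<Prod>i\<in>V. smat_conj u m (M i) (s i) (t i))"
proof -
  have "conjop (Uprod u V) (confs m V) (op_tensor V M) s t =
     (\<Sum>r\<in>confs m V. \<Sum>r'\<in>confs m V. \<Prod>i\<in>V. cnj (u (r i) (s i)) * M i (r i) (r' i) * u (r' i) (t i))"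
    by (simp add: conjop_def Uprod_def op_tensor_def prod.distrib)
  also have "\<dots> = (\<Sum>r\<in>confs m V. \<Prod>i\<in>V. \<Sum>l<m. cnj (u (r i) (s i)) * M i (r i) l * u l (t i))"
    by (intro sum.cong refl sum_prod_confs[OF V])
  also have "\<dots> = (\<Prod>i\<in>V. \<Sum>k<m. \<Sum>l<m. cnj (u k (s i)) * M i k l * u l (t i))"
    by (rule sum_prod_confs[OF V])
  finally show ?thesis by (simp add: smat_conj_def)
qed

text \<open>Orthonormality of the columns of \<open>u\<close> keeps the identity off
  \<open>A\<close> intact, and the factors of the product basis at the sites of \<open>A\<close>
  transform \<open>M\<close>.\<close>

lemma conjop_embed:
  assumes V: "finite V" "A \<subseteq> V" and st: "s \<in> conf0 m V" "t \<in> conf0 m V"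
    and u1: "\<And>a b. a < m \<Longrightarrow> b < m \<Longrightarrow> (\<Sum>k<m. cnj (u k a) * u k b) = (if a = b then 1 else 0)"
  shows "conjop (Uprod u V) (confs m V) (op_embed V A M) s t = ext0 A (conjop (Uprod u A) (confs m A) M) s t"
proof -
  have fA: "finite A" "finite (V - A)" using V finite_subset by auto
  let ?B = "V - A"
  have split: "(\<Sum>r\<in>confs m V. f r) = (\<Sum>\<alpha>\<in>confs m A. \<Sum>d\<in>confs m ?B. f (mg A \<alpha> d))" for f :: "('a \<Rightarrow> nat) \<Rightarrow> complex"
    by (subst sum.reindex_bij_betw[OF bij_mg[OF V(2)], symmetric]) (simp add: sum.cartesian_product case_prod_beta)
  have U: "Uprod u V (mg A \<alpha> d) s = Uprod u A \<alpha> s * Uprod u ?B d s" for \<alpha> d s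
  proof -
    have "Uprod u V (mg A \<alpha> d) s = Uprod u (A \<union> ?B) (mg A \<alpha> d) s" using V by (simp add: Un_absorb1)
    also have "\<dots> = Uprod u A (mg A \<alpha> d) s * Uprod u ?B (mg A \<alpha> d) s"
      unfolding Uprod_def by (rule prod.union_disjoint) (use fA in auto)
    also have "\<dots> = Uprod u A \<alpha> s * Uprod u ?B d s" by (simp add: Uprod_def mg_def)
    finally show ?thesis .
  qed
  have E: "op_embed V A M (mg A \<alpha> d) (mg A \<alpha>' d') = (if d = d' then M \<alpha> \<alpha>' else 0)"
    if "\<alpha> \<in> confs m A" "\<alpha>' \<in> confs m A" "d \<in> confs m ?B" "d' \<in> confs m ?B" for \<alpha> \<alpha>' d d'
  proof -
    have "restrict (mg A x z) A = x" "restrict (mg A x z) ?B = z" if "x \<in> confs m A" "z \<in> confs m ?B" for x z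
      using that by (auto simp: confs_def mg_def fun_eq_iff restrict_def PiE_iff extensional_def)
    thus ?thesis using that by (simp add: op_embed_def)
  qed
  have "conjop (Uprod u V) (confs m V) (op_embed V A M) s t =
    (\<Sum>\<alpha>\<in>confs m A. \<Sum>d\<in>confs m ?B. \<Sum>\<alpha>'\<in>confs m A. \<Sum>d'\<in>confs m ?B.
      if d = d' then (cnj (Uprod u A \<alpha> s) * M \<alpha> \<alpha>' * Uprod u A \<alpha>' t) * (cnj (Uprod u ?B d s) * Uprod u ?B d' t) else 0)"
    unfolding conjop_def split by (intro sum.cong refl) (simp add: E U mult_ac)
  also have "\<dots> = (\<Sum>\<alpha>\<in>confs m A. \<Sum>d\<in>confs m ?B. \<Sum>\<alpha>'\<in>confs m A.
      (cnj (Uprod u A \<alpha> s) * M \<alpha> \<alpha>' * Uprod u A \<alpha>' t) * (cnj (Uprod u ?B d s) * Uprod u ?B d t))"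
    using finite_confs[OF fA(2), of m] by (intro sum.cong refl) simp
  also have "\<dots> = (\<Sum>\<alpha>\<in>confs m A. \<Sum>\<alpha>'\<in>confs m A. \<Sum>d\<in>confs m ?B.
      (cnj (Uprod u A \<alpha> s) * M \<alpha> \<alpha>' * Uprod u A \<alpha>' t) * (cnj (Uprod u ?B d s) * Uprod u ?B d t))"
    by (rule sum.cong[OF refl]) (rule sum.swap)
  also have "\<dots> = conjop (Uprod u A) (confs m A) M s t * (\<Sum>d\<in>confs m ?B. cnj (Uprod u ?B d s) * Uprod u ?B d t)"
    unfolding conjop_def sum_distrib_left[symmetric] sum_distrib_right[symmetric] ..
  also have "(\<Sum>d\<in>confs m ?B. cnj (Uprod u ?B d s) * Uprod u ?B d t) = (if \<forall>i\<in>?B. s i = t i then 1 else 0)"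
  proof -
    have "(\<Sum>d\<in>confs m ?B. cnj (Uprod u ?B d s) * Uprod u ?B d t) = (\<Sum>d\<in>confs m ?B. \<Prod>i\<in>?B. cnj (u (d i) (s i)) * u (d i) (t i))"
      by (simp add: Uprod_def prod.distrib)
    also have "\<dots> = (\<Prod>i\<in>?B. \<Sum>k<m. cnj (u k (s i)) * u k (t i))" by (rule sum_prod_confs[OF fA(2)])
    also have "\<dots> = (\<Prod>i\<in>?B. if s i = t i then 1 else 0)"
      using st by (intro prod.cong refl u1) (auto simp: conf0_def)
    also have "\<dots> = (if \<forall>i\<in>?B. s i = t i then 1 else 0)" by (rule prod_delta[OF fA(2)])
    finally show ?thesis .
  qed
  also have "(\<forall>i\<in>?B. s i = t i) \<longleftrightarrow> (\<forall>i. i \<notin> A \<longrightarrow> s i = t i)"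
  proof -
    have "s i = t i" if "i \<notin> V" for i using st that by (auto simp: conf0_def)
    thus ?thesis by blast
  qed
  also have "conjop (Uprod u A) (confs m A) M s t = conjop (Uprod u A) (confs m A) M (restr0 s A) (restr0 t A)"
  proof -
    have "Uprod u A r s = Uprod u A r (restr0 s A)" for r s by (simp add: Uprod_def restr0_def)
    thus ?thesis unfolding conjop_def by simp
  qed
  finally show ?thesis by (auto simp: ext0_def)
qed

section \<open>Reduction of the spin system to the vacuum basis\<close>

text \<open>A nonzero column of \<open>P\<close>, normalized, is an eigenvector by idempotence. The
  squared Hilbert-Schmidt norm of the difference \<open>T\<close> between \<open>P\<close> and the
  projection onto \<open>\<phi>\<close> expands to 1 - 1 - 1 + 1 = 0; the trace condition provides
  the first 1.\<close>

lemma rank_one_proj_vector: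
  assumes "rank_one_proj m P"
  obtains \<phi> where "(\<Sum>a<m. (cmod (\<phi> a))\<^sup>2) = 1" "\<And>a b. a < m \<Longrightarrow> b < m \<Longrightarrow> P a b = \<phi> a * cnj (\<phi> b)"
proof -
  have herm: "cnj (P a b) = P b a" if "a < m" "b < m" for a b
    using assms that unfolding rank_one_proj_def orth_proj_def smat_hermitian_def by metis
  have idem: "(\<Sum>k<m. P a k * P k b) = P a b" if "a < m" "b < m" for a b
    using assms that by (auto simp: rank_one_proj_def orth_proj_def smat_eq_def smat_mult_def)
  have tr: "(\<Sum>a<m. P a a) = 1" using assms by (simp add: rank_one_proj_def smat_trace_def)
  then obtain j where j: "j < m" "P j j \<noteq> 0" by (metis (no_types, lifting) lessThan_iff sum.neutral zero_neq_one)
  define r where "r = (\<Sum>k<m. (cmod (P k j))\<^sup>2)"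
  have "0 < (cmod (P j j))\<^sup>2" using j by simp
  also have "\<dots> \<le> r" unfolding r_def by (rule member_le_sum) (use j in auto)
  finally have r: "0 < r" .
  define \<phi> where "\<phi> k = P k j / complex_of_real (sqrt r)" for k
  have n1: "(\<Sum>a<m. (cmod (\<phi> a))\<^sup>2) = 1"
    using r by (simp add: \<phi>_def norm_divide power_divide sum_divide_distrib[symmetric] r_def[symmetric])
  have n1c: "(\<Sum>a<m. \<phi> a * cnj (\<phi> a)) = 1"
    using n1 by (simp add: complex_norm_square[symmetric] del: of_real_power) (metis of_real_1 of_real_sum)
  have eig: "(\<Sum>b<m. P a b * \<phi> b) = \<phi> a" if "a < m" for a
  proof -
    have "(\<Sum>b<m. P a b * \<phi> b) = (\<Sum>b<m. P a b * P b j) / complex_of_real (sqrt r)"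
      by (simp add: \<phi>_def sum_divide_distrib)
    thus ?thesis using idem[OF that j(1)] by (simp add: \<phi>_def)
  qed
  define T where "T a b = P a b - \<phi> a * cnj (\<phi> b)" for a b
  have PP: "(\<Sum>a<m. \<Sum>b<m. P a b * cnj (P a b)) = 1"
  proof -
    have "(\<Sum>a<m. \<Sum>b<m. P a b * cnj (P a b)) = (\<Sum>a<m. \<Sum>b<m. P a b * P b a)"
      by (intro sum.cong refl) (simp add: herm)
    also have "\<dots> = 1" using idem tr by simp
    finally show ?thesis .
  qed
  have PQ: "(\<Sum>a<m. \<Sum>b<m. P a b * cnj (\<phi> a * cnj (\<phi> b))) = 1"
  proof -
    have "(\<Sum>a<m. \<Sum>b<m. P a b * cnj (\<phi> a * cnj (\<phi> b))) = (\<Sum>a<m. cnj (\<phi> a) * (\<Sum>b<m. P a b * \<phi> b))"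
      by (simp add: sum_distrib_left mult_ac)
    also have "\<dots> = (\<Sum>a<m. \<phi> a * cnj (\<phi> a))" by (intro sum.cong refl, subst eig) (auto simp: mult.commute)
    finally show ?thesis using n1c by simp
  qed
  have QP: "(\<Sum>a<m. \<Sum>b<m. (\<phi> a * cnj (\<phi> b)) * cnj (P a b)) = 1"
  proof -
    have "cnj (\<Sum>a<m. \<Sum>b<m. P a b * cnj (\<phi> a * cnj (\<phi> b))) = (\<Sum>a<m. \<Sum>b<m. (\<phi> a * cnj (\<phi> b)) * cnj (P a b))"
      by (simp add: mult_ac)
    thus ?thesis unfolding PQ by simp
  qed
  have QQ: "(\<Sum>a<m. \<Sum>b<m. (\<phi> a * cnj (\<phi> b)) * cnj (\<phi> a * cnj (\<phi> b))) = 1"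
  proof -
    have "(\<Sum>a<m. \<Sum>b<m. (\<phi> a * cnj (\<phi> b)) * cnj (\<phi> a * cnj (\<phi> b))) = (\<Sum>a<m. \<phi> a * cnj (\<phi> a)) * (\<Sum>b<m. \<phi> b * cnj (\<phi> b))"
      unfolding sum_product by (intro sum.cong refl) (simp add: mult_ac)
    thus ?thesis by (simp add: n1c)
  qed
  have "complex_of_real (\<Sum>a<m. \<Sum>b<m. (cmod (T a b))\<^sup>2) = (\<Sum>a<m. \<Sum>b<m. T a b * cnj (T a b))"
    unfolding of_real_sum by (intro sum.cong refl) (rule complex_norm_square)
  also have "\<dots> = (\<Sum>a<m. \<Sum>b<m. P a b * cnj (P a b)) - (\<Sum>a<m. \<Sum>b<m. P a b * cnj (\<phi> a * cnj (\<phi> b)))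
     - (\<Sum>a<m. \<Sum>b<m. (\<phi> a * cnj (\<phi> b)) * cnj (P a b)) + (\<Sum>a<m. \<Sum>b<m. (\<phi> a * cnj (\<phi> b)) * cnj (\<phi> a * cnj (\<phi> b)))"
    unfolding sum_subtractf[symmetric] sum.distrib[symmetric] by (intro sum.cong refl) (simp add: T_def algebra_simps)
  also have "\<dots> = 0" unfolding PP PQ QP QQ by simp
  finally have z: "(\<Sum>a<m. \<Sum>b<m. (cmod (T a b))\<^sup>2) = 0" by (metis of_real_eq_0_iff)
  have "T a b = 0" if "a < m" "b < m" for a b
  proof -
    have "(cmod (T a b))\<^sup>2 \<le> (\<Sum>b<m. (cmod (T a b))\<^sup>2)" by (rule member_le_sum) (use that in auto)
    also have "\<dots> \<le> (\<Sum>a<m. \<Sum>b<m. (cmod (T a b))\<^sup>2)" by (rule member_le_sum[where f="\<lambda>a. \<Sum>b<m. (cmod (T a b))\<^sup>2"]) (use that in \<open>auto intro: sum_nonneg\<close>)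
    finally show ?thesis using z by simp
  qed
  thus ?thesis using that[OF n1] by (simp add: T_def)
qed

text \<open>The Householder reflection exchanging the first basis vector with (a phase times) \<phi>; for
  v = 0 the factor 2 / N is the junk value 0, which is what is wanted.\<close>

lemma unitary_with_first_column:
  assumes n1: "(\<Sum>a<m. (cmod (\<phi> a))\<^sup>2) = 1" and m: "0 < m"
  obtains u :: smat where
    "\<And>a b. a < m \<Longrightarrow> b < m \<Longrightarrow> (\<Sum>k<m. cnj (u k a) * u k b) = (if a = b then 1 else 0)"
    "\<And>a b. a < m \<Longrightarrow> b < m \<Longrightarrow> (\<Sum>k<m. u a k * cnj (u b k)) = (if a = b then 1 else 0)"
    "\<And>a b. a < m \<Longrightarrow> b < m \<Longrightarrow> u a 0 * cnj (u b 0) = \<phi> a * cnj (\<phi> b)"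
proof -
  \<comment> \<open>This phase makes the first component of \<open>f\<close> real and nonnegative. A
    reflection exchanges two unit vectors only if their inner product is real.\<close>
  define c where "c = (if \<phi> 0 = 0 then 1 else cnj (\<phi> 0) / complex_of_real (cmod (\<phi> 0)))"
  have cc: "c * cnj c = 1"
  proof (cases "\<phi> 0 = 0")
    case False
    have "c * cnj c = (\<phi> 0 * cnj (\<phi> 0)) / (complex_of_real (cmod (\<phi> 0)))\<^sup>2" using False by (simp add: c_def power2_eq_square)
    also have "\<phi> 0 * cnj (\<phi> 0) = (complex_of_real (cmod (\<phi> 0)))\<^sup>2" by (simp add: complex_norm_square[symmetric])
    finally show ?thesis using False by simp
  qed (simp add: c_def)
  have c1: "cmod c = 1" by (auto simp: c_def norm_divide)
  define f where "f a = c * \<phi> a" for a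
  have f0: "f 0 = complex_of_real (cmod (\<phi> 0))"
  proof (cases "\<phi> 0 = 0")
    case False
    have "f 0 = (\<phi> 0 * cnj (\<phi> 0)) / complex_of_real (cmod (\<phi> 0))" using False by (simp add: f_def c_def)
    also have "\<phi> 0 * cnj (\<phi> 0) = complex_of_real (cmod (\<phi> 0)) * complex_of_real (cmod (\<phi> 0))" by (simp add: complex_norm_square[symmetric] power2_eq_square)
    finally show ?thesis using False by simp
  qed (simp add: f_def)
  have ff: "f a * cnj (f b) = \<phi> a * cnj (\<phi> b)" for a b
  proof -
    have "f a * cnj (f b) = (c * cnj c) * (\<phi> a * cnj (\<phi> b))" by (simp add: f_def mult_ac)
    thus ?thesis by (simp add: cc)
  qed
  have fn: "(\<Sum>a<m. (cmod (f a))\<^sup>2) = 1" using n1 by (simp add: f_def norm_mult c1)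
  define v where "v a = f a - (if a = 0 then 1 else 0)" for a :: nat
  define N where "N = (\<Sum>a<m. (cmod (v a))\<^sup>2)"
  obtain m' where m': "m = Suc m'" using m gr0_implies_Suc by blast
  define x where "x = cmod (\<phi> 0)"
  have v0: "v 0 = complex_of_real (x - 1)" by (simp add: v_def f0 x_def)
  have Nv: "N = 2 - 2 * x"
  proof -
    have "N = (x - 1)\<^sup>2 + (\<Sum>a<m'. (cmod (f (Suc a)))\<^sup>2)"
      unfolding N_def m' sum.lessThan_Suc_shift v0 norm_of_real by (simp add: v_def)
    moreover have "1 = x\<^sup>2 + (\<Sum>a<m'. (cmod (f (Suc a)))\<^sup>2)"
      using fn unfolding m' sum.lessThan_Suc_shift f0 norm_of_real x_def by simp
    ultimately show ?thesis by (simp add: power2_eq_square algebra_simps)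
  qed
  define s where "s = complex_of_real (2 / N)"
  define u where "u a b = (if a = b then 1 else 0) - s * (v a * cnj (v b))" for a b
  have u0: "u a 0 = f a" if "a < m" for a
  proof (cases "N = 0")
    case True
    have "(cmod (v a))\<^sup>2 \<le> N" unfolding N_def by (rule member_le_sum) (use that in auto)
    hence "v a = 0" using True by simp
    thus ?thesis by (auto simp: u_def v_def)
  next
    case False
    have "s * cnj (v 0) = complex_of_real (2 / N * (x - 1))" by (simp add: s_def v0)
    also have "2 / N * (x - 1) = -1" using False Nv by (simp add: field_simps)
    finally have "s * cnj (v 0) = -1" by simp
    moreover have "s * (v a * cnj (v 0)) = (s * cnj (v 0)) * v a" by (simp only: mult_ac)
    ultimately have "u a 0 = (if a = 0 then 1 else 0) + v a" unfolding u_def by simp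
    thus ?thesis by (simp add: v_def)
  qed
  have herm: "cnj (u a b) = u b a" for a b by (simp add: u_def s_def mult.commute)
  have sN: "s * s * complex_of_real N = 2 * s" by (simp add: s_def)
  have vN: "(\<Sum>k<m. cnj (v k) * v k) = complex_of_real N"
    unfolding N_def of_real_sum by (intro sum.cong refl) (simp add: complex_norm_square mult.commute del: of_real_power)
  have prod: "(\<Sum>k<m. u a k * u k b) = (if a = b then 1 else 0)" if "a < m" "b < m" for a b
  proof -
    have "(\<Sum>k<m. u a k * u k b) = (\<Sum>k<m. (if a = k then (if k = b then 1 else 0) else 0)) - (\<Sum>k<m. if a = k then s * (v k * cnj (v b)) else 0)
       - (\<Sum>k<m. if k = b then s * (v a * cnj (v k)) else 0) + (\<Sum>k<m. (s * s * (v a * cnj (v b))) * (cnj (v k) * v k))"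
      unfolding sum_subtractf[symmetric] sum.distrib[symmetric] by (intro sum.cong refl) (auto simp: u_def algebra_simps)
    also have "\<dots> = (if a = b then 1 else 0) - 2 * s * (v a * cnj (v b)) + (s * s * complex_of_real N) * (v a * cnj (v b))"
      unfolding sum_distrib_left[symmetric] vN using that by (simp add: mult_ac)
    also have "\<dots> = (if a = b then 1 else 0)" unfolding sN by simp
    finally show ?thesis .
  qed
  show ?thesis
  proof (rule that[of u])
    fix a b assume ab: "a < m" "b < m"
    show "(\<Sum>k<m. cnj (u k a) * u k b) = (if a = b then 1 else 0)" using prod[OF ab] by (simp add: herm)
    show "(\<Sum>k<m. u a k * cnj (u b k)) = (if a = b then 1 else 0)" using prod[OF ab] by (simp add: herm)
    show "u a 0 * cnj (u b 0) = \<phi> a * cnj (\<phi> b)" using ab by (simp add: u0 ff)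
  qed
qed

subsection \<open>Lattice geometry\<close>

lemma dist1_refl [simp]: "dist1 x x = 0"
  by (simp add: dist1_def)

lemma dist1_commute: "dist1 x y = dist1 y x"
  by (simp add: dist1_def abs_minus_commute)

lemma dist1_nonneg: "0 \<le> dist1 x y"
  by (simp add: dist1_def sum_nonneg)

lemma dist1_translate: "dist1 (x + a) (y + a) = dist1 x y"
  by (simp add: dist1_def)

lemma dist1_triangle: "dist1 x z \<le> dist1 x y + dist1 y z"
  unfolding dist1_def sum.distrib[symmetric] by (intro sum_mono) auto

lemma finite_dist1_ball: "finite {y. dist1 x y \<le> r}"
proof (rule finite_subset)
  show "{y. dist1 x y \<le> r} \<subseteq> vec_lambda ` PiE UNIV (\<lambda>k. {x $ k - r..x $ k + r})"
  proof
    fix y assume y: "y \<in> {y. dist1 x y \<le> r}"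
    have "\<bar>x $ k - y $ k\<bar> \<le> dist1 x y" for k
      unfolding dist1_def by (rule member_le_sum[where f="\<lambda>k. \<bar>x $ k - y $ k\<bar>"]) auto
    hence "\<bar>x $ k - y $ k\<bar> \<le> r" for k using y order_trans by blast
    hence "y $ k \<in> {x $ k - r..x $ k + r}" for k by (simp add: abs_le_iff) (smt (verit))
    hence "vec_lambda (\<lambda>k. y $ k) \<in> vec_lambda ` PiE UNIV (\<lambda>k. {x $ k - r..x $ k + r})" by (intro imageI) auto
    thus "y \<in> vec_lambda ` PiE UNIV (\<lambda>k. {x $ k - r..x $ k + r})" by simp
  qed
  show "finite (vec_lambda ` PiE UNIV (\<lambda>k. {x $ k - r..x $ k + r}))" by (intro finite_imageI finite_PiE) auto
qed

definition lat_nbr :: "int \<Rightarrow> ('d::finite site) rel" where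
  "lat_nbr r = {(x, y). dist1 x y \<le> r}"

definition lat_deg :: "'d::finite itself \<Rightarrow> int \<Rightarrow> nat" where
  "lat_deg _ r = card {y::'d site. dist1 0 y \<le> r}"

lemma bounded_degree_lat:
  assumes "0 \<le> r"
  shows "bounded_degree (lat_nbr r :: ('d::finite site) rel) (lat_deg TYPE('d) r)"
proof
  show "sym (lat_nbr r :: ('d site) rel)" by (auto simp: lat_nbr_def sym_def dist1_commute)
  fix x :: "'d site"
  show "(x, x) \<in> lat_nbr r" using assms by (simp add: lat_nbr_def)
  have eq: "lat_nbr r `` {x} = {y. dist1 x y \<le> r}" by (auto simp: lat_nbr_def)
  show "finite (lat_nbr r `` {x})" unfolding eq by (rule finite_dist1_ball)
  have "bij_betw (\<lambda>y. y - x) {y. dist1 x y \<le> r} {y. dist1 0 y \<le> r}"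
  proof (rule bij_betw_byWitness[where f'="\<lambda>y. y + x"])
    have "dist1 0 (y - x) = dist1 x y" for y using dist1_translate[of 0 x "y - x"] by simp
    thus "(\<lambda>y. y - x) ` {y. dist1 x y \<le> r} \<subseteq> {y. dist1 0 y \<le> r}" by auto
    have "dist1 x (y + x) = dist1 0 y" for y using dist1_translate[of 0 x y] by simp
    thus "(\<lambda>y. y + x) ` {y. dist1 0 y \<le> r} \<subseteq> {y. dist1 x y \<le> r}" by auto
  qed auto
  hence "card {y. dist1 x y \<le> r} = card {y::'d site. dist1 0 y \<le> r}" by (rule bij_betw_same_card)
  thus "card (lat_nbr r `` {x}) \<le> lat_deg TYPE('d) r" unfolding eq lat_deg_def by simp
qed

lemma dist1_le_lat_diam:
  assumes "finite A" "x \<in> A" "y \<in> A"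
  shows "dist1 x y \<le> lat_diam A"
proof -
  have eq: "{dist1 x y | x y. x \<in> A \<and> y \<in> A} = (\<lambda>(x, y). dist1 x y) ` (A \<times> A)" by auto
  have "finite {dist1 x y | x y. x \<in> A \<and> y \<in> A}" unfolding eq using assms by simp
  moreover have "dist1 x y \<in> {dist1 x y | x y. x \<in> A \<and> y \<in> A}" using assms by auto
  moreover have "A \<noteq> {}" using assms by auto
  ultimately show ?thesis by (simp add: lat_diam_def)
qed

text \<open>A nearest-neighbour path inside \<open>X\<close> cannot step from \<open>C1\<close> to
  \<open>C2\<close>, so it never leaves \<open>C1\<close>.\<close>

lemma not_lat_connected_if_separated:
  assumes "X \<subseteq> C1 \<union> C2" "X \<inter> C1 \<noteq> {}" "X \<inter> C2 \<noteq> {}" "\<And>u v. u \<in> C1 \<Longrightarrow> v \<in> C2 \<Longrightarrow> dist1 u v > 1"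
  shows "\<not> lat_connected X"
proof
  assume c: "lat_connected X"
  obtain x y where xy: "x \<in> X" "x \<in> C1" "y \<in> X" "y \<in> C2" using assms by auto
  have "(x, y) \<in> {(u, v). u \<in> X \<and> v \<in> X \<and> dist1 u v = 1}\<^sup>*" using c xy by (auto simp: lat_connected_def)
  hence "y \<in> C1"
  proof (induction rule: rtrancl_induct)
    case (step u v)
    thus ?case using assms(1) assms(4)[of u v] by auto
  qed (use xy in auto)
  thus False using assms(4)[of y y] xy by simp
qed

lemma ob_reindex:
  fixes M :: "'a op" and N :: "'b op"
  assumes bij: "bij_betw t D D'" and M: "\<And>s z. s \<in> D \<Longrightarrow> z \<in> D \<Longrightarrow> M s z = N (t s) (t z)" and ob: "ob D' c N"
  shows "ob D c M"
  unfolding ob_def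
proof (intro conjI allI)
  fix v :: "('a \<Rightarrow> nat) \<Rightarrow> complex"
  define w where "w = (\<lambda>r. v (the_inv_into D t r))"
  have inj: "inj_on t D" using bij by (simp add: bij_betw_def)
  have wt: "w (t s) = v s" if "s \<in> D" for s using the_inv_into_f_f[OF inj that] by (simp add: w_def)
  have nv: "vec_norm D f = vec_norm D' f'" if "\<And>s. s \<in> D \<Longrightarrow> f s = f' (t s)"
    for f :: "('a \<Rightarrow> nat) \<Rightarrow> complex" and f' :: "('b \<Rightarrow> nat) \<Rightarrow> complex"
    unfolding vec_norm_def sum.reindex_bij_betw[OF bij, symmetric] using that by simp
  have "op_apply D M v s = op_apply D' N w (t s)" if "s \<in> D" for s
    unfolding op_apply_def sum.reindex_bij_betw[OF bij, symmetric] using that by (simp add: M wt)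
  hence "vec_norm D (op_apply D M v) = vec_norm D' (op_apply D' N w)" by (intro nv) auto
  also have "\<dots> \<le> c * vec_norm D' w" by (rule obD[OF ob])
  also have "vec_norm D' w = vec_norm D v" by (rule nv[symmetric]) (simp add: wt)
  finally show "vec_norm D (op_apply D M v) \<le> c * vec_norm D v" .
qed (use ob in \<open>simp add: ob_def\<close>)

lemma shift_set_shift: "shift_set a (shift_set (- a) X) = X"
  by (auto simp: shift_set_def image_image)

lemma op_norm_nonneg: "finite D \<Longrightarrow> 0 \<le> op_norm D M"
  using ob_op_norm[of D M] by (simp add: ob_def)

text \<open>Translation relabels the configurations bijectively. The reverse inequality is the same
  statement for \<open>- a\<close>.\<close>

lemma op_norm_shift_le:
  assumes int: "is_interaction m \<Phi>" and A: "finite A"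
  shows "op_norm (confs m (shift_set a A)) (\<Phi> (shift_set a A)) \<le> op_norm (confs m A) (\<Phi> A)"
proof (rule op_norm_le, rule ob_reindex)
  let ?t = "\<lambda>s. restrict (\<lambda>i. s (i + a)) A"
  show "bij_betw ?t (confs m (shift_set a A)) (confs m A)"
  proof (rule bij_betw_byWitness[where f'="\<lambda>s. restrict (\<lambda>i. s (i - a)) (shift_set a A)"])
    show "\<forall>s\<in>confs m (shift_set a A). restrict (\<lambda>i. ?t s (i - a)) (shift_set a A) = s"
      by (auto simp: confs_def shift_set_def PiE_iff extensional_def fun_eq_iff restrict_def)
    show "\<forall>s\<in>confs m A. ?t (restrict (\<lambda>i. s (i - a)) (shift_set a A)) = s"
      by (auto simp: confs_def shift_set_def PiE_iff extensional_def fun_eq_iff restrict_def)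
    show "?t ` confs m (shift_set a A) \<subseteq> confs m A" by (auto simp: confs_def shift_set_def PiE_iff)
    show "(\<lambda>s. restrict (\<lambda>i. s (i - a)) (shift_set a A)) ` confs m A \<subseteq> confs m (shift_set a A)"
      by (auto simp: confs_def shift_set_def PiE_iff)
  qed
  fix s z assume "s \<in> confs m (shift_set a A)" "z \<in> confs m (shift_set a A)"
  thus "\<Phi> (shift_set a A) s z = \<Phi> A (?t s) (?t z)" using int by (auto simp: is_interaction_def)
next
  show "ob (confs m A) (op_norm (confs m A) (\<Phi> A)) (\<Phi> A)" by (rule ob_op_norm) (rule finite_confs[OF A])
qed

text \<open>Charge a nonempty set to each of its sites and translate that site to the origin. Every
  site then receives at most the \<kappa>-norm, that is 1, and the empty set carries no
  interaction.\<close>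

lemma kappa_norm_local_sum:
  fixes \<Upsilon> :: "('d::finite) interaction"
  assumes int: "is_interaction m \<Upsilon>" and kap: "kappa_norm_le m \<kappa> \<Upsilon> 1" and U: "finite U"
  shows "(\<Sum>X\<in>Pow U. exp (\<kappa> * real (card X)) * op_norm (confs m X) (\<Upsilon> X)) \<le> real (card U)"
proof -
  let ?f = "\<lambda>X. exp (\<kappa> * real (card X)) * op_norm (confs m X) (\<Upsilon> X)" and ?I = "{A. finite A \<and> (0::'d site) \<in> A}"
  have sm: "?f summable_on ?I" "infsum ?f ?I \<le> 1" using kap by (auto simp: kappa_norm_le_def Let_def)
  have f0: "0 \<le> ?f X" if "finite X" for X using op_norm_nonneg[OF finite_confs[OF that]] by simp
  have site: "(\<Sum>X\<in>{X\<in>Pow U. i \<in> X}. ?f X) \<le> 1" for i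
  proof -
    let ?S = "{X\<in>Pow U. i \<in> X}" and ?s = "shift_set (- i)"
    have fS: "finite ?S" using U by auto
    have inj: "inj_on ?s ?S"
    proof (rule inj_onI)
      fix X Y assume "?s X = ?s Y"
      hence "shift_set i (?s X) = shift_set i (?s Y)" by simp
      thus "X = Y" by (simp only: shift_set_shift)
    qed
    have fin: "finite X" if "X \<in> ?S" for X using that U by (auto intro: finite_subset)
    have "(\<Sum>X\<in>?S. ?f X) \<le> (\<Sum>X\<in>?S. ?f (?s X))"
    proof (rule sum_mono)
      fix X assume X: "X \<in> ?S"
      have fs: "finite (?s X)" using fin[OF X] by (simp add: shift_set_def)
      have "card (?s X) = card X" unfolding shift_set_def by (rule card_image) (simp add: inj_on_def)
      moreover have "op_norm (confs m X) (\<Upsilon> X) \<le> op_norm (confs m (?s X)) (\<Upsilon> (?s X))"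
        using op_norm_shift_le[OF int fs, of i] by (simp only: shift_set_shift)
      ultimately show "?f X \<le> ?f (?s X)" by (simp add: mult_left_mono)
    qed
    also have "\<dots> = sum ?f (?s ` ?S)" by (subst sum.reindex[OF inj]) simp
    also have "\<dots> \<le> infsum ?f ?I"
    proof (rule finite_sum_le_infsum[OF sm(1)])
      show "finite (?s ` ?S)" using fS by simp
      show "?s ` ?S \<subseteq> ?I" using fin by (force simp: shift_set_def)
    qed (use f0 in auto)
    finally show ?thesis using sm(2) by linarith
  qed
  have "op_zero_on (confs m {}) (\<Upsilon> {})" using int by (auto simp: is_interaction_def lat_connected_def)
  hence "ob (confs m {}) 0 (\<Upsilon> {})"
    using ob_zero[of "confs m {}"] ob_cong[of "confs m {}" "\<Upsilon> {}" "\<lambda>_ _. 0" 0] by (auto simp: op_zero_on_def)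
  hence e: "?f {} \<le> 0" using op_norm_le by (simp add: mult_le_0_iff)
  have "(\<Sum>X\<in>Pow U. ?f X) = ?f {} + (\<Sum>X\<in>Pow U - {{}}. ?f X)" by (rule sum.remove) (use U in auto)
  also have "\<dots> \<le> (\<Sum>X\<in>Pow U - {{}}. ?f X)" using e by simp
  also have "\<dots> \<le> (\<Sum>X\<in>Pow U - {{}}. \<Sum>i\<in>{i\<in>U. i \<in> X}. ?f X)"
  proof (rule sum_mono)
    fix X assume X: "X \<in> Pow U - {{}}"
    hence fX: "finite X" using U by (auto intro: finite_subset)
    have eq: "{i\<in>U. i \<in> X} = X" using X by auto
    have "1 \<le> card X" using X fX by (simp add: Suc_le_eq card_gt_0_iff)
    hence "1 * ?f X \<le> real (card X) * ?f X" using f0[OF fX] by (intro mult_right_mono) auto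
    thus "?f X \<le> (\<Sum>i\<in>{i\<in>U. i \<in> X}. ?f X)" unfolding eq by simp
  qed
  also have "\<dots> = (\<Sum>i\<in>U. \<Sum>X\<in>{X\<in>Pow U - {{}}. i \<in> X}. ?f X)"
    by (rule sum.swap_restrict) (use U in auto)
  also have "\<dots> \<le> (\<Sum>i\<in>U. 1)"
  proof (rule sum_mono)
    fix i
    have "{X\<in>Pow U - {{}}. i \<in> X} = {X\<in>Pow U. i \<in> X}" by auto
    thus "(\<Sum>X\<in>{X\<in>Pow U - {{}}. i \<in> X}. ?f X) \<le> 1" using site[of i] by simp
  qed
  finally show ?thesis by simp
qed

subsection \<open>The gapped system of a spin model\<close>

text \<open>The model together with a one-site unitary \<open>u\<close> whose first column spans the
  range of \<open>P\<close>, so that the vacuum becomes basis state 0. \<open>R\<close> bounds the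
  range of \<open>\<Phi>0\<close>; being at least 1, it ensures that sets separated at range
  \<open>R\<close> are not joined by nearest neighbours either.\<close>

locale spin_model =
  fixes m :: nat and \<Phi>0 \<Upsilon> :: "('d::finite) interaction" and P u :: smat and g \<kappa> :: real and R :: int
  assumes int0: "is_interaction m \<Phi>0" and R: "1 \<le> R"
    and fr0: "\<And>A. R < lat_diam A \<Longrightarrow> op_zero_on (confs m A) (\<Phi>0 A)"
    and g: "g > 0" and m: "0 < m"
    and comm: "\<And>L S. finite L \<Longrightarrow> S \<subseteq> L \<Longrightarrow>
        op_eq_on (confs m L)
          (op_mult (confs m L) (hamiltonian m \<Phi>0 L)
                   (op_tensor L (\<lambda>i. if i \<in> S then (\<lambda>a b. smat_id a b - P a b) else P)))
          (op_mult (confs m L)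
                   (op_tensor L (\<lambda>i. if i \<in> S then (\<lambda>a b. smat_id a b - P a b) else P))
                   (hamiltonian m \<Phi>0 L))"
    and gs: "\<And>L. finite L \<Longrightarrow>
        op_zero_on (confs m L) (op_mult (confs m L) (hamiltonian m \<Phi>0 L) (op_tensor L (\<lambda>i. P)))"
    and gap: "\<And>L S. finite L \<Longrightarrow> S \<subseteq> L \<Longrightarrow>
        op_psd (confs m L)
          (\<lambda>s t. op_mult (confs m L) (hamiltonian m \<Phi>0 L)
                     (op_tensor L (\<lambda>i. if i \<in> S then (\<lambda>a b. smat_id a b - P a b) else P)) s t
                 - complex_of_real (g * real (card S)) *
                   op_tensor L (\<lambda>i. if i \<in> S then (\<lambda>a b. smat_id a b - P a b) else P) s t)"
    and intU: "is_interaction m \<Upsilon>" and kap: "kappa_norm_le m \<kappa> \<Upsilon> 1" and \<kappa>: "0 \<le> \<kappa>"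
    and u1: "\<And>a b. a < m \<Longrightarrow> b < m \<Longrightarrow> (\<Sum>k<m. cnj (u k a) * u k b) = (if a = b then 1 else 0)"
    and u2: "\<And>a b. a < m \<Longrightarrow> b < m \<Longrightarrow> (\<Sum>k<m. u a k * cnj (u b k)) = (if a = b then 1 else 0)"
    and uP: "\<And>a b. a < m \<Longrightarrow> b < m \<Longrightarrow> P a b = u a 0 * cnj (u b 0)"
begin

definition vac_op :: "'d interaction \<Rightarrow> 'd interaction" where
  "vac_op \<Phi> A = conjop (Uprod u A) (confs m A) (\<Phi> A)"

lemma unitary: "finite V \<Longrightarrow> unitary_kernel (Uprod u V) (confs m V) (conf0 m V)"
  by (rule unitary_Uprod) (auto simp: u1 u2)

lemma conjop_hamiltonian:
  assumes V: "finite V" and st: "s \<in> conf0 m V" "t \<in> conf0 m V"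
  shows "conjop (Uprod u V) (confs m V) (hamiltonian m \<Phi> V) s t = (\<Sum>A\<in>Pow V. ext0 A (vac_op \<Phi> A) s t)"
proof -
  have "conjop (Uprod u V) (confs m V) (hamiltonian m \<Phi> V) s t =
     conjop (Uprod u V) (confs m V) (\<lambda>s t. \<Sum>A\<in>Pow V. op_embed V A (\<Phi> A) s t) s t"
    by (rule conjop_cong) (simp add: hamiltonian_def)
  also have "\<dots> = (\<Sum>A\<in>Pow V. conjop (Uprod u V) (confs m V) (op_embed V A (\<Phi> A)) s t)" by (rule conjop_sum)
  also have "\<dots> = (\<Sum>A\<in>Pow V. ext0 A (vac_op \<Phi> A) s t)"
    unfolding vac_op_def by (intro sum.cong refl conjop_embed V st u1) auto
  finally show ?thesis .
qed

abbreviation defect_proj :: "'d site set \<Rightarrow> 'd site set \<Rightarrow> 'd site op" where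
  "defect_proj V S \<equiv> op_tensor V (\<lambda>i. if i \<in> S then (\<lambda>a b. smat_id a b - P a b) else P)"

lemma smat_conj_P: "a < m \<Longrightarrow> b < m \<Longrightarrow> smat_conj u m P a b = (if a = 0 \<and> b = 0 then 1 else 0)"
proof -
  assume ab: "a < m" "b < m"
  have "smat_conj u m P a b = (\<Sum>k<m. \<Sum>l<m. (cnj (u k a) * u k 0) * (cnj (u l 0) * u l b))"
    unfolding smat_conj_def by (intro sum.cong refl) (simp add: uP mult_ac)
  also have "\<dots> = (\<Sum>k<m. cnj (u k a) * u k 0) * (\<Sum>l<m. cnj (u l 0) * u l b)" by (simp add: sum_product)
  finally show ?thesis using ab m by (simp add: u1)
qed

lemma smat_conj_id: "a < m \<Longrightarrow> b < m \<Longrightarrow> smat_conj u m smat_id a b = (if a = b then 1 else 0)"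
proof -
  assume ab: "a < m" "b < m"
  have "smat_conj u m smat_id a b = (\<Sum>k<m. \<Sum>l<m. if k = l then cnj (u k a) * u l b else 0)"
    unfolding smat_conj_def by (intro sum.cong refl) (simp add: smat_id_def)
  thus ?thesis using u1[OF ab] by simp
qed

lemma smat_conj_diff: "smat_conj u m (\<lambda>a b. A a b - B a b) a b = smat_conj u m A a b - smat_conj u m B a b"
  by (simp add: smat_conj_def left_diff_distrib right_diff_distrib sum_subtractf)

text \<open>At a site of \<open>S\<close> the factor keeps the excited basis states, elsewhere the
  vacuum state. In the new basis the defect projections are therefore diagonal indicators of the
  excited set.\<close>

lemma conjop_defect:
  assumes V: "finite V" and S: "S \<subseteq> V" and st: "s \<in> conf0 m V" "t \<in> conf0 m V"
  shows "conjop (Uprod u V) (confs m V) (defect_proj V S) s t = (if s = t \<and> supp0 s = S then 1 else 0)"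
proof -
  have lt: "s i < m" "t i < m" for i using st m by (auto simp: conf0_def)
  have "conjop (Uprod u V) (confs m V) (defect_proj V S) s t =
     (\<Prod>i\<in>V. if s i = t i \<and> (i \<in> S \<longleftrightarrow> s i \<noteq> 0) then 1 else 0)"
    unfolding conjop_tensor[OF V]
  proof (rule prod.cong[OF refl])
    fix i
    show "smat_conj u m (if i \<in> S then \<lambda>a b. smat_id a b - P a b else P) (s i) (t i) = (if s i = t i \<and> (i \<in> S \<longleftrightarrow> s i \<noteq> 0) then 1 else 0)"
      using smat_conj_P[OF lt, of i i] smat_conj_id[OF lt, of i i] smat_conj_diff[of smat_id P "s i" "t i"] by auto
  qed
  also have "\<dots> = (if \<forall>i\<in>V. s i = t i \<and> (i \<in> S \<longleftrightarrow> s i \<noteq> 0) then 1 else 0)"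
    using V by (induction V rule: finite_induct) auto
  also have "(\<forall>i\<in>V. s i = t i \<and> (i \<in> S \<longleftrightarrow> s i \<noteq> 0)) \<longleftrightarrow> s = t \<and> supp0 s = S"
  proof
    assume *: "\<forall>i\<in>V. s i = t i \<and> (i \<in> S \<longleftrightarrow> s i \<noteq> 0)"
    have i: "s i = t i" "i \<in> S \<longleftrightarrow> s i \<noteq> 0" for i
      using * st S by (cases "i \<in> V"; auto simp: conf0_def)+
    have "s = t" by (rule ext) (rule i)
    moreover have "supp0 s = S" unfolding supp0_def using i(2) by blast
    ultimately show "s = t \<and> supp0 s = S" by simp
  qed (auto simp: supp0_def)
  finally show ?thesis .
qed

abbreviation H0v :: "'d site set \<Rightarrow> 'd site op" where
  "H0v V \<equiv> conjop (Uprod u V) (confs m V) (hamiltonian m \<Phi>0 V)"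

lemma mult_defect_right:
  assumes V: "finite V" and S: "S \<subseteq> V" and st: "s \<in> conf0 m V" "t \<in> conf0 m V"
  shows "op_mult (conf0 m V) M (conjop (Uprod u V) (confs m V) (defect_proj V S)) s t = (if supp0 t = S then M s t else 0)"
proof -
  have "op_mult (conf0 m V) M (conjop (Uprod u V) (confs m V) (defect_proj V S)) s t = (\<Sum>r\<in>conf0 m V. if r = t then (if supp0 t = S then M s t else 0) else 0)"
    unfolding op_mult_def by (intro sum.cong refl) (auto simp: conjop_defect[OF V S] st)
  thus ?thesis using finite_conf0[OF V, of m] st by simp
qed

lemma mult_defect_left:
  assumes V: "finite V" and S: "S \<subseteq> V" and st: "s \<in> conf0 m V" "t \<in> conf0 m V"
  shows "op_mult (conf0 m V) (conjop (Uprod u V) (confs m V) (defect_proj V S)) M s t = (if supp0 s = S then M s t else 0)"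
proof -
  have "op_mult (conf0 m V) (conjop (Uprod u V) (confs m V) (defect_proj V S)) M s t = (\<Sum>r\<in>conf0 m V. if r = s then (if supp0 s = S then M s t else 0) else 0)"
    unfolding op_mult_def by (intro sum.cong refl) (auto simp: conjop_defect[OF V S] st)
  thus ?thesis using finite_conf0[OF V, of m] st by simp
qed

text \<open>Commuting with the indicator of every excited set means having no entries between
  different excited sets.\<close>

lemma H0v_supp:
  assumes V: "finite V" and st: "s \<in> conf0 m V" "t \<in> conf0 m V" and ne: "supp0 s \<noteq> supp0 t"
  shows "H0v V s t = 0"
proof -
  interpret unitary_kernel "Uprod u V" "confs m V" "conf0 m V" by (rule unitary[OF V])
  let ?S = "supp0 t"
  have S: "?S \<subseteq> V" by (rule supp0_subset[OF st(2)])
  have "conjop (Uprod u V) (confs m V) (op_mult (confs m V) (hamiltonian m \<Phi>0 V) (defect_proj V ?S)) s t =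
    conjop (Uprod u V) (confs m V) (op_mult (confs m V) (defect_proj V ?S) (hamiltonian m \<Phi>0 V)) s t"
    by (rule conjop_cong) (use comm[OF V S] in \<open>simp add: op_eq_on_def\<close>)
  thus ?thesis unfolding conjop_mult mult_defect_left[OF V S st] mult_defect_right[OF V S st] using ne by simp
qed

lemma H0v_vac:
  assumes V: "finite V" and s: "x \<in> conf0 m V"
  shows "H0v V x (\<lambda>_. 0) = 0"
proof -
  interpret unitary_kernel "Uprod u V" "confs m V" "conf0 m V" by (rule unitary[OF V])
  have z: "(\<lambda>_. 0) \<in> conf0 m V" using m by (simp add: conf0_def)
  have "(\<lambda>i. P) = (\<lambda>i. if i \<in> ({}::'d site set) then (\<lambda>a b. smat_id a b - P a b) else P)" by auto
  hence "op_zero_on (confs m V) (op_mult (confs m V) (hamiltonian m \<Phi>0 V) (defect_proj V {}))" using gs[OF V] by simp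
  hence "conjop (Uprod u V) (confs m V) (op_mult (confs m V) (hamiltonian m \<Phi>0 V) (defect_proj V {})) x (\<lambda>_. 0) = 0"
    by (rule conjop_zero)
  thus ?thesis unfolding conjop_mult using mult_defect_right[OF V _ s z, of "{}" "H0v V"] by (simp add: supp0_def)
qed

text \<open>The assumptions speak of total Hamiltonians. Induction on \<open>card A\<close> passes
  to single terms: the term of \<open>A\<close> is the Hamiltonian of volume \<open>A\<close> minus
  the terms of the proper subsets.\<close>

lemma vac_op_supp_vac:
  "finite A \<Longrightarrow> (\<forall>s\<in>conf0 m A. \<forall>t\<in>conf0 m A. supp0 s \<noteq> supp0 t \<longrightarrow> vac_op \<Phi>0 A s t = 0) \<and> vac_op \<Phi>0 A (\<lambda>_. 0) (\<lambda>_. 0) = 0"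
proof (induction "card A" arbitrary: A rule: less_induct)
  case less
  have z: "(\<lambda>_. 0) \<in> conf0 m B" for B :: "'d site set" using m by (simp add: conf0_def)
  have IH: "(\<forall>s\<in>conf0 m B. \<forall>t\<in>conf0 m B. supp0 s \<noteq> supp0 t \<longrightarrow> vac_op \<Phi>0 B s t = 0) \<and> vac_op \<Phi>0 B (\<lambda>_. 0) (\<lambda>_. 0) = 0"
    if "B \<in> Pow A - {A}" for B
  proof (rule less(1))
    show "card B < card A" using that less(2) by (auto intro: psubset_card_mono)
    show "finite B" using that less(2) by (auto intro: finite_subset)
  qed
  have top: "vac_op \<Phi>0 A s t = H0v A s t - (\<Sum>B\<in>Pow A - {A}. ext0 B (vac_op \<Phi>0 B) s t)" if st: "s \<in> conf0 m A" "t \<in> conf0 m A" for s t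
  proof -
    have "ext0 A (vac_op \<Phi>0 A) s t = vac_op \<Phi>0 A s t"
      using st by (simp add: ext0_def restr0_id) (auto simp: conf0_def)
    moreover have "H0v A s t = ext0 A (vac_op \<Phi>0 A) s t + (\<Sum>B\<in>Pow A - {A}. ext0 B (vac_op \<Phi>0 B) s t)"
      unfolding conjop_hamiltonian[OF less(2) st] by (rule sum.remove) (use less(2) in auto)
    ultimately show ?thesis by simp
  qed
  show ?case
  proof (intro conjI ballI impI)
    fix s t assume st: "s \<in> conf0 m A" "t \<in> conf0 m A" "supp0 s \<noteq> supp0 t"
    have "ext0 B (vac_op \<Phi>0 B) s t = 0" if "B \<in> Pow A - {A}" for B
      by (rule ext0_supp_preserving[OF _ st(1,2) m st(3)]) (use IH[OF that] in auto)
    thus "vac_op \<Phi>0 A s t = 0" unfolding top[OF st(1,2)] using H0v_supp[OF less(2) st] by simp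
  next
    have r: "restr0 (\<lambda>_. 0) B = (\<lambda>_. 0)" for B :: "'d site set" by (auto simp: restr0_def)
    have "ext0 B (vac_op \<Phi>0 B) (\<lambda>_. 0) (\<lambda>_. 0) = 0" if "B \<in> Pow A - {A}" for B
      using IH[OF that] by (simp add: ext0_def r)
    thus "vac_op \<Phi>0 A (\<lambda>_. 0) (\<lambda>_. 0) = 0" unfolding top[OF z z] using H0v_vac[OF less(2) z] by simp
  qed
qed

lemma vac_op_zero: "op_zero_on (confs m A) (\<Phi> A) \<Longrightarrow> op_zero_on (conf0 m A) (vac_op \<Phi> A)"
  unfolding vac_op_def op_zero_on_def[of "conf0 m A"] by (simp add: conjop_zero)

text \<open>On vectors with excited set \<open>S\<close> the defect projection is the identity, so
  the operator inequality of the assumption becomes an inequality for the form of the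
  Hamiltonian.\<close>

lemma gap_vac:
  assumes V: "finite V" and S: "S \<subseteq> V" and v: "\<And>x. x \<in> conf0 m V \<Longrightarrow> supp0 x \<noteq> S \<Longrightarrow> v x = 0"
  shows "g * real (card S) * (vec_norm (conf0 m V) v)\<^sup>2 \<le> Re (ip (conf0 m V) v (op_apply (conf0 m V) (H0v V) v))"
proof -
  interpret unitary_kernel "Uprod u V" "confs m V" "conf0 m V" by (rule unitary[OF V])
  let ?D = "confs m V" and ?D' = "conf0 m V" and ?c = "complex_of_real (g * real (card S))"
  let ?M = "\<lambda>x z. op_mult ?D (hamiltonian m \<Phi>0 V) (defect_proj V S) x z - ?c * defect_proj V S x z"
  have "0 \<le> Re (ip ?D (Uv v) (op_apply ?D ?M (Uv v)))" using gap[OF V S] by (simp add: op_psd_def ip_def)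
  also have "ip ?D (Uv v) (op_apply ?D ?M (Uv v)) = ip ?D' v (op_apply ?D' (conjop (Uprod u V) ?D ?M) v)"
    by (rule form_conjop[symmetric])
  also have "op_apply ?D' (conjop (Uprod u V) ?D ?M) v x = op_apply ?D' (H0v V) v x - ?c * v x" if s: "x \<in> ?D'" for x
  proof -
    have "conjop (Uprod u V) ?D ?M x z * v z = H0v V x z * v z - (if x = z then ?c * v z else 0)" if t: "z \<in> ?D'" for z
    proof (cases "supp0 z = S")
      case True
      have "conjop (Uprod u V) ?D ?M x z = H0v V x z - ?c * (if x = z then 1 else 0)"
        unfolding conjop_diff conjop_cmult conjop_mult mult_defect_right[OF V S s t] conjop_defect[OF V S s t] using True by auto
      thus ?thesis by (simp add: left_diff_distrib)
    qed (use v[OF t] in auto)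
    thus ?thesis using s finite_conf0[OF V, of m] by (simp add: op_apply_def sum_subtractf)
  qed
  hence "ip ?D' v (op_apply ?D' (conjop (Uprod u V) ?D ?M) v) = ip ?D' v (\<lambda>x. op_apply ?D' (H0v V) v x - ?c * v x)"
    by (simp add: ip_def)
  also have "Re \<dots> = Re (ip ?D' v (op_apply ?D' (H0v V) v)) - g * real (card S) * (vec_norm ?D' v)\<^sup>2"
    unfolding ip_diff_right ip_cmult_right ip_self by simp
  finally show ?thesis by simp
qed

lemma hermitian_hamiltonian:
  assumes "is_interaction m \<Phi>"
  shows "op_hermitian (confs m V) (hamiltonian m \<Phi> V)"
proof (rule op_hermitianI)
  fix s t assume st: "s \<in> confs m V" "t \<in> confs m V"
  have "op_embed V A (\<Phi> A) t s = cnj (op_embed V A (\<Phi> A) s t)" if A: "A \<in> Pow V" for A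
  proof -
    have "restrict s A \<in> confs m A" "restrict t A \<in> confs m A" using st A by (auto simp: confs_def PiE_iff)
    moreover have "op_hermitian (confs m A) (\<Phi> A)" using assms by (simp add: is_interaction_def)
    ultimately show ?thesis using op_hermitianD by (fastforce simp: op_embed_def)
  qed
  thus "hamiltonian m \<Phi> V t s = cnj (hamiltonian m \<Phi> V s t)" by (simp add: hamiltonian_def)
qed

text \<open>Terms of \<open>\<Phi>0\<close> are localized by their diameter, those of
  \<open>\<Upsilon>\<close> by connectedness alone, as the perturbation may have infinite
  range.\<close>

sublocale gapped_system m "lat_nbr R" "lat_deg TYPE('d) R" "vac_op \<Phi>0" "vac_op \<Upsilon>" g \<kappa> "\<lambda>X. op_norm (confs m X) (\<Upsilon> X)"
proof (rule gapped_system.intro)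
  show "0 < m" by (rule m)
  show "bounded_degree (lat_nbr R :: ('d site) rel) (lat_deg TYPE('d) R)" by (rule bounded_degree_lat) (use R in simp)
  fix A :: "'d site set" assume A: "finite A"
  show "op_zero_on (conf0 m A) (vac_op \<Phi>0 A)" if "\<not> A \<times> A \<subseteq> lat_nbr R"
  proof -
    have "\<exists>x\<in>A. \<exists>y\<in>A. R < dist1 x y" using that by (force simp: lat_nbr_def)
    then obtain x y where "x \<in> A" "y \<in> A" "R < dist1 x y" by blast
    hence "R < lat_diam A" using dist1_le_lat_diam[OF A] by fastforce
    thus ?thesis by (intro vac_op_zero fr0)
  qed
  show "vac_op \<Phi>0 A s t = 0" if "s \<in> conf0 m A" "t \<in> conf0 m A" "supp0 s \<noteq> supp0 t" for s t
    using vac_op_supp_vac[OF A] that by blast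
  show "vac_op \<Phi>0 A (\<lambda>_. 0) (\<lambda>_. 0) = 0" using vac_op_supp_vac[OF A] by blast
  have H: "(\<Sum>B\<in>Pow A. ext0 B (vac_op \<Phi>0 B) s t) = H0v A s t" if "s \<in> conf0 m A" "t \<in> conf0 m A" for s t
    by (rule conjop_hamiltonian[OF A that, symmetric])
  have herm: "op_hermitian (conf0 m A) (H0v A)" by (rule conjop_hermitian[OF hermitian_hamiltonian[OF int0]])
  show "op_hermitian (conf0 m A) (\<lambda>s t. \<Sum>B\<in>Pow A. ext0 B (vac_op \<Phi>0 B) s t)"
    by (rule op_hermitianI) (simp only: H op_hermitianD[OF herm])
  fix S and v :: "('d site \<Rightarrow> nat) \<Rightarrow> complex"
  assume S: "S \<subseteq> A" and v: "\<And>s. s \<in> conf0 m A \<Longrightarrow> supp0 s \<noteq> S \<Longrightarrow> v s = 0"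
  have "op_apply (conf0 m A) (\<lambda>s t. \<Sum>B\<in>Pow A. ext0 B (vac_op \<Phi>0 B) s t) v s = op_apply (conf0 m A) (H0v A) v s" if "s \<in> conf0 m A" for s
    using that H by (simp add: op_apply_def)
  hence "ip (conf0 m A) v (op_apply (conf0 m A) (\<lambda>s t. \<Sum>B\<in>Pow A. ext0 B (vac_op \<Phi>0 B) s t) v) = ip (conf0 m A) v (op_apply (conf0 m A) (H0v A) v)"
    by (simp add: ip_def)
  thus "g * real (card S) * (vec_norm (conf0 m A) v)\<^sup>2 \<le> Re (ip (conf0 m A) v (op_apply (conf0 m A) (\<lambda>s t. \<Sum>B\<in>Pow A. ext0 B (vac_op \<Phi>0 B) s t) v))"
    using gap_vac[OF A S v] by simp
next
  fix X C1 C2 :: "'d site set"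
  assume X: "finite X" "X \<subseteq> C1 \<union> C2" "X \<inter> C1 \<noteq> {}" "X \<inter> C2 \<noteq> {}" "lat_nbr R `` C1 \<inter> C2 = {}"
  have "\<not> lat_connected X"
  proof (rule not_lat_connected_if_separated[OF X(2-4)])
    fix a b assume "a \<in> C1" "b \<in> C2"
    hence "(a, b) \<notin> lat_nbr R" using X(5) by auto
    thus "1 < dist1 a b" using R by (simp add: lat_nbr_def)
  qed
  thus "op_zero_on (conf0 m X) (vac_op \<Upsilon> X)" using intU by (intro vac_op_zero) (simp add: is_interaction_def)
next
  show "op_zero_on (conf0 m {}) (vac_op \<Upsilon> {})" using intU by (intro vac_op_zero) (simp add: is_interaction_def lat_connected_def)
next
  fix X :: "'d site set" assume X: "finite X"
  interpret unitary_kernel "Uprod u X" "confs m X" "conf0 m X" by (rule unitary[OF X])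
  show "ob (conf0 m X) (op_norm (confs m X) (\<Upsilon> X)) (vac_op \<Upsilon> X)"
    unfolding vac_op_def by (rule ob_conjop) (rule ob_op_norm, rule finite_confs[OF X])
next
  fix U :: "'d site set" assume "finite U"
  thus "(\<Sum>X\<in>Pow U. exp (\<kappa> * real (card X)) * op_norm (confs m X) (\<Upsilon> X)) \<le> real (card U)"
    by (rule kappa_norm_local_sum[OF intU kap])
qed (use \<kappa> g in auto)

section \<open>Traces of product observables in the spin system\<close>

abbreviation \<Phi> :: "'d interaction" where "\<Phi> \<equiv> int_add \<Phi>0 \<Upsilon>"

definition Tr_spin :: "real \<Rightarrow> ('d site \<Rightarrow> smat) \<Rightarrow> 'd site set \<Rightarrow> complex" where
  "Tr_spin b Ob V = op_trace (confs m V) (op_mult (confs m V) (op_exp (confs m V) (-b) (hamiltonian m \<Phi> V)) (op_tensor V Ob))"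

lemma Tr_spin_eq:
  assumes V: "finite V"
  shows "Tr_spin b Ob V = Tr_obs b (\<lambda>i. smat_conj u m (Ob i)) V"
proof -
  interpret unitary_kernel "Uprod u V" "confs m V" "conf0 m V" by (rule unitary[OF V])
  let ?D = "confs m V" and ?D' = "conf0 m V" and ?U = "Uprod u V"
  have H: "conjop ?U ?D (hamiltonian m \<Phi> V) x z = Ham V V x z" if "x \<in> ?D'" "z \<in> ?D'" for x z
  proof -
    have "conjop ?U ?D (hamiltonian m \<Phi> V) x z = conjop ?U ?D (\<lambda>x z. hamiltonian m \<Phi>0 V x z + hamiltonian m \<Upsilon> V x z) x z"
      by (rule conjop_cong) (simp add: hamiltonian_def op_embed_def int_add_def sum.distrib[symmetric], intro sum.cong refl, simp add: int_add_def)
    thus ?thesis unfolding conjop_add conjop_hamiltonian[OF V that] by (simp add: Ham_def H0_def)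
  qed
  have "Tr_spin b Ob V = op_trace ?D' (conjop ?U ?D (op_mult ?D (op_exp ?D (-b) (hamiltonian m \<Phi> V)) (op_tensor V Ob)))"
    unfolding Tr_spin_def by (rule trace_conjop[symmetric])
  also have "\<dots> = op_trace ?D' (op_mult ?D' (op_exp ?D' (-b) (Ham V V)) (\<lambda>x z. \<Prod>i\<in>V. smat_conj u m (Ob i) (x i) (z i)))"
    unfolding op_trace_def
  proof (rule sum.cong[OF refl])
    fix x assume s: "x \<in> ?D'"
    have "conjop ?U ?D (op_exp ?D (-b) (hamiltonian m \<Phi> V)) x z = op_exp ?D' (-b) (Ham V V) x z" if t: "z \<in> ?D'" for z
      unfolding conjop_exp[OF s t] by (rule op_exp_cong[OF H s t])
    thus "conjop ?U ?D (op_mult ?D (op_exp ?D (-b) (hamiltonian m \<Phi> V)) (op_tensor V Ob)) x x =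
       op_mult ?D' (op_exp ?D' (-b) (Ham V V)) (\<lambda>x z. \<Prod>i\<in>V. smat_conj u m (Ob i) (x i) (z i)) x x"
      unfolding conjop_mult by (intro op_mult_cong) (auto simp: conjop_tensor[OF V])
  qed
  finally show ?thesis by (simp add: Tr_obs_def)
qed

lemma Tr_obs_scale: "Tr_obs d (\<lambda>i a b. q i * Ob i a b) V = (\<Prod>i\<in>V. q i) * Tr_obs d Ob V"
  unfolding Tr_obs_def op_trace_def op_mult_def sum_distrib_left by (intro sum.cong refl) (simp add: prod.distrib mult_ac)

lemma Tr_obs_cong:
  assumes V: "\<And>i a b. a < m \<Longrightarrow> b < m \<Longrightarrow> Ob i a b = Ob' i a b"
  shows "Tr_obs d Ob V = Tr_obs d Ob' V"
proof -
  have lt: "s i < m" if "s \<in> conf0 m V" for s i using that m by (cases "i \<in> V") (auto simp: conf0_def)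
  show ?thesis unfolding Tr_obs_def op_trace_def op_mult_def
    by (intro sum.cong refl arg_cong2[where f="(*)"] prod.cong V lt) auto
qed

text \<open>The factors of the observable are divided by their vacuum entries to meet the
  normalization \<open>Ob i 0 0 = 1\<close>, and the product of these entries is restored at the
  end. \<open>K\<close> bounds the normalized entries.\<close>

theorem spin_log_ratio:
  assumes A: "finite A" "0 \<le> a" and n: "0 < n" and t: "0 \<le> t"
    and K: "1 \<le> K" "\<And>i a b. a < m \<Longrightarrow> b < m \<Longrightarrow> cmod (smat_conj u m (Ob i) a b) \<le> K * cmod (smat_conj u m (Ob i) 0 0)"
    and q: "\<And>i. smat_conj u m (Ob i) 0 0 \<noteq> 0"
    and small: "(1 + 2 * exp a) ^ lat_deg TYPE('d) R * (real m ^ 2 * K ^ 2 * (exp (t - \<kappa>) + exp (- g * t))) * 2 ^ (5 * lat_deg TYPE('d) R) * 2 ^ (5 * lat_deg TYPE('d) R) \<le> 1/2"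
  shows "\<exists>l. nb A a l \<le> 4 * real (card A) \<and> (\<forall>V\<subseteq>A. Tr_spin (real n * t) (\<lambda>_. smat_id) V \<noteq> 0 \<and>
     Tr_spin (real n * t) Ob V = (\<Prod>i\<in>V. smat_conj u m (Ob i) 0 0) * Tr_spin (real n * t) (\<lambda>_. smat_id) V * exp (l V))"
proof -
  define O' where "O' i a b = smat_conj u m (Ob i) a b / smat_conj u m (Ob i) 0 0" for i a b
  have KO: "cmod (O' i a b) \<le> K" if "a < m" "b < m" for i a b
    using K(2)[OF that, of i] q[of i] by (simp add: O'_def norm_divide field_simps)
  have O0: "O' i 0 0 = 1" for i using q by (simp add: O'_def)
  obtain l where l: "nb A a l \<le> 4 * real (card A)" "\<forall>V\<subseteq>A. Tr_obs (real n * t) (\<lambda>_. smat_id) V \<noteq> 0 \<and>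
     Tr_obs (real n * t) O' V = Tr_obs (real n * t) (\<lambda>_. smat_id) V * exp (l V)"
    using log_ratio_expansion[where Ob=O', OF A n t K(1) KO O0 small] by blast
  show ?thesis
  proof (intro exI[of _ l] conjI allI impI l(1))
    fix V assume V: "V \<subseteq> A"
    have fV: "finite V" using V A finite_subset by blast
    have I: "Tr_spin (real n * t) (\<lambda>_. smat_id) V = Tr_obs (real n * t) (\<lambda>_. smat_id) V"
      unfolding Tr_spin_eq[OF fV] by (rule Tr_obs_cong) (simp add: smat_conj_id, simp add: smat_id_def)
    thus "Tr_spin (real n * t) (\<lambda>_. smat_id) V \<noteq> 0" using l(2) V by simp
    have "Tr_spin (real n * t) Ob V = Tr_obs (real n * t) (\<lambda>i a b. smat_conj u m (Ob i) 0 0 * O' i a b) V"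
      unfolding Tr_spin_eq[OF fV] by (rule Tr_obs_cong) (simp add: O'_def q)
    also have "\<dots> = (\<Prod>i\<in>V. smat_conj u m (Ob i) 0 0) * Tr_obs (real n * t) O' V" by (rule Tr_obs_scale)
    finally show "Tr_spin (real n * t) Ob V = (\<Prod>i\<in>V. smat_conj u m (Ob i) 0 0) * Tr_spin (real n * t) (\<lambda>_. smat_id) V * exp (l V)"
      using l(2) V I by (simp add: mult.assoc)
  qed
qed

lemma Tr_spin_Un:
  assumes V: "finite V1" "finite V2" and disj: "V1 \<inter> V2 = {}" and sep: "\<And>x y. x \<in> V1 \<Longrightarrow> y \<in> V2 \<Longrightarrow> 1 < dist1 x y"
  shows "Tr_spin b Ob (V1 \<union> V2) = Tr_spin b Ob V1 * Tr_spin b Ob V2"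
proof -
  have z: "op_zero_on (conf0 m A) (vac_op \<Psi> A)" if "is_interaction m \<Psi>" "A \<subseteq> V1 \<union> V2" "A \<inter> V1 \<noteq> {}" "A \<inter> V2 \<noteq> {}" for A \<Psi>
    using not_lat_connected_if_separated[OF that(2-4) sep] that(1) by (intro vac_op_zero) (simp add: is_interaction_def)
  have "finite (V1 \<union> V2)" using V by simp
  thus ?thesis unfolding Tr_spin_eq[OF V(1)] Tr_spin_eq[OF V(2)] Tr_spin_eq[OF \<open>finite (V1 \<union> V2)\<close>]
    by (intro Tr_obs_Un[OF V disj] z int0 intU)
qed

end

section \<open>Positivity and the zero-temperature limit\<close>

text \<open>The squared Hilbert-Schmidt norm.\<close>

definition hs :: "('a \<Rightarrow> nat) set \<Rightarrow> 'a op \<Rightarrow> real" where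
  "hs D M = (\<Sum>t\<in>D. \<Sum>s\<in>D. (cmod (M s t))\<^sup>2)"

lemma hs_nonneg: "0 \<le> hs D M"
  by (simp add: hs_def sum_nonneg)

lemma hs_columns: "finite D \<Longrightarrow> hs D M = (\<Sum>t\<in>D. (vec_norm D (\<lambda>s. M s t))\<^sup>2)"
  by (simp add: hs_def vec_norm_sq)

lemma op_trace_commute: "op_trace D (op_mult D A B) = op_trace D (op_mult D B A)"
  unfolding op_trace_def op_mult_def by (subst sum.swap) (simp add: mult.commute)

lemma hs_contraction:
  assumes D: "finite D" and W: "ob D 1 W"
  shows "hs D (op_mult D W M) \<le> hs D M"
  unfolding hs_columns[OF D]
proof (rule sum_mono)
  fix t
  have "vec_norm D (\<lambda>s. op_mult D W M s t) = vec_norm D (op_apply D W (\<lambda>r. M r t))"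
    by (rule vec_norm_cong) (simp add: op_mult_def op_apply_def)
  also have "\<dots> \<le> vec_norm D (\<lambda>r. M r t)" using obD[OF W, of "\<lambda>r. M r t"] by simp
  finally show "(vec_norm D (\<lambda>s. op_mult D W M s t))\<^sup>2 \<le> (vec_norm D (\<lambda>r. M r t))\<^sup>2"
    by (intro power_mono) auto
qed

text \<open>Cauchy-Schwarz in each row bounds the unit vector \<open>v = W v\<close> by the entries
  of \<open>W\<close>. It keeps the partition function away from 0 once the ground energy has been
  shifted to 0.\<close>

lemma hs_ge_1:
  assumes D: "finite D" and fixed: "\<And>s. s \<in> D \<Longrightarrow> op_apply D W v s = v s" and v: "vec_norm D v = 1"
  shows "1 \<le> hs D W"
proof -
  have "1 = (\<Sum>s\<in>D. (cmod (op_apply D W v s))\<^sup>2)" using v vec_norm_sq[of D v] by (simp add: fixed)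
  also have "\<dots> \<le> (\<Sum>s\<in>D. \<Sum>t\<in>D. (cmod (W s t))\<^sup>2)"
  proof (rule sum_mono)
    fix s
    have "op_apply D W v s = ip D (\<lambda>t. cnj (W s t)) v" by (simp add: op_apply_def ip_def)
    hence "cmod (op_apply D W v s) \<le> vec_norm D (\<lambda>t. cnj (W s t)) * vec_norm D v" by (simp only: ip_le)
    hence "(cmod (op_apply D W v s))\<^sup>2 \<le> (vec_norm D (\<lambda>t. cnj (W s t)))\<^sup>2" using v by (intro power_mono) auto
    thus "(cmod (op_apply D W v s))\<^sup>2 \<le> (\<Sum>t\<in>D. (cmod (W s t))\<^sup>2)" by (simp add: vec_norm_sq)
  qed
  also have "\<dots> = hs D W" unfolding hs_def by (rule sum.swap)
  finally show ?thesis .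
qed

text \<open>Split the exponential into two halves and the projection into two copies; cyclicity of
  the trace produces a product of \<open>op_mult D ?F Ob\<close> with its adjoint. The result is
  visibly real and nonnegative, and it decreases under contractions.\<close>

lemma trace_exp_hs:
  assumes D: "finite D" and H: "op_hermitian D H" and Ob: "op_hermitian D Ob"
    and idem: "\<And>s t. s \<in> D \<Longrightarrow> t \<in> D \<Longrightarrow> op_mult D Ob Ob s t = Ob s t"
  shows "op_trace D (op_mult D (op_exp D b H) Ob) = complex_of_real (hs D (op_mult D (op_exp D (b / 2) H) Ob))"
proof -
  let ?F = "op_exp D (b / 2) H"
  have hF: "op_hermitian D ?F" by (rule op_exp_hermitian[OF D H])
  have "op_trace D (op_mult D (op_exp D b H) Ob) = (\<Sum>s\<in>D. \<Sum>t\<in>D. op_exp D b H s t * Ob t s)"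
    by (simp add: op_trace_def op_mult_def)
  also have "\<dots> = (\<Sum>s\<in>D. \<Sum>t\<in>D. op_mult D ?F ?F s t * op_mult D Ob Ob t s)"
    using op_exp_add[OF D, of _ _ "b / 2" "b / 2" H] by (intro sum.cong refl) (simp add: idem)
  also have "\<dots> = op_trace D (op_mult D (op_mult D ?F ?F) (op_mult D Ob Ob))"
    by (simp add: op_trace_def op_mult_def[of D "op_mult D ?F ?F"])
  also have "\<dots> = op_trace D (op_mult D ?F (op_mult D (op_mult D ?F Ob) Ob))"
    unfolding op_trace_def
  proof (rule sum.cong[OF refl])
    fix s
    have "op_mult D (op_mult D ?F ?F) (op_mult D Ob Ob) s s = op_mult D ?F (op_mult D ?F (op_mult D Ob Ob)) s s"
      by (rule op_mult_assoc[OF D])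
    also have "\<dots> = op_mult D ?F (op_mult D (op_mult D ?F Ob) Ob) s s"
      by (rule op_mult_cong) (auto simp: op_mult_assoc[OF D])
    finally show "op_mult D (op_mult D ?F ?F) (op_mult D Ob Ob) s s = op_mult D ?F (op_mult D (op_mult D ?F Ob) Ob) s s" .
  qed
  also have "\<dots> = op_trace D (op_mult D (op_mult D (op_mult D ?F Ob) Ob) ?F)" by (rule op_trace_commute)
  also have "\<dots> = op_trace D (op_mult D (op_mult D ?F Ob) (op_mult D Ob ?F))"
    unfolding op_trace_def by (intro sum.cong refl op_mult_assoc[OF D])
  also have "\<dots> = (\<Sum>s\<in>D. \<Sum>t\<in>D. op_mult D ?F Ob s t * op_mult D Ob ?F t s)"
    by (simp add: op_trace_def op_mult_def[of D "op_mult D ?F Ob"])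
  also have "\<dots> = (\<Sum>s\<in>D. \<Sum>t\<in>D. complex_of_real ((cmod (op_mult D ?F Ob s t))\<^sup>2))"
  proof (intro sum.cong refl)
    fix s t assume st: "s \<in> D" "t \<in> D"
    have "op_mult D Ob ?F t s = cnj (op_mult D ?F Ob s t)"
      using st by (simp add: op_mult_def op_hermitianD[OF hF] op_hermitianD[OF Ob] mult.commute)
    thus "op_mult D ?F Ob s t * op_mult D Ob ?F t s = complex_of_real ((cmod (op_mult D ?F Ob s t))\<^sup>2)"
      by (simp only: complex_norm_square)
  qed
  also have "\<dots> = complex_of_real (hs D (op_mult D ?F Ob))"
    unfolding hs_def of_real_sum by (rule sum.swap)
  finally show ?thesis .
qed

lemma ob_exp:
  assumes D: "finite D" and M: "ob D s M" and b: "0 \<le> b"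
  shows "ob D (exp (b * s)) (op_exp D b M)"
  unfolding ob_def
proof (intro conjI allI)
  fix v :: "('a \<Rightarrow> nat) \<Rightarrow> complex"
  let ?p = "\<lambda>N x t. \<Sum>n<N. complex_of_real (b ^ n / fact n) * op_pow D M n x t"
  have s0: "0 \<le> s" using M by (simp add: ob_def)
  have "(\<lambda>N. ?p N x t) \<longlonglongrightarrow> op_exp D b M x t" if "x \<in> D" "t \<in> D" for x t
    using egf_sums[OF geom_bounded_pow[OF D that], of b M] by (simp add: sums_def op_exp_egf)
  hence "(\<lambda>N. vec_norm D (op_apply D (?p N) v)) \<longlonglongrightarrow> vec_norm D (op_apply D (op_exp D b M) v)"
    unfolding vec_norm_def op_apply_def by (intro tendsto_intros) auto
  moreover have "vec_norm D (op_apply D (?p N) v) \<le> exp (b * s) * vec_norm D v" for N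
  proof -
    have "ob D (\<Sum>n<N. cmod (complex_of_real (b ^ n / fact n)) * s ^ n) (?p N)"
      by (intro ob_sum ob_cmult ob_pow D M) auto
    moreover have "(\<Sum>n<N. cmod (complex_of_real (b ^ n / fact n)) * s ^ n) \<le> exp (b * s)"
    proof -
      have "(\<Sum>n<N. cmod (complex_of_real (b ^ n / fact n)) * s ^ n) = (\<Sum>n<N. (b * s) ^ n /\<^sub>R fact n)"
      proof (rule sum.cong[OF refl])
        fix n
        have "cmod (complex_of_real (b ^ n / fact n)) = b ^ n / fact n" unfolding norm_of_real using b by simp
        thus "cmod (complex_of_real (b ^ n / fact n)) * s ^ n = (b * s) ^ n /\<^sub>R fact n"
          by (simp only: power_mult_distrib) (simp add: divide_inverse)
      qed
      also have "\<dots> \<le> exp (b * s)"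
        unfolding exp_def by (rule sum_le_suminf[OF summable_exp_generic]) (use b s0 in auto)
      finally show ?thesis .
    qed
    ultimately have "ob D (exp (b * s)) (?p N)" by (rule ob_mono)
    thus ?thesis by (rule obD)
  qed
  ultimately show "vec_norm D (op_apply D (op_exp D b M) v) \<le> exp (b * s) * vec_norm D v"
    by (intro LIMSEQ_le_const2) auto
qed simp

text \<open>If \<open>K\<close> is positive and bounded by \<open>c\<close>, then
  \<open>c - K\<close> has norm at most \<open>c\<close>, so its exponential is at most
  \<open>exp (b * c)\<close>. The factor of the shift cancels this.\<close>

lemma exp_contraction:
  assumes D: "finite D" and K: "op_hermitian D K" and pos: "\<And>v. 0 \<le> Re (ip D v (op_apply D K v))" and b: "0 \<le> b"
  shows "ob D 1 (op_exp D (-b) K)"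
proof -
  obtain c where c: "ob D c K" using ob_exists[OF D] by blast
  have c0: "0 \<le> c" using c by (simp add: ob_def)
  let ?B = "\<lambda>s t. complex_of_real c * op_id s t - K s t"
  have "ob D c ?B"
  proof (rule hermitian_form_bound[OF D _ c0])
    show "op_hermitian D ?B" by (rule op_hermitianI) (simp add: op_hermitianD[OF K] op_id_def)
    fix v
    have "op_apply D ?B v s = complex_of_real c * v s - op_apply D K v s" if "s \<in> D" for s
      using that D by (simp add: op_apply_def left_diff_distrib sum_subtractf op_id_def
          if_distrib[of "\<lambda>x. x * _"] if_distrib[of "\<lambda>x. _ * x"] sum.delta cong: if_cong)
    hence "ip D v (op_apply D ?B v) = ip D v (\<lambda>s. complex_of_real c * v s - op_apply D K v s)" by (simp add: ip_def)
    also have "Re \<dots> = c * (vec_norm D v)\<^sup>2 - Re (ip D v (op_apply D K v))"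
      unfolding ip_diff_right ip_cmult_right ip_self by simp
    finally have eq: "Re (ip D v (op_apply D ?B v)) = c * (vec_norm D v)\<^sup>2 - Re (ip D v (op_apply D K v))" .
    have "Re (ip D v (op_apply D K v)) \<le> c * (vec_norm D v)\<^sup>2"
    proof -
      have "Re (ip D v (op_apply D K v)) \<le> cmod (ip D v (op_apply D K v))" by (rule complex_Re_le_cmod)
      also have "\<dots> \<le> vec_norm D v * vec_norm D (op_apply D K v)" by (rule ip_le)
      also have "\<dots> \<le> vec_norm D v * (c * vec_norm D v)" by (intro mult_left_mono obD[OF c]) auto
      finally show ?thesis by (simp add: power2_eq_square mult_ac)
    qed
    thus "\<bar>Re (ip D v (op_apply D ?B v))\<bar> \<le> c * (vec_norm D v)\<^sup>2" unfolding eq using pos[of v] by linarith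
  qed
  hence "ob D (cmod (exp (complex_of_real (- b * c))) * exp (b * c)) (\<lambda>s t. exp (complex_of_real (- b * c)) * op_exp D b ?B s t)"
    by (intro ob_cmult ob_exp[OF D _ b])
  moreover have "cmod (exp (complex_of_real (- b * c))) * exp (b * c) = 1"
    by (simp only: norm_exp_eq_Re Re_complex_of_real exp_add[symmetric]) simp
  ultimately have "ob D 1 (\<lambda>s t. exp (complex_of_real (- b * c)) * op_exp D b ?B s t)" by simp
  thus ?thesis using ob_cong[of D "op_exp D (-b) K" "\<lambda>s t. exp (complex_of_real (- b * c)) * op_exp D b ?B s t" 1] op_exp_shift[OF D, of _ _ b K c] by blast
qed

text \<open>Minimize the form on the unit sphere. Vectors are functions of all configurations, so
  the coordinates outside \<open>D\<close> are pinned to 0 and the others to the unit disc, which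
  gives a compact product.\<close>

lemma ground_state_exists:
  fixes D :: "('a \<Rightarrow> nat) set"
  assumes D: "finite D" "D \<noteq> {}"
  obtains v where "vec_norm D v = 1"
    "\<And>w. vec_norm D w = 1 \<Longrightarrow> Re (ip D v (op_apply D H v)) \<le> Re (ip D w (op_apply D H w))"
proof -
  let ?B = "PiE UNIV (\<lambda>s::'a \<Rightarrow> nat. if s \<in> D then cball 0 1 else {0::complex})"
  let ?S = "?B \<inter> {v. vec_norm D v = 1}"
  let ?q = "\<lambda>v. Re (ip D v (op_apply D H v))"
  have "compact ?B"
    unfolding compactin_euclidean_iff[symmetric] euclidean_product_topology[symmetric] compactin_PiE
    by (auto simp: compactin_euclidean_iff)
  moreover have cont: "continuous_on UNIV (\<lambda>v. v s)" for s :: "'a \<Rightarrow> nat" and v :: "('a \<Rightarrow> nat) \<Rightarrow> complex"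
    by (rule continuous_on_product_coordinates)
  have cv: "continuous_on UNIV (\<lambda>v::('a \<Rightarrow> nat) \<Rightarrow> complex. v s)" for s
    by (rule continuous_on_product_coordinates)
  have cn: "continuous_on UNIV (\<lambda>v. vec_norm D v)" unfolding vec_norm_def by (intro continuous_intros cv)
  have cq: "continuous_on UNIV ?q" unfolding ip_def op_apply_def by (intro continuous_intros cv)
  have "closed {v. vec_norm D v = 1}" by (rule closed_Collect_eq[OF cn continuous_on_const])
  ultimately have "compact ?S" by (rule compact_Int_closed)
  moreover have "?S \<noteq> {}"
  proof -
    obtain z where t: "z \<in> D" using D by auto
    have "(\<lambda>r. if r = z then 1 else 0) \<in> ?S" using t vec_norm_delta[OF D(1) t] by auto
    thus ?thesis by blast
  qed
  ultimately have "\<exists>v\<in>?S. \<forall>w\<in>?S. ?q v \<le> ?q w"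
    by (rule continuous_attains_inf[OF _ _ continuous_on_subset[OF cq subset_UNIV]])
  then obtain v where v: "v \<in> ?S" "\<And>w. w \<in> ?S \<Longrightarrow> ?q v \<le> ?q w" by (elim bexE) simp
  show ?thesis
  proof (rule that[of v])
    show "vec_norm D v = 1" using v by simp
    fix w assume w: "vec_norm D w = 1"
    let ?w = "\<lambda>s. if s \<in> D then w s else 0"
    have n: "vec_norm D ?w = 1" using w vec_norm_cong[of D ?w w] by simp
    have "cmod (w s) \<le> 1" if "s \<in> D" for s using vec_norm_entry[OF D(1) that, of w] w by simp
    hence "?w \<in> ?S" using n by (auto simp: dist_norm)
    hence "?q v \<le> ?q ?w" by (rule v(2))
    also have "?q ?w = ?q w" by (simp add: ip_def op_apply_def cong: sum.cong)
    finally show "?q v \<le> ?q w" .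
  qed
qed

text \<open>A minimizer of the form is an eigenvector, because the form of \<open>K\<close>, which
  is minimal and 0 at \<open>v\<close>, has vanishing first variation in the direction
  \<open>x = K v\<close>.\<close>

lemma ground_energy_exists:
  fixes D :: "('a \<Rightarrow> nat) set"
  assumes D: "finite D" "D \<noteq> {}" and H: "op_hermitian D H"
  obtains E v where "vec_norm D v = 1" "\<And>w. 0 \<le> Re (ip D w (op_apply D (\<lambda>s r. H s r - complex_of_real E * op_id s r) w))"
    "\<And>s. s \<in> D \<Longrightarrow> op_apply D (\<lambda>s r. H s r - complex_of_real E * op_id s r) v s = 0"
proof -
  obtain v where v: "vec_norm D v = 1"
    "\<And>w. vec_norm D w = 1 \<Longrightarrow> Re (ip D v (op_apply D H v)) \<le> Re (ip D w (op_apply D H w))"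
    using ground_state_exists[OF D] by blast
  define E where "E = Re (ip D v (op_apply D H v))"
  define K where "K = (\<lambda>s r. H s r - complex_of_real E * op_id s r)"
  have Ka: "op_apply D K w s = op_apply D H w s - complex_of_real E * w s" if "s \<in> D" for w s
    using that D by (simp add: K_def op_apply_def left_diff_distrib sum_subtractf op_id_def
        if_distrib[of "\<lambda>x. x * _"] if_distrib[of "\<lambda>x. _ * x"] sum.delta cong: if_cong)
  have Kq: "Re (ip D w (op_apply D K w)) = Re (ip D w (op_apply D H w)) - E * (vec_norm D w)\<^sup>2" for w
  proof -
    have "ip D w (op_apply D K w) = ip D w (\<lambda>s. op_apply D H w s - complex_of_real E * w s)"
      by (simp add: ip_def Ka)
    thus ?thesis unfolding ip_diff_right ip_cmult_right ip_self by simp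
  qed
  have pos: "0 \<le> Re (ip D w (op_apply D K w))" for w
  proof (cases "vec_norm D w = 0")
    case True
    hence "\<forall>s\<in>D. w s = 0" using vec_norm_eq_0_iff[OF D(1)] by blast
    hence "ip D w (op_apply D K w) = 0" by (simp add: ip_def)
    thus ?thesis by simp
  next
    case False
    define k where "k = complex_of_real (1 / vec_norm D w)"
    have ck: "cmod k = 1 / vec_norm D w" using vec_norm_nonneg[of D w] by (simp add: k_def norm_divide)
    have kk: "cnj k * k = complex_of_real ((1 / vec_norm D w)\<^sup>2)" by (simp add: k_def power2_eq_square)
    have "vec_norm D (\<lambda>s. k * w s) = 1" unfolding vec_norm_cmult ck using False by simp
    hence "E \<le> Re (ip D (\<lambda>s. k * w s) (op_apply D H (\<lambda>s. k * w s)))" unfolding E_def by (rule v(2))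
    also have "op_apply D H (\<lambda>s. k * w s) = (\<lambda>s. k * op_apply D H w s)" by (rule ext) (rule op_apply_cmult)
    also have "ip D (\<lambda>s. k * w s) (\<lambda>s. k * op_apply D H w s) = (cnj k * k) * ip D w (op_apply D H w)"
      by (simp add: ip_cmult_left ip_cmult_right mult.assoc)
    also have "Re \<dots> = (1 / vec_norm D w)\<^sup>2 * Re (ip D w (op_apply D H w))" unfolding kk by simp
    finally have "E * (vec_norm D w)\<^sup>2 \<le> Re (ip D w (op_apply D H w))"
      using False by (simp add: field_simps)
    thus ?thesis unfolding Kq by simp
  qed
  have hK: "op_hermitian D K" by (rule op_hermitianI) (simp add: K_def op_hermitianD[OF H] op_id_def)
  have z: "Re (ip D v (op_apply D K v)) = 0" unfolding Kq using v(1) by (simp add: E_def)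
  define x where "x = op_apply D K v"
  define N where "N = (vec_norm D x)\<^sup>2"
  define c where "c = Re (ip D x (op_apply D K x))"
  have quad: "0 \<le> 2 * t * N + t\<^sup>2 * c" for t :: real
  proof -
    let ?w = "\<lambda>s. v s + complex_of_real t * x s"
    have Kw: "op_apply D K ?w = (\<lambda>s. x s + complex_of_real t * op_apply D K x s)"
      by (rule ext) (simp add: op_apply_add op_apply_cmult x_def)
    have 1: "ip D v (op_apply D K x) = ip D x x" using hermitian_ip[OF hK, of v x] by (simp add: x_def)
    have "0 \<le> Re (ip D ?w (op_apply D K ?w))" by (rule pos)
    also have "ip D ?w (op_apply D K ?w) = ip D v x + complex_of_real t * ip D v (op_apply D K x) + complex_of_real t * ip D x x
       + complex_of_real (t\<^sup>2) * ip D x (op_apply D K x)"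
      unfolding Kw ip_add_left ip_add_right ip_cmult_left ip_cmult_right by (simp add: power2_eq_square algebra_simps)
    also have "Re \<dots> = 2 * t * N + t\<^sup>2 * c"
      unfolding 1 ip_self using z by (simp add: N_def c_def x_def[symmetric])
    finally show ?thesis .
  qed
  have N0: "0 \<le> N" by (simp add: N_def)
  have "N = 0"
  proof (rule ccontr)
    assume "N \<noteq> 0"
    hence Np: "0 < N" using N0 by simp
    have c0: "0 \<le> c" unfolding c_def by (rule pos)
    \<comment> \<open>At \<open>t = - e\<close> the quadratic expression equals
      \<open>- (e\<^sup>2 * (c + 2))\<close>, which contradicts \<open>quad\<close>.\<close>
    define e where "e = N / (c + 1)"
    have e: "N = e * (c + 1)" "0 < e" using Np c0 by (auto simp: e_def)
    have "2 * (- e) * N + (- e)\<^sup>2 * c = - (e\<^sup>2 * (c + 2))"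
      by (simp add: e(1) power2_eq_square algebra_simps)
    also have "\<dots> < 0" using e c0 by (simp add: mult_pos_pos)
    finally show False using quad[of "- e"] by simp
  qed
  hence "\<forall>s\<in>D. x s = 0" using vec_norm_eq_0_iff[OF D(1), of x] by (simp add: N_def)
  thus ?thesis using that[of v E] v(1) pos by (simp add: K_def x_def)
qed

lemma antimono_tendsto:
  fixes f :: "real \<Rightarrow> real"
  assumes anti: "\<And>s t. 0 \<le> s \<Longrightarrow> s \<le> t \<Longrightarrow> f t \<le> f s" and lb: "\<And>t. 0 \<le> t \<Longrightarrow> c \<le> f t"
  shows "\<exists>L\<ge>c. (f \<longlongrightarrow> L) at_top"
proof -
  let ?L = "Inf (f ` {0..})"
  have bdd: "bdd_below (f ` {0..})" by (rule bdd_belowI[of _ c]) (use lb in auto)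
  have le: "?L \<le> f t" if "0 \<le> t" for t by (rule cInf_lower[OF _ bdd]) (use that in auto)
  have "c \<le> ?L" by (rule cInf_greatest) (use lb in auto)
  moreover have "(f \<longlongrightarrow> ?L) at_top"
  proof (rule order_tendstoI)
    fix a assume a: "a < ?L"
    show "\<forall>\<^sub>F x in at_top. a < f x" using eventually_ge_at_top[of 0]
      by eventually_elim (use le a in fastforce)
  next
    fix a assume "?L < a"
    then obtain t where t: "0 \<le> t" "f t < a" using cInf_lessD[of "f ` {0..}" a] by auto
    show "\<forall>\<^sub>F x in at_top. f x < a" using eventually_ge_at_top[of t]
      by eventually_elim (use anti t in fastforce)
  qed
  ultimately show ?thesis by blast
qed

text \<open>With the ground energy subtracted, numerator and denominator are squared Hilbert-Schmidt
  norms that decrease in \<open>b\<close>, and the denominator stays at least 1. Both converge,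
  hence so does the quotient.\<close>

lemma gibbs_limit:
  fixes D :: "('a \<Rightarrow> nat) set"
  assumes D: "finite D" "D \<noteq> {}" and H: "op_hermitian D H" and Ob: "op_hermitian D Ob"
    and idem: "\<And>r z. r \<in> D \<Longrightarrow> z \<in> D \<Longrightarrow> op_mult D Ob Ob r z = Ob r z"
  shows "\<exists>L\<ge>0. ((\<lambda>b. gibbs_fin D H b Ob) \<longlongrightarrow> complex_of_real L) at_top"
proof -
  obtain E v where v: "vec_norm D v = 1" and pos: "\<And>w. 0 \<le> Re (ip D w (op_apply D (\<lambda>r z. H r z - complex_of_real E * op_id r z) w))"
    and ev: "\<And>r. r \<in> D \<Longrightarrow> op_apply D (\<lambda>r z. H r z - complex_of_real E * op_id r z) v r = 0"
    by (rule ground_energy_exists[OF D H], rule that)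
  define K where "K = (\<lambda>r z. H r z - complex_of_real E * op_id r z)"
  have hK: "op_hermitian D K" by (rule op_hermitianI) (simp add: K_def op_hermitianD[OF H] op_id_def)
  have con: "ob D 1 (op_exp D (-b) K)" if "0 \<le> b" for b
    by (rule exp_contraction[OF D(1) hK _ that]) (unfold K_def, rule pos)
  have shift: "op_exp D (-b) H r z = exp (complex_of_real (- b * E)) * op_exp D (-b) K r z" if st: "r \<in> D" "z \<in> D" for b r z
  proof -
    have "op_exp D (-b) H r z = exp (complex_of_real (- b * E)) * op_exp D b (\<lambda>r z. complex_of_real E * op_id r z - H r z) r z"
      by (rule op_exp_shift[OF D(1) st])
    also have "op_exp D b (\<lambda>r z. complex_of_real E * op_id r z - H r z) r z = op_exp D (-b) K r z"
    proof -
      have eq: "(\<lambda>r z. complex_of_real E * op_id r z - H r z) = (\<lambda>r z. - K r z)" by (simp add: K_def fun_eq_iff)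
      show ?thesis unfolding eq op_exp_egf egf_uminus op_pow_uminus ..
    qed
    finally show ?thesis .
  qed
  have exp_id: "op_trace D (op_mult D M op_id) = op_trace D M" for M
    unfolding op_trace_def by (intro sum.cong refl op_mult_id_right D(1))
  have hid: "op_hermitian D op_id" by (rule op_hermitianI) (simp add: op_id_def)
  define f where "f b = hs D (op_mult D (op_exp D (- b / 2) K) Ob)" for b
  define p where "p b = hs D (op_mult D (op_exp D (- b / 2) K) op_id)" for b
  have gf: "gibbs_fin D H b Ob = complex_of_real (f b / p b)" for b
  proof -
    have "op_trace D (op_mult D (op_exp D (-b) H) M) = exp (complex_of_real (- b * E)) * op_trace D (op_mult D (op_exp D (-b) K) M)" for M
      unfolding op_trace_def op_mult_def sum_distrib_left
      by (intro sum.cong refl) (simp only: shift mult.assoc)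
    from this[of Ob] this[of op_id] have "gibbs_fin D H b Ob = op_trace D (op_mult D (op_exp D (-b) K) Ob) / op_trace D (op_mult D (op_exp D (-b) K) op_id)"
      by (simp add: gibbs_fin_def exp_id)
    also have "op_trace D (op_mult D (op_exp D (-b) K) Ob) = complex_of_real (f b)"
      unfolding f_def using trace_exp_hs[OF D(1) hK Ob idem, of "-b"] by simp
    also have "op_trace D (op_mult D (op_exp D (-b) K) op_id) = complex_of_real (p b)"
      unfolding p_def using trace_exp_hs[OF D(1) hK hid op_mult_id_right[OF D(1)], of "-b"] by simp
    finally show ?thesis by simp
  qed
  have anti: "hs D (op_mult D (op_exp D (- t / 2) K) M) \<le> hs D (op_mult D (op_exp D (- s / 2) K) M)" if "0 \<le> s" "s \<le> t" for s t M
  proof -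
    have "op_exp D (- t / 2) K r z = op_mult D (op_exp D (- (t - s) / 2) K) (op_exp D (- s / 2) K) r z" if "r \<in> D" "z \<in> D" for r z
    proof -
      have "- (t - s) / 2 + - s / 2 = - t / 2" by (simp add: field_simps)
      thus ?thesis using op_exp_add[OF D(1) that, of "- (t - s) / 2" "- s / 2" K] by (simp only:)
    qed
    hence "op_mult D (op_exp D (- t / 2) K) M r z = op_mult D (op_mult D (op_exp D (- (t - s) / 2) K) (op_exp D (- s / 2) K)) M r z" if "r \<in> D" for r z
      using that by (intro op_mult_cong) auto
    hence "hs D (op_mult D (op_exp D (- t / 2) K) M) = hs D (op_mult D (op_exp D (- (t - s) / 2) K) (op_mult D (op_exp D (- s / 2) K) M))"
      by (simp add: hs_def op_mult_assoc[OF D(1)])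
    also have "\<dots> \<le> hs D (op_mult D (op_exp D (- s / 2) K) M)"
      using con[of "(t - s) / 2"] that by (intro hs_contraction[OF D(1)]) (simp add: minus_divide_left)
    finally show ?thesis .
  qed
  obtain Lf where Lf: "0 \<le> Lf" "(f \<longlongrightarrow> Lf) at_top"
    using antimono_tendsto[of f 0] anti hs_nonneg unfolding f_def by blast
  have p1: "1 \<le> p b" for b
    unfolding p_def
  proof (rule hs_ge_1[OF D(1) _ v])
    fix r assume s: "r \<in> D"
    \<comment> \<open>\<open>K\<close> annihilates the ground vector, so only the zeroth power
      contributes and the exponential fixes \<open>v\<close>.\<close>
    have pw: "(\<Sum>z\<in>D. op_pow D K n r z * v z) = (if n = 0 then v r else 0)" for n
    proof (cases n)
      case 0
      thus ?thesis using s D by (simp add: op_id_def if_distrib[of "\<lambda>x. x * _"] sum.delta cong: if_cong)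
    next
      case (Suc k)
      have "(\<Sum>z\<in>D. op_pow D K n r z * v z) = (\<Sum>z\<in>D. \<Sum>d\<in>D. op_pow D K k r d * K d z * v z)"
        unfolding Suc by (intro sum.cong refl) (simp only: op_pow_Suc_right[OF D(1) s] op_mult_def sum_distrib_right)
      also have "\<dots> = (\<Sum>d\<in>D. op_pow D K k r d * op_apply D K v d)"
        unfolding op_apply_def sum_distrib_left mult.assoc by (rule sum.swap)
      also have "\<dots> = 0" using ev by (intro sum.neutral) (simp add: K_def)
      finally show ?thesis using Suc by simp
    qed
    have "op_apply D (op_mult D (op_exp D (- b / 2) K) op_id) v r = op_apply D (op_exp D (- b / 2) K) v r"
      by (simp add: op_apply_def op_mult_id_right[OF D(1)])
    also have "\<dots> = (\<Sum>z\<in>D. v z * egf (- b / 2) (\<lambda>n. op_pow D K n r z))"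
      by (simp add: op_apply_def op_exp_egf mult.commute)
    also have "\<dots> = egf (- b / 2) (\<lambda>n. \<Sum>z\<in>D. v z * op_pow D K n r z)"
      using geom_bounded_pow[OF D(1) s] by (simp add: egf_sum egf_cmult geom_bounded_cmult)
    also have "\<dots> = egf (- b / 2) (\<lambda>n. v r * (complex_of_real 0) ^ n)"
      using pw by (intro arg_cong[where f="egf _"] ext) (simp add: mult.commute power_0_left)
    also have "\<dots> = v r * egf (- b / 2) (\<lambda>n. (complex_of_real 0) ^ n)"
    proof (rule egf_cmult)
      show "geom_bounded (\<lambda>n. (complex_of_real 0) ^ n)" unfolding geom_bounded_def
        by (intro exI[of _ 1] exI[of _ 0]) (simp add: norm_power)
    qed
    also have "\<dots> = v r" unfolding egf_power_seq by simp
    finally show "op_apply D (op_mult D (op_exp D (- b / 2) K) op_id) v r = v r" .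
  qed
  obtain Lp where Lp: "1 \<le> Lp" "(p \<longlongrightarrow> Lp) at_top"
    using antimono_tendsto[of p 1] anti p1 unfolding p_def by blast
  have "((\<lambda>b. complex_of_real (f b / p b)) \<longlongrightarrow> complex_of_real (Lf / Lp)) at_top"
    using Lf(2) Lp by (intro tendsto_of_real tendsto_divide) auto
  thus ?thesis unfolding gf using Lf(1) Lp(1) by (intro exI[of _ "Lf / Lp"]) auto
qed

lemma gibbs_fin_nonneg:
  assumes D: "finite D" and H: "op_hermitian D H" and Ob: "op_hermitian D Ob"
    and idem: "\<And>s t. s \<in> D \<Longrightarrow> t \<in> D \<Longrightarrow> op_mult D Ob Ob s t = Ob s t"
  shows "\<exists>r\<ge>0. gibbs_fin D H b Ob = complex_of_real r"
proof -
  have hid: "op_hermitian D op_id" by (rule op_hermitianI) (simp add: op_id_def)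
  have "op_trace D (op_exp D (-b) H) = op_trace D (op_mult D (op_exp D (-b) H) op_id)"
    unfolding op_trace_def by (intro sum.cong refl op_mult_id_right[symmetric] D)
  also have "\<dots> = complex_of_real (hs D (op_mult D (op_exp D (-b / 2) H) op_id))"
    by (rule trace_exp_hs[OF D H hid op_mult_id_right[OF D]])
  finally have 1: "op_trace D (op_exp D (-b) H) = complex_of_real (hs D (op_mult D (op_exp D (-b / 2) H) op_id))" .
  have 2: "op_trace D (op_mult D (op_exp D (-b) H) Ob) = complex_of_real (hs D (op_mult D (op_exp D (-b / 2) H) Ob))"
    by (rule trace_exp_hs[OF D H Ob idem])
  show ?thesis unfolding gibbs_fin_def 1 2 of_real_divide[symmetric]
    by (rule exI[of _ "hs D (op_mult D (op_exp D (-b / 2) H) Ob) / hs D (op_mult D (op_exp D (-b / 2) H) op_id)"])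
       (intro conjI refl divide_nonneg_nonneg hs_nonneg)
qed

section \<open>Classical Gibbs measures for absolutely summable potentials\<close>

text \<open>Numerator and normalization change by factors of at most \<open>exp e\<close> each, and
  a quotient is at most 1. The claim is symmetric in \<open>a\<close> and \<open>b\<close>, so one
  direction suffices.\<close>

lemma softmax_diff:
  fixes a b :: "'b \<Rightarrow> real"
  assumes Y: "finite Y" "x \<in> Y" and ab: "\<And>y. y \<in> Y \<Longrightarrow> \<bar>a y - b y\<bar> \<le> e"
  shows "\<bar>exp (a x) / (\<Sum>y\<in>Y. exp (a y)) - exp (b x) / (\<Sum>y\<in>Y. exp (b y))\<bar> \<le> exp (2 * e) - 1"
proof -
  have key: "exp (a x) / (\<Sum>y\<in>Y. exp (a y)) - exp (b x) / (\<Sum>y\<in>Y. exp (b y)) \<le> exp (2 * e) - 1"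
    if ab: "\<And>y. y \<in> Y \<Longrightarrow> \<bar>a y - b y\<bar> \<le> e" for a b :: "'b \<Rightarrow> real"
  proof -
    let ?A = "\<Sum>y\<in>Y. exp (a y)" and ?B = "\<Sum>y\<in>Y. exp (b y)"
    have pos: "0 < ?A" "0 < ?B" using Y by (auto intro!: sum_pos)
    have e0: "0 \<le> e" using ab[OF Y(2)] by linarith
    have "?B \<le> (\<Sum>y\<in>Y. exp e * exp (a y))"
    proof (rule sum_mono)
      fix y assume "y \<in> Y"
      hence "b y \<le> e + a y" using ab[of y] by linarith
      thus "exp (b y) \<le> exp e * exp (a y)" unfolding exp_add[symmetric] by simp
    qed
    hence B: "?B \<le> exp e * ?A" by (simp add: sum_distrib_left)
    have "a x \<le> e + b x" using ab[OF Y(2)] by linarith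
    hence A: "exp (a x) \<le> exp e * exp (b x)" unfolding exp_add[symmetric] by simp
    have E: "exp (2 * e) = exp e * exp e" by (simp only: mult_2 exp_add)
    have "exp (a x) * ?B \<le> (exp e * exp (b x)) * (exp e * ?A)" by (rule mult_mono[OF A B]) (use pos in auto)
    hence "exp (a x) * ?B / ?B \<le> (exp e * exp (b x)) * (exp e * ?A) / ?B" using pos by (intro divide_right_mono) auto
    also have "(exp e * exp (b x)) * (exp e * ?A) / ?B = exp (2 * e) * (exp (b x) / ?B) * ?A"
      unfolding E by (simp only: times_divide_eq_left times_divide_eq_right mult_ac)
    finally have "exp (a x) / ?A \<le> exp (2 * e) * (exp (b x) / ?B)"
      using pos by (simp add: pos_divide_le_eq)
    moreover have "exp (b x) / ?B \<le> 1"
      using pos member_le_sum[of x Y "\<lambda>y. exp (b y)"] Y by simp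
    moreover have "0 \<le> exp (2 * e) - 1" using e0 by simp
    ultimately have "exp (a x) / ?A - exp (b x) / ?B \<le> (exp (2 * e) - 1) * (exp (b x) / ?B)"
      unfolding left_diff_distrib by linarith
    also have "\<dots> \<le> (exp (2 * e) - 1) * 1" using \<open>exp (b x) / ?B \<le> 1\<close> \<open>0 \<le> exp (2 * e) - 1\<close> by (intro mult_left_mono)
    finally show ?thesis by simp
  qed
  have "\<bar>b y - a y\<bar> \<le> e" if "y \<in> Y" for y using ab[OF that] by (simp add: abs_minus_commute)
  hence "exp (b x) / (\<Sum>y\<in>Y. exp (b y)) - exp (a x) / (\<Sum>y\<in>Y. exp (a y)) \<le> exp (2 * e) - 1" by (rule key)
  moreover have "exp (a x) / (\<Sum>y\<in>Y. exp (a y)) - exp (b x) / (\<Sum>y\<in>Y. exp (b y)) \<le> exp (2 * e) - 1" by (rule key[OF ab])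
  ultimately show ?thesis by linarith
qed

lemma cylinder_measurable:
  assumes Sp: "finite Sp" and J: "finite J" "J \<subseteq> I" and M: "sets M = sets (PiM I (\<lambda>_. count_space Sp))"
  shows "{z \<in> space M. restrict z J = y} \<in> sets M"
proof (cases "y \<in> PiE J (\<lambda>_. Sp)")
  case True
  have "(\<lambda>z. restrict z J) \<in> measurable M (PiM J (\<lambda>_. count_space Sp))"
    unfolding measurable_cong_sets[OF M refl] by (rule measurable_restrict_subset[OF J(2)])
  moreover have "{y} \<in> sets (PiM J (\<lambda>_. count_space Sp))"
    using True count_space_PiM_finite[OF J(1), of "\<lambda>_. Sp"] Sp by (simp add: countable_finite)
  ultimately have "(\<lambda>z. restrict z J) -` {y} \<inter> space M \<in> sets M" by (rule measurable_sets)
  also have "(\<lambda>z. restrict z J) -` {y} \<inter> space M = {z \<in> space M. restrict z J = y}" by auto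
  finally show ?thesis .
next
  case False
  have "space M = PiE I (\<lambda>_. Sp)" using sets_eq_imp_space_eq[OF M] by (simp add: space_PiM)
  hence "{z \<in> space M. restrict z J = y} = {}" using False J by (auto simp: PiE_iff)
  thus ?thesis by (simp only: sets.empty_sets)
qed

text \<open>A spin takes finitely many values, so every box with finite base is a finite disjoint
  union of cylinders over single configurations.\<close>

lemma measure_eqI_cylinders:
  assumes Sp: "finite Sp" and M: "sets M = sets (PiM I (\<lambda>_. count_space Sp))" and N: "sets N = sets (PiM I (\<lambda>_. count_space Sp))"
    and fin: "finite_measure M"
    and eq: "\<And>J y. finite J \<Longrightarrow> J \<subseteq> I \<Longrightarrow> y \<in> PiE J (\<lambda>_. Sp) \<Longrightarrow>
       emeasure M {z \<in> space M. restrict z J = y} = emeasure N {z \<in> space N. restrict z J = y}"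
  shows "M = N"
proof (rule measure_eqI_PiM_infinite[OF M N _ fin])
  fix A J assume J: "finite J" "J \<subseteq> I" and A: "\<And>i. i \<in> J \<Longrightarrow> A i \<in> sets (count_space Sp)"
  have sub: "PiE J A \<subseteq> PiE J (\<lambda>_. Sp)" using A by (intro PiE_mono) auto
  have finY: "finite (PiE J A)" by (rule finite_subset[OF sub]) (use J Sp in \<open>auto intro: finite_PiE\<close>)
  have box: "emeasure L (prod_emb I (\<lambda>_. count_space Sp) J (PiE J A)) = (\<Sum>y\<in>PiE J A. emeasure L {z \<in> space L. restrict z J = y})"
    if L: "sets L = sets (PiM I (\<lambda>_. count_space Sp))" for L
  proof -
    have spL: "space L = PiE I (\<lambda>_. Sp)" using sets_eq_imp_space_eq[OF L] by (simp add: space_PiM)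
    have "prod_emb I (\<lambda>_. count_space Sp) J (PiE J A) = (\<Union>y\<in>PiE J A. {z \<in> space L. restrict z J = y})"
      unfolding prod_emb_def spL by auto
    moreover have "(\<Sum>y\<in>PiE J A. emeasure L {z \<in> space L. restrict z J = y}) = emeasure L (\<Union>y\<in>PiE J A. {z \<in> space L. restrict z J = y})"
      by (rule sum_emeasure) (use finY cylinder_measurable[OF Sp J L] in \<open>auto simp: disjoint_family_on_def\<close>)
    ultimately show ?thesis by simp
  qed
  show "emeasure M (prod_emb I (\<lambda>_. count_space Sp) J (PiE J A)) = emeasure N (prod_emb I (\<lambda>_. count_space Sp) J (PiE J A))"
    unfolding box[OF M] box[OF N] by (intro sum.cong refl eq J) (use sub in auto)
qed

lemma summable_on_meeting:
  fixes f :: "'a set \<Rightarrow> real"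
  assumes f: "\<And>i. f summable_on {A. finite A \<and> i \<in> A}" and B: "finite B"
  shows "f summable_on {A. finite A \<and> A \<inter> B \<noteq> {}}"
  using B
proof (induction B rule: finite_induct)
  case (insert i B)
  have "{A. finite A \<and> A \<inter> insert i B \<noteq> {}} = {A. finite A \<and> i \<in> A} \<union> ({A. finite A \<and> A \<inter> B \<noteq> {}} - {A. finite A \<and> i \<in> A})" by auto
  moreover have "f summable_on \<dots>"
    by (rule summable_on_Un_disjoint[OF f]) (use insert in \<open>auto intro: summable_on_subset_banach\<close>)
  ultimately show ?case by simp
qed simp

text \<open>One potential serves all finite volumes, with normalization 1 in each. \<open>p\<close>
  gives the limits of the marginals, and \<open>bnd\<close> is a bound on the potential that is
  uniform in the spins and summable at each site.\<close>

locale classical_gibbs =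
  fixes Sp :: "real set" and \<Psi> :: "'d::finite site set \<Rightarrow> ('d site \<Rightarrow> real) \<Rightarrow> real"
    and p :: "'d site set \<Rightarrow> ('d site \<Rightarrow> real) \<Rightarrow> real" and bnd :: "'d site set \<Rightarrow> real"
  assumes Sp: "finite Sp" "Sp \<noteq> {}"
    and normalized: "\<And>L. finite L \<Longrightarrow> (\<Sum>x\<in>PiE L (\<lambda>_. Sp). exp (\<Sum>A\<in>Pow L. \<Psi> A (restrict x A))) = 1"
    and marg_lim: "\<And>B x. finite B \<Longrightarrow> x \<in> PiE B (\<lambda>_. Sp) \<Longrightarrow>
      ((\<lambda>L. \<Sum>y\<in>{y\<in>PiE L (\<lambda>_. Sp). restrict y B = x}. exp (\<Sum>A\<in>Pow L. \<Psi> A (restrict y A))) \<longlongrightarrow> p B x) (finite_subsets_at_top UNIV)"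
    and bnd: "\<And>A x. finite A \<Longrightarrow> x \<in> PiE A (\<lambda>_. Sp) \<Longrightarrow> \<bar>\<Psi> A x\<bar> \<le> bnd A"
    and bnd_summable: "\<And>i. bnd summable_on {A. finite A \<and> i \<in> A}"
begin

abbreviation "Om B \<equiv> PiE B (\<lambda>_. Sp)"

definition w :: "'d site set \<Rightarrow> ('d site \<Rightarrow> real) \<Rightarrow> real" where
  "w L x = exp (\<Sum>A\<in>Pow L. \<Psi> A (restrict x A))"

definition marg :: "'d site set \<Rightarrow> 'd site set \<Rightarrow> ('d site \<Rightarrow> real) \<Rightarrow> real" where
  "marg L B x = (\<Sum>y\<in>{y\<in>Om L. restrict y B = x}. w L y)"

lemma finite_Om: "finite B \<Longrightarrow> finite (Om B)"
  using Sp by (intro finite_PiE) auto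

lemma marg_tendsto: "finite B \<Longrightarrow> x \<in> Om B \<Longrightarrow> ((\<lambda>L. marg L B x) \<longlongrightarrow> p B x) (finite_subsets_at_top UNIV)"
  using marg_lim by (simp add: marg_def w_def)

lemma eventually_superset: "finite B \<Longrightarrow> eventually (\<lambda>L. finite L \<and> B \<subseteq> L) (finite_subsets_at_top UNIV)"
  unfolding eventually_finite_subsets_at_top by (intro exI[of _ B]) auto

lemma p_nonneg: "finite B \<Longrightarrow> x \<in> Om B \<Longrightarrow> 0 \<le> p B x"
  by (rule tendsto_lowerbound[OF marg_tendsto]) (auto simp: marg_def w_def intro!: sum_nonneg)

lemma sum_marg:
  assumes "finite L" "finite H" "H \<subseteq> L" and Y: "\<And>y. y \<in> Om L \<Longrightarrow> P y \<longleftrightarrow> restrict y H \<in> Y" "Y \<subseteq> Om H"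
  shows "(\<Sum>z\<in>Y. f z * marg L H z) = (\<Sum>y\<in>{y\<in>Om L. P y}. f (restrict y H) * w L y)"
proof -
  have fY: "finite Y" using Y(2) finite_Om[OF assms(2)] by (rule finite_subset)
  have "(\<Sum>z\<in>Y. f z * marg L H z) = (\<Sum>z\<in>Y. \<Sum>y\<in>{y\<in>{y\<in>Om L. P y}. restrict y H = z}. f (restrict y H) * w L y)"
  proof (rule sum.cong[OF refl])
    fix z assume z: "z \<in> Y"
    have eq: "{y\<in>{y\<in>Om L. P y}. restrict y H = z} = {y\<in>Om L. restrict y H = z}" using z Y(1) by auto
    show "f z * marg L H z = (\<Sum>y\<in>{y\<in>{y\<in>Om L. P y}. restrict y H = z}. f (restrict y H) * w L y)"
      unfolding eq marg_def sum_distrib_left by (intro sum.cong refl) auto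
  qed
  also have "\<dots> = (\<Sum>y\<in>{y\<in>Om L. P y}. f (restrict y H) * w L y)"
    by (rule sum.group) (use fY finite_Om[OF assms(1)] Y in auto)
  finally show ?thesis .
qed

text \<open>The marginals in a finite volume are exactly consistent, and a finite sum passes to the
  limit.\<close>

lemma p_consistent:
  assumes H: "finite H" "B \<subseteq> H" and x: "x \<in> Om B"
  shows "p B x = (\<Sum>z\<in>{z\<in>Om H. restrict z B = x}. p H z)"
proof (rule tendsto_unique[OF _ marg_tendsto])
  have fB: "finite B" using H finite_subset by blast
  show "finite B" by (rule fB)
  have "((\<lambda>L. \<Sum>z\<in>{z\<in>Om H. restrict z B = x}. marg L H z) \<longlongrightarrow> (\<Sum>z\<in>{z\<in>Om H. restrict z B = x}. p H z)) (finite_subsets_at_top UNIV)"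
    by (intro tendsto_sum marg_tendsto H) auto
  moreover have "\<forall>\<^sub>F L in finite_subsets_at_top UNIV. (\<Sum>z\<in>{z\<in>Om H. restrict z B = x}. marg L H z) = marg L B x"
    using eventually_superset[OF H(1)]
  proof eventually_elim
    case (elim L)
    have BH: "H \<inter> B = B" using H by auto
    have "(\<Sum>z\<in>{z\<in>Om H. restrict z B = x}. 1 * marg L H z) = (\<Sum>y\<in>{y\<in>Om L. restrict y B = x}. 1 * w L y)"
    proof (rule sum_marg)
      fix y assume "y \<in> Om L"
      hence "restrict y H \<in> Om H" using elim by auto
      thus "restrict y B = x \<longleftrightarrow> restrict y H \<in> {z\<in>Om H. restrict z B = x}" by (simp add: restrict_restrict BH)
    qed (use elim H in auto)
    thus ?case by (simp add: marg_def)
  qed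
  ultimately show "((\<lambda>L. marg L B x) \<longlongrightarrow> (\<Sum>z\<in>{z\<in>Om H. restrict z B = x}. p H z)) (finite_subsets_at_top UNIV)"
    by (rule Lim_transform_eventually)
qed (use x in auto)

lemma p_sum:
  assumes "finite B"
  shows "(\<Sum>x\<in>Om B. p B x) = 1"
proof -
  have "p {} (\<lambda>_. undefined) = 1"
  proof (rule tendsto_unique[OF _ marg_tendsto])
    have "marg L {} (\<lambda>_. undefined) = 1" if "finite L" for L
      using normalized[OF that] by (simp add: marg_def w_def restrict_def)
    thus "((\<lambda>L. marg L {} (\<lambda>_. undefined)) \<longlongrightarrow> 1) (finite_subsets_at_top UNIV)"
      by (intro tendsto_eventually) (use eventually_superset[of "{}"] in \<open>auto elim: eventually_mono\<close>)
  qed auto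
  also have "p {} (\<lambda>_. undefined) = (\<Sum>z\<in>{z\<in>Om B. restrict z {} = (\<lambda>_. undefined)}. p B z)"
    by (rule p_consistent) (use assms in auto)
  finally show ?thesis by (simp add: restrict_def)
qed

subsection \<open>Existence of the infinite-volume measure\<close>

definition q :: "'d site set \<Rightarrow> ('d site \<Rightarrow> real) pmf" where
  "q B = embed_pmf (\<lambda>x. if x \<in> Om B then p B x else 0)"

lemma pmf_q: "finite B \<Longrightarrow> pmf (q B) x = (if x \<in> Om B then p B x else 0)"
  unfolding q_def
proof (rule pmf_embed_pmf)
  assume B: "finite B"
  show "0 \<le> (if x \<in> Om B then p B x else 0)" for x using p_nonneg[OF B] by auto
  have "(\<integral>\<^sup>+x. ennreal (if x \<in> Om B then p B x else 0) \<partial>count_space UNIV) = (\<Sum>x\<in>Om B. ennreal (if x \<in> Om B then p B x else 0))"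
    by (rule nn_integral_count_space') (use finite_Om[OF B] in auto)
  also have "\<dots> = (\<Sum>x\<in>Om B. ennreal (p B x))" by (intro sum.cong) auto
  also have "\<dots> = ennreal (\<Sum>x\<in>Om B. p B x)" by (rule sum_ennreal) (use p_nonneg[OF B] in auto)
  finally show "(\<integral>\<^sup>+x. ennreal (if x \<in> Om B then p B x else 0) \<partial>count_space UNIV) = 1" by (simp add: p_sum[OF B])
qed

lemma prob_q: "finite B \<Longrightarrow> measure_pmf.prob (q B) S = (\<Sum>x\<in>Om B \<inter> S. p B x)"
proof -
  assume B: "finite B"
  have sub: "set_pmf (q B) \<subseteq> Om B" by (auto simp: set_pmf_iff pmf_q[OF B] split: if_splits)
  have "measure_pmf.prob (q B) S = measure_pmf.prob (q B) (Om B \<inter> S)"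
    by (rule measure_prob_cong_0) (use sub in \<open>auto simp: set_pmf_iff pmf_q[OF B]\<close>)
  also have "\<dots> = (\<Sum>x\<in>Om B \<inter> S. pmf (q B) x)" by (rule measure_measure_pmf_finite) (use finite_Om[OF B] in auto)
  also have "\<dots> = (\<Sum>x\<in>Om B \<inter> S. p B x)" by (intro sum.cong) (auto simp: pmf_q[OF B])
  finally show ?thesis .
qed

lemma map_q:
  assumes H: "finite H" "J \<subseteq> H"
  shows "map_pmf (\<lambda>x. restrict x J) (q H) = q J"
proof (rule pmf_eqI)
  fix x
  have fJ: "finite J" using H finite_subset by blast
  have "pmf (map_pmf (\<lambda>x. restrict x J) (q H)) x = (\<Sum>z\<in>Om H \<inter> (\<lambda>x. restrict x J) -` {x}. p H z)"
    by (simp add: pmf_map prob_q[OF H(1)])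
  also have "Om H \<inter> (\<lambda>x. restrict x J) -` {x} = {z\<in>Om H. restrict z J = x}" by auto
  also have "(\<Sum>z\<in>{z\<in>Om H. restrict z J = x}. p H z) = (if x \<in> Om J then p J x else 0)"
  proof (cases "x \<in> Om J")
    case True
    thus ?thesis by (simp add: p_consistent[OF H True])
  next
    case False
    hence "{z\<in>Om H. restrict z J = x} = {}" using H by (auto simp: PiE_iff)
    thus ?thesis using False by (simp only: sum.empty if_False)
  qed
  finally show "pmf (map_pmf (\<lambda>x. restrict x J) (q H)) x = pmf (q J) x" by (simp only: pmf_q[OF fJ])
qed

definition PJ :: "'d site set \<Rightarrow> ('d site \<Rightarrow> real) measure" where
  "PJ J = distr (measure_pmf (q J)) (PiM J (\<lambda>_. borel)) (\<lambda>x. restrict x J)"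

lemma restrict_q_measurable: "(\<lambda>x. restrict x J) \<in> measurable (measure_pmf r) (PiM J (\<lambda>_. borel :: real measure))"
  by (auto simp: space_PiM)

lemma polish: "polish_projective UNIV PJ"
  unfolding polish_projective_def projective_family_def
proof (intro conjI allI impI)
  show "PJ J = distr (PJ H) (PiM J (\<lambda>_. borel)) (\<lambda>f. restrict f J)" if "J \<subseteq> H" "finite H" "H \<subseteq> UNIV" for J H
  proof -
    have HJ: "H \<inter> J = J" using that by auto
    have "PJ J = distr (distr (measure_pmf (q H)) (count_space UNIV) (\<lambda>x. restrict x J)) (PiM J (\<lambda>_. borel)) (\<lambda>x. restrict x J)"
      unfolding PJ_def map_q[OF that(2,1), symmetric] map_pmf_rep_eq ..
    also have "\<dots> = distr (measure_pmf (q H)) (PiM J (\<lambda>_. borel)) ((\<lambda>x. restrict x J) \<circ> (\<lambda>x. restrict x J))"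
      by (rule distr_distr) (auto simp: space_PiM)
    also have "(\<lambda>x. restrict x J) \<circ> (\<lambda>x. restrict x J) = (\<lambda>x. restrict x J) \<circ> (\<lambda>x. restrict x H)"
      by (auto simp: restrict_restrict HJ)
    also have "distr (measure_pmf (q H)) (PiM J (\<lambda>_. borel)) \<dots> = distr (PJ H) (PiM J (\<lambda>_. borel)) (\<lambda>f. restrict f J)"
      unfolding PJ_def by (rule distr_distr[symmetric]) (use restrict_q_measurable measurable_restrict_subset[OF that(1)] in auto)
    finally show ?thesis .
  qed
  show "prob_space (PJ J)" for J
    unfolding PJ_def by (rule measure_pmf.prob_space_distr) (rule restrict_q_measurable)
qed

text \<open>Kolmogorov's theorem is available for real-valued coordinates only; \<open>snap\<close> moves the measure to \<open>Sp\<close>.\<close>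

definition snap :: "real \<Rightarrow> real" where
  "snap r = (if r \<in> Sp then r else (SOME s. s \<in> Sp))"

lemma snap_Sp: "snap r \<in> Sp"
  using Sp(2) by (auto simp: snap_def some_in_eq)

lemma snap_vimage: "snap -` {a} \<in> sets borel"
proof -
  have "snap -` {a} = (Sp \<inter> {a}) \<union> (if a = (SOME s. s \<in> Sp) then - Sp else {})"
    using some_in_eq[of Sp] Sp(2) by (auto simp: snap_def split: if_splits)
  moreover have "- Sp \<in> sets borel" using Sp(1) by (intro borel_comp borel_closed finite_imp_closed)
  moreover have "Sp \<inter> {a} \<in> sets borel" using Sp(1) by (intro borel_closed finite_imp_closed) auto
  ultimately show ?thesis by (simp split: if_splits)
qed

lemma snap_measurable: "snap \<in> measurable borel (count_space Sp)"
  using snap_vimage snap_Sp by (auto simp: measurable_count_space_eq2[OF Sp(1)])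

lemma exists_measure:
  "\<exists>\<mu>. prob_space \<mu> \<and> sets \<mu> = sets (config_space Sp) \<and> (\<forall>B. finite B \<longrightarrow> (\<forall>x\<in>Om B. measure \<mu> {z \<in> space \<mu>. restrict z B = x} = p B x))"
proof -
  interpret polish_projective UNIV PJ by (rule polish)
  let ?k = "\<lambda>z i. snap (z i)"
  have km: "?k \<in> measurable lim (config_space Sp)"
    unfolding config_space_def
  proof (rule measurable_PiM_single')
    fix i :: "'d site"
    have "(\<lambda>z. z i) \<in> measurable (PiM UNIV (\<lambda>_. borel)) borel" by (rule measurable_component_singleton) simp
    hence "(\<lambda>z. z i) \<in> measurable lim borel" by (simp add: measurable_cong_sets[OF sets_lim refl])
    thus "(\<lambda>z. snap (z i)) \<in> measurable lim (count_space Sp)" by (rule measurable_compose[OF _ snap_measurable])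
  qed (auto simp: snap_Sp)
  define \<mu> where "\<mu> = distr lim (config_space Sp) ?k"
  have sp: "space \<mu> = PiE UNIV (\<lambda>_. Sp)" by (simp add: \<mu>_def config_space_def space_PiM)
  have "measure \<mu> {z \<in> space \<mu>. restrict z B = x} = p B x" if B: "finite B" and x: "x \<in> Om B" for B x
  proof -
    have m: "{z \<in> space \<mu>. restrict z B = x} \<in> sets (config_space Sp)"
      using cylinder_measurable[OF Sp(1) B subset_UNIV, of \<mu> x] by (simp add: \<mu>_def config_space_def)
    have X: "PiE B (\<lambda>i. snap -` {x i}) \<in> sets (PiM B (\<lambda>_. borel))"
      by (rule sets_PiM_I_finite[OF B]) (rule snap_vimage)
    have "measure \<mu> {z \<in> space \<mu>. restrict z B = x} = measure lim (?k -` {z \<in> space \<mu>. restrict z B = x} \<inter> space lim)"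
      unfolding \<mu>_def by (rule measure_distr[OF km]) (use m in \<open>simp add: \<mu>_def\<close>)
    also have "?k -` {z \<in> space \<mu>. restrict z B = x} \<inter> space lim = emb UNIV B (PiE B (\<lambda>i. snap -` {x i}))"
    proof -
      have "restrict (?k z) B = x \<longleftrightarrow> (\<forall>i\<in>B. snap (z i) = x i)" for z
        using x by (auto simp: fun_eq_iff PiE_iff extensional_def restrict_def)
      thus ?thesis by (auto simp: sp snap_Sp space_PiM prod_emb_def PiE_iff)
    qed
    also have "measure lim \<dots> = measure (PJ B) (PiE B (\<lambda>i. snap -` {x i}))"
      by (rule measure_lim_emb[OF subset_UNIV B X])
    also have "\<dots> = measure_pmf.prob (q B) ((\<lambda>y. restrict y B) -` (PiE B (\<lambda>i. snap -` {x i})))"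
      unfolding PJ_def using measure_distr[OF restrict_q_measurable X] by simp
    also have "\<dots> = (\<Sum>y\<in>Om B \<inter> (\<lambda>y. restrict y B) -` (PiE B (\<lambda>i. snap -` {x i})). p B y)" by (rule prob_q[OF B])
    also have "Om B \<inter> (\<lambda>y. restrict y B) -` (PiE B (\<lambda>i. snap -` {x i})) = {x}"
    proof
      show "{x} \<subseteq> Om B \<inter> (\<lambda>y. restrict y B) -` (PiE B (\<lambda>i. snap -` {x i}))" using x by (auto simp: snap_def PiE_iff)
      show "Om B \<inter> (\<lambda>y. restrict y B) -` (PiE B (\<lambda>i. snap -` {x i})) \<subseteq> {x}"
      proof
        fix y assume y: "y \<in> Om B \<inter> (\<lambda>y. restrict y B) -` (PiE B (\<lambda>i. snap -` {x i}))"
        have "y i = x i" for i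
        proof (cases "i \<in> B")
          case True
          hence "snap (y i) = x i" "y i \<in> Sp" using y by (auto simp: PiE_iff)
          thus ?thesis by (simp add: snap_def)
        next
          case False
          thus ?thesis using x y by (auto simp: PiE_iff extensional_def)
        qed
        thus "y \<in> {x}" by auto
      qed
    qed
    also have "(\<Sum>y\<in>{x}. p B y) = p B x" by simp
    finally show ?thesis .
  qed
  moreover have "prob_space \<mu>" unfolding \<mu>_def by (rule P.prob_space_distr[OF km])
  ultimately show ?thesis by (intro exI[of _ \<mu>]) (auto simp: \<mu>_def)
qed

subsection \<open>The DLR equations\<close>

definition En :: "'d site set \<Rightarrow> 'd site set \<Rightarrow> ('d site \<Rightarrow> real) \<Rightarrow> real" where
  "En L K z = (\<Sum>A\<in>{A\<in>Pow K. A \<inter> L \<noteq> {}}. \<Psi> A (restrict z A))"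

text \<open>The specification kernel with the energy cut to subsets of \<open>K\<close>. It depends
  on the spins in \<open>K\<close> only, and with \<open>K\<close> the whole finite volume it is the
  exact conditional probability there.\<close>

definition ker :: "'d site set \<Rightarrow> ('d site \<Rightarrow> real) \<Rightarrow> 'd site set \<Rightarrow> ('d site \<Rightarrow> real) \<Rightarrow> real" where
  "ker L x K z = exp (En L K (glue L x z)) / (\<Sum>y\<in>Om L. exp (En L K (glue L y z)))"

lemma glue_Om: "y \<in> Om L \<Longrightarrow> (\<And>i. i \<in> K \<Longrightarrow> z i \<in> Sp) \<Longrightarrow> i \<in> K \<Longrightarrow> glue L y z i \<in> Sp"
  by (auto simp: glue_def PiE_iff)

text \<open>The error is at most a tail of the sum of \<open>bnd\<close>, so it is small uniformly
  in the spins and for all \<open>K\<close> beyond \<open>K0\<close>.\<close>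

lemma energy_approx:
  assumes L: "finite V" and e: "0 < e"
  obtains K0 where "finite K0" "\<And>K z. finite K \<Longrightarrow> K0 \<subseteq> K \<Longrightarrow> (\<And>i. z i \<in> Sp) \<Longrightarrow> \<bar>local_energy \<Psi> V z - En V K z\<bar> \<le> e"
proof -
  let ?S = "{A. finite A \<and> A \<inter> V \<noteq> {}}"
  have bs: "bnd summable_on ?S" by (rule summable_on_meeting[OF bnd_summable L])
  have "(sum bnd \<longlongrightarrow> infsum bnd ?S) (finite_subsets_at_top ?S)" using has_sum_infsum[OF bs] by (simp add: has_sum_def)
  hence "\<forall>\<^sub>F F in finite_subsets_at_top ?S. dist (sum bnd F) (infsum bnd ?S) < e" using e by (rule tendstoD)
  then obtain F0 where F0: "finite F0" "F0 \<subseteq> ?S" and "\<forall>F. finite F \<and> F0 \<subseteq> F \<and> F \<subseteq> ?S \<longrightarrow> dist (sum bnd F) (infsum bnd ?S) < e"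
    unfolding eventually_finite_subsets_at_top by (elim exE conjE)
  hence F0': "dist (sum bnd F) (infsum bnd ?S) < e" if "finite F" "F0 \<subseteq> F" "F \<subseteq> ?S" for F using that by blast
  show ?thesis
  proof (rule that[of "\<Union>F0"])
    show "finite (\<Union>F0)" using F0 by auto
    fix K and z :: "'d site \<Rightarrow> real" assume K: "finite K" "\<Union>F0 \<subseteq> K" and z: "\<And>i. z i \<in> Sp"
    let ?F = "{A\<in>Pow K. A \<inter> V \<noteq> {}}"
    have F: "finite ?F" "F0 \<subseteq> ?F" "?F \<subseteq> ?S" using K F0 by (auto intro: finite_subset)
    have le: "\<bar>\<Psi> A (restrict z A)\<bar> \<le> bnd A" if "A \<in> ?S" for A using that z by (intro bnd) auto
    have abs: "(\<lambda>A. norm (\<Psi> A (restrict z A))) summable_on ?S"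
      by (rule summable_on_comparison_test[OF bs]) (use le in auto)
    have sm: "(\<lambda>A. \<Psi> A (restrict z A)) summable_on ?S" by (rule Infinite_Sum.abs_summable_summable[OF abs])
    have 1: "local_energy \<Psi> V z - En V K z = infsum (\<lambda>A. \<Psi> A (restrict z A)) (?S - ?F)"
      unfolding local_energy_def En_def infsum_Diff[OF sm summable_on_finite[OF F(1)] F(3)] infsum_finite[OF F(1)] ..
    have sb: "bnd summable_on (?S - ?F)" by (rule summable_on_subset_banach[OF bs]) auto
    have sm': "(\<lambda>A. \<Psi> A (restrict z A)) summable_on (?S - ?F)" by (rule summable_on_subset_banach[OF sm]) auto
    have 2: "norm (infsum (\<lambda>A. \<Psi> A (restrict z A)) (?S - ?F)) \<le> infsum bnd (?S - ?F)"
      by (rule norm_infsum_le[OF has_sum_infsum[OF sm'] has_sum_infsum[OF sb]]) (use le in auto)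
    have 3: "infsum bnd (?S - ?F) = infsum bnd ?S - sum bnd ?F"
      unfolding infsum_Diff[OF bs summable_on_finite[OF F(1)] F(3)] infsum_finite[OF F(1)] ..
    have "infsum bnd ?S - sum bnd ?F \<le> e" using F0'[OF F] unfolding dist_real_def by linarith
    thus "\<bar>local_energy \<Psi> V z - En V K z\<bar> \<le> e" using 2 unfolding 1 3 real_norm_def by linarith
  qed
qed

lemma En_cong: "(\<And>i. i \<in> K \<Longrightarrow> z i = z' i) \<Longrightarrow> En L K z = En L K z'"
  unfolding En_def by (intro sum.cong refl arg_cong[where f="\<Psi> _"]) (auto simp: restrict_def fun_eq_iff)

lemma ker_cong: "(\<And>i. i \<in> K \<Longrightarrow> z i = z' i) \<Longrightarrow> ker L x K z = ker L x K z'"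
proof -
  assume "\<And>i. i \<in> K \<Longrightarrow> z i = z' i"
  hence "En L K (glue L y z) = En L K (glue L y z')" for y by (intro En_cong) (auto simp: glue_def)
  thus ?thesis by (simp add: ker_def)
qed

lemma ker_bounds:
  assumes "finite L" "x \<in> Om L"
  shows "0 \<le> ker L x K z" "ker L x K z \<le> 1"
proof -
  let ?Z = "\<Sum>y\<in>Om L. exp (En L K (glue L y z))"
  have "0 < ?Z" using assms finite_Om by (intro sum_pos) auto
  moreover have "exp (En L K (glue L x z)) \<le> ?Z" by (rule member_le_sum) (use assms finite_Om in auto)
  ultimately show "0 \<le> ker L x K z" "ker L x K z \<le> 1" by (auto simp: ker_def)
qed

lemma spec_kernel_bounds:
  assumes "finite L" "x \<in> Om L"
  shows "0 \<le> spec_kernel Sp \<Psi> L x z" "spec_kernel Sp \<Psi> L x z \<le> 1"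
proof -
  let ?Z = "\<Sum>y\<in>Om L. exp (local_energy \<Psi> L (glue L y z))"
  have "0 < ?Z" using assms finite_Om by (intro sum_pos) auto
  moreover have "exp (local_energy \<Psi> L (glue L x z)) \<le> ?Z" by (rule member_le_sum) (use assms finite_Om in auto)
  ultimately show "0 \<le> spec_kernel Sp \<Psi> L x z" "spec_kernel Sp \<Psi> L x z \<le> 1" by (auto simp: spec_kernel_def)
qed

lemma ker_approx:
  assumes L: "finite V" and x: "x \<in> Om V" and e: "0 < e"
  obtains K0 where "finite K0" "\<And>K v. finite K \<Longrightarrow> K0 \<subseteq> K \<Longrightarrow> (\<And>i. v i \<in> Sp) \<Longrightarrow> \<bar>spec_kernel Sp \<Psi> V x v - ker V x K v\<bar> \<le> e"
proof -
  \<comment> \<open>Chosen so that the bound \<open>exp (2 * d) - 1\<close> of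
    \<open>softmax_diff\<close> is exactly \<open>e\<close>.\<close>
  define d where "d = ln (1 + e) / 2"
  have d: "0 < d" "exp (2 * d) - 1 = e" using e by (auto simp: d_def)
  obtain K0 where K0: "finite K0" "\<And>K z. finite K \<Longrightarrow> K0 \<subseteq> K \<Longrightarrow> (\<And>i. z i \<in> Sp) \<Longrightarrow> \<bar>local_energy \<Psi> V z - En V K z\<bar> \<le> d"
    using energy_approx[OF L d(1)] by blast
  show ?thesis
  proof (rule that[OF K0(1)])
    fix K and v :: "'d site \<Rightarrow> real" assume K: "finite K" "K0 \<subseteq> K" and om: "\<And>i. v i \<in> Sp"
    show "\<bar>spec_kernel Sp \<Psi> V x v - ker V x K v\<bar> \<le> e"
      unfolding spec_kernel_def ker_def d(2)[symmetric]
      by (rule softmax_diff[OF finite_Om[OF L] x]) (use om in \<open>auto intro!: K0(2)[OF K] glue_Om[of _ _ UNIV]\<close>)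
  qed
qed

text \<open>The weight in \<open>V\<close> is the exponential of the terms that meet
  \<open>W\<close>, times the weight of \<open>V - W\<close>. The kernel ignores the spins in
  \<open>W\<close>, so summing over them cancels its denominator and leaves the weight with
  \<open>x\<close> in their place.\<close>

lemma finite_volume_DLR:
  assumes L: "finite W" and x: "x \<in> Om W" and B: "B \<inter> W = {}" and V: "finite V" "W \<union> B \<subseteq> V"
    and y: "y \<in> Om B"
  shows "marg V (W \<union> B) (glue W x y) = (\<Sum>z\<in>{z\<in>Om V. restrict z B = y}. ker W x V z * w V z)"
proof -
  let ?R = "V - W"
  have split: "w V (glue W u z) = exp (En W V (glue W u z)) * w ?R z" for u z
  proof -
    have "(\<Sum>A\<in>Pow V. \<Psi> A (restrict (glue W u z) A)) = En W V (glue W u z) + (\<Sum>A\<in>Pow V - {A\<in>Pow V. A \<inter> W \<noteq> {}}. \<Psi> A (restrict (glue W u z) A))"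
      unfolding En_def by (subst sum.subset_diff[of "{A\<in>Pow V. A \<inter> W \<noteq> {}}" "Pow V"]) (use V in \<open>auto simp: add.commute\<close>)
    also have "Pow V - {A\<in>Pow V. A \<inter> W \<noteq> {}} = Pow ?R" by auto
    also have "(\<Sum>A\<in>Pow ?R. \<Psi> A (restrict (glue W u z) A)) = (\<Sum>A\<in>Pow ?R. \<Psi> A (restrict z A))"
      by (intro sum.cong refl arg_cong[where f="\<Psi> _"]) (auto simp: glue_def restrict_def fun_eq_iff)
    finally show ?thesis unfolding w_def by (simp only: exp_add)
  qed
  have wc: "w V z = w V z'" if "\<And>i. i \<in> V \<Longrightarrow> z i = z' i" for z z'
    unfolding w_def by (intro arg_cong[where f=exp] sum.cong refl arg_cong[where f="\<Psi> _"]) (use that in \<open>auto simp: restrict_def fun_eq_iff\<close>)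
  let ?T = "{z\<in>Om ?R. restrict z B = y}"
  let ?j = "\<lambda>u z. glue W u z"
  have bij: "bij_betw (\<lambda>(u, z). glue W u z) (Om W \<times> ?T) {z\<in>Om V. restrict z B = y}"
  proof (rule bij_betw_byWitness[where f'="\<lambda>z. (restrict z W, restrict z ?R)"])
    have BR: "?R \<inter> B = B" using B V by auto
    show "\<forall>a\<in>Om W \<times> ?T. (restrict (case a of (u, z) \<Rightarrow> glue W u z) W, restrict (case a of (u, z) \<Rightarrow> glue W u z) ?R) = a"
      by (auto simp: glue_def fun_eq_iff PiE_iff extensional_def restrict_def)
    show "\<forall>z\<in>{z\<in>Om V. restrict z B = y}. (case (restrict z W, restrict z ?R) of (u, z) \<Rightarrow> glue W u z) = z"
      using V by (auto simp: glue_def fun_eq_iff PiE_iff extensional_def restrict_def)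
    have "restrict (glue W u z) B = restrict z B" for u z using B by (auto simp: glue_def restrict_def fun_eq_iff)
    thus "(\<lambda>(u, z). glue W u z) ` (Om W \<times> ?T) \<subseteq> {z\<in>Om V. restrict z B = y}"
      using V by (auto simp: glue_def PiE_iff extensional_def)
    show "(\<lambda>z. (restrict z W, restrict z ?R)) ` {z\<in>Om V. restrict z B = y} \<subseteq> Om W \<times> ?T"
      using V by (auto simp: restrict_restrict BR PiE_iff)
  qed
  have kg: "ker W x V (glue W u z) = ker W x V z" for u z
  proof -
    have "glue W v (glue W u z) = glue W v z" for v by (auto simp: glue_def)
    thus ?thesis by (simp add: ker_def)
  qed
  have Z: "ker W x V z * (\<Sum>u\<in>Om W. exp (En W V (glue W u z))) = exp (En W V (glue W x z))" for z
  proof -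
    have "0 < (\<Sum>u\<in>Om W. exp (En W V (glue W u z)))" using x finite_Om[OF L] by (intro sum_pos) auto
    thus ?thesis by (simp add: ker_def)
  qed
  have "(\<Sum>z\<in>{z\<in>Om V. restrict z B = y}. ker W x V z * w V z) = (\<Sum>(u, z)\<in>Om W \<times> ?T. ker W x V (glue W u z) * w V (glue W u z))"
    by (subst sum.reindex_bij_betw[OF bij, symmetric]) (simp add: case_prod_beta)
  also have "\<dots> = (\<Sum>z\<in>?T. \<Sum>u\<in>Om W. ker W x V (glue W u z) * w V (glue W u z))"
    by (subst sum.swap) (simp add: sum.cartesian_product)
  also have "\<dots> = (\<Sum>z\<in>?T. w V (glue W x z))"
  proof (rule sum.cong[OF refl])
    fix z
    have "(\<Sum>u\<in>Om W. ker W x V (glue W u z) * w V (glue W u z)) = (ker W x V z * (\<Sum>u\<in>Om W. exp (En W V (glue W u z)))) * w ?R z"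
      by (simp add: kg split sum_distrib_left sum_distrib_right mult.assoc)
    thus "(\<Sum>u\<in>Om W. ker W x V (glue W u z) * w V (glue W u z)) = w V (glue W x z)" unfolding Z split .
  qed
  also have "\<dots> = marg V (W \<union> B) (glue W x y)"
    unfolding marg_def
  proof (rule sum.reindex_bij_witness[of _ "\<lambda>z. restrict z ?R" "\<lambda>z. glue W x z"])
    have BR: "?R \<inter> B = B" using B V by auto
    fix z assume z: "z \<in> {z\<in>Om V. restrict z (W \<union> B) = glue W x y}"
    hence zx: "z i = glue W x y i" if "i \<in> W \<union> B" for i using that by (auto simp: fun_eq_iff restrict_def split: if_splits)
    have zx': "z i = x i" if "i \<in> W" for i using zx[of i] that by (simp add: glue_def)
    have zy': "z i = y i" if "i \<in> B" for i using zx[of i] that B by (auto simp: glue_def)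
    show "glue W x (restrict z ?R) = z" using z zx' V by (auto simp: glue_def fun_eq_iff restrict_def PiE_iff extensional_def)
    have "restrict z B = y" using zy' y by (auto simp: fun_eq_iff restrict_def PiE_iff extensional_def)
    thus "restrict z ?R \<in> ?T" using z V by (auto simp: restrict_restrict BR PiE_iff)
  next
    fix z assume z: "z \<in> ?T"
    show "restrict (glue W x z) ?R = z" using z by (auto simp: glue_def fun_eq_iff PiE_iff extensional_def restrict_def)
    have "restrict (glue W x z) (W \<union> B) = glue W x y"
    proof
      fix i
      show "restrict (glue W x z) (W \<union> B) i = glue W x y i"
        using z y by (auto simp: glue_def restrict_def PiE_iff extensional_def)
    qed
    thus "glue W x z \<in> {z\<in>Om V. restrict z (W \<union> B) = glue W x y}"
      using z x V by (auto simp: glue_def PiE_iff extensional_def)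
  qed auto
  finally show ?thesis by simp
qed

lemma sum_w_le:
  assumes "finite V"
  shows "(\<Sum>z\<in>{z\<in>Om V. P z}. w V z) \<le> 1"
proof -
  have "(\<Sum>z\<in>{z\<in>Om V. P z}. w V z) \<le> (\<Sum>z\<in>Om V. w V z)"
    by (rule sum_mono2) (use finite_Om[OF assms] in \<open>auto simp: w_def\<close>)
  thus ?thesis using normalized[OF assms] by (simp add: w_def)
qed

text \<open>The exact kernel of volume \<open>V\<close> involves more and more spins as
  \<open>V\<close> grows. It is exchanged for the kernel cut at a fixed \<open>K\<close>, for which
  the limit can be taken; both are within \<open>e\<close> of the specification kernel, whence
  \<open>2 * e\<close>.\<close>

lemma p_ker_approx:
  assumes L: "finite W" and x: "x \<in> Om W" and B: "finite B" "B \<inter> W = {}" and y: "y \<in> Om B" and e: "0 < e"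
    and K0: "finite K" "W \<union> B \<subseteq> K"
    and app: "\<And>K' v. finite K' \<Longrightarrow> K \<subseteq> K' \<Longrightarrow> (\<And>i. v i \<in> Sp) \<Longrightarrow> \<bar>spec_kernel Sp \<Psi> W x v - ker W x K' v\<bar> \<le> e"
  shows "\<bar>p (W \<union> B) (glue W x y) - (\<Sum>u\<in>{u\<in>Om K. restrict u B = y}. ker W x K u * p K u)\<bar> \<le> 2 * e"
proof -
  have gl: "glue W x y \<in> Om (W \<union> B)" using x y by (auto simp: glue_def PiE_iff extensional_def)
  have "((\<lambda>V. \<bar>marg V (W \<union> B) (glue W x y) - (\<Sum>u\<in>{u\<in>Om K. restrict u B = y}. ker W x K u * marg V K u)\<bar>) \<longlongrightarrow>
     \<bar>p (W \<union> B) (glue W x y) - (\<Sum>u\<in>{u\<in>Om K. restrict u B = y}. ker W x K u * p K u)\<bar>) (finite_subsets_at_top UNIV)"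
    by (intro tendsto_intros marg_tendsto gl K0) (use L B in auto)
  thus ?thesis
  proof (rule tendsto_upperbound)
    show "\<forall>\<^sub>F V in finite_subsets_at_top UNIV. \<bar>marg V (W \<union> B) (glue W x y) - (\<Sum>u\<in>{u\<in>Om K. restrict u B = y}. ker W x K u * marg V K u)\<bar> \<le> 2 * e"
      using eventually_superset[OF K0(1)]
    proof eventually_elim
      case (elim V)
      let ?T = "{z\<in>Om V. restrict z B = y}"
      have KB: "K \<inter> B = B" using K0 by auto
      have "marg V (W \<union> B) (glue W x y) = (\<Sum>z\<in>?T. ker W x V z * w V z)"
        by (rule finite_volume_DLR[OF L x B(2) _ _ y]) (use elim K0 in auto)
      moreover have "(\<Sum>u\<in>{u\<in>Om K. restrict u B = y}. ker W x K u * marg V K u) = (\<Sum>z\<in>?T. ker W x K (restrict z K) * w V z)"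
      proof (rule sum_marg)
        fix z assume "z \<in> Om V"
        hence "restrict z K \<in> Om K" using elim by auto
        thus "restrict z B = y \<longleftrightarrow> restrict z K \<in> {u\<in>Om K. restrict u B = y}" by (simp add: restrict_restrict KB)
      qed (use elim K0 in auto)
      moreover have "\<bar>(\<Sum>z\<in>?T. ker W x V z * w V z) - (\<Sum>z\<in>?T. ker W x K (restrict z K) * w V z)\<bar> \<le> (\<Sum>z\<in>?T. 2 * e * w V z)"
        unfolding sum_subtractf[symmetric]
      proof (rule order_trans[OF sum_abs sum_mono])
        fix z assume z: "z \<in> ?T"
        obtain s where s: "s \<in> Sp" using Sp(2) by auto
        define v where "v i = (if i \<in> V then z i else s)" for i
        have om: "v i \<in> Sp" for i using z s by (auto simp: v_def PiE_iff)
        have 1: "ker W x V z = ker W x V v" by (rule ker_cong) (simp add: v_def)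
        have 2: "ker W x K (restrict z K) = ker W x K v" by (rule ker_cong) (use elim in \<open>auto simp: v_def\<close>)
        have "\<bar>ker W x V z - ker W x K (restrict z K)\<bar> \<le> 2 * e"
          unfolding 1 2 using app[of V v] app[of K v] om elim K0 by auto
        moreover have "0 \<le> w V z" by (simp add: w_def)
        ultimately have "\<bar>ker W x V z - ker W x K (restrict z K)\<bar> * w V z \<le> 2 * e * w V z" by (rule mult_right_mono)
        thus "\<bar>ker W x V z * w V z - ker W x K (restrict z K) * w V z\<bar> \<le> 2 * e * w V z"
          using \<open>0 \<le> w V z\<close> by (simp add: left_diff_distrib[symmetric] abs_mult)
      qed
      moreover have "(\<Sum>z\<in>?T. 2 * e * w V z) \<le> 2 * e * 1"
        unfolding sum_distrib_left[symmetric] using e sum_w_le[of V "\<lambda>z. restrict z B = y"] elim by (intro mult_left_mono) auto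
      ultimately show ?case by linarith
    qed
  qed simp
qed

end

context classical_gibbs begin

context
  fixes \<mu> :: "('d site \<Rightarrow> real) measure"
  assumes prob: "prob_space \<mu>" and sets_mu: "sets \<mu> = sets (config_space Sp)"
    and cyl: "\<And>B x. finite B \<Longrightarrow> x \<in> Om B \<Longrightarrow> measure \<mu> {z \<in> space \<mu>. restrict z B = x} = p B x"
begin

interpretation prob_space \<mu> by (rule prob)

lemma sets_mu': "sets \<mu> = sets (PiM UNIV (\<lambda>_. count_space Sp))"
  using sets_mu by (simp add: config_space_def)

lemma space_mu: "space \<mu> = PiE UNIV (\<lambda>_. Sp)"
  using sets_eq_imp_space_eq[OF sets_mu'] by (simp add: space_PiM)

lemma cyl_sets: "finite J \<Longrightarrow> {z \<in> space \<mu>. restrict z J = y} \<in> sets \<mu>"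
  by (rule cylinder_measurable[OF Sp(1) _ subset_UNIV sets_mu'])

lemma ker_measurable:
  assumes K: "finite K"
  shows "ker L x K \<in> borel_measurable \<mu>"
proof -
  have "(\<lambda>z. restrict z K) \<in> measurable \<mu> (PiM K (\<lambda>_. count_space Sp))"
    unfolding measurable_cong_sets[OF sets_mu' refl] by (rule measurable_restrict_subset) auto
  moreover have "PiM K (\<lambda>_. count_space Sp) = count_space (Om K)"
    by (rule count_space_PiM_finite[OF K]) (use Sp in \<open>auto simp: countable_finite\<close>)
  ultimately have "(\<lambda>z. restrict z K) \<in> measurable \<mu> (count_space (Om K))" by simp
  hence "(\<lambda>z. ker L x K (restrict z K)) \<in> borel_measurable \<mu>" by (rule measurable_compose) simp
  also have "(\<lambda>z. ker L x K (restrict z K)) = ker L x K" by (intro ext ker_cong) simp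
  finally show ?thesis .
qed

lemma spec_kernel_measurable:
  assumes L: "finite V" and x: "x \<in> Om V"
  shows "spec_kernel Sp \<Psi> V x \<in> borel_measurable \<mu>"
proof -
  have "\<exists>K. finite K \<and> (\<forall>z. (\<forall>i. z i \<in> Sp) \<longrightarrow> \<bar>spec_kernel Sp \<Psi> V x z - ker V x K z\<bar> \<le> inverse (real (Suc n)))" for n
  proof -
    obtain K0 where "finite K0" "\<And>K z. finite K \<Longrightarrow> K0 \<subseteq> K \<Longrightarrow> (\<And>i. z i \<in> Sp) \<Longrightarrow> \<bar>spec_kernel Sp \<Psi> V x z - ker V x K z\<bar> \<le> inverse (real (Suc n))"
      by (rule ker_approx[OF L x, of "inverse (real (Suc n))"]) auto
    thus ?thesis by (intro exI[of _ K0]) auto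
  qed
  then obtain K where K: "\<And>n. finite (K n)"
    "\<And>n z. (\<forall>i. z i \<in> Sp) \<Longrightarrow> \<bar>spec_kernel Sp \<Psi> V x z - ker V x (K n) z\<bar> \<le> inverse (real (Suc n))" by metis
  show ?thesis
  proof (rule borel_measurable_LIMSEQ_metric[of "\<lambda>n. ker V x (K n)"])
    show "ker V x (K n) \<in> borel_measurable \<mu>" for n by (rule ker_measurable[OF K(1)])
    fix z assume "z \<in> space \<mu>"
    hence "\<forall>i. z i \<in> Sp" by (auto simp: space_mu)
    hence le: "norm (ker V x (K n) z - spec_kernel Sp \<Psi> V x z) \<le> inverse (real (Suc n))" for n
      using K(2)[of z n] by (simp add: abs_minus_commute)
    have "(\<lambda>n. ker V x (K n) z - spec_kernel Sp \<Psi> V x z) \<longlonglongrightarrow> 0"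
      by (rule Lim_null_comparison[OF always_eventually LIMSEQ_inverse_real_of_nat]) (use le in blast)
    thus "(\<lambda>n. ker V x (K n) z) \<longlonglongrightarrow> spec_kernel Sp \<Psi> V x z" by (simp add: LIM_zero_iff)
  qed
qed

lemma integral_ker:
  assumes K: "finite K" "B \<subseteq> K"
  shows "(\<integral>z. indicator {z \<in> space \<mu>. restrict z B = y} z * ker L x K z \<partial>\<mu>) = (\<Sum>u\<in>{u\<in>Om K. restrict u B = y}. ker L x K u * p K u)"
proof -
  let ?U = "{u\<in>Om K. restrict u B = y}"
  have fU: "finite ?U" using finite_Om[OF K(1)] by simp
  have KB: "K \<inter> B = B" using K by auto
  have "(\<integral>z. indicator {z \<in> space \<mu>. restrict z B = y} z * ker L x K z \<partial>\<mu>)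
     = (\<integral>z. (\<Sum>u\<in>?U. ker L x K u * indicator {z \<in> space \<mu>. restrict z K = u} z) \<partial>\<mu>)"
  proof (rule Bochner_Integration.integral_cong[OF refl])
    fix z assume om: "z \<in> space \<mu>"
    have rK: "restrict z K \<in> Om K" using om by (auto simp: space_mu)
    have "(\<Sum>u\<in>?U. ker L x K u * indicator {z \<in> space \<mu>. restrict z K = u} z) = (\<Sum>u\<in>?U. if restrict z K = u then ker L x K u else 0)"
      by (intro sum.cong refl) (use om in \<open>auto simp: indicator_def\<close>)
    also have "\<dots> = (if restrict z K \<in> ?U then ker L x K (restrict z K) else 0)" by (rule sum.delta'[OF fU])
    also have "ker L x K (restrict z K) = ker L x K z" by (rule ker_cong) simp
    also have "(restrict z K \<in> ?U) = (restrict z B = y)" using rK by (simp add: restrict_restrict KB)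
    finally have S: "(\<Sum>u\<in>?U. ker L x K u * indicator {z \<in> space \<mu>. restrict z K = u} z) = (if restrict z B = y then ker L x K z else 0)" .
    show "indicator {z \<in> space \<mu>. restrict z B = y} z * ker L x K z = (\<Sum>u\<in>?U. ker L x K u * indicator {z \<in> space \<mu>. restrict z K = u} z)"
      unfolding S using om by (simp add: indicator_def)
  qed
  also have "\<dots> = (\<Sum>u\<in>?U. \<integral>z. ker L x K u * indicator {z \<in> space \<mu>. restrict z K = u} z \<partial>\<mu>)"
    by (rule Bochner_Integration.integral_sum) (auto intro!: integrable_mult_right integrable_real_indicator cyl_sets K simp: emeasure_eq_measure)
  also have "\<dots> = (\<Sum>u\<in>?U. ker L x K u * p K u)"
  proof (rule sum.cong[OF refl])
    fix u assume "u \<in> ?U"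
    hence "measure \<mu> {z \<in> space \<mu>. restrict z K = u} = p K u" using cyl[OF K(1)] by auto
    moreover have "{z \<in> space \<mu>. restrict z K = u} \<inter> space \<mu> = {z \<in> space \<mu>. restrict z K = u}" by auto
    ultimately show "(\<integral>z. ker L x K u * indicator {z \<in> space \<mu>. restrict z K = u} z \<partial>\<mu>) = ker L x K u * p K u" by simp
  qed
  finally show ?thesis .
qed

lemma integrable_bounded01:
  assumes "f \<in> borel_measurable \<mu>" "\<And>z. 0 \<le> f z" "\<And>z. f z \<le> (1::real)" "S \<in> sets \<mu>"
  shows "integrable \<mu> (\<lambda>z. indicator S z * f z)"
  by (rule integrable_const_bound[of _ 1]) (use assms in \<open>auto simp: indicator_def\<close>)

text \<open>The cut kernel mediates: it integrates to a finite sum of cylinder probabilities and is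
  uniformly close to the specification kernel. With accuracy \<open>e / 3\<close> the two errors add
  up to \<open>e\<close>.\<close>

lemma cylinder_DLR:
  assumes L: "finite V" and x: "x \<in> Om V" and B: "finite B" "B \<inter> V = {}" and y: "y \<in> Om B"
  shows "p (V \<union> B) (glue V x y) = (\<integral>z. indicator {z \<in> space \<mu>. restrict z B = y} z * spec_kernel Sp \<Psi> V x z \<partial>\<mu>)"
proof -
  let ?C = "{z \<in> space \<mu>. restrict z B = y}"
  let ?I = "\<integral>z. indicator ?C z * spec_kernel Sp \<Psi> V x z \<partial>\<mu>"
  have "\<bar>p (V \<union> B) (glue V x y) - ?I\<bar> \<le> 0 + e" if e: "0 < e" for e :: real
  proof -
    have e3: "0 < e / 3" using e by simp
    obtain K0 where K0: "finite K0" "\<And>K z. finite K \<Longrightarrow> K0 \<subseteq> K \<Longrightarrow> (\<And>i. z i \<in> Sp) \<Longrightarrow> \<bar>spec_kernel Sp \<Psi> V x z - ker V x K z\<bar> \<le> e / 3"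
      using ker_approx[OF L x e3] by blast
    define K where "K = K0 \<union> (V \<union> B)"
    have K: "finite K" "V \<union> B \<subseteq> K" "K0 \<subseteq> K" "B \<subseteq> K" using K0 L B by (auto simp: K_def)
    have 1: "\<bar>p (V \<union> B) (glue V x y) - (\<Sum>u\<in>{u\<in>Om K. restrict u B = y}. ker V x K u * p K u)\<bar> \<le> 2 * (e / 3)"
      by (rule p_ker_approx[OF L x B y e3 K(1,2)]) (use K0(2) K in blast)
    have i1: "integrable \<mu> (\<lambda>z. indicator ?C z * spec_kernel Sp \<Psi> V x z)"
      by (rule integrable_bounded01[OF spec_kernel_measurable[OF L x] spec_kernel_bounds[OF L x] cyl_sets[OF B(1)]])
    have i2: "integrable \<mu> (\<lambda>z. indicator ?C z * ker V x K z)"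
      by (rule integrable_bounded01[OF ker_measurable[OF K(1)] ker_bounds[OF L x] cyl_sets[OF B(1)]])
    have "norm (\<integral>z. indicator ?C z * spec_kernel Sp \<Psi> V x z - indicator ?C z * ker V x K z \<partial>\<mu>) \<le> (\<integral>z. e / 3 \<partial>\<mu>)"
    proof (rule order_trans[OF integral_norm_bound integral_mono])
      fix z assume "z \<in> space \<mu>"
      hence "\<bar>spec_kernel Sp \<Psi> V x z - ker V x K z\<bar> \<le> e / 3" by (intro K0(2) K) (auto simp: space_mu)
      thus "norm (indicator ?C z * spec_kernel Sp \<Psi> V x z - indicator ?C z * ker V x K z) \<le> e / 3"
        using e by (simp add: indicator_def)
    qed (use i1 i2 in auto)
    hence 2: "\<bar>?I - (\<integral>z. indicator ?C z * ker V x K z \<partial>\<mu>)\<bar> \<le> e / 3"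
      unfolding Bochner_Integration.integral_diff[OF i1 i2] by (simp add: prob_space)
    show ?thesis using 1 2 unfolding integral_ker[OF K(1,4)] by linarith
  qed
  hence "\<bar>p (V \<union> B) (glue V x y) - ?I\<bar> \<le> 0" by (rule field_le_epsilon)
  thus ?thesis by simp
qed

text \<open>For fixed \<open>x\<close> both sides are finite measures in the outside event
  \<open>F\<close>; \<open>cylinder_DLR\<close> says that they agree on cylinders, hence they are
  equal.\<close>

lemma DLR_mu: "DLR Sp \<Psi> \<mu>"
  unfolding DLR_def Let_def
proof (intro allI impI ballI)
  fix V :: "'d site set" and x F assume L: "finite V" and x: "x \<in> Om V" and F: "F \<in> sets (PiM (- V) (\<lambda>_. count_space Sp))"
  let ?N = "PiM (- V) (\<lambda>_. count_space Sp)"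
  let ?r = "\<lambda>z. restrict z (- V)"
  let ?X = "{z \<in> space \<mu>. restrict z V = x}"
  let ?E = "\<lambda>F. {z \<in> space \<mu>. ?r z \<in> F}"
  let ?f = "spec_kernel Sp \<Psi> V x"
  have fm: "?f \<in> borel_measurable \<mu>" by (rule spec_kernel_measurable[OF L x])
  have X: "?X \<in> sets \<mu>" by (rule cyl_sets[OF L])
  have rm: "?r \<in> measurable \<mu> ?N" unfolding measurable_cong_sets[OF sets_mu' refl] by (rule measurable_restrict_subset) auto
  have E: "?E G \<in> sets \<mu>" if "G \<in> sets ?N" for G
    using measurable_sets[OF rm that] by (simp add: vimage_def Int_def conj_commute)
  define M1 where "M1 = distr (density \<mu> (indicator ?X)) ?N ?r"
  define M2 where "M2 = distr (density \<mu> (\<lambda>z. ennreal (?f z))) ?N ?r"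
  have e1: "emeasure M1 G = emeasure \<mu> (?X \<inter> ?E G)" if G: "G \<in> sets ?N" for G
  proof -
    have "emeasure M1 G = emeasure (density \<mu> (indicator ?X)) (?r -` G \<inter> space (density \<mu> (indicator ?X)))"
      unfolding M1_def by (rule emeasure_distr) (use rm G in \<open>auto simp: measurable_density_eq1\<close>)
    also have "?r -` G \<inter> space (density \<mu> (indicator ?X)) = ?E G" by auto
    also have "emeasure (density \<mu> (indicator ?X)) (?E G) = emeasure \<mu> (?X \<inter> ?E G)"
      by (subst emeasure_density) (use X E[OF G] in \<open>auto simp flip: indicator_inter_arith intro!: nn_integral_indicator\<close>)
    finally show ?thesis .
  qed
  have e2: "emeasure M2 G = ennreal (\<integral>z. indicator (?E G) z * ?f z \<partial>\<mu>)" if G: "G \<in> sets ?N" for G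
  proof -
    have "emeasure M2 G = emeasure (density \<mu> (\<lambda>z. ennreal (?f z))) (?r -` G \<inter> space (density \<mu> (\<lambda>z. ennreal (?f z))))"
      unfolding M2_def by (rule emeasure_distr) (use rm G in \<open>auto simp: measurable_density_eq1\<close>)
    also have "?r -` G \<inter> space (density \<mu> (\<lambda>z. ennreal (?f z))) = ?E G" by auto
    also have "emeasure (density \<mu> (\<lambda>z. ennreal (?f z))) (?E G) = (\<integral>\<^sup>+z. ennreal (indicator (?E G) z * ?f z) \<partial>\<mu>)"
      by (subst emeasure_density) (use fm E[OF G] in \<open>auto intro!: nn_integral_cong simp: indicator_def\<close>)
    also have "\<dots> = ennreal (\<integral>z. indicator (?E G) z * ?f z \<partial>\<mu>)"
      by (rule nn_integral_eq_integral[OF integrable_bounded01[OF fm spec_kernel_bounds[OF L x] E[OF G]]])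
        (use spec_kernel_bounds[OF L x] in \<open>auto simp: indicator_def\<close>)
    finally show ?thesis .
  qed
  have "M1 = M2"
  proof (rule measure_eqI_cylinders[OF Sp(1), where I="- V"])
    show "sets M1 = sets ?N" "sets M2 = sets ?N" by (simp_all add: M1_def M2_def)
    have s1: "space M1 = space ?N" "space M2 = space ?N" by (simp_all add: M1_def M2_def)
    show "finite_measure M1"
      by (rule finite_measureI) (use e1[OF sets.top] in \<open>auto simp: s1\<close>)
    fix J y assume J: "finite J" "J \<subseteq> - V" and y: "y \<in> Om J"
    have JL: "J \<inter> V = {}" using J by auto
    have c: "{z \<in> space ?N. restrict z J = y} \<in> sets ?N" by (rule cylinder_measurable[OF Sp(1) J refl])
    have LJ: "- V \<inter> J = J" using J by auto
    have Ec: "?E {z \<in> space ?N. restrict z J = y} = {z \<in> space \<mu>. restrict z J = y}"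
      using measurable_space[OF rm] by (auto simp: restrict_restrict LJ)
    have gl: "glue V x y \<in> Om (V \<union> J)" using x y by (auto simp: glue_def PiE_iff extensional_def)
    have "restrict z (V \<union> J) = glue V x y \<longleftrightarrow> restrict z V = x \<and> restrict z J = y" for z
    proof -
      have "restrict z (V \<union> J) = glue V x y \<longleftrightarrow> (\<forall>i\<in>V. z i = x i) \<and> (\<forall>i\<in>J. z i = y i)"
        using gl JL y by (auto simp: fun_eq_iff restrict_def glue_def PiE_iff extensional_def split: if_splits)
      moreover have "restrict z V = x \<longleftrightarrow> (\<forall>i\<in>V. z i = x i)" "restrict z J = y \<longleftrightarrow> (\<forall>i\<in>J. z i = y i)"
        using x y by (auto simp: fun_eq_iff restrict_def PiE_iff extensional_def)
      ultimately show ?thesis by simp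
    qed
    hence Xc: "?X \<inter> {z \<in> space \<mu>. restrict z J = y} = {z \<in> space \<mu>. restrict z (V \<union> J) = glue V x y}" by auto
    have "emeasure M1 {z \<in> space M1. restrict z J = y} = ennreal (p (V \<union> J) (glue V x y))"
      unfolding s1 e1[OF c] Ec Xc emeasure_eq_measure using cyl[OF _ gl] L J by simp
    moreover have "emeasure M2 {z \<in> space M2. restrict z J = y} = ennreal (p (V \<union> J) (glue V x y))"
      unfolding s1 e2[OF c] Ec cylinder_DLR[OF L x J(1) JL y] ..
    ultimately show "emeasure M1 {z \<in> space M1. restrict z J = y} = emeasure M2 {z \<in> space M2. restrict z J = y}" by simp
  qed
  hence "emeasure \<mu> (?X \<inter> ?E F) = ennreal (\<integral>z. indicator (?E F) z * ?f z \<partial>\<mu>)" using e1[OF F] e2[OF F] by simp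
  moreover have "0 \<le> (\<integral>z. indicator (?E F) z * ?f z \<partial>\<mu>)" using spec_kernel_bounds[OF L x] by (intro integral_nonneg_AE) auto
  ultimately show "measure \<mu> (?X \<inter> ?E F) = (\<integral>z\<in>?E F. ?f z \<partial>\<mu>)"
    by (simp add: set_lebesgue_integral_def measure_def)
qed

end

text \<open>Uniqueness comes from the prescribed cylinder probabilities, which determine the
  measure; the DLR equations are then proved for it.\<close>

theorem exists_unique_DLR_measure:
  "\<exists>!\<mu>. prob_space \<mu> \<and> sets \<mu> = sets (config_space Sp) \<and>
    (\<forall>B. finite B \<longrightarrow> (\<forall>x\<in>Om B. measure \<mu> {z \<in> space \<mu>. restrict z B = x} = p B x)) \<and> DLR Sp \<Psi> \<mu>"
proof -
  obtain \<mu> where mu: "prob_space \<mu>" "sets \<mu> = sets (config_space Sp)" "\<forall>B. finite B \<longrightarrow> (\<forall>x\<in>Om B. measure \<mu> {z \<in> space \<mu>. restrict z B = x} = p B x)"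
    using exists_measure by blast
  show ?thesis
  proof (rule ex1I[of _ \<mu>])
    show "prob_space \<mu> \<and> sets \<mu> = sets (config_space Sp) \<and>
      (\<forall>B. finite B \<longrightarrow> (\<forall>x\<in>Om B. measure \<mu> {z \<in> space \<mu>. restrict z B = x} = p B x)) \<and> DLR Sp \<Psi> \<mu>"
      using mu DLR_mu[of \<mu>] by blast
    fix \<nu> assume nu: "prob_space \<nu> \<and> sets \<nu> = sets (config_space Sp) \<and>
      (\<forall>B. finite B \<longrightarrow> (\<forall>x\<in>Om B. measure \<nu> {z \<in> space \<nu>. restrict z B = x} = p B x)) \<and> DLR Sp \<Psi> \<nu>"
    interpret m: prob_space \<mu> by (rule mu(1))
    interpret n: prob_space \<nu> using nu by blast
    show "\<nu> = \<mu>"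
    proof (rule measure_eqI_cylinders[OF Sp(1), where I=UNIV])
      show "sets \<nu> = sets (PiM UNIV (\<lambda>_. count_space Sp))" "sets \<mu> = sets (PiM UNIV (\<lambda>_. count_space Sp))"
        using nu mu(2) by (simp_all add: config_space_def)
      show "finite_measure \<nu>" by (rule n.finite_measure_axioms)
    qed (use nu mu(3) in \<open>simp add: n.emeasure_eq_measure m.emeasure_eq_measure\<close>)
  qed
qed

end

section \<open>The classical potential\<close>

text \<open>Along a nearest-neighbour path from \<open>x\<close> the distance to \<open>x\<close>
  grows by at most 1 in a step, so it attains every value up to \<open>dist1 x y\<close>, and it
  does so at sites of \<open>A\<close>.\<close>

lemma lat_diam_le_card:
  assumes A: "lat_connected A"
  shows "lat_diam A \<le> int (card A)"
proof -
  have fA: "finite A" "A \<noteq> {}" using A by (auto simp: lat_connected_def)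
  have "dist1 x y \<le> int (card A)" if xy: "x \<in> A" "y \<in> A" for x y
  proof -
    have "(x, y) \<in> {(u, v). u \<in> A \<and> v \<in> A \<and> dist1 u v = 1}\<^sup>*" using A xy by (auto simp: lat_connected_def)
    hence "{0..dist1 x y} \<subseteq> dist1 x ` A"
    proof (induction rule: rtrancl_induct)
      case base
      have "dist1 x x \<in> dist1 x ` A" using xy by blast
      thus ?case by simp
    next
      case (step y z)
      have "dist1 x z \<le> dist1 x y + 1" using dist1_triangle[of x z y] step(2) by simp
      moreover have "dist1 x z \<in> dist1 x ` A" using step(2) by auto
      ultimately have "{0..dist1 x z} \<subseteq> insert (dist1 x z) {0..dist1 x y}" by auto
      thus ?case using step(3) \<open>dist1 x z \<in> dist1 x ` A\<close> by blast
    qed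
    hence "card {0..dist1 x y} \<le> card (dist1 x ` A)" using fA by (intro card_mono) auto
    also have "\<dots> \<le> card A" by (rule card_image_le[OF fA(1)])
    finally show ?thesis using dist1_nonneg[of x y] by simp
  qed
  moreover have "finite {dist1 x y | x y. x \<in> A \<and> y \<in> A}"
  proof -
    have "{dist1 x y | x y. x \<in> A \<and> y \<in> A} = (\<lambda>(x, y). dist1 x y) ` (A \<times> A)" by auto
    thus ?thesis using fA by simp
  qed
  moreover have "{dist1 x y | x y. x \<in> A \<and> y \<in> A} \<noteq> {}" using fA by auto
  ultimately have "Max {dist1 x y | x y. x \<in> A \<and> y \<in> A} \<le> int (card A)" by (intro Max.boundedI) auto
  thus ?thesis using fA by (simp add: lat_diam_def)
qed

lemma lat_connected_conn: "lat_connected A \<Longrightarrow> conn (lat_nbr 1) A"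
proof -
  assume A: "lat_connected A"
  have "{(u, v). u \<in> A \<and> v \<in> A \<and> dist1 u v = 1} \<subseteq> lat_nbr 1 \<inter> A \<times> A" by (auto simp: lat_nbr_def)
  hence "{(u, v). u \<in> A \<and> v \<in> A \<and> dist1 u v = 1}\<^sup>* \<subseteq> (lat_nbr 1 \<inter> A \<times> A)\<^sup>*" by (rule rtrancl_mono)
  thus ?thesis using A unfolding conn_def lat_connected_def by blast
qed

text \<open>Connected sets through \<open>i\<close> are animals of the nearest-neighbour graph.
  Their generating function is bounded uniformly in the enclosing finite set, which bounds all
  finite partial sums.\<close>

lemma connected_weight_summable:
  fixes i :: "'d::finite site" and z :: real
  assumes z: "0 \<le> z" "z * 2 ^ lat_deg TYPE('d) 1 \<le> 1"
  shows "(\<lambda>A. if lat_connected A then z ^ card A else 0) summable_on {A. finite A \<and> i \<in> A}"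
proof (rule nonneg_bdd_above_summable_on)
  interpret bounded_degree "lat_nbr 1 :: 'd site rel" "lat_deg TYPE('d) 1" by (rule bounded_degree_lat) simp
  show "0 \<le> (if lat_connected A then z ^ card A else 0)" for A :: "'d site set" using z by simp
  show "bdd_above (sum (\<lambda>A. if lat_connected A then z ^ card A else 0) ` {F. F \<subseteq> {A. finite A \<and> i \<in> A} \<and> finite F})"
  proof (rule bdd_aboveI2)
    fix F assume F: "F \<in> {F. F \<subseteq> {A. finite A \<and> i \<in> A} \<and> finite F}"
    have fU: "finite (\<Union>F)" using F by auto
    have "(\<Sum>A\<in>F. if lat_connected A then z ^ card A else 0) = (\<Sum>A\<in>{A\<in>F. lat_connected A}. z ^ card A)"
      by (rule sum.inter_filter[symmetric]) (use F in auto)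
    also have "\<dots> \<le> (\<Sum>A\<in>animals (\<Union>F) i. z ^ card A)"
      by (rule sum_mono2[OF finite_animals[OF fU]]) (use F z lat_connected_conn in \<open>auto simp: animals_def\<close>)
    also have "\<dots> \<le> z * 2 ^ lat_deg TYPE('d) 1" by (rule sum_animals_le[OF fU z])
    finally show "(\<Sum>A\<in>F. if lat_connected A then z ^ card A else 0) \<le> 1" using z by simp
  qed
qed

lemma filterlim_Pow_finite_subsets: "filterlim Pow (finite_subsets_at_top {A. finite A}) (finite_subsets_at_top UNIV)"
  unfolding filterlim_finite_subsets_at_top
proof (intro allI impI)
  fix X :: "'a set set" assume X: "finite X \<and> X \<subseteq> {A. finite A}"
  show "\<forall>\<^sub>F L in finite_subsets_at_top UNIV. finite (Pow L) \<and> X \<subseteq> Pow L \<and> Pow L \<subseteq> {A. finite A}"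
    unfolding eventually_finite_subsets_at_top using X by (intro exI[of _ "\<Union>X"]) (auto intro: finite_subset)
qed

lemma sum_Pow_tendsto_infsum:
  fixes f :: "'a set \<Rightarrow> real"
  assumes f: "f summable_on {A. finite A \<and> A \<inter> B \<noteq> {}}" and z: "\<And>A. finite A \<Longrightarrow> A \<inter> B = {} \<Longrightarrow> f A = 0"
  shows "((\<lambda>L. \<Sum>A\<in>Pow L. f A) \<longlongrightarrow> infsum f {A. finite A \<and> A \<inter> B \<noteq> {}}) (finite_subsets_at_top UNIV)"
proof -
  have "(f has_sum infsum f {A. finite A \<and> A \<inter> B \<noteq> {}}) {A. finite A \<and> A \<inter> B \<noteq> {}}" by (rule has_sum_infsum[OF f])
  also have "?this \<longleftrightarrow> (f has_sum infsum f {A. finite A \<and> A \<inter> B \<noteq> {}}) {A. finite A}"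
    by (rule has_sum_cong_neutral) (use z in auto)
  finally show ?thesis unfolding has_sum_def by (rule filterlim_compose[OF _ filterlim_Pow_finite_subsets])
qed

text \<open>An additive function is its own decomposition over one-point sets. This is applied to
  the logarithms of the vacuum factors.\<close>

lemma mob_sum_over_sites:
  fixes c :: "'i \<Rightarrow> real"
  assumes A: "finite A"
  shows "\<bar>mob (\<lambda>V. \<Sum>i\<in>V. c i) A\<bar> \<le> (if is_singleton A then \<bar>c (the_elem A)\<bar> else 0)"
proof -
  have "mob (\<lambda>V. \<Sum>i\<in>V. c i) A = (if is_singleton A then c (the_elem A) else 0)"
  proof (rule mob_unique[OF A])
    fix T assume "T \<subseteq> A"
    hence T: "finite T" using A finite_subset by blast
    have "(\<Sum>S\<in>Pow T. if is_singleton S then c (the_elem S) else 0) = (\<Sum>S\<in>(\<lambda>i. {i}) ` T. if is_singleton S then c (the_elem S) else 0)"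
      by (rule sum.mono_neutral_right) (use T in \<open>auto simp: is_singleton_def\<close>)
    also have "\<dots> = (\<Sum>i\<in>T. c i)" by (subst sum.reindex) auto
    finally show "(\<Sum>i\<in>T. c i) = (\<Sum>S\<in>Pow T. if is_singleton S then c (the_elem S) else 0)" by simp
  qed
  thus ?thesis by simp
qed

lemma Re_mob: "Re (mob f A) = mob (\<lambda>V. Re (f V)) A"
proof -
  have "Re ((-1) ^ n * z) = (-1) ^ n * Re z" for n and z :: complex by (cases "even n") auto
  thus ?thesis by (simp add: mob_def)
qed

lemma mob_le_nb:
  assumes A: "finite A"
  shows "exp (a * real (card A)) * norm (mob l A) \<le> nb A a l"
  unfolding nb_def by (rule member_le_sum) (use A in auto)

lemma op_mult_tensor:
  assumes "finite V"
  shows "op_mult (confs m V) (op_tensor V M) (op_tensor V N) s t = op_tensor V (\<lambda>i. smat_mult m (M i) (N i)) s t"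
  unfolding op_mult_def op_tensor_def smat_mult_def prod.distrib[symmetric] by (rule sum_prod_confs[OF assms])

lemma confs_lt: "s \<in> confs m V \<Longrightarrow> i \<in> V \<Longrightarrow> s i < m"
  by (auto simp: confs_def)

lemma op_tensor_id:
  assumes "finite V" "s \<in> confs m V" "t \<in> confs m V"
  shows "op_tensor V (\<lambda>_. smat_id) s t = op_id s t"
proof -
  have "(\<forall>i\<in>V. s i = t i) \<longleftrightarrow> s = t" using assms by (auto simp: confs_def fun_eq_iff PiE_iff extensional_def)
  thus ?thesis by (simp add: op_tensor_def smat_id_def prod_delta[OF assms(1)] op_id_def)
qed

lemma gibbs_fin_cong:
  assumes "\<And>s t. s \<in> D \<Longrightarrow> t \<in> D \<Longrightarrow> Ob s t = Ob' s t"
  shows "gibbs_fin D H b Ob = gibbs_fin D H b Ob'"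
  unfolding gibbs_fin_def op_trace_def by (intro arg_cong2[where f="(/)"] sum.cong refl op_mult_cong) (use assms in auto)

lemma gibbs_fin_sum: "gibbs_fin D H b (\<lambda>s t. \<Sum>y\<in>Y. Ob y s t) = (\<Sum>y\<in>Y. gibbs_fin D H b (Ob y))"
proof -
  have "op_trace D (op_mult D M (\<lambda>s t. \<Sum>y\<in>Y. Ob y s t)) = (\<Sum>y\<in>Y. op_trace D (op_mult D M (Ob y)))" for M
  proof -
    have "op_trace D (op_mult D M (\<lambda>s t. \<Sum>y\<in>Y. Ob y s t)) = (\<Sum>s\<in>D. \<Sum>r\<in>D. \<Sum>y\<in>Y. M s r * Ob y r s)"
      by (simp add: op_trace_def op_mult_def sum_distrib_left)
    also have "\<dots> = (\<Sum>s\<in>D. \<Sum>y\<in>Y. \<Sum>r\<in>D. M s r * Ob y r s)" by (intro sum.cong refl sum.swap)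
    also have "\<dots> = (\<Sum>y\<in>Y. \<Sum>s\<in>D. \<Sum>r\<in>D. M s r * Ob y r s)" by (rule sum.swap)
    finally show ?thesis by (simp add: op_trace_def op_mult_def)
  qed
  thus ?thesis by (simp add: gibbs_fin_def sum_divide_distrib)
qed

text \<open>The smallness condition covers the whole interval from \<open>\<beta>0\<close> to
  \<open>2 * \<beta>0\<close>, because the slab length varies with the temperature. \<open>K\<close>
  compares all entries of \<open>Q x\<close> with its vacuum entry, and \<open>a\<close> is the
  decay rate aimed at.\<close>

locale low_temperature = spin_model m \<Phi>0 \<Upsilon> P u g \<kappa> R
  for m :: nat and \<Phi>0 \<Upsilon> :: "('d::finite) interaction" and P u :: smat and g \<kappa> :: real and R :: int +
  fixes Sp :: "real set" and Q :: "real \<Rightarrow> smat" and a \<beta>0 K :: real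
  assumes X: "spectral_decomp m Sp Q"
    and Q0: "\<And>x. x \<in> Sp \<Longrightarrow> smat_conj u m (Q x) 0 0 \<noteq> 0"
    and K1: "1 \<le> K" and K: "\<And>x a b. x \<in> Sp \<Longrightarrow> a < m \<Longrightarrow> b < m \<Longrightarrow> cmod (smat_conj u m (Q x) a b) \<le> K * cmod (smat_conj u m (Q x) 0 0)"
    and a: "0 \<le> a" and \<beta>0: "0 < \<beta>0"
    and small: "\<And>t. \<beta>0 \<le> t \<Longrightarrow> t \<le> 2 * \<beta>0 \<Longrightarrow> (1 + 2 * exp a) ^ lat_deg TYPE('d) R * (real m ^ 2 * K ^ 2 * (exp (t - \<kappa>) + exp (- g * t))) * 2 ^ (5 * lat_deg TYPE('d) R) * 2 ^ (5 * lat_deg TYPE('d) R) \<le> 1/2"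
begin

text \<open>Admitting the identity at single sites lets marginals be treated in the same way as
  probabilities of full configurations.\<close>

definition observable :: "('d site \<Rightarrow> smat) \<Rightarrow> bool" where
  "observable Ob \<longleftrightarrow> (\<forall>i. Ob i \<in> insert smat_id (Q ` Sp))"

definition state :: "ereal \<Rightarrow> 'd site set \<Rightarrow> ('d site \<Rightarrow> smat) \<Rightarrow> complex" where
  "state b V Ob = gibbs (confs m V) (hamiltonian m \<Phi> V) b (op_tensor V Ob)"

definition vac :: "('d site \<Rightarrow> smat) \<Rightarrow> 'd site \<Rightarrow> real" where
  "vac Ob i = cmod (smat_conj u m (Ob i) 0 0)"

definition vac_bound :: real where
  "vac_bound = (\<Sum>x\<in>Sp. \<bar>ln (cmod (smat_conj u m (Q x) 0 0))\<bar>)"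

definition log_state :: "ereal \<Rightarrow> ('d site \<Rightarrow> smat) \<Rightarrow> 'd site set \<Rightarrow> real" where
  "log_state b Ob V = ln (cmod (state b V Ob))"

text \<open>The norm bound \<open>4 * card A\<close> yields
  \<open>4 * card A * exp (- a * card A)\<close>, and \<open>card A \<le> exp (card A)\<close>
  explains the 1 in the exponent. The vacuum factors matter on one-point sets only, where
  \<open>exp a\<close> offsets the decay.\<close>

definition decay_bound :: "'d site set \<Rightarrow> real" where
  "decay_bound A = (if lat_connected A then (4 + exp a * vac_bound) * exp ((1 - a) * real (card A)) else 0)"

lemma confs_ne: "finite V \<Longrightarrow> confs m V \<noteq> {}"
  using m by (auto simp: confs_def PiE_eq_empty_iff)

lemma finite_Sp: "finite Sp" "Sp \<noteq> {}"
  using X by (auto simp: spectral_decomp_def)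

lemma Phi_hermitian: "op_hermitian (confs m V) (hamiltonian m \<Phi> V)"
proof (rule op_hermitianI)
  fix s t assume st: "s \<in> confs m V" "t \<in> confs m V"
  have H: "hamiltonian m \<Phi> V s t = hamiltonian m \<Phi>0 V s t + hamiltonian m \<Upsilon> V s t" for s t
    unfolding hamiltonian_def sum.distrib[symmetric] by (rule sum.cong) (simp_all add: op_embed_def int_add_def)
  show "hamiltonian m \<Phi> V t s = cnj (hamiltonian m \<Phi> V s t)"
    unfolding H complex_cnj_add op_hermitianD[OF hermitian_hamiltonian[OF int0] st] op_hermitianD[OF hermitian_hamiltonian[OF intU] st] ..
qed

lemma observable_proj:
  assumes "observable Ob"
  shows "orth_proj m (Ob i)"
proof -
  have "orth_proj m smat_id"
    by (auto simp: orth_proj_def smat_hermitian_def smat_eq_def smat_id_def smat_mult_def if_distrib[of "\<lambda>x. x * _"] cong: if_cong)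
  moreover have "orth_proj m (Q x)" if "x \<in> Sp" for x using X that by (auto simp: spectral_decomp_def)
  ultimately show ?thesis using assms unfolding observable_def by (metis (no_types, lifting) imageE insertE)
qed

lemma tensor_proj:
  assumes Ob: "observable Ob" and V: "finite V"
  shows "op_hermitian (confs m V) (op_tensor V Ob)"
    "\<And>s t. s \<in> confs m V \<Longrightarrow> t \<in> confs m V \<Longrightarrow> op_mult (confs m V) (op_tensor V Ob) (op_tensor V Ob) s t = op_tensor V Ob s t"
proof -
  show "op_hermitian (confs m V) (op_tensor V Ob)"
  proof (rule op_hermitianI)
    fix s t assume st: "s \<in> confs m V" "t \<in> confs m V"
    show "op_tensor V Ob t s = cnj (op_tensor V Ob s t)"
      unfolding op_tensor_def cnj_prod
    proof (rule prod.cong[OF refl])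
      fix i assume "i \<in> V"
      thus "Ob i (t i) (s i) = cnj (Ob i (s i) (t i))"
        using observable_proj[OF Ob, of i] confs_lt[OF st(1)] confs_lt[OF st(2)] unfolding orth_proj_def smat_hermitian_def by blast
    qed
  qed
  fix s t assume st: "s \<in> confs m V" "t \<in> confs m V"
  show "op_mult (confs m V) (op_tensor V Ob) (op_tensor V Ob) s t = op_tensor V Ob s t"
    unfolding op_mult_tensor[OF V] unfolding op_tensor_def
    by (rule prod.cong[OF refl]) (use observable_proj[OF Ob] confs_lt[OF st(1)] confs_lt[OF st(2)] in \<open>simp add: orth_proj_def smat_eq_def\<close>)
qed

lemma conj_id_00: "smat_conj u m smat_id 0 0 = 1"
  using smat_conj_id[OF m m] by simp

lemma observable_K:
  assumes "observable Ob"
  shows "smat_conj u m (Ob i) 0 0 \<noteq> 0" "a' < m \<Longrightarrow> b < m \<Longrightarrow> cmod (smat_conj u m (Ob i) a' b) \<le> K * cmod (smat_conj u m (Ob i) 0 0)"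
proof -
  consider "Ob i = smat_id" | x where "x \<in> Sp" "Ob i = Q x" using assms by (auto simp: observable_def)
  thus "smat_conj u m (Ob i) 0 0 \<noteq> 0" using Q0 conj_id_00 by cases auto
  assume ab: "a' < m" "b < m"
  consider "Ob i = smat_id" | x where "x \<in> Sp" "Ob i = Q x" using assms by (auto simp: observable_def)
  thus "cmod (smat_conj u m (Ob i) a' b) \<le> K * cmod (smat_conj u m (Ob i) 0 0)"
    using K[OF _ ab] K1 by cases (auto simp: conj_id_00 smat_conj_id[OF ab])
qed

lemma vac_pos: "observable Ob \<Longrightarrow> 0 < vac Ob i"
  using observable_K(1) by (simp add: vac_def)

lemma ln_vac_le: "observable Ob \<Longrightarrow> \<bar>ln (vac Ob i)\<bar> \<le> vac_bound"
proof -
  assume "observable Ob"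
  then consider "Ob i = smat_id" | x where "x \<in> Sp" "Ob i = Q x" by (auto simp: observable_def)
  thus ?thesis
  proof cases
    case 1
    thus ?thesis by (simp add: vac_def conj_id_00 vac_bound_def sum_nonneg)
  next
    case 2
    thus ?thesis unfolding vac_def vac_bound_def using member_le_sum[of x Sp "\<lambda>x. \<bar>ln (cmod (smat_conj u m (Q x) 0 0))\<bar>"] finite_Sp by simp
  qed
qed

section \<open>Logarithms of expectations at finite temperature\<close>

lemma state_finite:
  assumes V: "finite V"
  shows "state (ereal b) V Ob = Tr_spin b Ob V / Tr_spin b (\<lambda>_. smat_id) V"
proof -
  have "op_trace (confs m V) (op_exp (confs m V) (-b) (hamiltonian m \<Phi> V)) = Tr_spin b (\<lambda>_. smat_id) V"
    unfolding Tr_spin_def op_trace_def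
  proof (rule sum.cong[OF refl])
    fix x assume s: "x \<in> confs m V"
    let ?M = "op_exp (confs m V) (-b) (hamiltonian m \<Phi> V)"
    have "op_mult (confs m V) ?M (op_tensor V (\<lambda>_. smat_id)) x x = op_mult (confs m V) ?M op_id x x"
      by (rule op_mult_cong[OF refl]) (rule op_tensor_id[OF V _ s])
    also have "\<dots> = ?M x x" by (rule op_mult_id_right[OF finite_confs[OF V] s])
    finally show "?M x x = op_mult (confs m V) ?M (op_tensor V (\<lambda>_. smat_id)) x x" ..
  qed
  thus ?thesis by (simp add: state_def gibbs_def gibbs_fin_def Tr_spin_def)
qed

text \<open>A large inverse temperature is cut into slabs of length between \<open>\<beta>0\<close> and \<open>2 * \<beta>0\<close>.\<close>

lemma log_state_finite:
  assumes b: "\<beta>0 \<le> b" and A: "finite A" and Ob: "observable Ob"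
  obtains l where "nb A a l \<le> 4 * real (card A)"
    "\<And>V. V \<subseteq> A \<Longrightarrow> Tr_spin b (\<lambda>_. smat_id) V \<noteq> 0 \<and> 0 < cmod (state (ereal b) V Ob) \<and> state (ereal b) V Ob = complex_of_real (cmod (state (ereal b) V Ob))
       \<and> log_state (ereal b) Ob V = (\<Sum>i\<in>V. ln (vac Ob i)) + Re (l V)"
proof -
  define n where "n = nat \<lfloor>b / \<beta>0\<rfloor>"
  define t where "t = b / real n"
  have q1: "1 \<le> b / \<beta>0" using b \<beta>0 by simp
  have n: "0 < n" using q1 by (simp add: n_def)
  have rn: "real n = of_int \<lfloor>b / \<beta>0\<rfloor>" using q1 by (simp add: n_def)
  have "real n \<le> b / \<beta>0" unfolding rn by linarith
  hence t1: "\<beta>0 \<le> t" using \<beta>0 n by (simp add: t_def field_simps)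
  have "1 \<le> real n" using n by simp
  hence "b / \<beta>0 \<le> 2 * real n" unfolding rn by linarith
  hence t2: "t \<le> 2 * \<beta>0" using \<beta>0 n by (simp add: t_def field_simps)
  have nt: "real n * t = b" using n by (simp add: t_def)
  obtain l where l: "nb A a l \<le> 4 * real (card A)" "\<And>V. V \<subseteq> A \<Longrightarrow> Tr_spin b (\<lambda>_. smat_id) V \<noteq> 0 \<and>
     Tr_spin b Ob V = (\<Prod>i\<in>V. smat_conj u m (Ob i) 0 0) * Tr_spin b (\<lambda>_. smat_id) V * exp (l V)"
    using spin_log_ratio[where Ob=Ob, OF A a n _ K1 observable_K(2)[OF Ob] observable_K(1)[OF Ob] small[OF t1 t2]] t1 \<beta>0 unfolding nt by auto
  show ?thesis
  proof (rule that[OF l(1)])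
    fix V assume V: "V \<subseteq> A"
    have fV: "finite V" using V A finite_subset by blast
    have st: "state (ereal b) V Ob = (\<Prod>i\<in>V. smat_conj u m (Ob i) 0 0) * exp (l V)"
      unfolding state_finite[OF fV] using l(2)[OF V] by simp
    have nst: "cmod (state (ereal b) V Ob) = (\<Prod>i\<in>V. vac Ob i) * exp (Re (l V))"
      unfolding st by (simp add: norm_mult prod_norm[symmetric] vac_def)
    obtain r where r: "0 \<le> r" "gibbs_fin (confs m V) (hamiltonian m \<Phi> V) b (op_tensor V Ob) = complex_of_real r"
      using gibbs_fin_nonneg[OF finite_confs[OF fV] Phi_hermitian tensor_proj[OF Ob fV]] by blast
    have "state (ereal b) V Ob = complex_of_real r" unfolding state_def gibbs_def using r(2) by simp
    hence re: "state (ereal b) V Ob = complex_of_real (cmod (state (ereal b) V Ob))" using r(1) by simp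
    have pos: "0 < (\<Prod>i\<in>V. vac Ob i)" using vac_pos[OF Ob] by (intro prod_pos) auto
    have "log_state (ereal b) Ob V = ln (\<Prod>i\<in>V. vac Ob i) + Re (l V)"
      unfolding log_state_def nst using pos by (simp add: ln_mult)
    also have "ln (\<Prod>i\<in>V. vac Ob i) = (\<Sum>i\<in>V. ln (vac Ob i))" by (rule ln_prod[OF fV]) (use vac_pos[OF Ob] in \<open>auto simp: less_imp_neq[symmetric]\<close>)
    finally show "Tr_spin b (\<lambda>_. smat_id) V \<noteq> 0 \<and> 0 < cmod (state (ereal b) V Ob) \<and> state (ereal b) V Ob = complex_of_real (cmod (state (ereal b) V Ob))
       \<and> log_state (ereal b) Ob V = (\<Sum>i\<in>V. ln (vac Ob i)) + Re (l V)"
      using l(2)[OF V] re pos unfolding nst by simp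
  qed
qed

lemma state_Un:
  assumes "finite V1" "finite V2" "V1 \<inter> V2 = {}" "\<And>x y. x \<in> V1 \<Longrightarrow> y \<in> V2 \<Longrightarrow> 1 < dist1 x y"
  shows "state (ereal b) (V1 \<union> V2) Ob = state (ereal b) V1 Ob * state (ereal b) V2 Ob"
proof -
  have f: "finite (V1 \<union> V2)" using assms by simp
  show ?thesis unfolding state_finite[OF f] state_finite[OF assms(1)] state_finite[OF assms(2)]
    using Tr_spin_Un[OF assms, of b] by simp
qed

lemma state_id: "\<beta>0 \<le> b \<Longrightarrow> finite V \<Longrightarrow> (\<And>i. i \<in> V \<Longrightarrow> Ob i = smat_id) \<Longrightarrow> state (ereal b) V Ob = 1"
proof -
  assume b: "\<beta>0 \<le> b" and V: "finite V" and id: "\<And>i. i \<in> V \<Longrightarrow> Ob i = smat_id"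
  have I: "observable (\<lambda>_. smat_id)" by (simp add: observable_def)
  obtain l where "\<And>W. W \<subseteq> V \<Longrightarrow> Tr_spin b (\<lambda>_. smat_id) W \<noteq> 0"
    using log_state_finite[OF b V I] by metis
  hence "Tr_spin b (\<lambda>_. smat_id) V \<noteq> 0" by blast
  moreover have "Tr_spin b Ob V = Tr_spin b (\<lambda>_. smat_id) V"
    unfolding Tr_spin_def op_tensor_def using id by (simp cong: prod.cong)
  ultimately show ?thesis by (simp add: state_finite[OF V])
qed

text \<open>If \<open>A\<close> falls into two parts at distance above 1, expectations factorize,
  and the logarithm is a sum of two functions, one blind to \<open>y\<close> and the other blind to
  \<open>x\<close>.\<close>

lemma mob_log_state_zero:
  assumes b: "\<beta>0 \<le> b" and A: "finite A" and Ob: "observable Ob" and nc: "\<not> lat_connected A"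
  shows "mob (log_state (ereal b) Ob) A = 0"
proof (cases "A = {}")
  case True
  have "state (ereal b) {} Ob = 1" by (rule state_id[OF b]) auto
  thus ?thesis using True by (simp add: mob_def log_state_def)
next
  case False
  let ?r = "{(u, v). u \<in> A \<and> v \<in> A \<and> dist1 u v = 1}"
  obtain x y where xy: "x \<in> A" "y \<in> A" "(x, y) \<notin> ?r\<^sup>*" using False nc A by (auto simp: lat_connected_def)
  define C where "C = {z\<in>A. (x, z) \<in> ?r\<^sup>*}"
  have C: "C \<subseteq> A" "x \<in> C" "y \<in> A - C" using xy by (auto simp: C_def)
  have sep: "1 < dist1 p q" if "p \<in> C" "q \<in> A - C" for p q
  proof (rule ccontr)
    assume "\<not> 1 < dist1 p q"
    moreover have "dist1 p q \<noteq> 0"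
    proof
      assume "dist1 p q = 0"
      hence "(\<Sum>k\<in>UNIV. \<bar>p $ k - q $ k\<bar>) = 0" by (simp add: dist1_def)
      hence "p = q" by (simp add: sum_nonneg_eq_0_iff vec_eq_iff)
      thus False using that by simp
    qed
    ultimately have "dist1 p q = 1" using dist1_nonneg[of p q] by linarith
    hence "(p, q) \<in> ?r" using that C by auto
    moreover have "(x, p) \<in> ?r\<^sup>*" using that by (simp add: C_def)
    ultimately have "(x, q) \<in> ?r\<^sup>*" by (rule rtrancl_into_rtrancl[rotated])
    thus False using that by (simp add: C_def)
  qed
  obtain l where l: "\<And>V. V \<subseteq> A \<Longrightarrow> 0 < cmod (state (ereal b) V Ob)" using log_state_finite[OF b A Ob] by metis
  have split: "log_state (ereal b) Ob V = log_state (ereal b) Ob (V \<inter> C) + log_state (ereal b) Ob (V - C)" if V: "V \<subseteq> A" for V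
  proof -
    have fV: "finite V" using V A finite_subset by blast
    have "state (ereal b) ((V \<inter> C) \<union> (V - C)) Ob = state (ereal b) (V \<inter> C) Ob * state (ereal b) (V - C) Ob"
      by (rule state_Un) (use fV V sep in auto)
    moreover have "(V \<inter> C) \<union> (V - C) = V" by auto
    moreover have "0 < cmod (state (ereal b) (V \<inter> C) Ob)" "0 < cmod (state (ereal b) (V - C) Ob)" by (rule l; use V in auto)+
    ultimately show ?thesis by (simp add: log_state_def norm_mult ln_mult)
  qed
  have "mob (log_state (ereal b) Ob) A = mob (\<lambda>V. log_state (ereal b) Ob (V \<inter> C) + log_state (ereal b) Ob (V - C)) A"
    by (rule mob_cong) (rule split)
  also have "\<dots> = mob (\<lambda>V. log_state (ereal b) Ob (V \<inter> C)) A + mob (\<lambda>V. log_state (ereal b) Ob (V - C)) A" by (rule mob_add)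
  also have "mob (\<lambda>V. log_state (ereal b) Ob (V \<inter> C)) A = 0"
    by (rule mob_eq_0_if_insensitive[OF A xy(2)]) (use C in \<open>auto intro!: arg_cong[where f="log_state _ _"]\<close>)
  also have "mob (\<lambda>V. log_state (ereal b) Ob (V - C)) A = 0"
    by (rule mob_eq_0_if_insensitive[OF A xy(1)]) (use C in \<open>auto intro!: arg_cong[where f="log_state _ _"]\<close>)
  finally show ?thesis by simp
qed

lemma mob_log_state_le_finite:
  assumes b: "\<beta>0 \<le> b" and A: "finite A" and Ob: "observable Ob"
  shows "\<bar>mob (log_state (ereal b) Ob) A\<bar> \<le> decay_bound A"
proof (cases "lat_connected A")
  case False
  thus ?thesis using mob_log_state_zero[OF b A Ob] by (simp add: decay_bound_def)
next
  case True
  let ?n = "real (card A)"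
  have A1: "1 \<le> card A" using True by (simp add: lat_connected_def Suc_le_eq card_gt_0_iff)
  obtain l where l: "nb A a l \<le> 4 * ?n" "\<And>V. V \<subseteq> A \<Longrightarrow> log_state (ereal b) Ob V = (\<Sum>i\<in>V. ln (vac Ob i)) + Re (l V)"
    using log_state_finite[OF b A Ob] by metis
  have vb: "0 \<le> vac_bound" by (simp add: vac_bound_def sum_nonneg)
  have "mob (log_state (ereal b) Ob) A = mob (\<lambda>V. (\<Sum>i\<in>V. ln (vac Ob i)) + Re (l V)) A" by (rule mob_cong) (rule l(2))
  also have "\<dots> = mob (\<lambda>V. \<Sum>i\<in>V. ln (vac Ob i)) A + Re (mob l A)" by (simp add: mob_add Re_mob)
  finally have eq: "\<bar>mob (log_state (ereal b) Ob) A\<bar> \<le> \<bar>mob (\<lambda>V. \<Sum>i\<in>V. ln (vac Ob i)) A\<bar> + cmod (mob l A)"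
    using abs_Re_le_cmod[of "mob l A"] by linarith
  have "exp (a * ?n) * cmod (mob l A) \<le> 4 * ?n" using mob_le_nb[OF A, of a l] l(1) by linarith
  hence "cmod (mob l A) \<le> 4 * ?n * exp (- (a * ?n))" by (simp add: exp_minus field_simps)
  also have "\<dots> \<le> 4 * exp ?n * exp (- (a * ?n))"
    using exp_ge_add_one_self[of ?n] by (intro mult_right_mono mult_left_mono) (linarith | simp)+
  finally have 1: "cmod (mob l A) \<le> 4 * (exp ?n * exp (- (a * ?n)))" by simp
  have 2: "\<bar>mob (\<lambda>V. \<Sum>i\<in>V. ln (vac Ob i)) A\<bar> \<le> exp a * vac_bound * (exp ?n * exp (- (a * ?n)))"
  proof (cases "is_singleton A")
    case True
    hence n: "?n = 1" by (auto simp: is_singleton_def)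
    have "\<bar>mob (\<lambda>V. \<Sum>i\<in>V. ln (vac Ob i)) A\<bar> \<le> vac_bound"
      using mob_sum_over_sites[OF A, of "\<lambda>i. ln (vac Ob i)"] ln_vac_le[OF Ob, of "the_elem A"] True by simp
    also have "\<dots> \<le> vac_bound * exp 1" using vb by (simp add: mult_le_cancel_left1)
    also have "\<dots> = exp a * vac_bound * (exp ?n * exp (- (a * ?n)))" unfolding n by (simp add: exp_minus)
    finally show ?thesis .
  next
    case False
    thus ?thesis using mob_sum_over_sites[OF A, of "\<lambda>i. ln (vac Ob i)"] vb by simp
  qed
  have "exp ((1 - a) * ?n) = exp ?n * exp (- (a * ?n))" by (simp only: exp_add[symmetric]) (simp add: algebra_simps)
  thus ?thesis using eq 1 2 True unfolding decay_bound_def by (simp add: distrib_right)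
qed

section \<open>Passage to the ground state\<close>

lemma state_lower_bound:
  assumes b: "\<beta>0 \<le> b" and V: "finite V" and Ob: "observable Ob"
  shows "(\<Sum>i\<in>V. ln (vac Ob i)) - 4 * real (card V) \<le> log_state (ereal b) Ob V"
proof -
  obtain l where l: "nb V a l \<le> 4 * real (card V)" "\<And>W. W \<subseteq> V \<Longrightarrow> log_state (ereal b) Ob W = (\<Sum>i\<in>W. ln (vac Ob i)) + Re (l W)"
    using log_state_finite[OF b V Ob] by metis
  have "cmod (l V) \<le> 4 * real (card V)" using norm_le_nb[OF V a subset_refl, of l] l(1) by linarith
  thus ?thesis using l(2)[of V] abs_Re_le_cmod[of "l V"] by simp
qed

text \<open>\<open>gibbs_limit\<close> gives convergence. The lower bound by
  \<open>state_lower_bound\<close> does not depend on \<open>b\<close>, so the limit is positive and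
  logarithms may be taken through it.\<close>

lemma state_infinity:
  assumes V: "finite V" and Ob: "observable Ob"
  shows "((\<lambda>b. state (ereal b) V Ob) \<longlongrightarrow> state \<infinity> V Ob) at_top"
    "0 < cmod (state \<infinity> V Ob)" "state \<infinity> V Ob = complex_of_real (cmod (state \<infinity> V Ob))"
proof -
  obtain L where L: "0 \<le> L" "((\<lambda>b. gibbs_fin (confs m V) (hamiltonian m \<Phi> V) b (op_tensor V Ob)) \<longlongrightarrow> complex_of_real L) at_top"
    using gibbs_limit[OF finite_confs[OF V] confs_ne[OF V] Phi_hermitian tensor_proj[OF Ob V]] by blast
  have inf: "state \<infinity> V Ob = complex_of_real L" unfolding state_def gibbs_def using tendsto_Lim[OF _ L(2)] by simp
  show lim: "((\<lambda>b. state (ereal b) V Ob) \<longlongrightarrow> state \<infinity> V Ob) at_top"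
    unfolding inf using L(2) by (simp add: state_def gibbs_def)
  show "state \<infinity> V Ob = complex_of_real (cmod (state \<infinity> V Ob))" unfolding inf using L(1) by simp
  have "exp ((\<Sum>i\<in>V. ln (vac Ob i)) - 4 * real (card V)) \<le> cmod (state \<infinity> V Ob)"
  proof (rule tendsto_lowerbound[OF tendsto_norm[OF lim]])
    show "\<forall>\<^sub>F b in at_top. exp ((\<Sum>i\<in>V. ln (vac Ob i)) - 4 * real (card V)) \<le> cmod (state (ereal b) V Ob)"
      using eventually_ge_at_top[of \<beta>0]
    proof eventually_elim
      case (elim b)
      have "0 < cmod (state (ereal b) V Ob)" using log_state_finite[OF elim V Ob] by (metis subset_refl)
      thus ?case using state_lower_bound[OF elim V Ob] by (simp add: log_state_def ln_ge_iff)
    qed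
  qed simp
  thus "0 < cmod (state \<infinity> V Ob)" using exp_gt_zero less_le_trans by blast
qed

lemma inverse_temperature_cases:
  assumes "ereal \<beta>0 \<le> d"
  obtains b where "d = ereal b" "\<beta>0 \<le> b" | "d = \<infinity>"
  using assms by (cases d) auto

lemma state_pos:
  assumes b: "ereal \<beta>0 \<le> b" and V: "finite V" and Ob: "observable Ob"
  shows "0 < cmod (state b V Ob)" "state b V Ob = complex_of_real (cmod (state b V Ob))"
proof -
  from b show "0 < cmod (state b V Ob)"
    by (cases rule: inverse_temperature_cases) (use state_infinity[OF V Ob] log_state_finite[OF _ V Ob] in \<open>metis subset_refl\<close>)+
  from b show "state b V Ob = complex_of_real (cmod (state b V Ob))"
    by (cases rule: inverse_temperature_cases) (use state_infinity[OF V Ob] log_state_finite[OF _ V Ob] in \<open>metis subset_refl\<close>)+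
qed

lemma log_state_infinity:
  assumes V: "finite V" and Ob: "observable Ob"
  shows "((\<lambda>b. log_state (ereal b) Ob V) \<longlongrightarrow> log_state \<infinity> Ob V) at_top"
  unfolding log_state_def by (intro tendsto_ln tendsto_norm state_infinity[OF V Ob]) (use state_infinity(2)[OF V Ob] in simp)

lemma mob_log_state_infinity:
  assumes A: "finite A" and Ob: "observable Ob"
  shows "((\<lambda>b. mob (log_state (ereal b) Ob) A) \<longlongrightarrow> mob (log_state \<infinity> Ob) A) at_top"
  unfolding mob_def by (intro tendsto_intros log_state_infinity Ob) (use A in \<open>auto intro: finite_subset\<close>)

lemma mob_log_state_le:
  assumes d: "ereal \<beta>0 \<le> d" and A: "finite A" and Ob: "observable Ob"
  shows "\<bar>mob (log_state d Ob) A\<bar> \<le> decay_bound A"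
  using d
proof (cases rule: inverse_temperature_cases)
  case (1 b)
  thus ?thesis using mob_log_state_le_finite[OF _ A Ob] by simp
next
  case 2
  have "\<forall>\<^sub>F b in at_top. \<bar>mob (log_state (ereal b) Ob) A\<bar> \<le> decay_bound A"
    using eventually_ge_at_top[of \<beta>0] by eventually_elim (rule mob_log_state_le_finite[OF _ A Ob])
  thus ?thesis unfolding 2
    by (rule tendsto_upperbound[OF tendsto_rabs[OF mob_log_state_infinity[OF A Ob]]]) simp
qed

lemma state_id_all:
  assumes d: "ereal \<beta>0 \<le> d" and V: "finite V" and id: "\<And>i. i \<in> V \<Longrightarrow> Ob i = smat_id"
  shows "state d V Ob = 1"
  using d
proof (cases rule: inverse_temperature_cases)
  case (1 b)
  thus ?thesis using state_id[OF _ V id] by simp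
next
  case 2
  have "state d V Ob = state d V (\<lambda>_. smat_id)" for d unfolding state_def op_tensor_def using id by (simp cong: prod.cong)
  moreover have "state \<infinity> V (\<lambda>_. smat_id) = 1"
  proof (rule tendsto_unique[OF _ state_infinity(1)[OF V]])
    have "\<forall>\<^sub>F b in at_top. state (ereal b) V (\<lambda>_. smat_id) = 1"
      using eventually_ge_at_top[of \<beta>0] by eventually_elim (rule state_id[OF _ V], auto)
    thus "((\<lambda>b. state (ereal b) V (\<lambda>_. smat_id)) \<longlongrightarrow> 1) at_top" by (rule tendsto_eventually)
  qed (auto simp: observable_def)
  ultimately show ?thesis using 2 by simp
qed

section \<open>The potential and the measured distribution\<close>

text \<open>The observable of finding the spins \<open>x\<close> on \<open>B\<close>, with the
  identity elsewhere. Where \<open>x\<close> takes a value outside the spectrum the identity is used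
  too, so that this is an observable for every \<open>x\<close>.\<close>

definition obs :: "'d site set \<Rightarrow> ('d site \<Rightarrow> real) \<Rightarrow> 'd site \<Rightarrow> smat" where
  "obs B x i = (if i \<in> B \<and> x i \<in> Sp then Q (x i) else smat_id)"

lemma observable_obs: "observable (obs B x)"
  by (auto simp: observable_def obs_def)

definition pot :: "ereal \<Rightarrow> 'd site set \<Rightarrow> ('d site \<Rightarrow> real) \<Rightarrow> real" where
  "pot b A x = mob (log_state b (obs A x)) A"

lemma log_state_cong: "(\<And>i. i \<in> V \<Longrightarrow> Ob i = Ob' i) \<Longrightarrow> log_state b Ob V = log_state b Ob' V"
  unfolding log_state_def state_def op_tensor_def by (simp cong: prod.cong)

text \<open>The transform at \<open>A\<close> evaluates expectations in volumes inside
  \<open>A\<close> only, and there \<open>obs A\<close> and \<open>obs B\<close> coincide. Therefore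
  one potential serves every volume.\<close>

lemma pot_eq: "A \<subseteq> B \<Longrightarrow> pot b A (restrict x A) = mob (log_state b (obs B x)) A"
  unfolding pot_def by (intro mob_cong log_state_cong) (auto simp: obs_def)

lemma sum_pot:
  assumes "finite B"
  shows "(\<Sum>A\<in>Pow B. pot b A (restrict x A)) = log_state b (obs B x) B"
proof -
  have "(\<Sum>A\<in>Pow B. pot b A (restrict x A)) = (\<Sum>A\<in>Pow B. mob (log_state b (obs B x)) A)"
    by (intro sum.cong refl pot_eq) auto
  thus ?thesis by (simp add: sum_mob assms)
qed

lemma exp_sum_pot:
  assumes b: "ereal \<beta>0 \<le> b" and B: "finite B"
  shows "complex_of_real (exp (\<Sum>A\<in>Pow B. pot b A (restrict x A))) = state b B (obs B x)"
  unfolding sum_pot[OF B] log_state_def using state_pos[OF b B observable_obs, of B x] by simp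

lemma meas_dist_eq:
  assumes b: "ereal \<beta>0 \<le> b" and L: "finite V" and x: "x \<in> PiE V (\<lambda>_. Sp)"
  shows "meas_dist m \<Phi> Q b V x = complex_of_real (exp (\<Sum>A\<in>Pow V. pot b A (restrict x A)))"
proof -
  have "op_tensor V (\<lambda>i. Q (x i)) = op_tensor V (obs V x)"
    unfolding op_tensor_def by (intro ext prod.cong refl) (use x in \<open>auto simp: obs_def\<close>)
  thus ?thesis unfolding exp_sum_pot[OF b L] meas_dist_def state_def by simp
qed

lemma pot_le: "ereal \<beta>0 \<le> b \<Longrightarrow> finite A \<Longrightarrow> \<bar>pot b A x\<bar> \<le> decay_bound A"
  unfolding pot_def by (rule mob_log_state_le[OF _ _ observable_obs])

text \<open>Summing over the spins off \<open>B\<close> turns the spectral projections there into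
  the identity. Linearity of the Gibbs state gives the claim at finite temperature, and the ground
  state follows in the limit.\<close>

lemma sum_states:
  assumes d: "ereal \<beta>0 \<le> d" and L: "finite V" and B: "B \<subseteq> V" and x: "x \<in> PiE B (\<lambda>_. Sp)"
  shows "(\<Sum>y\<in>{y\<in>PiE V (\<lambda>_. Sp). restrict y B = x}. state d V (obs V y)) = state d V (obs B x)"
proof -
  let ?Y = "{y\<in>PiE V (\<lambda>_. Sp). restrict y B = x}"
  let ?S = "\<lambda>i. if i \<in> B then {x i} else Sp"
  have Y: "?Y = PiE V ?S"
  proof (intro set_eqI iffI)
    fix y assume y: "y \<in> ?Y"
    have "y i = x i" if "i \<in> B" for i using y that by auto
    thus "y \<in> PiE V ?S" using y by (auto simp: PiE_iff)
  next
    fix y assume y: "y \<in> PiE V ?S"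
    have yx: "y i = x i" if "i \<in> B" for i using y that B by (auto simp: PiE_iff split: if_splits)
    have "restrict y B = x" using yx x by (auto simp: fun_eq_iff PiE_iff extensional_def)
    moreover have "y i \<in> Sp" if "i \<in> V" for i using y that yx x by (cases "i \<in> B") (auto simp: PiE_iff)
    ultimately show "y \<in> ?Y" using y by (auto simp: PiE_iff)
  qed
  have fS: "finite (?S i)" for i using finite_Sp by simp
  have tensor: "(\<Sum>y\<in>?Y. op_tensor V (obs V y) r t) = op_tensor V (obs B x) r t"
    if st: "r \<in> confs m V" "t \<in> confs m V" for r t
  proof -
    have "(\<Sum>y\<in>?Y. op_tensor V (obs V y) r t) = (\<Sum>y\<in>PiE V ?S. \<Prod>i\<in>V. Q (y i) (r i) (t i))"
      unfolding op_tensor_def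
    proof (rule sum.cong[OF Y])
      fix y assume "y \<in> PiE V ?S"
      hence "y i \<in> Sp" if "i \<in> V" for i using Y that by blast
      thus "(\<Prod>i\<in>V. obs V y i (r i) (t i)) = (\<Prod>i\<in>V. Q (y i) (r i) (t i))" by (intro prod.cong refl) (simp add: obs_def)
    qed
    also have "\<dots> = (\<Prod>i\<in>V. \<Sum>s\<in>?S i. Q s (r i) (t i))"
      by (rule prod_sum_PiE[symmetric]) (use L fS in auto)
    also have "\<dots> = op_tensor V (obs B x) r t"
      unfolding op_tensor_def
    proof (rule prod.cong[OF refl])
      fix i assume i: "i \<in> V"
      have "(\<Sum>s\<in>Sp. Q s (r i) (t i)) = smat_id (r i) (t i)"
        using X confs_lt[OF st(1) i] confs_lt[OF st(2) i] by (simp add: spectral_decomp_def smat_eq_def)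
      thus "(\<Sum>s\<in>?S i. Q s (r i) (t i)) = obs B x i (r i) (t i)" using x by (auto simp: obs_def PiE_iff)
    qed
    finally show ?thesis .
  qed
  have fin: "(\<Sum>y\<in>?Y. state (ereal b) V (obs V y)) = state (ereal b) V (obs B x)" for b
    unfolding state_def gibbs_def
    by (simp only: PInfty_neq_ereal ereal.distinct if_False real_of_ereal.simps gibbs_fin_sum[symmetric]) (rule gibbs_fin_cong, rule tensor)
  from d show ?thesis
  proof (cases rule: inverse_temperature_cases)
    case 2
    have "((\<lambda>b. \<Sum>y\<in>?Y. state (ereal b) V (obs V y)) \<longlongrightarrow> (\<Sum>y\<in>?Y. state \<infinity> V (obs V y))) at_top"
      by (intro tendsto_sum state_infinity L observable_obs)
    moreover have "((\<lambda>b. \<Sum>y\<in>?Y. state (ereal b) V (obs V y)) \<longlongrightarrow> state \<infinity> V (obs B x)) at_top"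
      unfolding fin by (intro state_infinity L observable_obs)
    ultimately show ?thesis unfolding 2 by (rule tendsto_unique[rotated]) simp
  qed (use fin in simp)
qed

end

section \<open>Convergence of marginals, summability, and the thermodynamic limit\<close>

context low_temperature
begin

text \<open>The logarithm of a marginal in \<open>V\<close> is the sum of transforms over all
  subsets of \<open>V\<close>; this is its value in infinite volume, where the sets that meet
  \<open>B\<close> remain.\<close>

definition marginal_weight :: "ereal \<Rightarrow> 'd site set \<Rightarrow> ('d site \<Rightarrow> real) \<Rightarrow> real" where
  "marginal_weight b B x = exp (infsum (\<lambda>A. mob (log_state b (obs B x)) A) {A. finite A \<and> A \<inter> B \<noteq> {}})"

lemma vac_bound_nonneg: "0 \<le> vac_bound"
  by (simp add: vac_bound_def sum_nonneg)

lemma decay_bound_nonneg: "0 \<le> decay_bound A"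
  using vac_bound_nonneg by (simp add: decay_bound_def)

text \<open>Up to a constant this is the sum over connected sets with weight
  \<open>exp (c + 1 - a)\<close> per site; the 1 is the loss built into
  \<open>decay_bound\<close>.\<close>

lemma decay_bound_summable:
  assumes c: "exp (c + 1 - a) * 2 ^ lat_deg TYPE('d) 1 \<le> 1"
  shows "(\<lambda>A. exp (c * real (card A)) * decay_bound A) summable_on {A. finite A \<and> (i::'d site) \<in> A}"
proof -
  let ?C = "4 + exp a * vac_bound"
  have eq: "exp (c * real (card A)) * decay_bound A = ?C * (if lat_connected A then exp (c + 1 - a) ^ card A else 0)" for A :: "'d site set"
  proof -
    have "exp (c * real (card A)) * exp ((1 - a) * real (card A)) = exp (c + 1 - a) ^ card A"
      unfolding exp_of_nat2_mult[symmetric] exp_add[symmetric] by (simp only: distrib_right[symmetric] add_diff_eq)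
    thus ?thesis by (simp add: decay_bound_def)
  qed
  show ?thesis unfolding eq
    by (rule summable_on_cmult_right) (rule connected_weight_summable, use c in auto)
qed

context
  fixes c :: real
  assumes c: "0 < c" and ca: "exp (c + 1 - a) * 2 ^ lat_deg TYPE('d) 1 \<le> 1"
begin

lemma decay_summable: "decay_bound summable_on {A. finite A \<and> (i::'d site) \<in> A}"
proof (rule summable_on_comparison_test[OF decay_bound_summable[OF ca]])
  fix A :: "'d site set"
  have "1 * decay_bound A \<le> exp (c * real (card A)) * decay_bound A"
    using c decay_bound_nonneg by (intro mult_right_mono) auto
  thus "decay_bound A \<le> exp (c * real (card A)) * decay_bound A" by simp
qed (rule decay_bound_nonneg)

lemma marginal_tendsto:
  assumes b: "ereal \<beta>0 \<le> b" and B: "finite B" and x: "x \<in> PiE B (\<lambda>_. Sp)"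
  shows "((\<lambda>V. \<Sum>y\<in>{y\<in>PiE V (\<lambda>_. Sp). restrict y B = x}. exp (\<Sum>A\<in>Pow V. pot b A (restrict y A))) \<longlongrightarrow> marginal_weight b B x) (finite_subsets_at_top UNIV)"
proof -
  let ?f = "mob (log_state b (obs B x))"
  have "(\<lambda>A. norm (?f A)) summable_on {A. finite A \<and> A \<inter> B \<noteq> {}}"
    by (rule summable_on_comparison_test[OF summable_on_meeting[OF decay_summable B]]) (use mob_log_state_le[OF b _ observable_obs] in auto)
  hence sm: "?f summable_on {A. finite A \<and> A \<inter> B \<noteq> {}}" by (rule Infinite_Sum.abs_summable_summable)
  have "((\<lambda>V. \<Sum>A\<in>Pow V. ?f A) \<longlongrightarrow> infsum ?f {A. finite A \<and> A \<inter> B \<noteq> {}}) (finite_subsets_at_top UNIV)"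
  proof (rule sum_Pow_tendsto_infsum[OF sm])
    fix A assume A: "finite A" "A \<inter> B = {}"
    have "mob (log_state b (obs B x)) A = mob (\<lambda>_. 0) A"
    proof (rule mob_cong)
      fix T assume "T \<subseteq> A"
      hence "state b T (obs B x) = 1" using A by (intro state_id_all[OF b]) (auto simp: obs_def intro: finite_subset)
      thus "log_state b (obs B x) T = 0" by (simp add: log_state_def)
    qed
    thus "?f A = 0" by (simp add: mob_def)
  qed
  hence "((\<lambda>V. exp (\<Sum>A\<in>Pow V. ?f A)) \<longlongrightarrow> marginal_weight b B x) (finite_subsets_at_top UNIV)"
    unfolding marginal_weight_def by (rule tendsto_exp)
  moreover have "\<forall>\<^sub>F V in finite_subsets_at_top UNIV. exp (\<Sum>A\<in>Pow V. ?f A) = (\<Sum>y\<in>{y\<in>PiE V (\<lambda>_. Sp). restrict y B = x}. exp (\<Sum>A\<in>Pow V. pot b A (restrict y A)))"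
    unfolding eventually_finite_subsets_at_top
  proof (intro exI[of _ B] conjI B subset_UNIV allI impI)
    fix V assume L: "finite V \<and> B \<subseteq> V \<and> V \<subseteq> UNIV"
    hence fL: "finite V" "B \<subseteq> V" by auto
    have "complex_of_real (\<Sum>y\<in>{y\<in>PiE V (\<lambda>_. Sp). restrict y B = x}. exp (\<Sum>A\<in>Pow V. pot b A (restrict y A))) = state b V (obs B x)"
      unfolding of_real_sum exp_sum_pot[OF b fL(1)] by (rule sum_states[OF b fL x])
    also have "\<dots> = complex_of_real (exp (\<Sum>A\<in>Pow V. ?f A))"
      unfolding sum_mob[OF fL(1)] log_state_def using state_pos[OF b fL(1) observable_obs, of B x] by simp
    finally show "exp (\<Sum>A\<in>Pow V. ?f A) = (\<Sum>y\<in>{y\<in>PiE V (\<lambda>_. Sp). restrict y B = x}. exp (\<Sum>A\<in>Pow V. pot b A (restrict y A)))"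
      by (simp only: of_real_eq_iff)
  qed
  ultimately show ?thesis by (rule Lim_transform_eventually)
qed

lemma classical:
  assumes b: "ereal \<beta>0 \<le> b"
  shows "classical_gibbs Sp (pot b) (marginal_weight b) decay_bound"
proof
  fix V :: "'d site set" assume L: "finite V"
  let ?u = "\<lambda>_::'d site. undefined :: real"
  have "complex_of_real (\<Sum>y\<in>PiE V (\<lambda>_. Sp). exp (\<Sum>A\<in>Pow V. pot b A (restrict y A))) = (\<Sum>y\<in>{y\<in>PiE V (\<lambda>_. Sp). restrict y {} = ?u}. state b V (obs V y))"
    unfolding of_real_sum exp_sum_pot[OF b L] by (simp add: restrict_def)
  also have "\<dots> = state b V (obs {} ?u)" by (rule sum_states[OF b L]) auto
  also have "\<dots> = 1" by (rule state_id_all[OF b L]) (simp add: obs_def)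
  finally show "(\<Sum>y\<in>PiE V (\<lambda>_. Sp). exp (\<Sum>A\<in>Pow V. pot b A (restrict y A))) = 1" by (simp only: of_real_eq_1_iff)
qed (rule finite_Sp marginal_tendsto[OF b] pot_le[OF b] decay_summable; assumption)+

lemma max_abs_pot_le: "ereal \<beta>0 \<le> b \<Longrightarrow> finite A \<Longrightarrow> \<bar>max_abs Sp (pot b) A\<bar> \<le> decay_bound A"
proof -
  assume b: "ereal \<beta>0 \<le> b" and A: "finite A"
  let ?M = "(\<lambda>x. \<bar>pot b A x\<bar>) ` PiE A (\<lambda>_. Sp)"
  have M: "finite ?M" "?M \<noteq> {}" using finite_Sp A by (auto intro!: finite_PiE simp: PiE_eq_empty_iff)
  have "Max ?M \<le> decay_bound A" using M pot_le[OF b A] by (intro Max.boundedI) auto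
  moreover have "Max ?M \<in> ?M" by (rule Max_in[OF M])
  ultimately show ?thesis unfolding max_abs_def by auto
qed

lemma decay_card:
  assumes b: "ereal \<beta>0 \<le> b"
  shows "(\<lambda>A. exp (c * real (card A)) * max_abs Sp (pot b) A) summable_on {A. finite A \<and> (0::'d site) \<in> A}"
proof (rule Infinite_Sum.abs_summable_summable, rule summable_on_comparison_test[OF decay_bound_summable[OF ca]])
  fix A :: "'d site set" assume "A \<in> {A. finite A \<and> 0 \<in> A}"
  thus "norm (exp (c * real (card A)) * max_abs Sp (pot b) A) \<le> exp (c * real (card A)) * decay_bound A"
    using max_abs_pot_le[OF b] by (simp add: abs_mult)
qed simp

text \<open>The bound lives on connected sets, whose diameter is at most their number of sites, so
  decay in the size implies decay in the diameter.\<close>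

lemma decay_diam:
  assumes b: "ereal \<beta>0 \<le> b"
  shows "(\<lambda>A. exp (c * real_of_int (lat_diam A)) * max_abs Sp (pot b) A) summable_on {A. finite A \<and> (0::'d site) \<in> A}"
proof (rule Infinite_Sum.abs_summable_summable, rule summable_on_comparison_test[OF decay_bound_summable[OF ca]])
  fix A :: "'d site set" assume A: "A \<in> {A. finite A \<and> 0 \<in> A}"
  have le: "\<bar>max_abs Sp (pot b) A\<bar> \<le> decay_bound A" using max_abs_pot_le[OF b] A by auto
  show "norm (exp (c * real_of_int (lat_diam A)) * max_abs Sp (pot b) A) \<le> exp (c * real (card A)) * decay_bound A"
  proof (cases "lat_connected A")
    case True
    have "real_of_int (lat_diam A) \<le> real (card A)" using lat_diam_le_card[OF True] by linarith
    hence "c * real_of_int (lat_diam A) \<le> c * real (card A)" using c by simp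
    hence "exp (c * real_of_int (lat_diam A)) * \<bar>max_abs Sp (pot b) A\<bar> \<le> exp (c * real (card A)) * decay_bound A"
      using le by (intro mult_mono) auto
    thus ?thesis by (simp add: abs_mult)
  next
    case False
    thus ?thesis using le by (simp add: decay_bound_def)
  qed
qed simp

text \<open>Since the marginals converge to \<open>marginal_weight\<close>, requiring that they
  converge to the cylinder probabilities of \<mu> prescribes these probabilities. The claim then
  becomes \<open>exists_unique_DLR_measure\<close>.\<close>

lemma thermodynamic_limit:
  assumes b: "ereal \<beta>0 \<le> b"
  shows "\<exists>!\<mu>. prob_space \<mu> \<and> sets \<mu> = sets (config_space Sp) \<and>
           (\<forall>B. finite B \<longrightarrow> (\<forall>xB\<in>PiE B (\<lambda>_. Sp).
              ((\<lambda>V. meas_marginal m \<Phi> Sp Q b V B xB) \<longlongrightarrow>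
                 complex_of_real (measure \<mu> {z \<in> space \<mu>. restrict z B = xB}))
                (finite_subsets_at_top UNIV))) \<and>
           DLR Sp (pot b) \<mu>"
proof -
  interpret classical_gibbs Sp "pot b" "marginal_weight b" decay_bound by (rule classical[OF b])
  have lim: "((\<lambda>V. meas_marginal m \<Phi> Sp Q b V B x) \<longlongrightarrow> complex_of_real r) (finite_subsets_at_top UNIV) \<longleftrightarrow> r = marginal_weight b B x"
    if B: "finite B" and x: "x \<in> PiE B (\<lambda>_. Sp)" for B x r
  proof -
    have "((\<lambda>V. complex_of_real (\<Sum>y\<in>{y\<in>PiE V (\<lambda>_. Sp). restrict y B = x}. exp (\<Sum>A\<in>Pow V. pot b A (restrict y A)))) \<longlongrightarrow> complex_of_real (marginal_weight b B x)) (finite_subsets_at_top UNIV)"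
      by (rule tendsto_of_real[OF marginal_tendsto[OF b B x]])
    moreover have "\<forall>\<^sub>F V in finite_subsets_at_top UNIV. complex_of_real (\<Sum>y\<in>{y\<in>PiE V (\<lambda>_. Sp). restrict y B = x}. exp (\<Sum>A\<in>Pow V. pot b A (restrict y A))) = meas_marginal m \<Phi> Sp Q b V B x"
      unfolding eventually_finite_subsets_at_top
    proof (intro exI[of _ "{}"] conjI allI impI)
      fix V :: "'d site set" assume "finite V \<and> {} \<subseteq> V \<and> V \<subseteq> UNIV"
      hence L: "finite V" by simp
      show "complex_of_real (\<Sum>y\<in>{y\<in>PiE V (\<lambda>_. Sp). restrict y B = x}. exp (\<Sum>A\<in>Pow V. pot b A (restrict y A))) = meas_marginal m \<Phi> Sp Q b V B x"
        unfolding meas_marginal_def of_real_sum by (rule sum.cong[OF refl], rule meas_dist_eq[OF b L, symmetric]) simp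
    qed simp_all
    ultimately have l: "((\<lambda>V. meas_marginal m \<Phi> Sp Q b V B x) \<longlongrightarrow> complex_of_real (marginal_weight b B x)) (finite_subsets_at_top UNIV)"
      by (rule Lim_transform_eventually)
    have "complex_of_real r = complex_of_real (marginal_weight b B x)"
      if "((\<lambda>V. meas_marginal m \<Phi> Sp Q b V B x) \<longlongrightarrow> complex_of_real r) (finite_subsets_at_top UNIV)"
      by (rule tendsto_unique[OF _ that l]) simp
    thus ?thesis using l by auto
  qed
  have "(prob_space \<mu> \<and> sets \<mu> = sets (config_space Sp) \<and>
           (\<forall>B. finite B \<longrightarrow> (\<forall>x\<in>PiE B (\<lambda>_. Sp).
              ((\<lambda>V. meas_marginal m \<Phi> Sp Q b V B x) \<longlongrightarrow>
                 complex_of_real (measure \<mu> {z \<in> space \<mu>. restrict z B = x}))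
                (finite_subsets_at_top UNIV))) \<and>
           DLR Sp (pot b) \<mu>) \<longleftrightarrow>
     (prob_space \<mu> \<and> sets \<mu> = sets (config_space Sp) \<and>
    (\<forall>B. finite B \<longrightarrow> (\<forall>x\<in>PiE B (\<lambda>_. Sp). measure \<mu> {z \<in> space \<mu>. restrict z B = x} = marginal_weight b B x)) \<and> DLR Sp (pot b) \<mu>)" for \<mu>
    using lim by meson
  thus ?thesis using exists_unique_DLR_measure by simp
qed

end

end

theorem theorem7:
  fixes m :: nat and \<Phi>0 :: "('d::finite) interaction" and P :: smat and g :: real
    and Sp :: "real set" and Q :: "real \<Rightarrow> smat" and c :: real
  assumes int0: "is_interaction m \<Phi>0" and fr0: "finite_range m \<Phi>0"
    and P: "rank_one_proj m P" and g: "g > 0"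
    and comm: "\<And>\<Lambda> S. finite \<Lambda> \<Longrightarrow> S \<subseteq> \<Lambda> \<Longrightarrow>
        op_eq_on (confs m \<Lambda>)
          (op_mult (confs m \<Lambda>) (hamiltonian m \<Phi>0 \<Lambda>)
                   (op_tensor \<Lambda> (\<lambda>i. if i \<in> S then (\<lambda>a b. smat_id a b - P a b) else P)))
          (op_mult (confs m \<Lambda>)
                   (op_tensor \<Lambda> (\<lambda>i. if i \<in> S then (\<lambda>a b. smat_id a b - P a b) else P))
                   (hamiltonian m \<Phi>0 \<Lambda>))"
    and gs: "\<And>\<Lambda>. finite \<Lambda> \<Longrightarrow>
        op_zero_on (confs m \<Lambda>) (op_mult (confs m \<Lambda>) (hamiltonian m \<Phi>0 \<Lambda>) (op_tensor \<Lambda> (\<lambda>i. P)))"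
    and gap: "\<And>\<Lambda> S. finite \<Lambda> \<Longrightarrow> S \<subseteq> \<Lambda> \<Longrightarrow>
        op_psd (confs m \<Lambda>)
          (\<lambda>\<sigma> \<tau>. op_mult (confs m \<Lambda>) (hamiltonian m \<Phi>0 \<Lambda>)
                     (op_tensor \<Lambda> (\<lambda>i. if i \<in> S then (\<lambda>a b. smat_id a b - P a b) else P)) \<sigma> \<tau>
                 - complex_of_real (g * real (card S)) *
                   op_tensor \<Lambda> (\<lambda>i. if i \<in> S then (\<lambda>a b. smat_id a b - P a b) else P) \<sigma> \<tau>)"
    and X: "spectral_decomp m Sp Q"
    and A2: "\<And>x. x \<in> Sp \<Longrightarrow> Re (smat_trace m (smat_mult m (Q x) P)) > 0"
    and c: "c > 0"
  shows "\<exists>\<kappa>min>0. \<exists>\<beta>min>0. \<forall>\<kappa>\<ge>\<kappa>min. \<forall>\<Upsilon>. is_interaction m \<Upsilon> \<and> kappa_norm_le m \<kappa> \<Upsilon> 1 \<longrightarrow>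
     (let \<Phi> = int_add \<Phi>0 \<Upsilon> in
      \<exists>(\<Psi>fin :: ereal \<Rightarrow> 'd site set \<Rightarrow> 'd site set \<Rightarrow> ('d site \<Rightarrow> real) \<Rightarrow> real)
       (\<Psi> :: ereal \<Rightarrow> 'd site set \<Rightarrow> ('d site \<Rightarrow> real) \<Rightarrow> real).
        \<comment> \<open>finite-volume representation\<close>
        (\<forall>\<beta>\<ge>ereal \<beta>min. \<forall>\<Lambda>. finite \<Lambda> \<longrightarrow>
           (\<exists>Z>0. \<forall>x\<in>PiE \<Lambda> (\<lambda>_. Sp).
              meas_dist m \<Phi> Q \<beta> \<Lambda> x =
                complex_of_real (exp (\<Sum>A\<in>Pow \<Lambda>. \<Psi>fin \<beta> \<Lambda> A (restrict x A)) / Z))) \<and>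
        \<comment> \<open>infinite-volume limits of the potentials\<close>
        (\<forall>\<beta>\<ge>ereal \<beta>min. \<forall>A. finite A \<longrightarrow> (\<forall>x\<in>PiE A (\<lambda>_. Sp).
           ((\<lambda>\<Lambda>. \<Psi>fin \<beta> \<Lambda> A x) \<longlongrightarrow> \<Psi> \<beta> A x) (finite_subsets_at_top UNIV))) \<and>
        \<comment> \<open>interchange with \<beta> \<rightarrow> \<infinity>\<close>
        (\<forall>A. finite A \<longrightarrow> (\<forall>x\<in>PiE A (\<lambda>_. Sp).
           (\<forall>\<Lambda>. finite \<Lambda> \<and> A \<subseteq> \<Lambda> \<longrightarrow>
              ((\<lambda>b. \<Psi>fin (ereal b) \<Lambda> A x) \<longlongrightarrow> \<Psi>fin \<infinity> \<Lambda> A x) at_top) \<and>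
           ((\<lambda>b. \<Psi> (ereal b) A x) \<longlongrightarrow> \<Psi> \<infinity> A x) at_top)) \<and>
        \<comment> \<open>unique thermodynamic limit, satisfying the DLR equations for \<Psi>\<close>
        (\<forall>\<beta>\<ge>ereal \<beta>min. \<exists>!\<mu>. prob_space \<mu> \<and> sets \<mu> = sets (config_space Sp) \<and>
           (\<forall>B. finite B \<longrightarrow> (\<forall>xB\<in>PiE B (\<lambda>_. Sp).
              ((\<lambda>\<Lambda>. meas_marginal m \<Phi> Sp Q \<beta> \<Lambda> B xB) \<longlongrightarrow>
                 complex_of_real (measure \<mu> {\<omega> \<in> space \<mu>. restrict \<omega> B = xB}))
                (finite_subsets_at_top UNIV))) \<and>
           DLR Sp (\<Psi> \<beta>) \<mu>) \<and>
        \<comment> \<open>exponential decay\<close>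
        (\<forall>\<beta>\<ge>ereal \<beta>min.
           (\<lambda>A. exp (c * real (card A)) * max_abs Sp (\<Psi> \<beta>) A) summable_on {A. finite A \<and> (0::'d site) \<in> A} \<and>
           (\<lambda>A. exp (c * real_of_int (lat_diam A)) * max_abs Sp (\<Psi> \<beta>) A) summable_on {A. finite A \<and> (0::'d site) \<in> A}))"
proof -
  have "smat_trace m P = 1" using P by (simp add: rank_one_proj_def)
  hence m: "0 < m" by (cases m) (auto simp: smat_trace_def)
  obtain \<phi> where phi: "(\<Sum>a<m. (cmod (\<phi> a))\<^sup>2) = 1" "\<And>a b. a < m \<Longrightarrow> b < m \<Longrightarrow> P a b = \<phi> a * cnj (\<phi> b)"
    using rank_one_proj_vector[OF P] by blast
  obtain u :: smat where u:
    "\<And>a b. a < m \<Longrightarrow> b < m \<Longrightarrow> (\<Sum>k<m. cnj (u k a) * u k b) = (if a = b then 1 else 0)"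
    "\<And>a b. a < m \<Longrightarrow> b < m \<Longrightarrow> (\<Sum>k<m. u a k * cnj (u b k)) = (if a = b then 1 else 0)"
    "\<And>a b. a < m \<Longrightarrow> b < m \<Longrightarrow> u a 0 * cnj (u b 0) = \<phi> a * cnj (\<phi> b)"
    using unitary_with_first_column[OF phi(1) m] by blast
  have uP: "P a b = u a 0 * cnj (u b 0)" if "a < m" "b < m" for a b using phi(2)[OF that] u(3)[OF that] by simp
  obtain R0 where R0: "\<And>A. R0 < lat_diam A \<Longrightarrow> op_zero_on (confs m A) (\<Phi>0 A)" using fr0 by (auto simp: finite_range_def)
  \<comment> \<open>The maximum keeps nearest neighbours within range, as \<open>spin_model\<close>
    demands.\<close>
  define R where "R = max 1 R0"
  have fr: "op_zero_on (confs m A) (\<Phi>0 A)" if "R < lat_diam A" for A using R0[of A] that by (simp add: R_def)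
  \<comment> \<open>The vacuum entry of \<open>Q x\<close> is the trace of \<open>Q x\<close> times
    \<open>P\<close>, so \<open>A2\<close> makes it nonzero.\<close>
  have Q0: "smat_conj u m (Q x) 0 0 \<noteq> 0" if x: "x \<in> Sp" for x
  proof -
    have "smat_conj u m (Q x) 0 0 = smat_trace m (smat_mult m (Q x) P)"
      unfolding smat_conj_def smat_trace_def smat_mult_def by (intro sum.cong refl) (simp add: uP mult_ac)
    thus ?thesis using A2[OF x] by auto
  qed
  have Spf: "finite Sp" using X by (simp add: spectral_decomp_def)
  \<comment> \<open>The sum of all the quotients dominates each of them, and the leading 1 provides
    \<open>1 \<le> K\<close>.\<close>
  define K where "K = 1 + (\<Sum>x\<in>Sp. \<Sum>a<m. \<Sum>b<m. cmod (smat_conj u m (Q x) a b) / cmod (smat_conj u m (Q x) 0 0))"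
  have K1: "1 \<le> K" by (simp add: K_def sum_nonneg)
  have K: "cmod (smat_conj u m (Q x) a b) \<le> K * cmod (smat_conj u m (Q x) 0 0)" if "x \<in> Sp" "a < m" "b < m" for x a b
  proof -
    let ?r = "\<lambda>x a b. cmod (smat_conj u m (Q x) a b) / cmod (smat_conj u m (Q x) 0 0)"
    have "?r x a b \<le> (\<Sum>b<m. ?r x a b)" by (rule member_le_sum) (use that in auto)
    also have "\<dots> \<le> (\<Sum>a<m. \<Sum>b<m. ?r x a b)" by (rule member_le_sum) (use that in \<open>auto intro: sum_nonneg\<close>)
    also have "\<dots> \<le> (\<Sum>x\<in>Sp. \<Sum>a<m. \<Sum>b<m. ?r x a b)" by (rule member_le_sum) (use that Spf in \<open>auto intro!: sum_nonneg\<close>)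
    also have "\<dots> \<le> K" by (simp add: K_def)
    finally show ?thesis using Q0[OF that(1)] by (simp add: divide_le_eq)
  qed
  \<comment> \<open>Chosen so that \<open>exp (c + 1 - a) * 2 ^ lat_deg TYPE('d) 1\<close> is
    exactly 1, the threshold for the sum over connected sets.\<close>
  define a where "a = c + 1 + ln 2 * real (lat_deg TYPE('d) 1)"
  have a0: "0 \<le> a" using c by (simp add: a_def)
  have "exp (c + 1 - a) = 1 / 2 ^ lat_deg TYPE('d) 1"
    by (simp add: a_def exp_minus exp_of_nat2_mult divide_inverse)
  hence ca: "exp (c + 1 - a) * 2 ^ lat_deg TYPE('d) 1 \<le> 1" by simp
  \<comment> \<open>The left-hand side of the smallness condition without the two
    exponentials.\<close>
  define S where "S = (1 + 2 * exp a) ^ lat_deg TYPE('d) R * (real m ^ 2 * K ^ 2) * 2 ^ (5 * lat_deg TYPE('d) R) * 2 ^ (5 * lat_deg TYPE('d) R)"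
  have S: "0 < S" unfolding S_def using m K1 by (intro mult_pos_pos zero_less_power) (auto intro: add_pos_pos)
  \<comment> \<open>If both exponentials are at most \<open>e\<close>, the condition reads
    \<open>S * (e + e) = 1 / 2\<close>.\<close>
  define e where "e = 1 / (4 * S)"
  have e: "0 < e" using S by (simp add: e_def)
  \<comment> \<open>From this slab length on, the gap factor \<open>exp (- g * t)\<close> is at most
    \<open>e\<close>.\<close>
  define b0 where "b0 = max 1 (- ln e / g)"
  have b0: "0 < b0" by (simp add: b0_def)
  \<comment> \<open>Fixed after \<open>b0\<close>: for slabs as long as \<open>2 * b0\<close>, still
    \<open>exp (t - \<kappa>)\<close> is at most \<open>e\<close>.\<close>
  define k0 where "k0 = max 1 (2 * b0 - ln e)"
  have k0: "0 < k0" by (simp add: k0_def)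
  have main: "low_temperature m \<Phi>0 \<Upsilon> P u g \<kappa> R Sp Q a b0 K"
    if \<kappa>: "k0 \<le> \<kappa>" and U: "is_interaction m \<Upsilon> \<and> kappa_norm_le m \<kappa> \<Upsilon> 1" for \<kappa> and \<Upsilon> :: "'d interaction"
  proof -
    have R: "1 \<le> R" and kpos: "0 \<le> \<kappa>" and U1: "is_interaction m \<Upsilon>" and U2: "kappa_norm_le m \<kappa> \<Upsilon> 1"
      using \<kappa> k0 U by (auto simp: R_def)
    have spin: "spin_model m \<Phi>0 \<Upsilon> P u g \<kappa> R"
      by unfold_locales (rule int0 R fr g m comm gs gap U1 U2 kpos u(1,2) uP; assumption)+
    show ?thesis
    proof (rule low_temperature.intro[OF spin low_temperature_axioms.intro])
      fix t assume t: "b0 \<le> t" "t \<le> 2 * b0"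
      have "t - \<kappa> \<le> ln e" using t \<kappa> by (simp add: k0_def)
      hence 1: "exp (t - \<kappa>) \<le> e" using e by (simp add: ln_ge_iff)
      have "- ln e / g \<le> t" using t by (simp add: b0_def)
      hence "- ln e \<le> t * g" by (simp only: pos_divide_le_eq[OF g])
      hence "- g * t \<le> ln e" by (simp add: mult.commute)
      hence 2: "exp (- g * t) \<le> e" using e by (simp add: ln_ge_iff)
      have "S * (exp (t - \<kappa>) + exp (- g * t)) \<le> S * (e + e)" using 1 2 S by (intro mult_left_mono add_mono) auto
      also have "\<dots> = 1 / 2" using S by (simp add: e_def)
      finally show "(1 + 2 * exp a) ^ lat_deg TYPE('d) R * (real m ^ 2 * K ^ 2 * (exp (t - \<kappa>) + exp (- g * t))) * 2 ^ (5 * lat_deg TYPE('d) R) * 2 ^ (5 * lat_deg TYPE('d) R) \<le> 1 / 2"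
        by (simp add: S_def mult_ac)
    qed (rule X Q0 K1 K a0 b0; assumption)+
  qed
  show ?thesis
    unfolding Let_def
  proof (rule exI[of _ k0], rule conjI[OF k0], rule exI[of _ b0], rule conjI[OF b0], intro allI impI, goal_cases)
    case (1 \<kappa> \<Upsilon>)
    interpret low_temperature m \<Phi>0 \<Upsilon> P u g \<kappa> R Sp Q a b0 K by (rule main[OF 1])
    show ?case
    proof (rule exI[of _ "\<lambda>\<beta> _. pot \<beta>"], rule exI[of _ pot], intro conjI allI impI ballI)
      fix \<beta> and V :: "'d site set" assume "ereal b0 \<le> \<beta>" "finite V"
      thus "\<exists>Z>0. \<forall>x\<in>PiE V (\<lambda>_. Sp). meas_dist m \<Phi> Q \<beta> V x = complex_of_real (exp (\<Sum>A\<in>Pow V. pot \<beta> A (restrict x A)) / Z)"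
        by (intro exI[of _ 1]) (simp add: meas_dist_eq)
    next
      fix A :: "'d site set" and x assume "finite A" "x \<in> PiE A (\<lambda>_. Sp)"
      thus "((\<lambda>b. pot (ereal b) A x) \<longlongrightarrow> pot \<infinity> A x) at_top"
        unfolding pot_def by (intro mob_log_state_infinity observable_obs)
      thus "((\<lambda>b. pot (ereal b) A x) \<longlongrightarrow> pot \<infinity> A x) at_top" .
    qed (rule tendsto_const thermodynamic_limit[OF c ca] decay_card[OF c ca] decay_diam[OF c ca]; assumption)+
  qed
qed

end
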